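(* Let $G$ be a compact Lie group, let $1\leq p_1,p_2<\infty$ and $0<r\leq 1$, and put $\widetilde{p_1}=\min\{2,p_1\}$. Let $A:L^{p_1}(G)\to L^{p_2}(G)$ be a linear continuous operator whose matrix-valued symbol $\sigma_A(\xi)$ depends only on $\xi$ (and not on $x\in G$). (1) If $1\leq p_2\leq 2$ and $$\sum_{[\xi]\in\widehat G}d_{\xi}^{\,1+\left(\frac{1}{\widetilde{p_1}}-\frac{1}{2}\right)r}\,\|\sigma_A(\xi)\|_{S_r}^r<\infty,$$ then $A:L^{p_1}(G)\to L^{p_2}(G)$ is $r$-nuclear. (2) If $p_2>2$ and $$\sum_{[\xi]\in\widehat G}d_{\xi}^{\,1+\left(\frac{1}{\widetilde{p_1}}-\frac{1}{p_2}\right)r}\,\|(\sigma_A(\xi))^t\|_{op(\ell^{\infty},\ell^{\infty})}^{\frac{p_2-2}{p_2}r}\,\|\sigma_A(\xi)\|_{S_{\frac{2r}{p_2}}}^{\frac{2r}{p_2}}<\infty,$$ then $A:L^{p_1}(G)\to L^{p_2}(G)$ is $r$-nuclear.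
   Context: $G$ carries its normalised Haar measure. $\widehat G$ is the set of equivalence classes of continuous irreducible unitary representations of $G$; for each $[\xi]\in\widehat G$ one fixes a representative viewed, via an orthonormal basis of its representation space, as a unitary-matrix-valued function $\xi:G\to\mathbb C^{d_\xi\times d_\xi}$, where $d_\xi$ is its dimension. The matrix-valued symbol of a linear continuous operator $A$ from $C^\infty(G)$ to $\mathcal D'(G)$ (in particular of a bounded operator $L^{p_1}(G)\to L^{p_2}(G)$) is $\sigma_A(x,\xi):=\xi(x)^*(A\xi)(x)\in\mathbb C^{d_\xi\times d_\xi}$, where $(A\xi)_{ij}=A(\xi_{ij})$; then $Af(x)=\sum_{[\xi]\in\widehat G}d_\xi\operatorname{Tr}(\xi(x)\sigma_A(x,\xi)\widehat f(\xi))$ (in the sense of distributions, for $f\in C^\infty(G)$) with $\widehat f(\xi)=\int_G f(x)\xi(x)^*dx$. For a matrix $M$, $|M|=(M^*M)^{1/2}$, and $\|M\|_{S_q}=(\operatorname{Tr}(|M|^q))^{1/q}$ for $q>0$; $M^t$ is the transpose. For $B\in\mathbb C^{d\times d}$, $\|B\|_{op(\ell^\infty,\ell^\infty)}:=\max_{1\le i\le d}\sum_{j=1}^d|B_{ij}|$. For $0<r\le1$ and Banach spaces $E,F$, a linear operator $T:E\to F$ is $r$-nuclear if there are sequences $(x_n')$ in $E'$ and $(y_n)$ in $F$ with $Tx=\sum_{n=1}^\infty\langle x,x_n'\rangle y_n$ for all $x\in E$ and $\sum_{n=1}^\infty\|x_n'\|_{E'}^r\|y_n\|_F^r<\infty$.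 *)

theory Defs
  imports "HOL-Analysis.Analysis" "Jordan_Normal_Form.Schur_Decomposition"
begin

section \<open>Compact Lie groups\<close>

text \<open>
  Points of \<open>\<real>\<^sup>n\<close> are the elements of \<^term>\<open>topspace (Euclidean_space n)\<close>, that is, functions
  \<^typ>\<open>nat \<Rightarrow> real\<close> vanishing from index \<open>n\<close> on. Unlike a model space of class
  \<^class>\<open>euclidean_space\<close>, this includes dimension \<open>0\<close>, so finite groups are compact Lie groups.
\<close>

definition partial_deriv :: "nat \<Rightarrow> ((nat \<Rightarrow> real) \<Rightarrow> real) \<Rightarrow> (nat \<Rightarrow> real) \<Rightarrow> real" where
  "partial_deriv i f x = deriv (\<lambda>t. f (x(i := t))) (x i)"

text \<open>
  On a set \<open>S\<close> that is open in \<open>\<real>\<^sup>n\<close>: all partial derivatives of order at most \<open>k\<close> exist and are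
  continuous. The values of \<open>f\<close> outside \<open>S\<close> are irrelevant.
\<close>

primrec Ck_on :: "nat \<Rightarrow> nat \<Rightarrow> (nat \<Rightarrow> real) set \<Rightarrow> ((nat \<Rightarrow> real) \<Rightarrow> real) \<Rightarrow> bool" where
  "Ck_on n 0 S f \<longleftrightarrow> continuous_on S f"
| "Ck_on n (Suc k) S f \<longleftrightarrow> continuous_on S f \<and>
     (\<forall>i<n. (\<forall>x\<in>S. (\<lambda>t. f (x(i := t))) field_differentiable (at (x i))) \<and>
            Ck_on n k S (partial_deriv i f))"

definition smooth_map :: "nat \<Rightarrow> (nat \<Rightarrow> real) set \<Rightarrow> nat \<Rightarrow> ((nat \<Rightarrow> real) \<Rightarrow> (nat \<Rightarrow> real)) \<Rightarrow> bool" where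
  "smooth_map m S n F \<longleftrightarrow> (\<forall>j<n. \<forall>k. Ck_on m k S (\<lambda>x. F x j))"

definition first_half :: "nat \<Rightarrow> (nat \<Rightarrow> real) \<Rightarrow> (nat \<Rightarrow> real)" where
  "first_half n z = (\<lambda>i. if i < n then z i else 0)"

definition second_half :: "nat \<Rightarrow> (nat \<Rightarrow> real) \<Rightarrow> (nat \<Rightarrow> real)" where
  "second_half n z = (\<lambda>i. if i < n then z (n + i) else 0)"

definition is_chart :: "nat \<Rightarrow> 'g::topological_space set \<Rightarrow> ('g \<Rightarrow> nat \<Rightarrow> real) \<Rightarrow> bool" where
  "is_chart n U \<phi> \<longleftrightarrow> open U \<and> openin (Euclidean_space n) (\<phi> ` U) \<and>
     (\<exists>\<psi>. homeomorphism U (\<phi> ` U) \<phi> \<psi>)"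

definition smooth_atlas :: "nat \<Rightarrow> ('g::topological_space set \<times> ('g \<Rightarrow> nat \<Rightarrow> real)) set \<Rightarrow> bool" where
  "smooth_atlas n \<A> \<longleftrightarrow>
     (\<forall>(U, \<phi>)\<in>\<A>. is_chart n U \<phi>) \<and> (\<Union>(U, \<phi>)\<in>\<A>. U) = UNIV \<and>
     (\<forall>(U, \<phi>)\<in>\<A>. \<forall>(V, \<psi>)\<in>\<A>. smooth_map n (\<phi> ` (U \<inter> V)) n (\<lambda>x. \<psi> (inv_into U \<phi> x)))"

text \<open>
  The library's class of topological groups is written additively but does not assume
  commutativity: throughout, \<open>x + y\<close>, \<open>- x\<close> and \<open>0\<close> are the product, the inverse and the unit of
  a group that need not be abelian.

  The product is required to be smooth on \<open>G \<times> G\<close>; in charts, a point of \<open>\<real>\<^sup>n \<times> \<real>\<^sup>n\<close> is given by the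
  two halves of a point of \<open>\<real>\<^sup>2\<^sup>n\<close>.
\<close>

definition lie_group_atlas ::
    "nat \<Rightarrow> ('g::topological_group_add set \<times> ('g \<Rightarrow> nat \<Rightarrow> real)) set \<Rightarrow> bool" where
  "lie_group_atlas n \<A> \<longleftrightarrow>
     smooth_atlas n \<A> \<and>
     (\<forall>(U, \<phi>)\<in>\<A>. \<forall>(V, \<psi>)\<in>\<A>. \<forall>(W, \<theta>)\<in>\<A>.
        smooth_map (n + n)
          {z \<in> topspace (Euclidean_space (n + n)).
             first_half n z \<in> \<phi> ` U \<and> second_half n z \<in> \<psi> ` V \<and>
             inv_into U \<phi> (first_half n z) + inv_into V \<psi> (second_half n z) \<in> W}
          n (\<lambda>z. \<theta> (inv_into U \<phi> (first_half n z) + inv_into V \<psi> (second_half n z)))) \<and>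
     (\<forall>(U, \<phi>)\<in>\<A>. \<forall>(V, \<psi>)\<in>\<A>.
        smooth_map n {x \<in> \<phi> ` U. - inv_into U \<phi> x \<in> V} n (\<lambda>x. \<psi> (- inv_into U \<phi> x)))"

text \<open>Second countability is not demanded separately: it follows from compactness.\<close>

definition compact_lie_group :: "'g::{topological_group_add, t2_space} itself \<Rightarrow> bool" where
  "compact_lie_group _ \<longleftrightarrow> compact (UNIV :: 'g set) \<and>
     (\<exists>n \<A>. lie_group_atlas n (\<A> :: ('g set \<times> ('g \<Rightarrow> nat \<Rightarrow> real)) set))"

definition normalised_haar :: "'g::topological_group_add measure \<Rightarrow> bool" where
  "normalised_haar \<mu> \<longleftrightarrow> sets \<mu> = sets borel \<and> emeasure \<mu> UNIV = 1 \<and>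
     (\<forall>a. \<forall>B\<in>sets borel. emeasure \<mu> ((\<lambda>x. a + x) ` B) = emeasure \<mu> B)"

section \<open>The unitary dual\<close>

definition unitary_mat :: "nat \<Rightarrow> complex mat \<Rightarrow> bool" where
  "unitary_mat d U \<longleftrightarrow> U \<in> carrier_mat d d \<and>
     mat_adjoint U * U = 1\<^sub>m d \<and> U * mat_adjoint U = 1\<^sub>m d"

definition rep_dim :: "('g::zero \<Rightarrow> complex mat) \<Rightarrow> nat" where
  "rep_dim \<xi> = dim_row (\<xi> 0)"

definition unitary_rep :: "('g::topological_group_add \<Rightarrow> complex mat) \<Rightarrow> bool" where
  "unitary_rep \<xi> \<longleftrightarrow>
     (\<forall>x. unitary_mat (rep_dim \<xi>) (\<xi> x)) \<and>
     (\<forall>x y. \<xi> (x + y) = \<xi> x * \<xi> y) \<and>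
     (\<forall>i<rep_dim \<xi>. \<forall>j<rep_dim \<xi>. continuous_on UNIV (\<lambda>x. \<xi> x $$ (i, j)))"

definition irreducible_unitary_rep :: "('g::topological_group_add \<Rightarrow> complex mat) \<Rightarrow> bool" where
  "irreducible_unitary_rep \<xi> \<longleftrightarrow> unitary_rep \<xi> \<and> rep_dim \<xi> > 0 \<and>
     (\<forall>W. VectorSpace.subspace class_ring W (module_vec TYPE(complex) (rep_dim \<xi>)) \<longrightarrow>
          (\<forall>x. \<forall>w\<in>W. \<xi> x *\<^sub>v w \<in> W) \<longrightarrow>
          W = {0\<^sub>v (rep_dim \<xi>)} \<or> W = carrier_vec (rep_dim \<xi>))"

definition equivalent_reps :: "('g::zero \<Rightarrow> complex mat) \<Rightarrow> ('g \<Rightarrow> complex mat) \<Rightarrow> bool" where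
  "equivalent_reps \<xi> \<eta> \<longleftrightarrow> rep_dim \<xi> = rep_dim \<eta> \<and>
     (\<exists>S \<in> carrier_mat (rep_dim \<xi>) (rep_dim \<xi>). invertible_mat S \<and> (\<forall>x. S * \<xi> x = \<eta> x * S))"

definition unitary_dual :: "('g::topological_group_add \<Rightarrow> complex mat) set set" where
  "unitary_dual = {\<xi>. irreducible_unitary_rep \<xi>} //
     {(\<xi>, \<eta>). irreducible_unitary_rep \<xi> \<and> irreducible_unitary_rep \<eta> \<and> equivalent_reps \<xi> \<eta>}"

section \<open>Matrix norms\<close>

text \<open>\<open>N\<^sup>q\<close> for a positive semidefinite matrix \<open>N\<close> and \<open>q > 0\<close>, by the spectral calculus.\<close>

definition psd_powr :: "complex mat \<Rightarrow> real \<Rightarrow> complex mat" where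
  "psd_powr N q = (THE B. \<exists>U l. unitary_mat (dim_row N) U \<and> (\<forall>i<dim_row N. l i \<ge> 0) \<and>
     N = U * mat_diag (dim_row N) (\<lambda>i. complex_of_real (l i)) * mat_adjoint U \<and>
     B = U * mat_diag (dim_row N) (\<lambda>i. complex_of_real (l i powr q)) * mat_adjoint U)"

definition mat_abs :: "complex mat \<Rightarrow> complex mat" where
  "mat_abs M = psd_powr (mat_adjoint M * M) (1/2)"

text \<open>The trace below is real and nonnegative; taking the real part only adjusts the type.\<close>

definition schatten_norm :: "real \<Rightarrow> complex mat \<Rightarrow> real" where
  "schatten_norm q M = Re (sum_list (diag_mat (psd_powr (mat_abs M) q))) powr (1 / q)"

definition op_infty_norm :: "complex mat \<Rightarrow> real" where
  "op_infty_norm B = Max ((\<lambda>i. \<Sum>j<dim_col B. cmod (B $$ (i, j))) ` {..<dim_row B})"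

section \<open>Lebesgue spaces and nuclear operators\<close>

text \<open>
  A Banach space of (classes of) functions is given by the set \<open>E\<close> of all representing functions
  together with the seminorm \<open>nE\<close>; functions at seminorm distance \<open>0\<close> represent the same element.
  Accordingly, operators act on representatives and identities between elements hold up to
  seminorm \<open>0\<close>.
\<close>

definition lp_space :: "'a measure \<Rightarrow> real \<Rightarrow> ('a \<Rightarrow> complex) set" where
  "lp_space \<mu> p = {f \<in> borel_measurable \<mu>. integrable \<mu> (\<lambda>x. cmod (f x) powr p)}"

definition lp_norm :: "'a measure \<Rightarrow> real \<Rightarrow> ('a \<Rightarrow> complex) \<Rightarrow> real" where
  "lp_norm \<mu> p f = (\<integral>x. cmod (f x) powr p \<partial>\<mu>) powr (1 / p)"

definition bounded_linear_op ::
    "('a \<Rightarrow> complex) set \<Rightarrow> (('a \<Rightarrow> complex) \<Rightarrow> real) \<Rightarrow> ('b \<Rightarrow> complex) set \<Rightarrow> (('b \<Rightarrow> complex) \<Rightarrow> real) \<Rightarrow>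
     (('a \<Rightarrow> complex) \<Rightarrow> ('b \<Rightarrow> complex)) \<Rightarrow> bool" where
  "bounded_linear_op E nE F nF T \<longleftrightarrow>
     (\<forall>f\<in>E. T f \<in> F) \<and>
     (\<forall>f\<in>E. \<forall>g\<in>E. nF (\<lambda>x. T (\<lambda>y. f y + g y) x - (T f x + T g x)) = 0) \<and>
     (\<forall>c. \<forall>f\<in>E. nF (\<lambda>x. T (\<lambda>y. c * f y) x - c * T f x) = 0) \<and>
     (\<exists>C. \<forall>f\<in>E. nF (T f) \<le> C * nE f)"

definition dual_space ::
    "('a \<Rightarrow> complex) set \<Rightarrow> (('a \<Rightarrow> complex) \<Rightarrow> real) \<Rightarrow> (('a \<Rightarrow> complex) \<Rightarrow> complex) set" where
  "dual_space E nE = {\<Lambda>.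
     (\<forall>f\<in>E. \<forall>g\<in>E. \<Lambda> (\<lambda>y. f y + g y) = \<Lambda> f + \<Lambda> g) \<and>
     (\<forall>c. \<forall>f\<in>E. \<Lambda> (\<lambda>y. c * f y) = c * \<Lambda> f) \<and>
     (\<exists>C. \<forall>f\<in>E. cmod (\<Lambda> f) \<le> C * nE f)}"

definition dual_norm ::
    "('a \<Rightarrow> complex) set \<Rightarrow> (('a \<Rightarrow> complex) \<Rightarrow> real) \<Rightarrow> (('a \<Rightarrow> complex) \<Rightarrow> complex) \<Rightarrow> real" where
  "dual_norm E nE \<Lambda> = Sup {cmod (\<Lambda> f) | f. f \<in> E \<and> nE f \<le> 1}"

definition r_nuclear ::
    "real \<Rightarrow> ('a \<Rightarrow> complex) set \<Rightarrow> (('a \<Rightarrow> complex) \<Rightarrow> real) \<Rightarrow> ('b \<Rightarrow> complex) set \<Rightarrow> (('b \<Rightarrow> complex) \<Rightarrow> real) \<Rightarrow>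
     (('a \<Rightarrow> complex) \<Rightarrow> ('b \<Rightarrow> complex)) \<Rightarrow> bool" where
  "r_nuclear r E nE F nF T \<longleftrightarrow> (\<exists>\<Lambda> y.
     (\<forall>n::nat. \<Lambda> n \<in> dual_space E nE) \<and> (\<forall>n. y n \<in> F) \<and>
     (\<forall>f\<in>E. (\<lambda>N. nF (\<lambda>x. T f x - (\<Sum>n<N. \<Lambda> n f * y n x))) \<longlonglongrightarrow> 0) \<and>
     summable (\<lambda>n. dual_norm E nE (\<Lambda> n) powr r * nF (y n) powr r))"

section \<open>Matrix-valued symbols\<close>

definition symbol ::
    "(('g \<Rightarrow> complex) \<Rightarrow> ('g::zero \<Rightarrow> complex)) \<Rightarrow> 'g \<Rightarrow> ('g \<Rightarrow> complex mat) \<Rightarrow> complex mat" where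
  "symbol A x \<xi> = mat_adjoint (\<xi> x) *
     Matrix.mat (rep_dim \<xi>) (rep_dim \<xi>) (\<lambda>(i, j). A (\<lambda>y. \<xi> y $$ (i, j)) x)"

end

theory Submission
  imports Defs "HOL-Probability.Probability" "Jordan_Normal_Form.Spectral_Radius"
begin

unbundle no vec_syntax

text \<open>
  On a matrix coefficient of \<open>\<xi>\<close>, the operator acts as \<open>\<xi>\<^sub>a\<^sub>b \<mapsto> (\<xi> \<sigma>)\<^sub>a\<^sub>b\<close>. By Schur orthogonality this is
  also the action of the \<open>d\<^sup>2\<close> rank-one terms
  \<open>f \<mapsto> \<langle>f, (V \<xi> Q)\<^sub>i\<^sub>j\<rangle> d (V \<xi> \<sigma> Q)\<^sub>i\<^sub>j\<close>, for any unitary \<open>V\<close> and \<open>Q\<close>. If the sum of all these terms is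
  absolutely summable in norm, it is a bounded operator that agrees with \<open>A\<close> on trigonometric
  polynomials, hence everywhere, because these are dense by the Peter--Weyl theorem.

  For the norms, \<open>Q\<close> diagonalises \<open>\<sigma>\<^sup>*\<sigma>\<close>, so that the \<open>j\<close>-th column of \<open>\<sigma> Q\<close> has norm \<open>s\<^sub>j\<close>, the
  \<open>j\<close>-th singular value. With \<open>V = 1\<close> the \<open>L\<^sup>p\<close> norms for \<open>p > 2\<close> would involve the basis-dependent
  size of the entries of \<open>\<sigma> Q\<close>. Instead \<open>V\<close> is the discrete Fourier matrix with randomly signed columns:
  by Khintchine's inequality some choice of signs gives \<open>(V \<xi> \<sigma> Q)\<^sub>i\<^sub>j\<close> an \<open>L\<^sup>p\<close> norm of order
  \<open>d\<^sup>-\<^sup>1\<^sup>/\<^sup>2 s\<^sub>j\<close> on average. So the condition of part (1) suffices for all \<open>p\<^sub>2 < \<infinity>\<close>, and the condition of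
  part (2) implies it term by term.

  The Peter--Weyl theorem is obtained without spectral theory of compact operators: the normalised
  convolution powers of a Hermitian kernel orthogonal to all coefficients converge to an idempotent,
  whose range is a finite-dimensional translation-invariant space of continuous functions; a minimal
  invariant subspace carries an irreducible representation, whose coefficients span it.
\<close>

section \<open>Haar measure and continuous functions\<close>

text \<open>The exponents come from three factors. Schur orthogonality puts \<open>1 / d\<close>
  into every pairing with a coefficient, so reconstruction multiplies each output function by
  \<open>d\<close>. A functional whose kernel is bounded by 1 and has squared norm
  \<open>1 / d\<close> has norm at most \<open>d powr (1 / min 2 p1 - 1)\<close> on L^p1. The sign
  average gives the outputs a norm of order \<open>d * (s_j / sqrt d)\<close>. Raising to the power
  \<open>r\<close> and summing over \<open>i\<close> and \<open>j\<close> yields the weight of part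
  (1); the row index \<open>i\<close> accounts for the leading factor \<open>d\<close>. One choice
  of signs has to serve all \<open>d^2\<close> entries at once, so it is the sum of the
  \<open>r\<close>-th powers that is averaged.

  Two obstacles shape the analysis. The Haar measure is given as a left-invariant Borel measure,
  without regularity: inversion invariance, positivity on open sets, Fubini for continuous kernels
  and the density of C(G) in L^p have to be derived. And C(G) is in general not complete in the L^2
  norm: limits are formed only after a convolution, which turns L^2 closeness into uniform
  closeness.\<close>

locale haar_group =
  fixes \<mu> :: "'g::{topological_group_add, t2_space} measure"
  assumes compact_UNIV: "compact (UNIV :: 'g set)" and haar: "normalised_haar \<mu>"
begin

lemma sets_haar [measurable_cong]: "sets \<mu> = sets borel"
  using haar by (simp add: normalised_haar_def)

lemma space_haar [simp]: "space \<mu> = UNIV"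
  using sets_eq_imp_space_eq[OF sets_haar] by simp

sublocale prob_space \<mu>
  by standard (use haar in \<open>simp add: normalised_haar_def\<close>)

lemma measure_UNIV [simp]: "measure \<mu> UNIV = 1"
  using prob_space by simp

lemma bounded_continuous:
  assumes "continuous_on UNIV (f :: 'g \<Rightarrow> 'b::metric_space)"
  shows "bounded (range f)"
  using assms compact_UNIV compact_continuous_image compact_imp_bounded by blast

lemma measurable_continuous:
  assumes "continuous_on UNIV (f :: 'g \<Rightarrow> 'b::topological_space)"
  shows "f \<in> borel_measurable \<mu>"
  using borel_measurable_continuous_onI[OF assms]
  by (simp add: measurable_cong_sets[OF sets_haar refl])

lemma integrable_continuous:
  assumes "continuous_on UNIV (f :: 'g \<Rightarrow> 'b::{banach, second_countable_topology})"
  shows "integrable \<mu> f"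
proof -
  obtain B where "\<And>x. norm (f x) \<le> B"
    using bounded_continuous[OF assms] by (auto simp: bounded_iff)
  then show ?thesis
    using measurable_continuous[OF assms] by (intro integrable_const_bound[of _ B]) auto
qed

lemma distr_translation: "distr \<mu> \<mu> (\<lambda>x. a + x) = \<mu>"
proof (rule measure_eqI)
  show "sets (distr \<mu> \<mu> (\<lambda>x. a + x)) = sets \<mu>" by simp
  fix B assume B: "B \<in> sets (distr \<mu> \<mu> (\<lambda>x. a + x))"
  have m: "(\<lambda>x. a + x) \<in> \<mu> \<rightarrow>\<^sub>M \<mu>"
    using borel_measurable_continuous_onI[of "\<lambda>x::'g. a + x"]
    by (simp add: measurable_cong_sets[OF sets_haar sets_haar] continuous_intros)
  \<comment> \<open>Invariance is assumed for images of sets; the preimage is the image under the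
    inverse translation.\<close>
  have eq: "(\<lambda>x. a + x) -` B = (\<lambda>x. - a + x) ` B"
  proof (intro Set.set_eqI iffI)
    fix x assume "x \<in> (\<lambda>x. a + x) -` B"
    then have "- a + (a + x) \<in> (\<lambda>x. - a + x) ` B" by blast
    then show "x \<in> (\<lambda>x. - a + x) ` B" by (simp only: minus_add_cancel)
  qed (auto simp: add.assoc[symmetric])
  have "emeasure (distr \<mu> \<mu> (\<lambda>x. a + x)) B = emeasure \<mu> ((\<lambda>x. a + x) -` B)"
    using B m by (subst emeasure_distr) auto
  also have "\<dots> = emeasure \<mu> B"
    using haar B sets_haar by (simp add: eq normalised_haar_def)
  finally show "emeasure (distr \<mu> \<mu> (\<lambda>x. a + x)) B = emeasure \<mu> B" .
qed

lemma integral_translation: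
  assumes "continuous_on UNIV (f :: 'g \<Rightarrow> 'b::{banach, second_countable_topology})"
  shows "(\<integral>x. f (a + x) \<partial>\<mu>) = (\<integral>x. f x \<partial>\<mu>)"
proof -
  have m: "(\<lambda>x. a + x) \<in> \<mu> \<rightarrow>\<^sub>M \<mu>"
    using borel_measurable_continuous_onI[of "\<lambda>x::'g. a + x"]
    by (simp add: measurable_cong_sets[OF sets_haar sets_haar] continuous_intros)
  show ?thesis
    using integral_distr[OF m measurable_continuous[OF assms]] by (simp add: distr_translation)
qed

text \<open>If \<open>U\<close> were null, so would be all its translates; by compactness finitely
  many of them cover the group, which has measure 1.\<close>

lemma measure_open_pos:
  assumes "open U" "(U::'g set) \<noteq> {}"
  shows "measure \<mu> U > 0"
proof (rule ccontr)
  assume "\<not> measure \<mu> U > 0"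
  then have z: "emeasure \<mu> U = 0"
    by (simp add: emeasure_eq_measure measure_nonneg order.antisym not_less)
  obtain u where u: "u \<in> U" using assms by blast
  define T where "T a = (\<lambda>x::'g. a + x) ` U" for a
  have Teq: "T a = (\<lambda>x. - a + x) -` U" for a
  proof (intro Set.set_eqI iffI)
    fix x assume "x \<in> (\<lambda>x. - a + x) -` U"
    then have "a + (- a + x) \<in> T a" unfolding T_def by blast
    then show "x \<in> T a" by (simp only: add_minus_cancel)
  qed (auto simp: T_def)
  have oT: "open (T a)" for a
    unfolding Teq by (intro open_vimage assms continuous_intros)
  have "UNIV \<subseteq> (\<Union>a. T a)"
  proof
    fix x :: 'g
    have "- (x - u) + x = u" by (simp add: minus_diff_eq)
    then have "x \<in> T (x - u)" using u unfolding Teq by simp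
    then show "x \<in> (\<Union>a. T a)" by blast
  qed
  then obtain D where D: "finite D" "UNIV \<subseteq> (\<Union>a\<in>D. T a)"
    using compactE_image[OF compact_UNIV, of UNIV T] oT by metis
  have "T a \<in> null_sets \<mu>" for a
    using haar z assms oT[of a] sets_haar unfolding T_def normalised_haar_def by (auto simp: null_sets_def)
  then have "(\<Union>a\<in>D. T a) \<in> null_sets \<mu>"
    using D(1) by (intro null_sets_UN') (auto simp: countable_finite)
  then have "emeasure \<mu> (\<Union>a\<in>D. T a) = 0" by auto
  moreover have "(\<Union>a\<in>D. T a) = UNIV" using D by auto
  ultimately show False using emeasure_space_1 by simp
qed

lemma integral_continuous_pos:
  assumes c: "continuous_on UNIV (f :: 'g \<Rightarrow> real)" and n: "\<And>x. 0 \<le> f x" and p: "0 < f a"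
  shows "0 < (\<integral>x. f x \<partial>\<mu>)"
proof -
  define U where "U = f -` {f a / 2<..}"
  have oU: "open U" unfolding U_def by (intro open_vimage c) auto
  have "a \<in> U" using p by (simp add: U_def)
  then have U: "measure \<mu> U > 0" using measure_open_pos[OF oU] by blast
  have sU: "U \<in> sets \<mu>" using oU sets_haar by simp
  have "0 < f a / 2 * measure \<mu> U" using U p by simp
  also have "\<dots> = (\<integral>x. f a / 2 * indicator U x \<partial>\<mu>)" using sU by simp
  also have "\<dots> \<le> (\<integral>x. f x \<partial>\<mu>)"
    using sU n p by (intro integral_mono integrable_continuous c integrable_mult_right integrable_real_indicator)
      (auto simp: U_def indicator_def emeasure_eq_measure)
  finally show ?thesis .
qed

section \<open>Continuous functions of two variables and Fubini's theorem for them\<close>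

lemma continuous_on_curried:
  assumes "continuous_on UNIV (\<lambda>(x, y). F x y)" "continuous_on S f" "continuous_on S g"
  shows "continuous_on S (\<lambda>x. F (f x) (g x))"
  using continuous_on_compose2[OF assms(1) continuous_on_Pair[OF assms(2,3)]] by simp

lemma cont_slice:
  assumes "continuous_on UNIV (\<lambda>(x, y). F x y)"
  shows "continuous_on UNIV (F x)" "continuous_on UNIV (\<lambda>x. F x y)"
  by (rule continuous_on_curried[OF assms]; intro continuous_intros)+

text \<open>Tube lemma: the second factor is compact, so one neighbourhood of \<open>x\<close> works
  for all \<open>y\<close>.\<close>

lemma uniform_slice:
  fixes F :: "'a::topological_space \<Rightarrow> 'g \<Rightarrow> complex"
  assumes "continuous_on UNIV (\<lambda>(x, y). F x y)" "e > 0"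
  obtains X where "x \<in> X" "open X" "\<And>x' y. x' \<in> X \<Longrightarrow> cmod (F x' y - F x y) \<le> e"
proof -
  obtain X where "x \<in> X" "open X" "\<forall>x'\<in>X \<inter> UNIV. \<forall>t\<in>UNIV. dist (case (x', t) of (x, y) \<Rightarrow> F x y) (case (x, t) of (x, y) \<Rightarrow> F x y) \<le> e"
    using continuous_on_prod_compactE[of UNIV UNIV "\<lambda>(x, y). F x y" x e] assms compact_UNIV
    unfolding UNIV_Times_UNIV by blast
  then show thesis by (intro that[of X]) (auto simp: dist_norm)
qed

lemma norm_integral_le:
  assumes "integrable \<mu> (f :: 'g \<Rightarrow> complex)" "\<And>x. cmod (f x) \<le> e"
  shows "cmod (\<integral>x. f x \<partial>\<mu>) \<le> e"
proof -
  have "cmod (\<integral>x. f x \<partial>\<mu>) \<le> (\<integral>x. cmod (f x) \<partial>\<mu>)" by (rule integral_norm_bound)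
  also have "\<dots> \<le> (\<integral>x. e \<partial>\<mu>)" using assms by (intro integral_mono) auto
  finally show ?thesis by simp
qed

lemma norm_integral_diff_le:
  assumes "integrable \<mu> (f :: 'g \<Rightarrow> complex)" "integrable \<mu> g" "\<And>x. cmod (f x - g x) \<le> e"
  shows "cmod ((\<integral>x. f x \<partial>\<mu>) - (\<integral>x. g x \<partial>\<mu>)) \<le> e"
  using norm_integral_le[of "\<lambda>x. f x - g x" e] assms by simp

lemma continuous_integral:
  fixes F :: "'a::topological_space \<Rightarrow> 'g \<Rightarrow> complex"
  assumes "continuous_on UNIV (\<lambda>(x, y). F x y)"
  shows "continuous_on UNIV (\<lambda>x. \<integral>y. F x y \<partial>\<mu>)"
  unfolding continuous_on_topological
proof (intro ballI allI impI)
  fix x B assume "open B" "(\<integral>y. F x y \<partial>\<mu>) \<in> B"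
  then obtain e where e: "e > 0" "\<And>z. dist z (\<integral>y. F x y \<partial>\<mu>) < e \<Longrightarrow> z \<in> B"
    by (metis open_dist)
  obtain X where X: "x \<in> X" "open X" "\<And>x' y. x' \<in> X \<Longrightarrow> cmod (F x' y - F x y) \<le> e / 2"
    using uniform_slice[OF assms, of "e/2" x] e by auto
  have "(\<integral>y. F x' y \<partial>\<mu>) \<in> B" if "x' \<in> X" for x'
  proof (rule e(2))
    note i = integrable_continuous[OF cont_slice(1)[OF assms]]
    have "(\<integral>y. F x' y \<partial>\<mu>) - (\<integral>y. F x y \<partial>\<mu>) = (\<integral>y. F x' y - F x y \<partial>\<mu>)"
      using i by simp
    moreover have "cmod \<dots> \<le> e / 2" using X(3)[OF that] i by (intro norm_integral_le) auto
    ultimately show "dist (\<integral>y. F x' y \<partial>\<mu>) (\<integral>y. F x y \<partial>\<mu>) < e" using e by (simp add: dist_norm)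
  qed
  then show "\<exists>A. open A \<and> x \<in> A \<and> (\<forall>y\<in>UNIV. y \<in> A \<longrightarrow> (\<integral>ya. F y ya \<partial>\<mu>) \<in> B)"
    using X by auto
qed

text \<open>A finite cover by the neighbourhoods of \<open>uniform_slice\<close> is made disjoint,
  and \<open>t\<close> sends each cell to its centre. Thus \<open>F (t x) y\<close> is a
  finite-valued Borel function of \<open>x\<close> that is uniformly close to
  \<open>F x y\<close>.\<close>

lemma step_approximation:
  fixes F :: "'g \<Rightarrow> 'g \<Rightarrow> complex"
  assumes "continuous_on UNIV (\<lambda>(x, y). F x y)" "e > 0"
  obtains t :: "'g \<Rightarrow> 'g" where "finite (range t)" "\<And>a. t -` {a} \<in> sets borel"
    "\<And>x y. cmod (F x y - F (t x) y) \<le> e"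
proof -
  have "\<forall>x. \<exists>X. x \<in> X \<and> open X \<and> (\<forall>x' y. x' \<in> X \<longrightarrow> cmod (F x' y - F x y) \<le> e)"
    using uniform_slice[OF assms] by metis
  then obtain X where X: "\<And>x. x \<in> X x" "\<And>x. open (X x)"
    "\<And>x x' y. x' \<in> X x \<Longrightarrow> cmod (F x' y - F x y) \<le> e" by metis
  obtain D where D: "finite D" "UNIV \<subseteq> (\<Union>a\<in>D. X a)"
    by (rule compactE_image[OF compact_UNIV, of UNIV X]) (use X in auto)
  obtain p :: "nat \<Rightarrow> 'g" and n where p: "D = p ` {i. i < n}"
    using finite_imp_nat_seg_image_inj_on[OF D(1)] by (elim exE conjE)
  \<comment> \<open>Each cell drops the points already covered by an earlier neighbourhood, so every
    point gets a unique label \<open>l x\<close>.\<close>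
  define Y where "Y i = X (p i) - (\<Union>j<i. X (p j))" for i
  have Y_sets: "Y i \<in> sets borel" for i
    unfolding Y_def using X(2) by (intro sets.Diff sets.finite_UN) auto
  have "\<exists>i. i < n \<and> x \<in> Y i" for x
  proof -
    have ex: "\<exists>i. i < n \<and> x \<in> X (p i)" using D(2) p by auto
    obtain i where "i < n \<and> x \<in> X (p i)" "\<forall>j<i. \<not> (j < n \<and> x \<in> X (p j))"
      using exists_least_iff[THEN iffD1, OF ex] by auto
    then have "i < n \<and> x \<in> Y i" unfolding Y_def by auto
    then show ?thesis ..
  qed
  then obtain l where l: "\<And>x. l x < n" "\<And>x. x \<in> Y (l x)" by metis
  have l_eq: "x \<in> Y i \<longleftrightarrow> l x = i" for i x
  proof
    show "x \<in> Y i" if "l x = i" using l(2)[of x] that by simp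
    show "l x = i" if "x \<in> Y i"
      using that l(2)[of x] linorder_cases[of i "l x"] unfolding Y_def by fastforce
  qed
  show thesis
  proof
    show "finite (range (p \<circ> l))"
      using l by (auto intro!: finite_subset[OF _ D(1)] simp: p)
    show "cmod (F x y - F ((p \<circ> l) x) y) \<le> e" for x y
      using X(3)[of x "p (l x)" y] l(2)[of x] unfolding Y_def by simp
    fix a
    have "(p \<circ> l) -` {a} = (\<Union>i\<in>{i. i < n \<and> p i = a}. Y i)" using l l_eq by auto
    then show "(p \<circ> l) -` {a} \<in> sets borel"
      using Y_sets by (auto intro!: sets.finite_UN)
  qed
qed

lemma integral_step:
  fixes h :: "'g \<Rightarrow> complex"
  assumes t: "finite (range t)" "\<And>a. t -` {a} \<in> sets borel"
  shows "integrable \<mu> (\<lambda>x. h (t x))"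
    "(\<integral>x. h (t x) \<partial>\<mu>) = (\<Sum>a\<in>range t. measure \<mu> (t -` {a}) *\<^sub>R h a)"
proof -
  have eq: "h (t x) = (\<Sum>a\<in>range t. indicator (t -` {a}) x *\<^sub>R h a)" for x
  proof -
    have "(\<Sum>a\<in>range t. indicator (t -` {a}) x *\<^sub>R h a) = (\<Sum>a\<in>range t. if a = t x then h a else 0)"
      by (intro sum.cong) (auto simp: indicator_def)
    also have "\<dots> = h (t x)" using t(1) by simp
    finally show ?thesis by simp
  qed
  have i: "integrable \<mu> (\<lambda>x. indicator (t -` {a}) x *\<^sub>R h a)" for a
    using t sets_haar by (intro integrable_scaleR_left integrable_real_indicator) (auto simp: emeasure_eq_measure)
  show "integrable \<mu> (\<lambda>x. h (t x))" unfolding eq by (intro Bochner_Integration.integrable_sum i)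
  show "(\<integral>x. h (t x) \<partial>\<mu>) = (\<Sum>a\<in>range t. measure \<mu> (t -` {a}) *\<^sub>R h a)"
    unfolding eq Bochner_Integration.integral_sum[OF i]
    using t sets_haar by (intro sum.cong) (auto simp: emeasure_eq_measure)
qed

text \<open>A step approximation in \<open>x\<close> reduces the claim to a finite sum, where the
  order of integration is irrelevant; the approximation is uniform, so each iterated integral moves
  by at most \<open>e\<close>. Arguing with iterated integrals avoids the question whether the Borel
  sets of the product are generated by rectangles.\<close>

lemma integral_swap:
  fixes F :: "'g \<Rightarrow> 'g \<Rightarrow> complex"
  assumes F: "continuous_on UNIV (\<lambda>(x, y). F x y)"
  shows "(\<integral>x. (\<integral>y. F x y \<partial>\<mu>) \<partial>\<mu>) = (\<integral>y. (\<integral>x. F x y \<partial>\<mu>) \<partial>\<mu>)"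
proof -
  have F': "continuous_on UNIV (\<lambda>(y, x). F x y)"
    unfolding case_prod_unfold by (rule continuous_on_curried[OF F]; intro continuous_intros)
  note i1 = integrable_continuous[OF cont_slice(1)[OF F]]
  note i2 = integrable_continuous[OF cont_slice(1)[OF F']]
  have "cmod ((\<integral>x. (\<integral>y. F x y \<partial>\<mu>) \<partial>\<mu>) - (\<integral>y. (\<integral>x. F x y \<partial>\<mu>) \<partial>\<mu>)) \<le> 2 * e" if e: "e > 0" for e
  proof -
    obtain t where t: "finite (range t)" "\<And>a. t -` {a} \<in> sets borel"
      "\<And>x y. cmod (F x y - F (t x) y) \<le> e" using step_approximation[OF F e] by blast
    note st = integral_step[OF t(1,2)]
    let ?S = "\<Sum>a\<in>range t. measure \<mu> (t -` {a}) *\<^sub>R (\<integral>y. F a y \<partial>\<mu>)"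
    have 1: "cmod ((\<integral>x. (\<integral>y. F x y \<partial>\<mu>) \<partial>\<mu>) - ?S) \<le> e"
      unfolding st(2)[of "\<lambda>x. \<integral>y. F x y \<partial>\<mu>", symmetric]
      by (intro norm_integral_diff_le st i1 t integrable_continuous continuous_integral F)
    have s: "(\<integral>y. (\<integral>x. F (t x) y \<partial>\<mu>) \<partial>\<mu>) = ?S" "integrable \<mu> (\<lambda>y. \<integral>x. F (t x) y \<partial>\<mu>)"
      unfolding st(2)[of "\<lambda>x. F x _"] using i1 by simp_all
    have 2: "cmod ((\<integral>y. (\<integral>x. F x y \<partial>\<mu>) \<partial>\<mu>) - ?S) \<le> e"
      unfolding s(1)[symmetric]
      by (intro norm_integral_diff_le s st(1)[of "\<lambda>x. F x _"] i2 t integrable_continuous continuous_integral F')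
    show ?thesis using 1 2 norm_triangle_ineq4[of "(\<integral>x. (\<integral>y. F x y \<partial>\<mu>) \<partial>\<mu>) - ?S" "(\<integral>y. (\<integral>x. F x y \<partial>\<mu>) \<partial>\<mu>) - ?S"] by simp
  qed
  then have "cmod ((\<integral>x. (\<integral>y. F x y \<partial>\<mu>) \<partial>\<mu>) - (\<integral>y. (\<integral>x. F x y \<partial>\<mu>) \<partial>\<mu>)) \<le> 0 + e" if "e > 0" for e
    using that[THEN half_gt_zero] by fastforce
  then have "cmod ((\<integral>x. (\<integral>y. F x y \<partial>\<mu>) \<partial>\<mu>) - (\<integral>y. (\<integral>x. F x y \<partial>\<mu>) \<partial>\<mu>)) \<le> 0"
    using field_le_epsilon by blast
  then show ?thesis by simp
qed

end

section \<open>Inner product and convolution\<close>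

abbreviation continuous_fun :: "('g::topological_space \<Rightarrow> complex) \<Rightarrow> bool" where
  "continuous_fun f \<equiv> continuous_on UNIV f"

text \<open>The inverse makes this a left action: translating by \<open>b\<close> and then by
  \<open>a\<close> is translating by \<open>a + b\<close>.\<close>

definition ltrans :: "'g::group_add \<Rightarrow> ('g \<Rightarrow> 'b) \<Rightarrow> 'g \<Rightarrow> 'b" where
  "ltrans a f = (\<lambda>x. f (- a + x))"

text \<open>Convolution by such a kernel is a self-adjoint operator, the analogue of a Hermitian
  matrix.\<close>

definition hermitian_fun :: "('g::group_add \<Rightarrow> complex) \<Rightarrow> bool" where
  "hermitian_fun f \<longleftrightarrow> (\<forall>x. f (- x) = cnj (f x))"

lemma continuous_on_div:
  fixes f :: "'g::topological_group_add \<Rightarrow> 'b::topological_space"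
  assumes "continuous_on UNIV f" "continuous_on S a" "continuous_on S b"
  shows "continuous_on S (\<lambda>x. f (- a x + b x))"
  by (rule continuous_on_compose2[OF assms(1) continuous_on_add[OF continuous_on_minus[OF assms(2)] assms(3)]]) simp

context haar_group
begin

definition ip :: "('g \<Rightarrow> complex) \<Rightarrow> ('g \<Rightarrow> complex) \<Rightarrow> complex" where
  "ip f g = (\<integral>x. f x * cnj (g x) \<partial>\<mu>)"

text \<open>The squared L^2 norm. On continuous functions it is definite, because nonempty open sets
  have positive measure.\<close>

definition sqn :: "('g \<Rightarrow> complex) \<Rightarrow> real" where
  "sqn f = Re (ip f f)"

text \<open>For Hermitian \<open>k\<close> this is the convolution \<open>f * k\<close>. Written as \<open>\<langle>f, L\<^sub>x k\<rangle>\<close>, it requires only the left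
  invariance of the measure, and it is bounded by Cauchy--Schwarz.\<close>

definition star :: "('g \<Rightarrow> complex) \<Rightarrow> ('g \<Rightarrow> complex) \<Rightarrow> 'g \<Rightarrow> complex" where
  "star f k = (\<lambda>x. ip f (ltrans x k))"

lemma continuous_ltrans [continuous_intros]:
  assumes "continuous_on UNIV (f :: 'g \<Rightarrow> 'b::topological_space)"
  shows "continuous_on UNIV (ltrans a f)"
  unfolding ltrans_def
  by (rule continuous_on_compose2[OF assms]) (auto intro!: continuous_intros)

lemma ltrans_ltrans: "ltrans a (ltrans b f) = ltrans (a + b) (f :: 'g \<Rightarrow> 'b)"
  unfolding ltrans_def by (simp only: minus_add add.assoc)

lemma ltrans_0 [simp]: "ltrans 0 f = (f :: 'g \<Rightarrow> 'b)"
  unfolding ltrans_def by simp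

lemma ip_integrable:
  assumes "continuous_fun f" "continuous_fun g"
  shows "integrable \<mu> (\<lambda>x. f x * cnj (g x))"
  using assms by (intro integrable_continuous continuous_intros)

lemma ip_add_left:
  assumes "continuous_fun f" "continuous_fun g" "continuous_fun h"
  shows "ip (\<lambda>x. f x + g x) h = ip f h + ip g h"
  using ip_integrable[OF assms(1,3)] ip_integrable[OF assms(2,3)] by (simp add: ip_def ring_distribs)

lemma ip_diff_left:
  assumes "continuous_fun f" "continuous_fun g" "continuous_fun h"
  shows "ip (\<lambda>x. f x - g x) h = ip f h - ip g h"
  using ip_integrable[OF assms(1,3)] ip_integrable[OF assms(2,3)] by (simp add: ip_def ring_distribs)

lemma ip_scale_left: "ip (\<lambda>x. c * f x) h = c * ip f h"
  by (simp add: ip_def mult.assoc)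

lemma ip_cnj: "cnj (ip f g) = ip g f"
proof -
  have "ip g f = (\<integral>x. cnj (f x * cnj (g x)) \<partial>\<mu>)"
    unfolding ip_def by (rule Bochner_Integration.integral_cong) auto
  also have "\<dots> = cnj (ip f g)"
    unfolding ip_def by (rule Bochner_Integration.integral_cnj)
  finally show ?thesis by (rule sym)
qed

lemma ip_add_right:
  assumes "continuous_fun f" "continuous_fun g" "continuous_fun h"
  shows "ip h (\<lambda>x. f x + g x) = ip h f + ip h g"
  using arg_cong[OF ip_add_left[OF assms], of cnj] by (simp add: ip_cnj)

lemma ip_diff_right:
  assumes "continuous_fun f" "continuous_fun g" "continuous_fun h"
  shows "ip h (\<lambda>x. f x - g x) = ip h f - ip h g"
  using arg_cong[OF ip_diff_left[OF assms], of cnj] by (simp add: ip_cnj)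

lemma ip_scale_right: "ip h (\<lambda>x. c * f x) = cnj c * ip h f"
  using arg_cong[OF ip_scale_left[of c f h], of cnj] by (simp add: ip_cnj)

lemma ip_sum_left:
  assumes "finite I" "\<And>i. i \<in> I \<Longrightarrow> continuous_fun (f i)" "continuous_fun h"
  shows "ip (\<lambda>x. \<Sum>i\<in>I. f i x) h = (\<Sum>i\<in>I. ip (f i) h)"
  unfolding ip_def sum_distrib_right
  using assms by (intro Bochner_Integration.integral_sum ip_integrable)

lemma ip_sum_right:
  assumes "finite I" "\<And>i. i \<in> I \<Longrightarrow> continuous_fun (f i)" "continuous_fun h"
  shows "ip h (\<lambda>x. \<Sum>i\<in>I. f i x) = (\<Sum>i\<in>I. ip h (f i))"
proof -
  have "ip h (\<lambda>x. \<Sum>i\<in>I. f i x) = cnj (ip (\<lambda>x. \<Sum>i\<in>I. f i x) h)" by (simp add: ip_cnj)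
  also have "\<dots> = (\<Sum>i\<in>I. cnj (ip (f i) h))" by (simp add: ip_sum_left[OF assms])
  finally show ?thesis by (simp add: ip_cnj)
qed

lemma sqn_eq: "sqn f = (\<integral>x. (cmod (f x))\<^sup>2 \<partial>\<mu>)"
proof -
  have "ip f f = (\<integral>x. complex_of_real ((cmod (f x))\<^sup>2) \<partial>\<mu>)"
    unfolding ip_def by (rule arg_cong[where f = "lebesgue_integral \<mu>"]) (simp add: complex_norm_square del: of_real_power)
  then show ?thesis by (simp add: sqn_def del: of_real_power)
qed

lemma ip_self: "ip f f = of_real (sqn f)"
  using arg_cong[OF ip_cnj[of f f], of Im] by (simp add: sqn_def complex_eq_iff)

lemma sqn_nonneg: "0 \<le> sqn f"
  by (simp add: sqn_eq)

lemma sqn_integrable: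
  assumes "continuous_fun f" shows "integrable \<mu> (\<lambda>x. (cmod (f x))\<^sup>2)"
  using assms by (intro integrable_continuous continuous_intros)

lemma sqn_pos:
  assumes "continuous_fun f" "f a \<noteq> 0"
  shows "0 < sqn f"
  unfolding sqn_eq using assms by (intro integral_continuous_pos[where a = a] continuous_intros) auto

lemma sqn_0_iff:
  assumes "continuous_fun f" shows "sqn f = 0 \<longleftrightarrow> f = (\<lambda>_. 0)"
  using sqn_pos[OF assms] by (force simp: sqn_def ip_def)

lemma sqn_le:
  assumes "continuous_fun f" "\<And>x. cmod (f x) \<le> e"
  shows "sqn f \<le> e\<^sup>2"
proof -
  have "sqn f \<le> (\<integral>x. e\<^sup>2 \<partial>\<mu>)"
    unfolding sqn_eq using assms by (intro integral_mono sqn_integrable) (auto intro: power_mono)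
  then show ?thesis by simp
qed

lemma sqn_scale: "sqn (\<lambda>x. c * f x) = (cmod c)\<^sup>2 * sqn f"
  by (simp add: sqn_eq norm_mult power_mult_distrib)

lemma sqn_diff:
  assumes "continuous_fun f" "continuous_fun g"
  shows "sqn (\<lambda>x. f x - g x) = sqn f - 2 * Re (ip f g) + sqn g"
proof -
  have "ip (\<lambda>x. f x - g x) (\<lambda>x. f x - g x) = ip f f - ip f g - (cnj (ip f g) - ip g g)"
    using assms by (simp add: ip_diff_left ip_diff_right ip_cnj continuous_intros)
  then show ?thesis by (simp add: sqn_def)
qed

text \<open>The factors 2 replace the square roots of the triangle inequality, by
  \<open>(a + b)^2 \<le> 2 a^2 + 2 b^2\<close>.\<close>

lemma sqn_triangle:
  assumes "continuous_fun f" "continuous_fun g"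
  shows "sqn f \<le> 2 * sqn (\<lambda>x. f x - g x) + 2 * sqn g"
proof -
  have "(cmod (f x))\<^sup>2 \<le> 2 * (cmod (f x - g x))\<^sup>2 + 2 * (cmod (g x))\<^sup>2" for x
  proof -
    have "(cmod (f x))\<^sup>2 \<le> (cmod (f x - g x) + cmod (g x))\<^sup>2"
      by (intro power_mono) (use norm_triangle_ineq[of "f x - g x" "g x"] in auto)
    also have "\<dots> \<le> 2 * (cmod (f x - g x))\<^sup>2 + 2 * (cmod (g x))\<^sup>2"
      using zero_le_power2[of "cmod (f x - g x) - cmod (g x)"] by (simp add: power2_sum power2_diff)
    finally show ?thesis .
  qed
  then have "sqn f \<le> (\<integral>x. 2 * (cmod (f x - g x))\<^sup>2 + 2 * (cmod (g x))\<^sup>2 \<partial>\<mu>)"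
    unfolding sqn_eq using assms by (intro integral_mono integrable_continuous continuous_intros) auto
  also have "\<dots> = 2 * sqn (\<lambda>x. f x - g x) + 2 * sqn g"
    unfolding sqn_eq using assms by (subst Bochner_Integration.integral_add) (auto intro!: integrable_continuous continuous_intros)
  finally show ?thesis .
qed

lemma ip_CS:
  assumes "continuous_fun f" "continuous_fun g"
  shows "(cmod (ip f g))\<^sup>2 \<le> sqn f * sqn g"
proof (cases "sqn g = 0")
  case True
  then have "g = (\<lambda>_. 0)" using assms sqn_0_iff by simp
  then show ?thesis by (simp add: ip_def sqn_def)
next
  case False
  then have p: "sqn g > 0" using sqn_nonneg[of g] by simp
  \<comment> \<open>The coefficient of the orthogonal projection of \<open>f\<close> onto
    \<open>g\<close>, which minimises the distance below.\<close>
  define c where "c = ip f g / sqn g"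
  have "0 \<le> sqn (\<lambda>x. f x - c * g x)" by (rule sqn_nonneg)
  also have "\<dots> = sqn f - 2 * Re (cnj c * ip f g) + (cmod c)\<^sup>2 * sqn g"
    using assms by (subst sqn_diff) (auto intro!: continuous_intros simp: sqn_scale ip_scale_right)
  also have "cnj c * ip f g = of_real ((cmod (ip f g))\<^sup>2 / sqn g)"
    unfolding c_def using complex_norm_square[of "ip f g"] by (simp add: mult.commute)
  also have "(cmod c)\<^sup>2 * sqn g = (cmod (ip f g))\<^sup>2 / sqn g"
    unfolding c_def using p by (simp add: norm_divide power_divide field_simps power2_eq_square)
  finally have "(cmod (ip f g))\<^sup>2 / sqn g \<le> sqn f" by simp
  then show ?thesis using p by (simp add: field_simps)
qed

lemma ip_ltrans:
  assumes "continuous_fun f" "continuous_fun g"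
  shows "ip (ltrans a f) (ltrans a g) = ip f g"
  using integral_translation[of "\<lambda>x. f x * cnj (g x)" "- a"] assms
  by (simp add: ip_def ltrans_def continuous_intros)

lemma sqn_ltrans: "continuous_fun f \<Longrightarrow> sqn (ltrans a f) = sqn f"
  by (simp add: sqn_def ip_ltrans)

lemma ip_ltrans_left:
  assumes "continuous_fun f" "continuous_fun g"
  shows "ip (ltrans a f) g = ip f (ltrans (- a) g)"
  using ip_ltrans[OF assms(1) continuous_ltrans[OF assms(2)], of a "- a"] by (simp add: ltrans_ltrans)

text \<open>Integrate \<open>f (- x + y)\<close> in both orders. Over \<open>y\<close>, left
  invariance gives the integral of \<open>f\<close>; over \<open>x\<close>, after replacing
  \<open>x\<close> by \<open>y + x\<close>, the argument becomes \<open>- x\<close>.\<close>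

lemma integral_uminus:
  assumes f: "continuous_fun f"
  shows "(\<integral>x. f (- x) \<partial>\<mu>) = (\<integral>x. f x \<partial>\<mu>)"
proof -
  have c: "continuous_on UNIV (\<lambda>(x, y). f (- x + y))"
    unfolding case_prod_unfold
    by (intro continuous_on_div[OF f] continuous_intros)
  have "(\<integral>x. f x \<partial>\<mu>) = (\<integral>x. (\<integral>y. f (- x + y) \<partial>\<mu>) \<partial>\<mu>)"
    by (simp add: integral_translation[OF f])
  also have "\<dots> = (\<integral>y. (\<integral>x. f (- x + y) \<partial>\<mu>) \<partial>\<mu>)" by (rule integral_swap[OF c])
  also have "\<dots> = (\<integral>y. (\<integral>x. f (- (y + x) + y) \<partial>\<mu>) \<partial>\<mu>)"
    by (subst integral_translation[OF cont_slice(2)[OF c]]) simp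
  also have "\<dots> = (\<integral>x. f (- x) \<partial>\<mu>)"
    by (simp only: minus_add add.assoc left_minus add_0_right lebesgue_integral_const) simp
  finally show ?thesis by simp
qed

lemma continuous_star_kernel:
  fixes f k :: "'g \<Rightarrow> complex"
  assumes "continuous_fun f" "continuous_fun k"
  shows "continuous_on UNIV (\<lambda>(x, y). f y * cnj (k (- x + y)))"
  unfolding case_prod_unfold
  by (intro continuous_intros continuous_on_div[OF assms(2)] continuous_on_compose2[OF assms(1)]) auto

lemma star_apply: "star f k x = (\<integral>y. f y * cnj (k (- x + y)) \<partial>\<mu>)"
  by (simp add: star_def ip_def ltrans_def)

lemma continuous_star [continuous_intros]:
  assumes "continuous_fun f" "continuous_fun k"
  shows "continuous_fun (star f k)"
  unfolding star_apply[abs_def] by (rule continuous_integral[OF continuous_star_kernel[OF assms]])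

lemma star_bound:
  assumes "continuous_fun f" "continuous_fun k"
  shows "(cmod (star f k x))\<^sup>2 \<le> sqn f * sqn k"
  unfolding star_def using ip_CS[of f "ltrans x k"] assms by (simp add: continuous_intros sqn_ltrans)

lemma star_diff_left:
  assumes "continuous_fun f" "continuous_fun g" "continuous_fun k"
  shows "star (\<lambda>x. f x - g x) k x = star f k x - star g k x"
  unfolding star_def using assms by (simp add: ip_diff_left continuous_intros)

lemma star_diff_right:
  assumes "continuous_fun f" "continuous_fun g" "continuous_fun k"
  shows "star k (\<lambda>x. f x - g x) x = star k f x - star k g x"
proof -
  have "ltrans x (\<lambda>x. f x - g x) = (\<lambda>y. ltrans x f y - ltrans x g y)" by (simp add: ltrans_def)
  then show ?thesis unfolding star_def using assms by (simp add: ip_diff_right continuous_intros)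
qed

lemma star_scale_left: "star (\<lambda>x. c * f x) k = (\<lambda>x. c * star f k x)"
  unfolding star_def by (simp add: ip_scale_left)

lemma star_scale_right: "star k (\<lambda>x. c * f x) = (\<lambda>x. cnj c * star k f x)"
proof -
  have "ltrans x (\<lambda>x. c * f x) = (\<lambda>y. c * ltrans x f y)" for x by (simp add: ltrans_def)
  then show ?thesis unfolding star_def by (simp add: ip_scale_right)
qed

text \<open>Convolution from the right commutes with left translation. Hence the functions fixed by
  a convolution form a translation-invariant space.\<close>

lemma star_ltrans:
  assumes "continuous_fun f" "continuous_fun k"
  shows "star (ltrans a f) k = ltrans a (star f k)"
  unfolding star_def using assms by (simp add: ip_ltrans_left ltrans_ltrans continuous_ltrans ltrans_def[of a "\<lambda>x. ip f (ltrans x k)"])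

lemma ip_eq_star: "ip f g = star f g 0"
  by (simp add: star_def)

lemma star_uminus:
  assumes "continuous_fun f" "continuous_fun k"
  shows "star f k (- x) = cnj (star k f x)"
  unfolding star_def ip_cnj using ip_ltrans_left[OF assms, of x] by simp

text \<open>\<open>star f k\<close> is the convolution of \<open>f\<close> with the adjoint kernel
  \<open>x \<mapsto> cnj (k (- x))\<close>. Both sides therefore convolve \<open>f\<close> with a
  kernel and then with the adjoint of \<open>l\<close>; the kernel is the adjoint of
  \<open>k\<close> on the left and \<open>k\<close> itself on the right, so \<open>k\<close> has to
  be Hermitian. Taking adjoints reverses products, which is why \<open>l\<close> and
  \<open>k\<close> change places.\<close>

lemma star_assoc:
  assumes C: "continuous_fun f" "continuous_fun k" "continuous_fun l" and h: "hermitian_fun k"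
  shows "star (star f k) l = star f (star l k)"
proof
  fix x
  have c: "continuous_on UNIV (\<lambda>(y, z). f z * cnj (k (- y + z)) * cnj (l (- x + y)))"
    unfolding case_prod_unfold
    by (intro continuous_on_mult continuous_on_cnj continuous_on_div[OF C(2)] continuous_on_div[OF C(3)]
        continuous_on_compose2[OF C(1)] continuous_on_const continuous_on_fst continuous_on_snd continuous_on_id) auto
  have inner: "(\<integral>y. cnj (k (- y + z)) * cnj (l (- x + y)) \<partial>\<mu>) = cnj (star l k (- x + z))" for z
  proof -
    have ck: "continuous_fun (\<lambda>y. cnj (k (- y + z)) * cnj (l (- x + y)))"
      by (intro continuous_on_mult continuous_on_cnj continuous_on_div[OF C(2)] continuous_on_div[OF C(3)]
        continuous_on_const continuous_on_id)
    have "(\<integral>y. cnj (k (- y + z)) * cnj (l (- x + y)) \<partial>\<mu>)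
        = (\<integral>y. cnj (k (- (x + y) + z)) * cnj (l (- x + (x + y))) \<partial>\<mu>)"
      by (rule integral_translation[OF ck, symmetric])
    also have "\<dots> = (\<integral>y. cnj (l y * cnj (k (- (- x + z) + y))) \<partial>\<mu>)"
    proof (rule Bochner_Integration.integral_cong[OF refl])
      fix y
      have "k (- (x + y) + z) = k (- (- (- x + z) + y))" by (simp only: minus_add add.assoc minus_minus)
      also have "\<dots> = cnj (k (- (- x + z) + y))" using h by (simp add: hermitian_fun_def)
      finally show "cnj (k (- (x + y) + z)) * cnj (l (- x + (x + y))) = cnj (l y * cnj (k (- (- x + z) + y)))"
        by (simp add: add.assoc[symmetric])
    qed
    also have "\<dots> = cnj (star l k (- x + z))"
      unfolding star_apply by (rule Bochner_Integration.integral_cnj)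
    finally show ?thesis .
  qed
  have "star (star f k) l x = (\<integral>y. (\<integral>z. f z * cnj (k (- y + z)) * cnj (l (- x + y)) \<partial>\<mu>) \<partial>\<mu>)"
    by (simp add: star_apply)
  also have "\<dots> = (\<integral>z. (\<integral>y. f z * cnj (k (- y + z)) * cnj (l (- x + y)) \<partial>\<mu>) \<partial>\<mu>)"
    by (rule integral_swap[OF c])
  also have "\<dots> = (\<integral>z. f z * (\<integral>y. cnj (k (- y + z)) * cnj (l (- x + y)) \<partial>\<mu>) \<partial>\<mu>)"
    by (simp add: mult.assoc)
  also have "\<dots> = star f (star l k) x" by (simp add: inner star_apply[of f])
  finally show "star (star f k) l x = star f (star l k) x" .
qed

lemma sqn_uniform_limit:
  assumes l: "uniform_limit UNIV c u sequentially" and C: "\<And>n. continuous_fun (c n)" "continuous_fun u"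
  shows "(\<lambda>n. sqn (\<lambda>x. c n x - u x)) \<longlonglongrightarrow> 0"
proof (rule tendstoI)
  fix e :: real assume e: "e > 0"
  have "\<forall>\<^sub>F n in sequentially. \<forall>x\<in>UNIV. dist (c n x) (u x) < sqrt (e / 2)"
    using l e unfolding uniform_limit_iff by simp
  then show "\<forall>\<^sub>F n in sequentially. dist (sqn (\<lambda>x. c n x - u x)) 0 < e"
  proof eventually_elim
    case (elim n)
    have "sqn (\<lambda>x. c n x - u x) \<le> (sqrt (e / 2))\<^sup>2"
      using elim C by (intro sqn_le continuous_intros) (auto simp: dist_norm less_imp_le)
    then show ?case using e sqn_nonneg[of "\<lambda>x. c n x - u x"] by simp
  qed
qed

lemma ip_tendsto:
  assumes C: "\<And>n. continuous_fun (c n)" "continuous_fun u" "\<And>n. continuous_fun (d n)" "continuous_fun v"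
    and l: "(\<lambda>n. sqn (\<lambda>x. c n x - u x)) \<longlonglongrightarrow> 0" "(\<lambda>n. sqn (\<lambda>x. d n x - v x)) \<longlonglongrightarrow> 0"
  shows "(\<lambda>n. ip (c n) (d n)) \<longlonglongrightarrow> ip u v"
proof -
  let ?b = "\<lambda>n. sqrt (sqn (\<lambda>x. c n x - u x) * (2 * sqn (\<lambda>x. d n x - v x) + 2 * sqn v))
      + sqrt (sqn u * sqn (\<lambda>x. d n x - v x))"
  have b: "cmod (ip (c n) (d n) - ip u v) \<le> ?b n" for n
  proof -
    have "ip (c n) (d n) - ip u v = ip (\<lambda>x. c n x - u x) (d n) + ip u (\<lambda>x. d n x - v x)"
      using C by (simp add: ip_diff_left ip_diff_right)
    moreover have "cmod (ip (\<lambda>x. c n x - u x) (d n)) \<le> sqrt (sqn (\<lambda>x. c n x - u x) * (2 * sqn (\<lambda>x. d n x - v x) + 2 * sqn v))"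
    proof (rule real_le_rsqrt)
      have "(cmod (ip (\<lambda>x. c n x - u x) (d n)))\<^sup>2 \<le> sqn (\<lambda>x. c n x - u x) * sqn (d n)"
        using C by (intro ip_CS continuous_intros)
      also have "\<dots> \<le> sqn (\<lambda>x. c n x - u x) * (2 * sqn (\<lambda>x. d n x - v x) + 2 * sqn v)"
        using C by (intro mult_left_mono sqn_triangle sqn_nonneg)
      finally show "(cmod (ip (\<lambda>x. c n x - u x) (d n)))\<^sup>2 \<le> sqn (\<lambda>x. c n x - u x) * (2 * sqn (\<lambda>x. d n x - v x) + 2 * sqn v)" .
    qed
    moreover have "cmod (ip u (\<lambda>x. d n x - v x)) \<le> sqrt (sqn u * sqn (\<lambda>x. d n x - v x))"
      using C by (intro real_le_rsqrt ip_CS continuous_intros)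
    ultimately show ?thesis by (metis norm_triangle_mono)
  qed
  have "?b \<longlonglongrightarrow> sqrt (0 * (2 * 0 + 2 * sqn v)) + sqrt (sqn u * 0)"
    by (intro tendsto_intros l)
  then have "?b \<longlonglongrightarrow> 0" by simp
  then have "(\<lambda>n. ip (c n) (d n) - ip u v) \<longlonglongrightarrow> 0"
    by (rule Lim_null_comparison[rotated]) (use b in auto)
  then show ?thesis by (rule LIM_zero_cancel)
qed

lemma ip_tendsto_uniform:
  assumes "uniform_limit UNIV c u sequentially" "\<And>n. continuous_fun (c n)" "continuous_fun u"
    "uniform_limit UNIV d v sequentially" "\<And>n. continuous_fun (d n)" "continuous_fun v"
  shows "(\<lambda>n. ip (c n) (d n)) \<longlonglongrightarrow> ip u v"
  using assms by (intro ip_tendsto sqn_uniform_limit)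

end

section \<open>Powers of a Hermitian kernel\<close>

context haar_group
begin

definition perp :: "('g \<Rightarrow> complex) set \<Rightarrow> ('g \<Rightarrow> complex) set" where
  "perp M = {f. continuous_fun f \<and> (\<forall>m\<in>M. ip f m = 0)}"

text \<open>Off by one: \<open>star_power k n\<close> is the convolution power with
  \<open>n + 1\<close> factors, because convolution has in general no unit among the continuous
  functions.\<close>

primrec star_power :: "('g \<Rightarrow> complex) \<Rightarrow> nat \<Rightarrow> 'g \<Rightarrow> complex" where
  "star_power k 0 = k"
| "star_power k (Suc n) = star (star_power k n) k"

lemma continuous_star_power: "continuous_fun k \<Longrightarrow> continuous_fun (star_power k n)"
  by (induction n) (auto intro: continuous_star)

lemma star_power_commutes:
  assumes "continuous_fun k" "hermitian_fun k"
  shows "star k (star_power k n) = star_power k (Suc n) \<and> hermitian_fun (star_power k n)"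
proof (induction n)
  case (Suc n)
  note C = continuous_star_power[OF assms(1)]
  have "hermitian_fun (star_power k (Suc n))"
    unfolding hermitian_fun_def
  proof
    fix x
    have "star_power k (Suc n) (- x) = cnj (star k (star_power k n) x)"
      using star_uminus[OF C[of n] assms(1)] by simp
    then show "star_power k (Suc n) (- x) = cnj (star_power k (Suc n) x)" using Suc by simp
  qed
  moreover have "star k (star_power k (Suc n)) = star (star k (star_power k n)) k"
    using star_assoc[OF assms(1) C[of n] assms(1)] Suc by simp
  ultimately show ?case using Suc by simp
qed (use assms in auto)

lemma star_power_add:
  assumes "continuous_fun k" "hermitian_fun k"
  shows "star (star_power k a) (star_power k b) = star_power k (Suc (a + b))"
proof (induction b arbitrary: a)
  case (Suc b)
  note C = continuous_star_power[OF assms(1)]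
  have "star (star_power k a) (star_power k (Suc b)) = star (star_power k a) (star k (star_power k b))"
    using star_power_commutes[OF assms, of b] by simp
  also have "\<dots> = star (star (star_power k a) (star_power k b)) k"
    using star_assoc[OF C[of a] C[of b] assms(1)] star_power_commutes[OF assms, of b] by simp
  also have "\<dots> = star_power k (Suc (a + Suc b))" using Suc by simp
  finally show ?case .
qed simp

lemma perp_star:
  assumes "\<And>f. f \<in> perp M \<Longrightarrow> star f k \<in> perp M" "k \<in> perp M"
  shows "star_power k n \<in> perp M"
  using assms by (induction n) auto

text \<open>The measure has total mass 1, so the pointwise Cauchy-Schwarz bound is also an L^2
  bound. This is the submultiplicativity used for the traces in
  \<open>projection_kernel\<close>.\<close>

lemma sqn_star:
  assumes "continuous_fun f" "continuous_fun k"
  shows "sqn (star f k) \<le> sqn f * sqn k"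
proof -
  have "cmod (star f k x) \<le> sqrt (sqn f * sqn k)" for x
    using star_bound[OF assms] by (intro real_le_rsqrt)
  then have "sqn (star f k) \<le> (sqrt (sqn f * sqn k))\<^sup>2"
    using assms by (intro sqn_le continuous_star)
  then show ?thesis by (simp add: sqn_nonneg)
qed

lemma continuous_uniform_limit:
  assumes "uniform_limit UNIV c u sequentially" "\<And>n. continuous_fun (c n)"
  shows "continuous_fun (u :: 'g \<Rightarrow> complex)"
  by (rule uniform_limit_theorem[OF _ assms(1)]) (use assms(2) in auto)

lemma perp_uniform_limit:
  assumes "uniform_limit UNIV c u sequentially" "\<And>n. c n \<in> perp M" "\<And>m. m \<in> M \<Longrightarrow> continuous_fun m"
  shows "u \<in> perp M"
proof -
  have C: "\<And>n. continuous_fun (c n)" using assms(2) by (simp add: perp_def)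
  have u: "continuous_fun u" using continuous_uniform_limit[OF assms(1)] C by blast
  have "ip u m = 0" if m: "m \<in> M" for m
  proof -
    have "(\<lambda>n. ip (c n) m) \<longlonglongrightarrow> ip u m"
      using assms(3)[OF m] by (intro ip_tendsto_uniform[OF assms(1) C u] uniform_limit_const)
    moreover have "ip (c n) m = 0" for n using assms(2)[of n] m by (simp add: perp_def)
    ultimately show ?thesis by (simp add: LIMSEQ_const_iff)
  qed
  then show ?thesis using u by (simp add: perp_def)
qed

text \<open>The normalised even convolution powers of a Hermitian kernel converge uniformly to the
  orthogonal projection onto an eigenspace; the limit is nonzero because the normalised traces
  decrease but stay above 1, by submultiplicativity.\<close>

lemma projection_kernel:
  assumes k: "continuous_fun k" "hermitian_fun k" "k a0 \<noteq> 0"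
    and M: "k \<in> perp M" "\<And>f. f \<in> perp M \<Longrightarrow> star f k \<in> perp M" "\<And>m. m \<in> M \<Longrightarrow> continuous_fun m"
  obtains u where "continuous_fun u" "u \<in> perp M" "star u u = u" "sqn u \<ge> 1"
proof -
  define P where "P = star_power k"
  \<comment> \<open>\<open>s n\<close> equals \<open>P (Suc (2 * n)) 0\<close>, the trace of the
    convolution power with \<open>2 n + 2\<close> factors; spectrally, it is the sum of the
    eigenvalues of \<open>k\<close>, each to the power \<open>2 n + 2\<close>.\<close>
  define s where "s n = sqn (P n)" for n
  have C: "continuous_fun (P n)" for n unfolding P_def by (rule continuous_star_power[OF k(1)])
  have H: "hermitian_fun (P n)" for n unfolding P_def using star_power_commutes[OF k(1,2)] by blast
  have add: "star (P a) (P b) = P (Suc (a + b))" for a b unfolding P_def by (rule star_power_add[OF k(1,2)])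
  have ipP: "ip (P a) (P b) = P (Suc (a + b)) 0" for a b by (simp add: ip_eq_star add)
  have s_eq: "P (Suc (2 * n)) 0 = of_real (s n)" for n
    using ipP[of n n] ip_self[of "P n"] by (simp add: s_def mult_2)
  have s_nn: "s n \<ge> 0" for n by (simp add: s_def sqn_nonneg)
  have sub: "s (Suc (a + b)) \<le> s a * s b" for a b
    unfolding s_def add[symmetric] by (rule sqn_star[OF C C])
  have logc: "(s (Suc n))\<^sup>2 \<le> s n * s (Suc (Suc n))" for n
  proof -
    have "ip (P n) (P (Suc (Suc n))) = of_real (s (Suc n))"
      unfolding ipP s_eq[symmetric] by (simp add: mult_2)
    then show ?thesis using ip_CS[OF C C, of n "Suc (Suc n)"] by (simp add: s_def)
  qed
  have s0: "s 0 > 0" unfolding s_def P_def using sqn_pos[OF k(1,3)] by simp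
  have s1: "s 1 > 0"
  proof -
    have "P 1 0 \<noteq> 0" using s_eq[of 0] s0 by simp
    then show ?thesis unfolding s_def using sqn_pos[OF C[of 1]] by blast
  qed
  have spos2: "s n > 0 \<and> s (Suc n) > 0" for n
  proof (induction n)
    case (Suc n)
    then have "0 < (s (Suc n))\<^sup>2" by simp
    also note logc[of n]
    finally have "0 < s n * s (Suc (Suc n))" .
    then show ?case using Suc by (simp add: zero_less_mult_iff)
  qed (use s0 s1 in simp)
  then have spos: "s n > 0" for n by blast
  \<comment> \<open>By log-convexity these ratios increase. Their limit \<open>\<Lambda>\<close> is,
    spectrally, the square of the largest modulus of an eigenvalue.\<close>
  define q where "q n = s (Suc n) / s n" for n
  have "incseq q"
    unfolding q_def using logc spos by (intro incseq_SucI) (simp add: field_simps power2_eq_square)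
  moreover have qb: "q n \<le> s 0" for n
    unfolding q_def using sub[of n 0] spos[of n] by (simp add: field_simps)
  ultimately obtain \<Lambda> where L: "q \<longlonglongrightarrow> \<Lambda>" "\<And>n. q n \<le> \<Lambda>"
    using incseq_convergent[of q "s 0"] by blast
  have "0 < q 0" unfolding q_def using spos by simp
  also note L(2)[of 0]
  finally have Lpos: "\<Lambda> > 0" .
  have ratio: "(\<lambda>n. s (n + j) / s n) \<longlonglongrightarrow> \<Lambda> ^ j" for j
  proof (induction j)
    case 0
    have "s n / s n = 1" for n using spos[of n] by simp
    then show ?case by simp
  next
    case (Suc j)
    have "(\<lambda>n. q (n + j) * (s (n + j) / s n)) \<longlonglongrightarrow> \<Lambda> * \<Lambda> ^ j"
      by (intro tendsto_mult Suc LIMSEQ_ignore_initial_segment L)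
    moreover have "q (n + j) * (s (n + j) / s n) = s (n + Suc j) / s n" for n
      using spos[of "n + j"] by (simp add: q_def)
    ultimately show ?case by (simp only: power_Suc)
  qed
  \<comment> \<open>Normalised traces; their limit is, spectrally, the total multiplicity of the
    eigenvalues of largest modulus.\<close>
  define \<sigma> where "\<sigma> n = s n / \<Lambda> ^ Suc n" for n
  have sig1: "\<sigma> j \<ge> 1" for j
  proof -
    \<comment> \<open>Submultiplicativity bounds \<open>s (n + Suc j) / s n\<close> by
      \<open>s j\<close>, and this quotient tends to \<open>\<Lambda> ^ Suc j\<close>.\<close>
    have "\<Lambda> ^ Suc j \<le> s j"
    proof (rule LIMSEQ_le_const2[OF ratio])
      have "s (n + Suc j) / s n \<le> s j" for n
        using sub[of n j] spos[of n] by (simp add: field_simps)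
      then show "\<exists>N. \<forall>n\<ge>N. s (n + Suc j) / s n \<le> s j" by blast
    qed
    then show ?thesis unfolding \<sigma>_def using Lpos by simp
  qed
  have "decseq \<sigma>"
  proof (rule decseq_SucI)
    fix n
    have "s (Suc n) \<le> \<Lambda> * s n" using L(2)[of n] spos[of n] by (simp add: q_def field_simps)
    then show "\<sigma> (Suc n) \<le> \<sigma> n" unfolding \<sigma>_def using Lpos by (simp add: field_simps)
  qed
  then obtain S where S: "\<sigma> \<longlonglongrightarrow> S" using decseq_convergent[of \<sigma> 1] sig1 by blast
  have S1: "S \<ge> 1" by (rule LIMSEQ_le_const[OF S]) (use sig1 in auto)
  \<comment> \<open>The power has \<open>2 n + 2\<close> factors, so dividing by
    \<open>\<Lambda> ^ Suc n\<close> scales its top eigenvalues to exactly 1; the even exponent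
    removes their signs.\<close>
  define c where "c n = (\<lambda>x. complex_of_real (1 / \<Lambda> ^ Suc n) * P (Suc (2 * n)) x)" for n
  have Cc: "continuous_fun (c n)" for n unfolding c_def by (intro continuous_intros C)
  have ipc: "ip (c n) (c m) = of_real (\<sigma> (Suc (n + m)))" for n m
  proof -
    have "ip (c n) (c m) = of_real (1 / \<Lambda> ^ Suc n) * (of_real (1 / \<Lambda> ^ Suc m) * P (Suc (2 * Suc (n + m))) 0)"
      unfolding c_def ip_scale_left ip_scale_right ipP by (simp add: algebra_simps)
    also have "\<dots> = of_real (\<sigma> (Suc (n + m)))"
      unfolding s_eq \<sigma>_def by (simp add: power_add field_simps)
    finally show ?thesis .
  qed
  have sqc: "sqn (\<lambda>x. c n x - c m x) = \<sigma> (Suc (n + n)) - 2 * \<sigma> (Suc (n + m)) + \<sigma> (Suc (m + m))" for n m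
    by (simp add: sqn_diff[OF Cc Cc] sqn_def ipc)
  \<comment> \<open>One more convolution with \<open>P 1\<close>, the square of \<open>k\<close>,
    raises the index by one. Through \<open>star_bound\<close>, L^2 closeness at index
    \<open>n\<close> becomes uniform closeness at index \<open>Suc n\<close>.\<close>
  have step: "star (c n) (P 1) = (\<lambda>x. of_real \<Lambda> * c (Suc n) x)" for n
    unfolding c_def star_scale_left add using Lpos by (auto simp: field_simps)
  have dist: "cmod (c (Suc n) x - c (Suc m) x) \<le> sqrt (sqn (\<lambda>x. c n x - c m x) * s 1) / \<Lambda>" for n m x
  proof -
    have "of_real \<Lambda> * (c (Suc n) x - c (Suc m) x) = star (\<lambda>x. c n x - c m x) (P 1) x"
      by (simp only: star_diff_left[OF Cc Cc C] step right_diff_distrib)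
    moreover have "cmod (star (\<lambda>x. c n x - c m x) (P 1) x) \<le> sqrt (sqn (\<lambda>x. c n x - c m x) * s 1)"
      unfolding s_def by (intro real_le_rsqrt star_bound continuous_intros Cc C)
    ultimately have "\<Lambda> * cmod (c (Suc n) x - c (Suc m) x) \<le> sqrt (sqn (\<lambda>x. c n x - c m x) * s 1)"
      using Lpos by (metis norm_mult norm_of_real abs_of_pos)
    then show ?thesis using Lpos by (simp add: field_simps)
  qed
  have "uniformly_Cauchy_on UNIV (\<lambda>n. c (Suc n))"
  proof (rule uniformly_Cauchy_onI)
    fix e :: real assume e: "e > 0"
    define d where "d = (\<Lambda> * e / 2)\<^sup>2 / s 1 / 4"
    have d: "d > 0" unfolding d_def using e Lpos spos[of 1] by simp
    obtain N where N: "\<And>n. n \<ge> N \<Longrightarrow> \<bar>\<sigma> n - S\<bar> < d"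
      using LIMSEQ_D[OF S d] by auto
    have "dist (c (Suc n) x) (c (Suc m) x) < e" if "n \<ge> N" "m \<ge> N" for n m x
    proof -
      have "sqn (\<lambda>x. c n x - c m x) \<le> 4 * d"
        unfolding sqc using N[of "Suc (n + n)"] N[of "Suc (n + m)"] N[of "Suc (m + m)"] that by linarith
      then have "sqrt (sqn (\<lambda>x. c n x - c m x) * s 1) \<le> sqrt (4 * d * s 1)"
        using spos[of 1] by (intro real_sqrt_le_mono mult_right_mono) auto
      also have "4 * d * s 1 = (\<Lambda> * e / 2)\<^sup>2" unfolding d_def using spos[of 1] by simp
      also have "sqrt \<dots> = \<Lambda> * e / 2" using Lpos e by (simp add: real_sqrt_abs)
      finally have "sqrt (sqn (\<lambda>x. c n x - c m x) * s 1) / \<Lambda> \<le> e / 2" using Lpos by (simp add: field_simps)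
      then show ?thesis using dist[of n x m] e unfolding dist_norm by linarith
    qed
    then show "\<exists>N. \<forall>x\<in>UNIV. \<forall>m\<ge>N. \<forall>n\<ge>N. dist (c (Suc m) x) (c (Suc n) x) < e" by blast
  qed
  then obtain u where u: "uniform_limit UNIV (\<lambda>n. c (Suc n)) u sequentially"
    using Cauchy_uniformly_convergent uniformly_convergent_on_def by blast
  have Cu: "continuous_fun u" using continuous_uniform_limit[OF u] Cc by blast
  show thesis
  proof
    show "continuous_fun u" by (rule Cu)
    have "P n \<in> perp M" for n unfolding P_def using M by (intro perp_star) auto
    then have "c n \<in> perp M" for n
      using Cc[of n] unfolding perp_def c_def mem_Collect_eq ip_scale_left by simp
    then show "u \<in> perp M" by (intro perp_uniform_limit[OF u] M)
    have "(\<lambda>n. ip (c (Suc n)) (c (Suc n))) \<longlonglongrightarrow> ip u u"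
      by (intro ip_tendsto_uniform u Cc Cu)
    then have "(\<lambda>n. Re (ip (c (Suc n)) (c (Suc n)))) \<longlonglongrightarrow> Re (ip u u)" by (rule tendsto_Re)
    then have "(\<lambda>n. \<sigma> (Suc (Suc n + Suc n))) \<longlonglongrightarrow> sqn u" unfolding ipc sqn_def by simp
    then show "sqn u \<ge> 1" by (rule LIMSEQ_le_const) (use sig1 in auto)
    have lim: "(\<lambda>n. c (Suc n) x) \<longlonglongrightarrow> u x" for x
      using tendsto_uniform_limitI[OF u] by blast
    \<comment> \<open>The square of \<open>c n\<close> is exactly \<open>c (Suc (2 * n))\<close>, so
      the squares run through a subsequence with the same limit \<open>u\<close>.\<close>
    show "star u u = u"
    proof
      fix x
      have ux: "uniform_limit UNIV (\<lambda>n. ltrans x (c (Suc n))) (ltrans x u) sequentially"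
        using u unfolding uniform_limit_iff ltrans_def by (auto elim!: eventually_mono)
      have "(\<lambda>n. ip (c (Suc n)) (ltrans x (c (Suc n)))) \<longlonglongrightarrow> ip u (ltrans x u)"
        by (intro ip_tendsto_uniform u ux Cc Cu continuous_intros)
      moreover have "ip (c n) (ltrans x (c n)) = c (Suc (2 * n)) x" for n
      proof -
        have "ip (c n) (ltrans x (c n)) = star (c n) (c n) x" by (simp add: star_def)
        also have "\<dots> = of_real (1 / \<Lambda> ^ Suc n) * (of_real (1 / \<Lambda> ^ Suc n) * P (Suc (2 * Suc (2 * n))) x)"
          unfolding c_def star_scale_left star_scale_right add by (simp add: mult_2)
        also have "\<dots> = c (Suc (2 * n)) x" unfolding c_def by (simp add: mult_2 power_add)
        finally show ?thesis .
      qed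
      moreover have "(\<lambda>n. c (Suc (2 * Suc n)) x) \<longlonglongrightarrow> u x"
      proof -
        have "strict_mono (\<lambda>n::nat. 2 * Suc n)" by (auto simp: strict_mono_def)
        from LIMSEQ_subseq_LIMSEQ[OF lim this] show ?thesis by (simp add: o_def)
      qed
      ultimately show "star u u x = u x" unfolding star_def using LIMSEQ_unique by fastforce
    qed
  qed
qed

end

section \<open>Coefficients of unitary representations\<close>

lemma mat_adjoint_dim [simp]: "dim_row (mat_adjoint A) = dim_col A" "dim_col (mat_adjoint A) = dim_row A"
  unfolding mat_adjoint_def by simp_all

lemma mat_adjoint_carrier [simp]: "A \<in> carrier_mat n m \<Longrightarrow> mat_adjoint A \<in> carrier_mat m n"
  by (intro carrier_matI) auto

lemma mat_adjoint_index [simp]: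
  "i < dim_col A \<Longrightarrow> j < dim_row A \<Longrightarrow> mat_adjoint A $$ (i, j) = cnj (A $$ (j, i))"
  unfolding mat_adjoint_def by (auto simp: mat_of_rows_index conjugate_complex_def)

lemma mat_mult_index:
  assumes "A \<in> carrier_mat n k" "B \<in> carrier_mat k m" "i < n" "j < m"
  shows "(A * B) $$ (i, j) = (\<Sum>l<k. A $$ (i, l) * B $$ (l, j))"
  using assms by (auto simp: scalar_prod_def atLeast0LessThan intro!: sum.cong)

lemma mat_vec_mult_index:
  assumes "A \<in> carrier_mat n k" "v \<in> carrier_vec k" "i < n"
  shows "(A *\<^sub>v v) $ i = (\<Sum>l<k. A $$ (i, l) * v $ l)"
  using assms by (auto simp: scalar_prod_def atLeast0LessThan intro!: sum.cong)

lemma unitary_mat_cols: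
  assumes "unitary_mat d U" "i < d" "j < d"
  shows "(\<Sum>k<d. cnj (U $$ (k, i)) * U $$ (k, j)) = (if i = j then 1 else 0)"
proof -
  have U: "U \<in> carrier_mat d d" "mat_adjoint U * U = 1\<^sub>m d"
    using assms(1) by (auto simp: unitary_mat_def)
  have "(\<Sum>k<d. cnj (U $$ (k, i)) * U $$ (k, j)) = (mat_adjoint U * U) $$ (i, j)"
    using U(1) assms(2,3) by (subst mat_mult_index[of _ d d _ d]) (auto intro!: sum.cong)
  then show ?thesis using U assms(2,3) by simp
qed

lemma unitary_rep_carrier:
  "unitary_rep \<xi> \<Longrightarrow> \<xi> x \<in> carrier_mat (rep_dim \<xi>) (rep_dim \<xi>)"
  by (simp add: unitary_rep_def unitary_mat_def)

lemma unitary_rep_dims [simp]: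
  assumes "unitary_rep \<xi>"
  shows "dim_row (\<xi> x) = rep_dim \<xi>" "dim_col (\<xi> x) = rep_dim \<xi>"
  using unitary_rep_carrier[OF assms, of x] by auto

lemma unitary_rep_0:
  assumes "unitary_rep \<xi>" shows "\<xi> 0 = 1\<^sub>m (rep_dim \<xi>)"
proof -
  let ?d = "rep_dim \<xi>"
  have u: "unitary_mat ?d (\<xi> 0)" and m: "\<xi> 0 = \<xi> 0 * \<xi> 0"
    using assms unfolding unitary_rep_def by (blast, metis add_0)
  then have c: "\<xi> 0 \<in> carrier_mat ?d ?d" and i: "mat_adjoint (\<xi> 0) * \<xi> 0 = 1\<^sub>m ?d"
    by (auto simp: unitary_mat_def)
  have "1\<^sub>m ?d = mat_adjoint (\<xi> 0) * (\<xi> 0 * \<xi> 0)" using i m by simp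
  also have "\<dots> = (mat_adjoint (\<xi> 0) * \<xi> 0) * \<xi> 0"
    using c by (intro assoc_mult_mat[symmetric]) auto
  also have "\<dots> = \<xi> 0" using c i by simp
  finally show ?thesis by simp
qed

lemma unitary_rep_uminus:
  assumes "unitary_rep \<xi>" shows "\<xi> (- x) = mat_adjoint (\<xi> x)"
proof -
  let ?d = "rep_dim \<xi>"
  have u: "unitary_mat ?d (\<xi> x)" and m: "\<xi> x * \<xi> (- x) = \<xi> 0"
    using assms unfolding unitary_rep_def by (blast, metis right_minus)
  note c = unitary_rep_carrier[OF assms]
  have "\<xi> (- x) = (mat_adjoint (\<xi> x) * \<xi> x) * \<xi> (- x)"
    using u c[of "- x"] by (simp add: unitary_mat_def)
  also have "\<dots> = mat_adjoint (\<xi> x) * (\<xi> x * \<xi> (- x))"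
    by (rule assoc_mult_mat[OF mat_adjoint_carrier[OF c] c c])
  also have "\<dots> = mat_adjoint (\<xi> x)" unfolding m unitary_rep_0[OF assms] using c[of x] by (intro right_mult_one_mat mat_adjoint_carrier)
  finally show ?thesis .
qed

lemma coef_uminus:
  assumes "unitary_rep \<xi>" "i < rep_dim \<xi>" "j < rep_dim \<xi>"
  shows "\<xi> (- x) $$ (i, j) = cnj (\<xi> x $$ (j, i))"
  using assms by (simp add: unitary_rep_uminus)

lemma coef_add:
  assumes "unitary_rep \<xi>" "i < rep_dim \<xi>" "j < rep_dim \<xi>"
  shows "\<xi> (x + y) $$ (i, j) = (\<Sum>k<rep_dim \<xi>. \<xi> x $$ (i, k) * \<xi> y $$ (k, j))"
proof -
  have "\<xi> (x + y) = \<xi> x * \<xi> y" using assms(1) by (simp add: unitary_rep_def)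
  then show ?thesis
    using mat_mult_index[OF unitary_rep_carrier[OF assms(1)] unitary_rep_carrier[OF assms(1)] assms(2,3)] by simp
qed

lemma coef_continuous:
  assumes "unitary_rep \<xi>" "i < rep_dim \<xi>" "j < rep_dim \<xi>"
  shows "continuous_fun (\<lambda>x. \<xi> x $$ (i, j))"
  using assms by (simp add: unitary_rep_def)

text \<open>The adjoint of a value is the value at the inverse, so multiplicativity and the value at
  0 yield both unitarity relations.\<close>

lemma unitary_repI:
  fixes a :: "nat \<Rightarrow> nat \<Rightarrow> 'g::topological_group_add \<Rightarrow> complex"
  assumes add: "\<And>i j x y. i < d \<Longrightarrow> j < d \<Longrightarrow> a i j (x + y) = (\<Sum>k<d. a i k x * a k j y)"
    and inv: "\<And>i j x. i < d \<Longrightarrow> j < d \<Longrightarrow> a i j (- x) = cnj (a j i x)"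
    and zero: "\<And>i j. i < d \<Longrightarrow> j < d \<Longrightarrow> a i j 0 = (if i = j then 1 else 0)"
    and cont: "\<And>i j. i < d \<Longrightarrow> j < d \<Longrightarrow> continuous_fun (a i j)"
  shows "unitary_rep (\<lambda>x. Matrix.mat d d (\<lambda>(i, j). a i j x))" (is "unitary_rep ?\<xi>")
    and "rep_dim (\<lambda>x. Matrix.mat d d (\<lambda>(i, j). a i j x)) = d"
proof -
  show dim: "rep_dim ?\<xi> = d" by (simp add: rep_dim_def)
  have c: "?\<xi> x \<in> carrier_mat d d" for x by simp
  have mult: "?\<xi> (x + y) = ?\<xi> x * ?\<xi> y" for x y
  proof (rule eq_matI)
    fix i j assume "i < dim_row (?\<xi> x * ?\<xi> y)" "j < dim_col (?\<xi> x * ?\<xi> y)"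
    then have ij: "i < d" "j < d" by auto
    show "?\<xi> (x + y) $$ (i, j) = (?\<xi> x * ?\<xi> y) $$ (i, j)"
      using ij add[OF ij, of x y] by (subst mat_mult_index[OF c c ij]) simp
  qed auto
  have adj: "mat_adjoint (?\<xi> x) = ?\<xi> (- x)" for x
    by (rule eq_matI) (auto simp: inv)
  have one: "?\<xi> 0 = 1\<^sub>m d"
    by (rule eq_matI) (auto simp: zero)
  have "unitary_mat d (?\<xi> x)" for x
    unfolding unitary_mat_def adj mult[symmetric] using one by simp
  then show "unitary_rep ?\<xi>"
    unfolding unitary_rep_def dim using mult cont by auto
qed

lemma subspace_module_vecD:
  assumes "VectorSpace.subspace class_ring W (module_vec TYPE(complex) d)"
  shows "W \<subseteq> carrier_vec d" "0\<^sub>v d \<in> W" "\<And>v w. v \<in> W \<Longrightarrow> w \<in> W \<Longrightarrow> v + w \<in> W"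
    "\<And>c v. v \<in> W \<Longrightarrow> c \<cdot>\<^sub>v v \<in> W"
  using assms unfolding VectorSpace.subspace_def LinearCombinations.submodule_def
  by (auto simp: module_vec_def)

lemma subspace_module_vecI:
  assumes "W \<subseteq> carrier_vec d" "0\<^sub>v d \<in> W" "\<And>v w. v \<in> W \<Longrightarrow> w \<in> W \<Longrightarrow> v + w \<in> W"
    "\<And>c v. v \<in> W \<Longrightarrow> c \<cdot>\<^sub>v v \<in> W"
  shows "VectorSpace.subspace class_ring W (module_vec TYPE(complex) d)"
proof -
  have v: "vectorspace class_ring (module_vec TYPE(complex) d)" by (rule vec_vs)
  then have "Module.module class_ring (module_vec TYPE(complex) d)"
    by (simp add: vectorspace_def)
  then show ?thesis
    using assms v unfolding VectorSpace.subspace_def LinearCombinations.submodule_def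
    by (auto simp: module_vec_def)
qed

text \<open>The span of the coefficients of all irreducible matrix representations, rather than of
  one representative per class, so that no choice enters the density argument.\<close>

inductive_set trig_poly :: "('g::topological_group_add \<Rightarrow> complex) set" where
  coef: "irreducible_unitary_rep \<xi> \<Longrightarrow> i < rep_dim \<xi> \<Longrightarrow> j < rep_dim \<xi> \<Longrightarrow> (\<lambda>x. \<xi> x $$ (i, j)) \<in> trig_poly"
| zero: "(\<lambda>x. 0) \<in> trig_poly"
| add: "f \<in> trig_poly \<Longrightarrow> g \<in> trig_poly \<Longrightarrow> (\<lambda>x. f x + g x) \<in> trig_poly"
| scale: "f \<in> trig_poly \<Longrightarrow> (\<lambda>x. c * f x) \<in> trig_poly"

lemma trig_poly_sum:
  "finite I \<Longrightarrow> (\<And>i. i \<in> I \<Longrightarrow> f i \<in> trig_poly) \<Longrightarrow> (\<lambda>x. \<Sum>i\<in>I. f i x) \<in> trig_poly"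
  by (induction I rule: finite_induct) (auto intro: trig_poly.intros)

lemma irreducible_unitary: "irreducible_unitary_rep \<xi> \<Longrightarrow> unitary_rep \<xi>"
  by (simp add: irreducible_unitary_rep_def)

lemma trig_poly_continuous: "f \<in> trig_poly \<Longrightarrow> continuous_fun f"
  by (induction rule: trig_poly.induct)
    (auto intro!: continuous_intros coef_continuous irreducible_unitary)

section \<open>Translation-invariant spaces and orthonormal systems\<close>

context haar_group
begin

definition invariant_space :: "('g \<Rightarrow> complex) set \<Rightarrow> bool" where
  "invariant_space V \<longleftrightarrow> (\<forall>f\<in>V. continuous_fun f) \<and> (\<lambda>_. 0) \<in> V \<and>
     (\<forall>f\<in>V. \<forall>g\<in>V. (\<lambda>x. f x + g x) \<in> V) \<and> (\<forall>c. \<forall>f\<in>V. (\<lambda>x. c * f x) \<in> V) \<and>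
     (\<forall>a. \<forall>f\<in>V. ltrans a f \<in> V)"

text \<open>A finite orthonormal system; the values of \<open>e\<close> from \<open>m\<close> on are
  irrelevant, and the empty system is allowed.\<close>

definition ortho :: "('g \<Rightarrow> complex) set \<Rightarrow> nat \<Rightarrow> (nat \<Rightarrow> 'g \<Rightarrow> complex) \<Rightarrow> bool" where
  "ortho V m e \<longleftrightarrow> (\<forall>i<m. e i \<in> V) \<and> (\<forall>i<m. \<forall>j<m. ip (e i) (e j) = (if i = j then 1 else 0))"

lemma invariant_spaceD:
  assumes "invariant_space V"
  shows "\<And>f. f \<in> V \<Longrightarrow> continuous_fun f" "(\<lambda>_. 0) \<in> V" "\<And>f g. f \<in> V \<Longrightarrow> g \<in> V \<Longrightarrow> (\<lambda>x. f x + g x) \<in> V"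
    "\<And>c f. f \<in> V \<Longrightarrow> (\<lambda>x. c * f x) \<in> V" "\<And>a f. f \<in> V \<Longrightarrow> ltrans a f \<in> V"
  using assms by (auto simp: invariant_space_def)

lemma invariant_space_sum:
  assumes "invariant_space V"
  shows "finite I \<Longrightarrow> (\<And>i. i \<in> I \<Longrightarrow> f i \<in> V) \<Longrightarrow> (\<lambda>x. \<Sum>i\<in>I. f i x) \<in> V"
  by (induction I rule: finite_induct) (auto intro: invariant_spaceD[OF assms])

lemma ip_combination:
  assumes "invariant_space V" "ortho V m e" "i < m"
  shows "ip (\<lambda>x. \<Sum>j<m. a j * e j x) (e i) = a i"
    and "ip (e i) (\<lambda>x. \<Sum>j<m. a j * e j x) = cnj (a i)"
proof -
  have C: "continuous_fun (e j)" if "j < m" for j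
    using assms(1,2) that by (auto simp: ortho_def invariant_space_def)
  have "ip (\<lambda>x. \<Sum>j<m. a j * e j x) (e i) = (\<Sum>j<m. a j * ip (e j) (e i))"
    using assms(3) C by (subst ip_sum_left) (auto intro!: continuous_intros simp: ip_scale_left)
  also have "\<dots> = (\<Sum>j<m. if j = i then a i else 0)"
    using assms(2,3) by (intro sum.cong) (auto simp: ortho_def)
  finally show 1: "ip (\<lambda>x. \<Sum>j<m. a j * e j x) (e i) = a i" using assms(3) by simp
  then show "ip (e i) (\<lambda>x. \<Sum>j<m. a j * e j x) = cnj (a i)"
    using ip_cnj[of "\<lambda>x. \<Sum>j<m. a j * e j x" "e i"] by simp
qed

text \<open>One Gram-Schmidt step: the new vector is the normalised residual of \<open>f\<close>
  after projection.\<close>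

lemma ortho_extend:
  assumes V: "invariant_space V" "ortho V m e" and f: "f \<in> V"
    and ne: "f \<noteq> (\<lambda>x. \<Sum>i<m. ip f (e i) * e i x)"
  obtains e' where "ortho V (Suc m) e'"
proof -
  note D = invariant_spaceD[OF V(1)]
  have e: "e i \<in> V" if "i < m" for i using V(2) that by (simp add: ortho_def)
  define p where "p = (\<lambda>x. \<Sum>i<m. ip f (e i) * e i x)"
  have p: "p \<in> V" unfolding p_def using e by (intro invariant_space_sum[OF V(1)] D) auto
  define g where "g = (\<lambda>x. f x + (-1) * p x)"
  have g: "g \<in> V" unfolding g_def by (intro D f p)
  have "ip g (e i) = 0" if "i < m" for i
  proof -
    have "ip g (e i) = ip f (e i) + (- 1) * ip p (e i)"
      unfolding g_def using D(1) f p e[OF that] by (subst ip_add_left) (auto intro!: continuous_intros simp only: ip_scale_left)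
    then show ?thesis using ip_combination(1)[OF V that, of "\<lambda>i. ip f (e i)"] unfolding p_def by simp
  qed
  then have ge: "ip g (e i) = 0" "ip (e i) g = 0" if "i < m" for i
    using that ip_cnj[of g "e i"] by auto
  obtain y where "g y \<noteq> 0" using ne unfolding g_def p_def by (auto simp: fun_eq_iff)
  then have s: "sqn g > 0" using sqn_pos[OF D(1)[OF g]] by blast
  define h where "h = (\<lambda>x. complex_of_real (1 / sqrt (sqn g)) * g x)"
  have h: "h \<in> V" unfolding h_def by (intro D g)
  have hh: "ip h h = 1"
    unfolding h_def ip_scale_left ip_scale_right ip_self
    using s by (simp flip: of_real_mult)
  have he: "ip h (e i) = 0" "ip (e i) h = 0" if "i < m" for i
    unfolding h_def ip_scale_left ip_scale_right using ge[OF that] by auto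
  have "ortho V (Suc m) (e(m := h))"
    using V(2) h hh he unfolding ortho_def by (auto simp: less_Suc_eq)
  then show thesis by (rule that)
qed

lemma bessel:
  assumes "invariant_space V" "ortho V m e" "continuous_fun f"
  shows "(\<Sum>i<m. (cmod (ip (e i) f))\<^sup>2) \<le> sqn f"
proof -
  have C: "continuous_fun (e j)" if "j < m" for j
    using assms(1,2) that by (auto simp: ortho_def invariant_space_def)
  define p where "p = (\<lambda>x. \<Sum>i<m. ip f (e i) * e i x)"
  have p: "continuous_fun p" unfolding p_def using C by (intro continuous_intros) auto
  have cp: "(cmod (ip (e i) f))\<^sup>2 = Re (ip f (e i) * cnj (ip f (e i)))" for i
  proof -
    have "cmod (ip (e i) f) = cmod (ip f (e i))" using complex_mod_cnj[of "ip f (e i)"] by (simp add: ip_cnj)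
    then show ?thesis by (simp flip: complex_norm_square)
  qed
  have fp: "ip f p = (\<Sum>i<m. cnj (ip f (e i)) * ip f (e i))"
    unfolding p_def using C assms(3) by (subst ip_sum_right) (auto intro!: continuous_intros simp: ip_scale_right)
  have pp: "ip p p = (\<Sum>i<m. cnj (ip f (e i)) * ip f (e i))"
  proof -
    have "ip p p = (\<Sum>i<m. cnj (ip f (e i)) * ip p (e i))"
      unfolding p_def[abs_def] using C p by (subst ip_sum_right) (auto intro!: continuous_intros simp: ip_scale_right p_def)
    then show ?thesis unfolding p_def using ip_combination(1)[OF assms(1,2)] by simp
  qed
  have "0 \<le> sqn (\<lambda>x. f x - p x)" by (rule sqn_nonneg)
  also have "\<dots> = sqn f - 2 * Re (ip f p) + Re (ip p p)"
    using sqn_diff[OF assms(3) p] by (simp add: sqn_def)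
  finally show ?thesis unfolding fp pp by (simp add: cp mult.commute)
qed

end

section \<open>Irreducible representations from invariant spaces\<close>

lemma coef_ltrans:
  assumes "unitary_rep \<xi>" "i < rep_dim \<xi>" "j < rep_dim \<xi>"
  shows "\<xi> (- x + y) $$ (i, j) = (\<Sum>l<rep_dim \<xi>. cnj (\<xi> x $$ (l, i)) * \<xi> y $$ (l, j))"
  using assms by (simp add: coef_add coef_uminus)

lemma trig_poly_ltrans: "f \<in> trig_poly \<Longrightarrow> ltrans a f \<in> trig_poly"
proof (induction rule: trig_poly.induct)
  case (coef \<xi> i j)
  have "ltrans a (\<lambda>x. \<xi> x $$ (i, j)) = (\<lambda>y. \<Sum>l<rep_dim \<xi>. cnj (\<xi> a $$ (l, i)) * \<xi> y $$ (l, j))"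
    unfolding ltrans_def using coef by (intro ext coef_ltrans irreducible_unitary)
  also have "\<dots> \<in> trig_poly"
    using coef by (intro trig_poly_sum trig_poly.scale trig_poly.coef) auto
  finally show ?case .
qed (auto simp: ltrans_def intro: trig_poly.intros)

context haar_group
begin

text \<open>Fourier coefficients turn convolution into a matrix product: the substitution
  \<open>x \<mapsto> y + x\<close> splits \<open>\<xi> (y + x)\<close> into \<open>\<xi> y\<close>
  and \<open>\<xi> x\<close>. In particular all coefficients of \<open>star f k\<close> vanish when
  those of \<open>f\<close> do.\<close>

lemma ip_star_coef:
  assumes f: "continuous_fun f" and k: "continuous_fun k"
    and \<xi>: "unitary_rep \<xi>" "i < rep_dim \<xi>" "j < rep_dim \<xi>"
  shows "ip (star f k) (\<lambda>x. \<xi> x $$ (i, j)) =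
    (\<Sum>l<rep_dim \<xi>. ip f (\<lambda>x. \<xi> x $$ (i, l)) * ip (\<lambda>x. cnj (k (- x))) (\<lambda>x. \<xi> x $$ (l, j)))"
proof -
  note C = coef_continuous[OF \<xi>(1)]
  have c: "continuous_on UNIV (\<lambda>(x, y). f y * cnj (k (- x + y)) * cnj (\<xi> x $$ (i, j)))"
    unfolding case_prod_unfold
    by (intro continuous_on_mult continuous_on_cnj continuous_on_div[OF k] continuous_on_compose2[OF f]
        continuous_on_compose2[OF C[OF \<xi>(2,3)]] continuous_on_fst continuous_on_snd continuous_on_id) auto
  have kc: "continuous_fun (\<lambda>x. cnj (k (- x)))"
    by (intro continuous_on_cnj continuous_on_compose2[OF k] continuous_intros) auto
  have "ip (star f k) (\<lambda>x. \<xi> x $$ (i, j)) = (\<integral>x. (\<integral>y. f y * cnj (k (- x + y)) * cnj (\<xi> x $$ (i, j)) \<partial>\<mu>) \<partial>\<mu>)"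
    unfolding ip_def[of "star f k"] star_apply by simp
  also have "\<dots> = (\<integral>y. (\<integral>x. f y * cnj (k (- x + y)) * cnj (\<xi> x $$ (i, j)) \<partial>\<mu>) \<partial>\<mu>)"
    by (rule integral_swap[OF c])
  also have "\<dots> = (\<integral>y. (\<integral>x. f y * cnj (k (- (y + x) + y)) * cnj (\<xi> (y + x) $$ (i, j)) \<partial>\<mu>) \<partial>\<mu>)"
    by (subst integral_translation[OF cont_slice(2)[OF c]]) simp
  also have "\<dots> = (\<integral>y. (\<Sum>l<rep_dim \<xi>. f y * cnj (\<xi> y $$ (i, l)) * ip (\<lambda>x. cnj (k (- x))) (\<lambda>x. \<xi> x $$ (l, j))) \<partial>\<mu>)"
  proof (rule Bochner_Integration.integral_cong[OF refl])
    fix y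
    have "- (y + x) + y = - x" for x :: 'g by (simp only: minus_add add.assoc left_minus add_0_right)
    then have "(\<integral>x. f y * cnj (k (- (y + x) + y)) * cnj (\<xi> (y + x) $$ (i, j)) \<partial>\<mu>)
       = (\<integral>x. (\<Sum>l<rep_dim \<xi>. f y * cnj (\<xi> y $$ (i, l)) * (cnj (k (- x)) * cnj (\<xi> x $$ (l, j)))) \<partial>\<mu>)"
      using \<xi> by (simp add: coef_add sum_distrib_left mult_ac)
    also have "\<dots> = (\<Sum>l<rep_dim \<xi>. f y * cnj (\<xi> y $$ (i, l)) * ip (\<lambda>x. cnj (k (- x))) (\<lambda>x. \<xi> x $$ (l, j)))"
      unfolding ip_def using \<xi> kc C
      by (subst Bochner_Integration.integral_sum) (auto intro!: integrable_continuous continuous_on_mult continuous_on_const continuous_on_cnj)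
    finally show "(\<integral>x. f y * cnj (k (- (y + x) + y)) * cnj (\<xi> (y + x) $$ (i, j)) \<partial>\<mu>) = \<dots>" .
  qed
  also have "\<dots> = (\<Sum>l<rep_dim \<xi>. ip f (\<lambda>x. \<xi> x $$ (i, l)) * ip (\<lambda>x. cnj (k (- x))) (\<lambda>x. \<xi> x $$ (l, j)))"
    unfolding ip_def[of f] using \<xi> f C
    by (subst Bochner_Integration.integral_sum) (auto intro!: integrable_continuous continuous_on_mult continuous_on_const continuous_on_cnj)
  finally show ?thesis .
qed

lemma perp_trig_star:
  assumes f: "f \<in> perp trig_poly" and k: "continuous_fun k"
  shows "star f k \<in> perp trig_poly"
proof -
  have C: "continuous_fun f" using f by (simp add: perp_def)
  have "ip (star f k) m = 0" if "m \<in> trig_poly" for m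
    using that
  proof (induction rule: trig_poly.induct)
    case (coef \<xi> i j)
    have "ip f (\<lambda>x. \<xi> x $$ (i, l)) = 0" if "l < rep_dim \<xi>" for l
      using f coef that by (auto simp: perp_def intro: trig_poly.coef)
    then show ?case using coef by (subst ip_star_coef[OF C k irreducible_unitary]) auto
  next
    case zero
    then show ?case by (simp add: ip_def)
  next
    case (add f g)
    then show ?case using C k by (subst ip_add_right) (auto intro: trig_poly_continuous continuous_star)
  next
    case (scale f c)
    then show ?case by (simp add: ip_scale_right)
  qed
  then show ?thesis using C k by (simp add: perp_def continuous_star)
qed

text \<open>A translate of a coefficient is a combination of coefficients in the same column, with
  weights that are conjugated coefficients at the translating element. Pairing with \<open>f\<close>
  leaves a combination of those weights, conjugated back.\<close>

lemma star_trig_poly: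
  assumes f: "continuous_fun f" and m: "m \<in> trig_poly"
  shows "star f m \<in> trig_poly"
  using m
proof (induction rule: trig_poly.induct)
  case (coef \<xi> i j)
  note u = irreducible_unitary[OF coef(1)]
  have "star f (\<lambda>x. \<xi> x $$ (i, j)) = (\<lambda>x. \<Sum>l<rep_dim \<xi>. ip f (\<lambda>y. \<xi> y $$ (l, j)) * \<xi> x $$ (l, i))"
  proof
    fix x
    have "star f (\<lambda>x. \<xi> x $$ (i, j)) x = ip f (\<lambda>y. \<Sum>l<rep_dim \<xi>. cnj (\<xi> x $$ (l, i)) * \<xi> y $$ (l, j))"
      unfolding star_def ltrans_def using coef u by (simp add: coef_ltrans)
    also have "\<dots> = (\<Sum>l<rep_dim \<xi>. ip f (\<lambda>y. cnj (\<xi> x $$ (l, i)) * \<xi> y $$ (l, j)))"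
      using coef f by (intro ip_sum_right continuous_intros coef_continuous u) auto
    also have "\<dots> = (\<Sum>l<rep_dim \<xi>. ip f (\<lambda>y. \<xi> y $$ (l, j)) * \<xi> x $$ (l, i))"
      by (simp only: ip_scale_right complex_cnj_cnj) (simp only: mult.commute)
    finally show "star f (\<lambda>x. \<xi> x $$ (i, j)) x = \<dots>" .
  qed
  also have "\<dots> \<in> trig_poly"
    using coef by (intro trig_poly_sum trig_poly.scale trig_poly.coef) auto
  finally show ?case .
next
  case zero
  then show ?case by (simp add: star_def ltrans_def ip_def trig_poly.zero)
next
  case (add g h)
  have "star f (\<lambda>x. g x + h x) = (\<lambda>x. star f g x + star f h x)"
  proof
    fix x
    have "ltrans x (\<lambda>x. g x + h x) = (\<lambda>y. ltrans x g y + ltrans x h y)" by (simp add: ltrans_def)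
    then show "star f (\<lambda>x. g x + h x) x = star f g x + star f h x"
      unfolding star_def using add f by (simp add: ip_add_right continuous_ltrans trig_poly_continuous)
  qed
  then show ?case using add trig_poly.add by simp
next
  case (scale g c)
  then show ?case by (simp add: star_scale_right trig_poly.scale)
qed

text \<open>\<open>u\<close> acts as a reproducing kernel: \<open>e i x\<close> is the inner product
  of \<open>e i\<close> with \<open>ltrans x u\<close>. Bessel's inequality bounds the sum of
  squares at each point, and integration bounds the number of functions. So \<open>V\<close> is
  finite-dimensional.\<close>

lemma ortho_bound:
  assumes V: "invariant_space V" "ortho V m e" and u: "continuous_fun u" "\<And>f. f \<in> V \<Longrightarrow> star f u = f"
  shows "real m \<le> sqn u"
proof -
  have e: "e i \<in> V" "ip (e i) (e i) = 1" if "i < m" for i using V(2) that by (auto simp: ortho_def)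
  then have C: "continuous_fun (e i)" if "i < m" for i using invariant_spaceD(1)[OF V(1)] that by blast
  have "(\<Sum>i<m. (cmod (e i x))\<^sup>2) \<le> sqn u" for x
  proof -
    have "(\<Sum>i<m. (cmod (e i x))\<^sup>2) = (\<Sum>i<m. (cmod (ip (e i) (ltrans x u)))\<^sup>2)"
      using u(2)[OF e(1)] by (intro sum.cong) (auto simp: star_def fun_eq_iff)
    also have "\<dots> \<le> sqn (ltrans x u)" by (rule bessel[OF V continuous_ltrans[OF u(1)]])
    finally show ?thesis using u by (simp add: sqn_ltrans)
  qed
  then have "(\<integral>x. (\<Sum>i<m. (cmod (e i x))\<^sup>2) \<partial>\<mu>) \<le> (\<integral>x. sqn u \<partial>\<mu>)"
    using C by (intro integral_mono integrable_continuous continuous_intros) auto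
  moreover have "(\<integral>x. (\<Sum>i<m. (cmod (e i x))\<^sup>2) \<partial>\<mu>) = (\<Sum>i<m. sqn (e i))"
    unfolding sqn_eq using C by (subst Bochner_Integration.integral_sum) (auto intro: sqn_integrable)
  moreover have "sqn (e i) = 1" if "i < m" for i using e(2)[OF that] by (simp add: sqn_def)
  ultimately show ?thesis by simp
qed

text \<open>Among the nonzero invariant subspaces one of least dimension is taken, where dimension
  is the largest size of an orthonormal system; the bound \<open>B\<close> makes this maximum exist.
  A nonzero invariant subspace of \<open>V\<close> has at least that dimension, hence contains an
  orthonormal system that spans \<open>V\<close>.\<close>

lemma minimal_invariant_space:
  assumes V0: "invariant_space V0" "f0 \<in> V0" "f0 \<noteq> (\<lambda>_. 0)"
    and b: "\<And>m e. ortho V0 m e \<Longrightarrow> m \<le> B"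
  obtains V d e where "invariant_space V" "V \<subseteq> V0" "d > 0" "ortho V d e"
    "\<And>f. f \<in> V \<Longrightarrow> f = (\<lambda>x. \<Sum>i<d. ip f (e i) * e i x)"
    "\<And>W. invariant_space W \<Longrightarrow> W \<subseteq> V \<Longrightarrow> W \<noteq> {\<lambda>_. 0} \<Longrightarrow> W = V"
proof -
  define Q where "Q V \<longleftrightarrow> invariant_space V \<and> V \<subseteq> V0 \<and> (\<exists>f\<in>V. f \<noteq> (\<lambda>_. 0))" for V
  define size where "size V = (GREATEST m. \<exists>e. ortho V m e)" for V
  have mono: "ortho W m e \<Longrightarrow> W \<subseteq> V \<Longrightarrow> ortho V m e" for W V m e by (auto simp: ortho_def)
  have o: "\<exists>e. ortho V (size V) e" "\<And>m e. ortho V m e \<Longrightarrow> m \<le> size V" if "Q V" for V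
  proof -
    have b': "\<forall>m. (\<exists>e. ortho V m e) \<longrightarrow> m \<le> B" using that b mono unfolding Q_def by blast
    \<comment> \<open>The empty system shows that the set of sizes is not empty.\<close>
    have "ortho V 0 undefined" by (simp add: ortho_def)
    then show "\<exists>e. ortho V (size V) e" unfolding size_def
      using GreatestI_nat[of "\<lambda>m. \<exists>e. ortho V m e" 0 B] b' by blast
    show "m \<le> size V" if "ortho V m e" for m e unfolding size_def
      using Greatest_le_nat[of "\<lambda>m. \<exists>e. ortho V m e" m B] b' that by blast
  qed
  have "Q V0" using V0 by (auto simp: Q_def)
  then obtain V where V: "Q V" "\<And>W. Q W \<Longrightarrow> size V \<le> size W"
    using ex_has_least_nat[of Q V0 size] by blast
  have inv: "invariant_space V" using V(1) by (simp add: Q_def)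
  have expand: "f = (\<lambda>x. \<Sum>i<size V. ip f (e i) * e i x)" if fe: "f \<in> V" "ortho V (size V) e" for f e
  proof (rule ccontr)
    assume "f \<noteq> (\<lambda>x. \<Sum>i<size V. ip f (e i) * e i x)"
    then obtain e' where "ortho V (Suc (size V)) e'" using ortho_extend[OF inv fe(2,1)] by blast
    then show False using o(2)[OF V(1)] by fastforce
  qed
  obtain e where e: "ortho V (size V) e" using o(1)[OF V(1)] by blast
  show thesis
  proof (rule that[OF inv _ _ e])
    show "V \<subseteq> V0" using V(1) by (simp add: Q_def)
    show "f = (\<lambda>x. \<Sum>i<size V. ip f (e i) * e i x)" if "f \<in> V" for f using expand[OF that e] .
    show "size V > 0"
    proof (rule ccontr)
      assume "\<not> size V > 0"
      moreover obtain f where "f \<in> V" "f \<noteq> (\<lambda>_. 0)" using V(1) by (auto simp: Q_def)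
      ultimately show False using expand[OF _ e] by fastforce
    qed
    fix W assume W: "invariant_space W" "W \<subseteq> V" "W \<noteq> {\<lambda>_. 0}"
    then have "Q W" using V(1) invariant_spaceD(2)[OF W(1)] unfolding Q_def by blast
    then obtain e' where e': "ortho W (size W) e'" "size V \<le> size W" using o(1) V(2) by blast
    then have e'': "ortho W (size V) e'" by (auto simp: ortho_def)
    have "V \<subseteq> W"
    proof
      fix f assume "f \<in> V"
      then have "f = (\<lambda>x. \<Sum>i<size V. ip f (e' i) * e' i x)" using expand mono[OF e'' W(2)] by blast
      also have "\<dots> \<in> W" using e'' invariant_spaceD[OF W(1)]
        by (intro invariant_space_sum[OF W(1)]) (auto simp: ortho_def)
      finally show "f \<in> W" .
    qed
    then show "W = V" using W by blast
  qed
qed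

text \<open>Coordinates enter conjugated because the matrix of left translation in \<open>e\<close>
  is the conjugate of the representation constructed from it. The map is antilinear, and still
  carries subspaces to subspaces.\<close>

lemma invariant_space_image:
  assumes V: "invariant_space V" "ortho V d e"
    and W: "VectorSpace.subspace class_ring W (module_vec TYPE(complex) d)"
    and trans: "\<And>a w. w \<in> W \<Longrightarrow> \<exists>w'\<in>W. ltrans a (\<lambda>y. \<Sum>i<d. cnj (w $ i) * e i y) = (\<lambda>y. \<Sum>i<d. cnj (w' $ i) * e i y)"
  shows "invariant_space ((\<lambda>w y. \<Sum>i<d. cnj (w $ i) * e i y) ` W)" (is "invariant_space (?T ` W)")
    and "(\<lambda>w y. \<Sum>i<d. cnj (w $ i) * e i y) ` W \<subseteq> V"
proof -
  note D = invariant_spaceD[OF V(1)] and WD = subspace_module_vecD[OF W]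
  have e: "e i \<in> V" if "i < d" for i using V(2) that by (simp add: ortho_def)
  show sub: "?T ` W \<subseteq> V" using e by (auto intro!: invariant_space_sum[OF V(1)] D)
  have z: "?T (0\<^sub>v d) = (\<lambda>_. 0)" by (auto simp: fun_eq_iff)
  have a: "(\<lambda>x. ?T v x + ?T w x) = ?T (v + w)" if "v \<in> W" "w \<in> W" for v w
  proof
    fix x
    have "v \<in> carrier_vec d" "w \<in> carrier_vec d" using that WD(1) by auto
    then have "?T (v + w) x = (\<Sum>i<d. cnj (v $ i) * e i x + cnj (w $ i) * e i x)"
      by (intro sum.cong) (auto simp: distrib_right)
    then show "?T v x + ?T w x = ?T (v + w) x" by (simp add: sum.distrib)
  qed
  have s: "(\<lambda>x. c * ?T w x) = ?T (cnj c \<cdot>\<^sub>v w)" if "w \<in> W" for c w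
  proof
    fix x
    have "w \<in> carrier_vec d" using that WD(1) by auto
    then have "?T (cnj c \<cdot>\<^sub>v w) x = (\<Sum>i<d. c * (cnj (w $ i) * e i x))"
      by (intro sum.cong) auto
    then show "c * ?T w x = ?T (cnj c \<cdot>\<^sub>v w) x" by (simp add: sum_distrib_left)
  qed
  show "invariant_space (?T ` W)"
    unfolding invariant_space_def
  proof (intro conjI ballI allI)
    show "continuous_fun f" if "f \<in> ?T ` W" for f using that sub D(1) by blast
    show "(\<lambda>_. 0) \<in> ?T ` W" using z[symmetric] WD(2) by (rule image_eqI)
    show "(\<lambda>x. f x + g x) \<in> ?T ` W" if fg: "f \<in> ?T ` W" "g \<in> ?T ` W" for f g
    proof -
      obtain v w where "v \<in> W" "w \<in> W" "f = ?T v" "g = ?T w" using fg by blast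
      then show ?thesis using a[of v w] WD(3)[of v w] by blast
    qed
    show "(\<lambda>x. c * f x) \<in> ?T ` W" if f: "f \<in> ?T ` W" for c f
    proof -
      obtain w where "w \<in> W" "f = ?T w" using f by blast
      then show ?thesis using s[of w c] WD(4)[of w "cnj c"] by blast
    qed
    show "ltrans a f \<in> ?T ` W" if f: "f \<in> ?T ` W" for a f
    proof -
      obtain w where "w \<in> W" "f = ?T w" using f by blast
      then show ?thesis using trans[of w a] by blast
    qed
  qed
qed

text \<open>A minimal translation-invariant space spanned by an orthonormal system \<open>e\<close> carries the irreducible
  representation with coefficients \<open>\<langle>e i, L\<^sub>x (e j)\<rangle>\<close>, that is, \<open>star (e i) (e j)\<close>.\<close>

lemma minimal_space_trig_poly:
  assumes V: "invariant_space V" "ortho V d e" "d > 0"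
    and span: "\<And>f. f \<in> V \<Longrightarrow> f = (\<lambda>x. \<Sum>i<d. ip f (e i) * e i x)"
    and min: "\<And>W. invariant_space W \<Longrightarrow> W \<subseteq> V \<Longrightarrow> W \<noteq> {\<lambda>_. 0} \<Longrightarrow> W = V"
  shows "e 0 \<in> trig_poly"
proof -
  note D = invariant_spaceD[OF V(1)]
  have e: "e i \<in> V" if "i < d" for i using V(2) that by (simp add: ortho_def)
  note C = D(1)[OF e]
  \<comment> \<open>\<open>a i j x\<close> is \<open>ip (e i) (ltrans x (e j))\<close>, the
    conjugate of the matrix of left translation in the basis \<open>e\<close>; conjugation preserves
    multiplicativity.\<close>
  define a where "a i j x = star (e i) (e j) x" for i j x
  have le: "ltrans x (e j) = (\<lambda>y. \<Sum>i<d. cnj (a i j x) * e i y)" if "j < d" for x j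
  proof -
    have "ip (ltrans x (e j)) (e i) = cnj (a i j x)" for i
      unfolding a_def star_def by (simp add: ip_cnj)
    then show ?thesis using span[OF D(5)[OF e[OF that]], of x] by simp
  qed
  have aadd: "a i j (x + y) = (\<Sum>k<d. a i k x * a k j y)" if ij: "i < d" "j < d" for i j x y
  proof -
    have "ltrans (x + y) (e j) = (\<lambda>z. \<Sum>k<d. cnj (a k j y) * ltrans x (e k) z)"
      unfolding ltrans_ltrans[symmetric] le[OF ij(2), of y] by (simp add: ltrans_def)
    then have "a i j (x + y) = ip (e i) (\<lambda>z. \<Sum>k<d. cnj (a k j y) * ltrans x (e k) z)"
      by (simp add: a_def star_def)
    also have "\<dots> = (\<Sum>k<d. ip (e i) (\<lambda>z. cnj (a k j y) * ltrans x (e k) z))"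
      using C ij by (intro ip_sum_right continuous_on_mult continuous_on_const continuous_ltrans) auto
    also have "\<dots> = (\<Sum>k<d. a i k x * a k j y)"
      by (simp only: ip_scale_right complex_cnj_cnj a_def star_def) (simp only: mult.commute)
    finally show ?thesis .
  qed
  have ainv: "a i j (- x) = cnj (a j i x)" if "i < d" "j < d" for i j x
    unfolding a_def using star_uminus[OF C C, OF that] .
  have azero: "a i j 0 = (if i = j then 1 else 0)" if "i < d" "j < d" for i j
    using V(2) that by (simp add: a_def star_def ortho_def)
  have acont: "continuous_fun (a i j)" if "i < d" "j < d" for i j
    unfolding a_def[abs_def] by (intro continuous_star C that)
  define \<xi> where "\<xi> = (\<lambda>x. Matrix.mat d d (\<lambda>(i, j). a i j x))"
  have rep: "unitary_rep \<xi>" and dim: "rep_dim \<xi> = d"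
    unfolding \<xi>_def using unitary_repI[of d a] aadd ainv azero acont by blast+
  have \<xi>_index: "\<xi> x $$ (i, j) = a i j x" if "i < d" "j < d" for x i j using that by (simp add: \<xi>_def)
  have irr: "irreducible_unitary_rep \<xi>"
    unfolding irreducible_unitary_rep_def dim
  proof (intro conjI allI impI rep V(3))
    fix W assume W: "VectorSpace.subspace class_ring W (module_vec TYPE(complex) d)"
      and inv: "\<forall>x. \<forall>w\<in>W. \<xi> x *\<^sub>v w \<in> W"
    note WD = subspace_module_vecD[OF W]
    let ?T = "\<lambda>w y. \<Sum>i<d. cnj (w $ i) * e i y"
    have Tip: "ip (e i) (?T w) = w $ i" if "i < d" for w i
      using ip_combination(2)[OF V(1,2) that, of "\<lambda>i. cnj (w $ i)"] by simp
    have trans: "ltrans x (?T w) = ?T (\<xi> x *\<^sub>v w)" if w: "w \<in> W" for x w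
    proof
      fix y
      have wc: "w \<in> carrier_vec d" using w WD(1) by blast
      have "ltrans x (?T w) y = (\<Sum>j<d. cnj (w $ j) * (\<Sum>i<d. cnj (a i j x) * e i y))"
        using le by (simp add: ltrans_def fun_eq_iff)
      also have "\<dots> = (\<Sum>i<d. \<Sum>j<d. cnj (a i j x) * cnj (w $ j) * e i y)"
        unfolding sum_distrib_left by (subst sum.swap) (simp add: mult_ac)
      also have "\<dots> = ?T (\<xi> x *\<^sub>v w) y"
      proof (rule sum.cong[OF refl])
        fix i assume "i \<in> {..<d}"
        then have i: "i < d" by simp
        have "(\<xi> x *\<^sub>v w) $ i = (\<Sum>j<d. a i j x * w $ j)"
          using mat_vec_mult_index[of "\<xi> x" d d w i] unitary_rep_carrier[OF rep, of x] wc i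
          by (simp add: dim \<xi>_index)
        then show "(\<Sum>j<d. cnj (a i j x) * cnj (w $ j) * e i y) = cnj ((\<xi> x *\<^sub>v w) $ i) * e i y"
          by (simp add: sum_distrib_right)
      qed
      finally show "ltrans x (?T w) y = ?T (\<xi> x *\<^sub>v w) y" .
    qed
    have ex: "\<exists>w'\<in>W. ltrans x (?T w) = ?T w'" if "w \<in> W" for x w
      using trans[OF that] inv that by blast
    note IV = invariant_space_image[OF V(1,2) W ex]
    show "W = {0\<^sub>v d} \<or> W = carrier_vec d"
    proof (cases "?T ` W = {\<lambda>_. 0}")
      case True
      have "w = 0\<^sub>v d" if "w \<in> W" for w
      proof -
        have T0: "?T w = (\<lambda>_. 0)" using True that by blast
        have "w $ i = 0" if "i < d" for i
          using Tip[OF that, of w] unfolding T0 by (simp add: ip_def)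
        then show ?thesis using \<open>w \<in> W\<close> WD(1) by (intro eq_vecI) auto
      qed
      then have "W = {0\<^sub>v d}" using WD(2) by blast
      then show ?thesis ..
    next
      case False
      have eq: "?T ` W = V" by (rule min[OF IV(1) IV(2) False])
      have "v \<in> W" if v: "v \<in> carrier_vec d" for v
      proof -
        have "?T v \<in> V" using e D by (intro invariant_space_sum[OF V(1)]) auto
        then obtain w where w: "w \<in> W" "?T v = ?T w" unfolding eq[symmetric] by blast
        have "v $ i = w $ i" if "i < d" for i using Tip[OF that, of v] Tip[OF that, of w] w(2) by simp
        then have "v = w" using v w(1) WD(1) by (intro eq_vecI) auto
        then show ?thesis using w by simp
      qed
      then show ?thesis using WD(1) by blast
    qed
  qed
  \<comment> \<open>Translating by \<open>- x\<close> and evaluating at the unit recovers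
    \<open>e 0 x\<close> from the coefficients in row 0.\<close>
  have "e 0 = (\<lambda>x. \<Sum>i<d. e i 0 * \<xi> x $$ (0, i))"
  proof
    fix x
    have "e 0 x = ltrans (- x) (e 0) 0" by (simp add: ltrans_def)
    also have "\<dots> = (\<Sum>i<d. cnj (a i 0 (- x)) * e i 0)" using le[OF V(3)] by simp
    also have "\<dots> = (\<Sum>i<d. e i 0 * \<xi> x $$ (0, i))"
      using V(3) by (intro sum.cong) (auto simp: ainv \<xi>_index)
    finally show "e 0 x = \<dots>" .
  qed
  also have "\<dots> \<in> trig_poly"
    using V(3) irr dim by (intro trig_poly_sum trig_poly.scale trig_poly.coef) auto
  finally show ?thesis .
qed

text \<open>Otherwise a minimal space of functions fixed by the idempotent kernel would contain a
  unit vector that is a trigonometric polynomial and orthogonal to itself.\<close>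

lemma hermitian_perp_eq_0:
  assumes h: "h \<in> perp trig_poly" "hermitian_fun h"
  shows "h = (\<lambda>_. 0)"
proof (rule ccontr)
  assume "h \<noteq> (\<lambda>_. 0)"
  then obtain a0 where a0: "h a0 \<noteq> 0" by auto
  have Ch: "continuous_fun h" using h by (simp add: perp_def)
  obtain u where u: "continuous_fun u" "u \<in> perp trig_poly" "star u u = u" "sqn u \<ge> 1"
    using projection_kernel[OF Ch h(2) a0 h(1) perp_trig_star[OF _ Ch] trig_poly_continuous] by blast
  \<comment> \<open>Orthogonality is built into \<open>V0\<close>, so that every subspace found
    inside it inherits the contradiction.\<close>
  define V0 where "V0 = {f \<in> perp trig_poly. star f u = f}"
  have inv: "invariant_space V0"
    unfolding invariant_space_def
  proof (intro conjI ballI allI)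
    fix f assume f: "f \<in> V0"
    then have Cf: "continuous_fun f" by (simp add: V0_def perp_def)
    then show "continuous_fun f" .
    show "(\<lambda>x. c * f x) \<in> V0" for c
      using f Cf unfolding V0_def perp_def by (auto simp: ip_scale_left star_scale_left intro: continuous_intros)
    show "(\<lambda>x. f x + g x) \<in> V0" if g: "g \<in> V0" for g
    proof -
      have Cg: "continuous_fun g" using g by (simp add: V0_def perp_def)
      have "star (\<lambda>x. f x + g x) u = (\<lambda>x. star f u x + star g u x)"
        unfolding star_def using Cf Cg u(1) by (simp add: ip_add_left continuous_ltrans)
      then show ?thesis
        using f g Cf Cg unfolding V0_def perp_def by (auto simp: ip_add_left trig_poly_continuous intro: continuous_intros)
    qed
    show "ltrans a f \<in> V0" for a
    proof -
      have "ip (ltrans a f) m = 0" if "m \<in> trig_poly" for m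
        using f Cf trig_poly_ltrans[OF that, of "- a"] trig_poly_continuous[OF that]
        by (simp add: ip_ltrans_left V0_def perp_def)
      then show ?thesis
        using f Cf u(1) by (simp add: V0_def perp_def star_ltrans continuous_ltrans)
    qed
  next
    show "(\<lambda>_. 0) \<in> V0" by (auto simp: V0_def perp_def ip_def star_def)
  qed
  have un: "u \<noteq> (\<lambda>_. 0)" using u(4) by (auto simp: sqn_eq)
  have uV: "u \<in> V0" using u by (simp add: V0_def)
  have ub: "m \<le> nat \<lfloor>sqn u\<rfloor>" if "ortho V0 m e" for m e
    using ortho_bound[OF inv that u(1)] by (auto simp: V0_def le_nat_floor)
  show False
  proof (rule minimal_invariant_space[OF inv uV un ub])
    fix V d e
    assume V: "invariant_space V" "V \<subseteq> V0" "d > 0" "ortho V d e"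
      "\<And>f. f \<in> V \<Longrightarrow> f = (\<lambda>x. \<Sum>i<d. ip f (e i) * e i x)"
      "\<And>W. invariant_space W \<Longrightarrow> W \<subseteq> V \<Longrightarrow> W \<noteq> {\<lambda>_. 0} \<Longrightarrow> W = V"
    have "e 0 \<in> trig_poly" by (rule minimal_space_trig_poly[OF V(1,4,3,5,6)])
    moreover have "e 0 \<in> perp trig_poly" using V(2,3,4) by (auto simp: ortho_def V0_def)
    ultimately have "ip (e 0) (e 0) = 0" by (simp add: perp_def)
    then show False using V(3,4) by (simp add: ortho_def)
  qed
qed

end

section \<open>The Peter--Weyl theorem\<close>

context haar_group
begin

lemma sqn_parallelogram:
  assumes "continuous_fun f" "continuous_fun g"
  shows "sqn (\<lambda>x. f x - g x) = 2 * sqn f + 2 * sqn g - sqn (\<lambda>x. f x + g x)"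
proof -
  have "sqn (\<lambda>x. f x - (- 1) * g x) = sqn f - 2 * Re (ip f (\<lambda>x. (- 1) * g x)) + sqn (\<lambda>x. (- 1) * g x)"
    using assms by (intro sqn_diff continuous_intros)
  then have "sqn (\<lambda>x. f x + g x) = sqn f + 2 * Re (ip f g) + sqn g"
    unfolding ip_scale_right sqn_scale by simp
  then show ?thesis using sqn_diff[OF assms] by simp
qed

lemma sqn_reflect:
  assumes "continuous_fun g"
  shows "sqn (\<lambda>x. cnj (g (- x))) = sqn g"
proof -
  have "continuous_fun (\<lambda>x. g x * cnj (g x))" using assms by (intro continuous_intros)
  from integral_uminus[OF this] show ?thesis by (simp add: sqn_def ip_def mult.commute)
qed

text \<open>If \<open>f\<close> had positive distance to the trigonometric polynomials, then for the residuals \<open>g\<^sub>n\<close> of a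
  minimising sequence the functions \<open>star g\<^sub>n g\<^sub>n\<close> would converge uniformly to a nonzero Hermitian
  kernel orthogonal to all of them. This avoids the completeness of \<open>L\<^sup>2\<close>.\<close>

lemma trig_poly_dense_sqn:
  assumes f: "continuous_fun f" and e: "e > 0"
  shows "\<exists>m\<in>trig_poly. sqn (\<lambda>x. f x - m x) < e"
proof (rule ccontr)
  assume neg: "\<not> (\<exists>m\<in>trig_poly. sqn (\<lambda>x. f x - m x) < e)"
  define D where "D = (\<lambda>m. sqn (\<lambda>x. f x - m x)) ` trig_poly"
  define \<delta> where "\<delta> = Inf D"
  have Dne: "D \<noteq> {}" unfolding D_def using trig_poly.zero by blast
  have Dbd: "bdd_below D" unfolding D_def by (intro bdd_belowI[of _ 0]) (auto simp: sqn_nonneg)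
  have \<delta>: "\<delta> \<ge> e" unfolding \<delta>_def using neg by (intro cInf_greatest Dne) (force simp: D_def)
  have \<delta>_le: "\<delta> \<le> sqn (\<lambda>x. f x - m x)" if "m \<in> trig_poly" for m
    unfolding \<delta>_def using that by (intro cInf_lower Dbd) (auto simp: D_def)
  have "\<exists>m\<in>trig_poly. sqn (\<lambda>x. f x - m x) < \<delta> + 1 / real (Suc n)" for n
    using cInf_lessD[OF Dne, of "\<delta> + 1 / real (Suc n)"] by (auto simp: \<delta>_def D_def)
  then obtain mm where mm: "\<And>n. mm n \<in> trig_poly" "\<And>n. sqn (\<lambda>x. f x - mm n x) < \<delta> + 1 / real (Suc n)"
    by metis
  define g where "g n = (\<lambda>x. f x - mm n x)" for n
  have Cg: "continuous_fun (g n)" for n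
    unfolding g_def by (intro continuous_on_diff f trig_poly_continuous mm)
  have sg: "sqn (g n) < \<delta> + 1 / real (Suc n)" "\<delta> \<le> sqn (g n)" for n
    using mm \<delta>_le unfolding g_def by blast+
  have sg1: "sqn (g n) \<le> \<delta> + 1" for n
  proof -
    have "1 / real (Suc n) \<le> 1" by simp
    then show ?thesis using sg(1)[of n] by linarith
  qed
  \<comment> \<open>Near-minimality forces near-orthogonality: moving \<open>mm n\<close> by the
    best multiple of \<open>m\<close> can lower the squared distance by at most
    \<open>1 / real (Suc n)\<close>.\<close>
  have ipg: "(cmod (ip (g n) m))\<^sup>2 \<le> (1 / real (Suc n)) * sqn m" if m: "m \<in> trig_poly" for n m
  proof (cases "sqn m = 0")
    case True
    then show ?thesis using ip_CS[OF Cg trig_poly_continuous[OF m], of n] by simp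
  next
    case False
    then have p: "sqn m > 0" using sqn_nonneg[of m] by simp
    define c where "c = ip (g n) m / sqn m"
    have "(\<lambda>x. mm n x + c * m x) \<in> trig_poly" by (intro trig_poly.intros mm m)
    from \<delta>_le[OF this] have "\<delta> \<le> sqn (\<lambda>x. g n x - c * m x)" by (simp add: g_def diff_diff_eq)
    also have "\<dots> = sqn (g n) - 2 * Re (cnj c * ip (g n) m) + (cmod c)\<^sup>2 * sqn m"
      using Cg trig_poly_continuous[OF m]
      by (subst sqn_diff) (auto intro!: continuous_intros simp: sqn_scale ip_scale_right)
    also have "cnj c * ip (g n) m = of_real ((cmod (ip (g n) m))\<^sup>2 / sqn m)"
      unfolding c_def using complex_norm_square[of "ip (g n) m"] by (simp add: mult.commute)
    also have "(cmod c)\<^sup>2 * sqn m = (cmod (ip (g n) m))\<^sup>2 / sqn m"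
      unfolding c_def using p by (simp add: norm_divide power_divide field_simps power2_eq_square)
    finally have "(cmod (ip (g n) m))\<^sup>2 / sqn m \<le> 1 / real (Suc n)" using sg(1)[of n] by simp
    then show ?thesis using p by (simp add: field_simps)
  qed
  \<comment> \<open>The midpoint of two approximants is again a trigonometric polynomial, so the
    parallelogram law makes the residuals Cauchy in L^2.\<close>
  have gg: "sqn (\<lambda>x. g n x - g p x) \<le> 2 / real (Suc n) + 2 / real (Suc p)" for n p
  proof -
    have "(\<lambda>x. (1/2) * (mm n x + mm p x)) \<in> trig_poly" by (intro trig_poly.intros mm)
    from \<delta>_le[OF this] have "\<delta> \<le> sqn (\<lambda>x. (1/2) * (g n x + g p x))"
      by (simp add: g_def field_simps)
    also have "\<dots> = sqn (\<lambda>x. g n x + g p x) / 4" unfolding sqn_scale by (simp add: power2_eq_square)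
    finally show ?thesis using sqn_parallelogram[OF Cg Cg, of n p] sg(1)[of n] sg(1)[of p] by simp
  qed
  \<comment> \<open>The residuals need not converge to a continuous function, but
    \<open>star (g n) (g n)\<close> converges uniformly, and its value at the unit is
    \<open>sqn (g n)\<close>, which stays at least \<open>\<delta>\<close>.\<close>
  define h where "h n = star (g n) (g n)" for n
  have Ch: "continuous_fun (h n)" for n unfolding h_def by (intro continuous_star Cg)
  have hd: "cmod (h n x - h p x) \<le> 2 * sqrt ((2 / real (Suc n) + 2 / real (Suc p)) * (\<delta> + 1))" for n p x
  proof -
    let ?B = "(2 / real (Suc n) + 2 / real (Suc p)) * (\<delta> + 1)"
    have "h n x - h p x = star (\<lambda>x. g n x - g p x) (g n) x + star (g p) (\<lambda>x. g n x - g p x) x"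
      unfolding h_def by (simp add: star_diff_left[OF Cg Cg Cg] star_diff_right[OF Cg Cg Cg])
    moreover have "cmod (star (\<lambda>x. g n x - g p x) (g n) x) \<le> sqrt ?B"
    proof (rule real_le_rsqrt)
      have "(cmod (star (\<lambda>x. g n x - g p x) (g n) x))\<^sup>2 \<le> sqn (\<lambda>x. g n x - g p x) * sqn (g n)"
        by (intro star_bound continuous_on_diff Cg)
      also have "\<dots> \<le> ?B" using gg sg1 sqn_nonneg by (intro mult_mono) auto
      finally show "(cmod (star (\<lambda>x. g n x - g p x) (g n) x))\<^sup>2 \<le> ?B" .
    qed
    moreover have "cmod (star (g p) (\<lambda>x. g n x - g p x) x) \<le> sqrt ?B"
    proof (rule real_le_rsqrt)
      have "(cmod (star (g p) (\<lambda>x. g n x - g p x) x))\<^sup>2 \<le> sqn (g p) * sqn (\<lambda>x. g n x - g p x)"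
        by (intro star_bound continuous_on_diff Cg)
      also have "\<dots> = sqn (\<lambda>x. g n x - g p x) * sqn (g p)" by simp
      also have "\<dots> \<le> ?B" using gg sg1 sqn_nonneg by (intro mult_mono) auto
      finally show "(cmod (star (g p) (\<lambda>x. g n x - g p x) x))\<^sup>2 \<le> ?B" .
    qed
    ultimately show ?thesis using norm_triangle_ineq[of "star (\<lambda>x. g n x - g p x) (g n) x"] by (smt (verit))
  qed
  have lim0: "(\<lambda>n. 1 / real (Suc n)) \<longlonglongrightarrow> 0" using lim_inverse_n' LIMSEQ_Suc by blast
  have "uniformly_Cauchy_on UNIV h"
  proof (rule uniformly_Cauchy_onI)
    fix r :: real assume r: "r > 0"
    \<comment> \<open>Solves \<open>4 * q * (\<delta> + 1) = (r / 4)^2\<close>, so that the bound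
      \<open>hd\<close> becomes \<open>r / 2\<close>.\<close>
    define q where "q = (r / 4)\<^sup>2 / (4 * (\<delta> + 1))"
    have q: "q > 0" unfolding q_def using r \<delta> e by simp
    obtain N where N: "\<And>n. n \<ge> N \<Longrightarrow> 1 / real (Suc n) < q"
      using LIMSEQ_D[OF lim0 q] by auto
    have "dist (h n x) (h p x) < r" if "n \<ge> N" "p \<ge> N" for n p x
    proof -
      have "2 / real (Suc n) + 2 / real (Suc p) \<le> 4 * q"
        using N[OF that(1)] N[OF that(2)] by simp
      then have "sqrt ((2 / real (Suc n) + 2 / real (Suc p)) * (\<delta> + 1)) \<le> sqrt (4 * q * (\<delta> + 1))"
        using \<delta> e by (intro real_sqrt_le_mono mult_right_mono) auto
      also have "4 * q * (\<delta> + 1) = (r / 4)\<^sup>2"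
      proof -
        have "4 * \<delta> + 4 \<noteq> 0" using \<delta> e by linarith
        then show ?thesis unfolding q_def by (simp add: field_simps)
      qed
      also have "sqrt \<dots> = r / 4" using r by simp
      finally show ?thesis using hd[of n x p] r unfolding dist_norm by linarith
    qed
    then show "\<exists>N. \<forall>x\<in>UNIV. \<forall>m\<ge>N. \<forall>n\<ge>N. dist (h m x) (h n x) < r" by blast
  qed
  then obtain u where u: "uniform_limit UNIV h u sequentially"
    using Cauchy_uniformly_convergent uniformly_convergent_on_def by blast
  have Cu: "continuous_fun u" using continuous_uniform_limit[OF u Ch] .
  have lim: "(\<lambda>n. h n x) \<longlonglongrightarrow> u x" for x using tendsto_uniform_limitI[OF u] by blast
  have herm: "hermitian_fun u"
    unfolding hermitian_fun_def
  proof
    fix x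
    have "(\<lambda>n. cnj (h n x)) \<longlonglongrightarrow> cnj (u x)" by (intro tendsto_cnj lim)
    moreover have "cnj (h n x) = h n (- x)" for n unfolding h_def using star_uminus[OF Cg Cg] by simp
    ultimately show "u (- x) = cnj (u x)" using LIMSEQ_unique[OF lim[of "- x"]] by simp
  qed
  have "ip u m = 0" if "m \<in> trig_poly" for m
    using that
  proof (induction rule: trig_poly.induct)
    case (coef \<xi> i j)
    note U = irreducible_unitary[OF coef(1)]
    let ?d = "rep_dim \<xi>" and ?x = "\<lambda>i j x. \<xi> x $$ (i, j)"
    \<comment> \<open>The first factor tends to 0 by near-orthogonality; the second is a fixed
      bound, because reflection preserves the L^2 norm.\<close>
    define b where "b n = (\<Sum>l<?d. sqrt ((1 / real (Suc n)) * sqn (?x i l)) * sqrt ((\<delta> + 1) * sqn (?x l j)))" for n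
    have bd: "cmod (ip (h n) (?x i j)) \<le> b n" for n
    proof -
      have "cmod (ip (h n) (?x i j)) \<le> (\<Sum>l<?d. cmod (ip (g n) (?x i l) * ip (\<lambda>x. cnj (g n (- x))) (?x l j)))"
        unfolding h_def ip_star_coef[OF Cg Cg U coef(2,3)] by (rule norm_sum)
      also have "\<dots> \<le> b n"
        unfolding b_def norm_mult
      proof (intro sum_mono mult_mono norm_ge_zero)
        fix l assume "l \<in> {..<?d}"
        then have l: "l < ?d" by simp
        show "cmod (ip (g n) (?x i l)) \<le> sqrt ((1 / real (Suc n)) * sqn (?x i l))"
          using coef l by (intro real_le_rsqrt ipg trig_poly.coef) auto
        show "cmod (ip (\<lambda>x. cnj (g n (- x))) (?x l j)) \<le> sqrt ((\<delta> + 1) * sqn (?x l j))"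
        proof (rule real_le_rsqrt)
          have cc: "continuous_fun (\<lambda>x. cnj (g n (- x)))"
            by (intro continuous_on_cnj continuous_on_compose2[OF Cg] continuous_intros) auto
          have "(cmod (ip (\<lambda>x. cnj (g n (- x))) (?x l j)))\<^sup>2 \<le> sqn (\<lambda>x. cnj (g n (- x))) * sqn (?x l j)"
            using l coef by (intro ip_CS cc coef_continuous U) auto
          also have "\<dots> \<le> (\<delta> + 1) * sqn (?x l j)"
            unfolding sqn_reflect[OF Cg] by (intro mult_right_mono sg1 sqn_nonneg)
          finally show "(cmod (ip (\<lambda>x. cnj (g n (- x))) (?x l j)))\<^sup>2 \<le> (\<delta> + 1) * sqn (?x l j)" .
        qed
      qed (auto simp: sqn_nonneg)
      finally show ?thesis .
    qed
    have "b \<longlonglongrightarrow> (\<Sum>l<?d. sqrt (0 * sqn (?x i l)) * sqrt ((\<delta> + 1) * sqn (?x l j)))"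
      unfolding b_def by (intro tendsto_intros lim0)
    then have "b \<longlonglongrightarrow> 0" by simp
    then have "(\<lambda>n. ip (h n) (?x i j)) \<longlonglongrightarrow> 0"
      by (rule Lim_null_comparison[OF always_eventually[OF allI[OF bd]]])
    moreover have "(\<lambda>n. ip (h n) (?x i j)) \<longlonglongrightarrow> ip u (?x i j)"
      using coef by (intro ip_tendsto_uniform u Ch Cu uniform_limit_const coef_continuous U)
    ultimately show ?case using LIMSEQ_unique by blast
  next
    case zero
    then show ?case by (simp add: ip_def)
  next
    case (add f g)
    then show ?case using Cu by (simp add: ip_add_right trig_poly_continuous)
  next
    case (scale f c)
    then show ?case by (simp add: ip_scale_right)
  qed
  then have "u = (\<lambda>_. 0)" using Cu herm by (intro hermitian_perp_eq_0) (auto simp: perp_def)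
  then have "(\<lambda>n. Re (h n 0)) \<longlonglongrightarrow> 0" using tendsto_Re[OF lim[of 0]] by simp
  moreover have "Re (h n 0) = sqn (g n)" for n unfolding h_def by (simp add: ip_eq_star[symmetric] sqn_def)
  ultimately have "(\<lambda>n. sqn (g n)) \<longlonglongrightarrow> 0" by simp
  then have "\<delta> \<le> 0" by (rule LIMSEQ_le_const) (use sg in auto)
  then show False using \<delta> e by simp
qed

section \<open>Uniform density of the trigonometric polynomials\<close>

lemma urysohn:
  assumes "closed S" "closed (T :: 'g set)" "S \<inter> T = {}"
  shows "\<exists>k :: 'g \<Rightarrow> real. continuous_on UNIV k \<and> (\<forall>x. 0 \<le> k x \<and> k x \<le> 1) \<and>
    (\<forall>x\<in>S. k x = 0) \<and> (\<forall>x\<in>T. k x = 1)"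
proof -
  have "\<forall>x y :: 'g. x \<noteq> y \<longrightarrow> (\<exists>U. open U \<and> (\<exists>V. open V \<and> x \<in> U \<and> y \<in> V \<and> U \<inter> V = {}))"
    by (intro allI impI, drule hausdorff) blast
  then have "Hausdorff_space (euclidean :: 'g topology)"
    unfolding Hausdorff_space_def disjnt_def by simp
  then have n: "normal_space (euclidean :: 'g topology)"
    using compact_UNIV by (intro compact_Hausdorff_or_regular_imp_normal_space) (auto simp: compact_space_def compactin_euclidean_iff)
  obtain f :: "'g \<Rightarrow> real" where f: "continuous_map euclidean euclideanreal f" "f ` S \<subseteq> {0}" "f ` T \<subseteq> {1}"
    using Urysohn_lemma_alt[OF n, of S T 0 1] assms by (auto simp: disjnt_def)
  have "continuous_on UNIV (\<lambda>x. max 0 (min 1 (f x)))"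
    using f(1) by (intro continuous_intros) simp
  then show ?thesis using f(2,3) by (intro exI[of _ "\<lambda>x. max 0 (min 1 (f x))"]) auto
qed

text \<open>Convolution with a normalised bump \<open>k\<close> near the unit moves \<open>f\<close>
  uniformly little. Replacing \<open>k\<close> by an L^2-close trigonometric polynomial costs,
  uniformly, at most the product of two L^2 norms, and by \<open>star_trig_poly\<close> the result
  is a trigonometric polynomial.\<close>

lemma trig_poly_dense:
  fixes f :: "'g \<Rightarrow> complex"
  assumes f: "continuous_fun f" and e: "e > 0"
  shows "\<exists>m\<in>trig_poly. \<forall>x. cmod (f x - m x) \<le> e"
proof -
  have c: "continuous_on UNIV (\<lambda>(y, x). f (x + y))"
    unfolding case_prod_unfold by (rule continuous_on_compose2[OF f]) (auto intro!: continuous_intros)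
  obtain U where U: "0 \<in> U" "open U" "\<And>y x. y \<in> U \<Longrightarrow> cmod (f (x + y) - f (x + 0)) \<le> e / 2"
    using uniform_slice[OF c, of "e/2" 0] e by auto
  have cl: "closed (- U)" "closed {0 :: 'g}" "- U \<inter> {0} = {}" using U by auto
  obtain k0 :: "'g \<Rightarrow> real" where k: "continuous_on UNIV k0 \<and> (\<forall>x. 0 \<le> k0 x \<and> k0 x \<le> 1) \<and>
    (\<forall>x\<in>- U. k0 x = 0) \<and> (\<forall>x\<in>{0}. k0 x = 1)"
    using urysohn[OF cl] ..
  have k0: "continuous_on UNIV k0" "\<And>x. 0 \<le> k0 x" "\<And>x. x \<in> - U \<Longrightarrow> k0 x = 0" "k0 0 = 1"
    using k by auto
  define I where "I = (\<integral>x. k0 x \<partial>\<mu>)"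
  have I: "I > 0" unfolding I_def using integral_continuous_pos[OF k0(1,2), of 0] k0(4) by simp
  define k where "k = (\<lambda>x. complex_of_real (k0 x / I))"
  have Ck: "continuous_fun k" unfolding k_def using I k0(1) by (intro continuous_intros) auto
  have star_k: "star f m x = (\<integral>y. f (x + y) * cnj (m y) \<partial>\<mu>)" if "continuous_fun m" for m x
  proof -
    have "continuous_fun (\<lambda>y. f y * cnj (m (- x + y)))"
      by (intro continuous_on_mult f continuous_on_cnj continuous_on_div[OF that] continuous_on_const continuous_on_id)
    from integral_translation[OF this, of x] show ?thesis
      by (simp add: star_apply add.assoc[symmetric])
  qed
  have 1: "cmod (star f k x - f x) \<le> e / 2" for x
  proof -
    have Cf: "continuous_fun (\<lambda>y. f (x + y))" using cont_slice(2)[OF c] cont_slice(1)[OF c]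
      by (intro continuous_on_compose2[OF f] continuous_intros) auto
    have ik: "(\<integral>y. k0 y / I \<partial>\<mu>) = 1" using I by (simp add: I_def)
    have kint: "integrable \<mu> (\<lambda>y. k0 y / I)" using k0(1) I by (intro integrable_continuous continuous_intros) auto
    have "star f k x - f x = (\<integral>y. f (x + y) * cnj (k y) \<partial>\<mu>) - f x * complex_of_real (\<integral>y. k0 y / I \<partial>\<mu>)"
      unfolding star_k[OF Ck] ik by simp
    also have "\<dots> = (\<integral>y. f (x + y) * cnj (k y) \<partial>\<mu>) - (\<integral>y. f x * k y \<partial>\<mu>)"
      unfolding k_def by (simp del: of_real_divide)
    also have "\<dots> = (\<integral>y. f (x + y) * cnj (k y) - f x * k y \<partial>\<mu>)"
      using Cf Ck by (intro Bochner_Integration.integral_diff[symmetric] integrable_continuous continuous_intros)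
    also have "cmod \<dots> \<le> (\<integral>y. cmod (f (x + y) * cnj (k y) - f x * k y) \<partial>\<mu>)" by (rule integral_norm_bound)
    also have "\<dots> \<le> (\<integral>y. e / 2 * (k0 y / I) \<partial>\<mu>)"
    proof (intro integral_mono integrable_mult_right kint)
      show "integrable \<mu> (\<lambda>y. cmod (f (x + y) * cnj (k y) - f x * k y))"
        using Cf Ck by (intro integrable_continuous continuous_intros)
      fix y
      have "f (x + y) * cnj (k y) - f x * k y = (f (x + y) - f x) * complex_of_real (k0 y / I)"
        by (simp add: k_def algebra_simps del: of_real_divide)
      then have eq: "cmod (f (x + y) * cnj (k y) - f x * k y) = cmod (f (x + y) - f x) * (k0 y / I)"
        using k0(2)[of y] I by (simp add: norm_mult del: of_real_divide)
      show "cmod (f (x + y) * cnj (k y) - f x * k y) \<le> e / 2 * (k0 y / I)"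
      proof (cases "y \<in> U")
        case True
        then show ?thesis unfolding eq using U(3)[OF True, of x] k0(2)[of y] I by (intro mult_right_mono) auto
      next
        case False
        then show ?thesis unfolding eq using k0(3) by simp
      qed
    qed
    also have "\<dots> = e / 2" using ik by simp
    finally show ?thesis .
  qed
  \<comment> \<open>The summand 1 keeps the denominator positive when \<open>f\<close>
    vanishes.\<close>
  define r where "r = (e / 2)\<^sup>2 / (sqn f + 1)"
  have r: "r > 0" unfolding r_def using e sqn_nonneg[of f] by (intro divide_pos_pos) auto
  obtain m where m: "m \<in> trig_poly" "sqn (\<lambda>x. k x - m x) < r" using trig_poly_dense_sqn[OF Ck r] by blast
  note Cm = trig_poly_continuous[OF m(1)]
  have 2: "cmod (star f k x - star f m x) \<le> e / 2" for x
  proof (rule power2_le_imp_le)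
    have "(cmod (star f k x - star f m x))\<^sup>2 \<le> sqn f * sqn (\<lambda>x. k x - m x)"
      unfolding star_diff_right[OF Ck Cm f, symmetric] by (intro star_bound f continuous_on_diff Ck Cm)
    also have "\<dots> \<le> (sqn f + 1) * r" using m(2) sqn_nonneg[of f] sqn_nonneg[of "\<lambda>x. k x - m x"] by (intro mult_mono) auto
    also have "\<dots> = (e / 2)\<^sup>2" unfolding r_def using sqn_nonneg[of f] by simp
    finally show "(cmod (star f k x - star f m x))\<^sup>2 \<le> (e / 2)\<^sup>2" .
  qed (use e in simp)
  have "cmod (f x - star f m x) \<le> e" for x
    using 1[of x] 2[of x] norm_triangle_ineq[of "f x - star f k x" "star f k x - star f m x"]
    by (simp add: norm_minus_commute)
  then show ?thesis using star_trig_poly[OF f m(1)] by blast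
qed

end

section \<open>Lebesgue spaces and sigma-compactness\<close>

text \<open>Convexity of the power is applied to positive arguments; at the boundary the bound
  reduces to \<open>c powr p \<le> c\<close> on the unit interval.\<close>

lemma powr_convex_nonneg:
  fixes x y s t p :: real
  assumes "1 \<le> p" "0 \<le> x" "0 \<le> y" "0 \<le> s" "0 \<le> t" "s + t = 1"
  shows "(s * x + t * y) powr p \<le> s * x powr p + t * y powr p"
proof -
  have le: "(c * z) powr p \<le> c * z powr p" if "0 \<le> c" "c \<le> 1" "0 \<le> z" for c z :: real
  proof -
    have "c powr p \<le> c" using that assms(1) powr_mono'[of 1 p c] by (cases "c = 0") auto
    then show ?thesis using that by (simp add: powr_mult mult_right_mono)
  qed
  consider "x = 0" | "y = 0" | "x > 0" "y > 0" using assms by linarith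
  then show ?thesis
  proof cases
    case 1
    then show ?thesis using le[of t y] assms by simp
  next
    case 2
    then show ?thesis using le[of s x] assms by simp
  next
    case 3
    have "((1 - t) *\<^sub>R x + t *\<^sub>R y) powr p \<le> (1 - t) * x powr p + t * y powr p"
      using convex_onD[OF powr_convex[OF assms(1)], of t x y] 3 assms by simp
    moreover have "1 - t = s" using assms by simp
    ultimately show ?thesis by simp
  qed
qed

lemma lp_space_measurable: "f \<in> lp_space M p \<Longrightarrow> f \<in> borel_measurable M"
  and lp_space_integrable: "f \<in> lp_space M p \<Longrightarrow> integrable M (\<lambda>x. cmod (f x) powr p)"
  by (auto simp: lp_space_def)

lemma lp_norm_nonneg: "0 \<le> lp_norm M p f"
  by (simp add: lp_norm_def)

lemma lp_norm_powr:
  assumes "p > 0" shows "lp_norm M p f powr p = (\<integral>x. cmod (f x) powr p \<partial>M)"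
  using assms by (simp add: lp_norm_def powr_powr)

lemma lp_norm_leI:
  assumes "p > 0" "0 \<le> B" "(\<integral>x. cmod (f x) powr p \<partial>M) \<le> B powr p"
  shows "lp_norm M p f \<le> B"
proof -
  have "lp_norm M p f \<le> (B powr p) powr (1 / p)"
    unfolding lp_norm_def using assms by (intro powr_mono2) auto
  then show ?thesis using assms by (simp add: powr_powr)
qed

text \<open>Minkowski's inequality from convexity: \<open>cmod (f x) + cmod (g x)\<close> is
  \<open>a + b\<close> times a convex combination of \<open>cmod (f x) / a\<close> and
  \<open>cmod (g x) / b\<close>, where \<open>a\<close> and \<open>b\<close> lie slightly above the
  two norms so that neither is zero.\<close>

lemma lp_space_add:
  assumes p: "1 \<le> p" and f: "f \<in> lp_space M p" and g: "g \<in> lp_space M p"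
  shows "(\<lambda>x. f x + g x) \<in> lp_space M p"
    and "lp_norm M p (\<lambda>x. f x + g x) \<le> lp_norm M p f + lp_norm M p g"
proof -
  have m: "(\<lambda>x. f x + g x) \<in> borel_measurable M"
    using f g lp_space_measurable by (intro borel_measurable_add) auto
  note i = lp_space_integrable[OF f] lp_space_integrable[OF g]
  have bound: "cmod (f x + g x) powr p \<le> (a + b) powr p *
      (a / (a + b) * (cmod (f x) powr p / a powr p) + b / (a + b) * (cmod (g x) powr p / b powr p))"
    if ab: "a > 0" "b > 0" for a b x
  proof -
    have "cmod (f x + g x) powr p \<le> (cmod (f x) + cmod (g x)) powr p"
      using p by (intro powr_mono2 norm_triangle_ineq) auto
    also have "cmod (f x) + cmod (g x) = (a + b) * (a / (a + b) * (cmod (f x) / a) + b / (a + b) * (cmod (g x) / b))"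
    proof -
      have "a + b \<noteq> 0" using ab by simp
      have "(a + b) * (a / (a + b) * (cmod (f x) / a) + b / (a + b) * (cmod (g x) / b))
         = (a + b) * (a / (a + b)) * (cmod (f x) / a) + (a + b) * (b / (a + b)) * (cmod (g x) / b)"
        by (simp only: ring_distribs mult.assoc)
      also have "\<dots> = cmod (f x) + cmod (g x)" using ab \<open>a + b \<noteq> 0\<close> by simp
      finally show ?thesis by simp
    qed
    also have "\<dots> powr p = (a + b) powr p * (a / (a + b) * (cmod (f x) / a) + b / (a + b) * (cmod (g x) / b)) powr p"
      by (rule powr_mult)
    also have "\<dots> \<le> (a + b) powr p * (a / (a + b) * (cmod (f x) / a) powr p + b / (a + b) * (cmod (g x) / b) powr p)"
      using ab p by (intro mult_left_mono powr_convex_nonneg) (auto simp: add_divide_distrib[symmetric])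
    finally show ?thesis using ab by (simp add: powr_divide)
  qed
  have int: "integrable M (\<lambda>x. cmod (f x + g x) powr p)"
  proof (rule Bochner_Integration.integrable_bound)
    show "integrable M (\<lambda>x. (1 + 1) powr p * (1 / (1 + 1) * (cmod (f x) powr p / 1 powr p) + 1 / (1 + 1) * (cmod (g x) powr p / 1 powr p)))"
      using i by simp
    show "(\<lambda>x. cmod (f x + g x) powr p) \<in> borel_measurable M" using m by simp
    show "AE x in M. norm (cmod (f x + g x) powr p)
       \<le> norm ((1 + 1) powr p * (1 / (1 + 1) * (cmod (f x) powr p / 1 powr p) + 1 / (1 + 1) * (cmod (g x) powr p / 1 powr p)))"
      using bound[of 1 1] by (intro AE_I2) (simp add: order_trans[OF _ abs_ge_self])
  qed
  then show "(\<lambda>x. f x + g x) \<in> lp_space M p" using m by (simp add: lp_space_def)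
  let ?a = "lp_norm M p f" and ?b = "lp_norm M p g"
  show "lp_norm M p (\<lambda>x. f x + g x) \<le> ?a + ?b"
  proof (rule field_le_epsilon)
    fix e :: real assume e: "e > 0"
    define a b where "a = ?a + e / 2" and "b = ?b + e / 2"
    have ab: "a > 0" "b > 0" using e lp_norm_nonneg[of M p f] lp_norm_nonneg[of M p g] by (auto simp: a_def b_def)
    have fa: "(\<integral>x. cmod (f x) powr p \<partial>M) / a powr p \<le> 1"
      using p e ab lp_norm_nonneg[of M p f] powr_mono2[of p ?a a] by (simp add: lp_norm_powr[symmetric] a_def)
    have gb: "(\<integral>x. cmod (g x) powr p \<partial>M) / b powr p \<le> 1"
      using p e ab lp_norm_nonneg[of M p g] powr_mono2[of p ?b b] by (simp add: lp_norm_powr[symmetric] b_def)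
    have "(\<integral>x. cmod (f x + g x) powr p \<partial>M) \<le> (\<integral>x. (a + b) powr p *
      (a / (a + b) * (cmod (f x) powr p / a powr p) + b / (a + b) * (cmod (g x) powr p / b powr p)) \<partial>M)"
      using int i bound[OF ab] by (intro integral_mono) auto
    also have "\<dots> = (a + b) powr p * (a / (a + b) * ((\<integral>x. cmod (f x) powr p \<partial>M) / a powr p)
        + b / (a + b) * ((\<integral>x. cmod (g x) powr p \<partial>M) / b powr p))"
      using i by simp
    also have "\<dots> \<le> (a + b) powr p * (a / (a + b) * 1 + b / (a + b) * 1)"
      using ab fa gb by (intro mult_left_mono add_mono) auto
    also have "a / (a + b) * 1 + b / (a + b) * 1 = 1" using ab by (simp add: add_divide_distrib[symmetric])
    finally have "lp_norm M p (\<lambda>x. f x + g x) \<le> a + b" using ab p by (intro lp_norm_leI) auto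
    then show "lp_norm M p (\<lambda>x. f x + g x) \<le> ?a + ?b + e" by (simp add: a_def b_def)
  qed
qed

lemma lp_space_scale:
  assumes "p > 0" "f \<in> lp_space M p"
  shows "(\<lambda>x. c * f x) \<in> lp_space M p" and "lp_norm M p (\<lambda>x. c * f x) = cmod c * lp_norm M p f"
proof -
  show "(\<lambda>x. c * f x) \<in> lp_space M p"
    using assms by (auto simp: lp_space_def norm_mult powr_mult)
  show "lp_norm M p (\<lambda>x. c * f x) = cmod c * lp_norm M p f"
    unfolding lp_norm_def using assms by (simp add: norm_mult powr_mult powr_powr)
qed

lemma lp_space_diff:
  assumes p: "1 \<le> p" and f: "f \<in> lp_space M p" and g: "g \<in> lp_space M p"
  shows "(\<lambda>x. f x - g x) \<in> lp_space M p"
    and "lp_norm M p (\<lambda>x. f x - g x) \<le> lp_norm M p f + lp_norm M p g"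
proof -
  have p0: "p > 0" using p by simp
  have eq: "(\<lambda>x. f x - g x) = (\<lambda>x. f x + (- 1) * g x)" by simp
  show "(\<lambda>x. f x - g x) \<in> lp_space M p" "lp_norm M p (\<lambda>x. f x - g x) \<le> lp_norm M p f + lp_norm M p g"
    unfolding eq
    using lp_space_add[OF p f lp_space_scale(1)[OF p0 g, of "- 1"]] lp_space_scale(2)[OF p0 g, of "- 1"] by auto
qed

lemma lp_norm_triangle:
  assumes p: "1 \<le> p" and "(\<lambda>x. f x - g x) \<in> lp_space M p" "(\<lambda>x. g x - h x) \<in> lp_space M p"
  shows "lp_norm M p (\<lambda>x. f x - h x) \<le> lp_norm M p (\<lambda>x. f x - g x) + lp_norm M p (\<lambda>x. g x - h x)"
  using lp_space_add(2)[OF assms] by simp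

lemma lp_space_sum:
  assumes p: "1 \<le> p" and "finite I" "\<And>i. i \<in> I \<Longrightarrow> f i \<in> lp_space M p"
  shows "(\<lambda>x. \<Sum>i\<in>I. f i x) \<in> lp_space M p \<and> lp_norm M p (\<lambda>x. \<Sum>i\<in>I. f i x) \<le> (\<Sum>i\<in>I. lp_norm M p (f i))"
  using assms(2,3)
proof (induction I rule: finite_induct)
  case empty
  then show ?case by (simp add: lp_space_def lp_norm_def)
next
  case (insert i I)
  then have "(\<lambda>x. \<Sum>i\<in>I. f i x) \<in> lp_space M p" "f i \<in> lp_space M p"
     "lp_norm M p (\<lambda>x. \<Sum>i\<in>I. f i x) \<le> (\<Sum>i\<in>I. lp_norm M p (f i))" by auto
  then show ?case using lp_space_add[OF p, of "f i" M "\<lambda>x. \<Sum>i\<in>I. f i x"] insert(1,2) by auto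
qed

lemma (in prob_space) lp_norm_bounded:
  assumes "1 \<le> p" "f \<in> borel_measurable M" "\<And>x. cmod (f x) \<le> B"
  shows "f \<in> lp_space M p" "lp_norm M p f \<le> B"
proof -
  have B: "0 \<le> B" using assms(3) norm_ge_zero order_trans by blast
  have b: "cmod (f x) powr p \<le> B powr p" for x using assms by (intro powr_mono2) auto
  have i: "integrable M (\<lambda>x. cmod (f x) powr p)"
    using b assms(2) by (intro integrable_const_bound[of _ "B powr p"]) auto
  then show "f \<in> lp_space M p" using assms(2) by (simp add: lp_space_def)
  have "(\<integral>x. cmod (f x) powr p \<partial>M) \<le> (\<integral>x. B powr p \<partial>M)" using i b by (intro integral_mono) auto
  then show "lp_norm M p f \<le> B" using B assms(1) prob_space by (intro lp_norm_leI) auto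
qed

section \<open>Sigma-compact sets\<close>

lemma compact_box: "compact {x :: nat \<Rightarrow> real. (\<forall>i\<ge>n. x i = 0) \<and> (\<forall>i. \<bar>x i\<bar> \<le> c)}"
proof -
  \<comment> \<open>Intersecting \<open>{0}\<close> with \<open>{- c..c}\<close> keeps the identity
    true for negative \<open>c\<close>, where both sides are empty.\<close>
  define S where "S i = (if i < n then {- c..c} else {0} \<inter> {- c..c})" for i :: nat
  have eq: "{x :: nat \<Rightarrow> real. (\<forall>i\<ge>n. x i = 0) \<and> (\<forall>i. \<bar>x i\<bar> \<le> c)} = Pi\<^sub>E UNIV S"
  proof (rule Set.set_eqI)
    fix x :: "nat \<Rightarrow> real"
    have "x i \<in> S i \<longleftrightarrow> (i \<ge> n \<longrightarrow> x i = 0) \<and> \<bar>x i\<bar> \<le> c" for i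
      by (auto simp: S_def abs_le_iff)
    then show "x \<in> {x. (\<forall>i\<ge>n. x i = 0) \<and> (\<forall>i. \<bar>x i\<bar> \<le> c)} \<longleftrightarrow> x \<in> Pi\<^sub>E UNIV S"
      by (auto simp: PiE_def)
  qed
  have "compact (S i)" for i by (auto simp: S_def)
  then have "compactin (product_topology (\<lambda>i. euclidean) UNIV) (Pi\<^sub>E UNIV S)"
    by (subst compactin_PiE) (auto simp: compactin_euclidean_iff)
  then show ?thesis unfolding eq euclidean_product_topology compactin_euclidean_iff .
qed

definition sigma_compact :: "'a::topological_space set \<Rightarrow> bool" where
  "sigma_compact U \<longleftrightarrow> (\<exists>\<K>. countable \<K> \<and> (\<forall>K\<in>\<K>. compact K) \<and> \<Union>\<K> = U)"

lemma sigma_compact_UN: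
  assumes "countable I" "\<And>i. i \<in> I \<Longrightarrow> sigma_compact (A i)"
  shows "sigma_compact (\<Union>i\<in>I. A i)"
proof -
  have "\<forall>i\<in>I. \<exists>\<K>. countable \<K> \<and> (\<forall>K\<in>\<K>. compact K) \<and> \<Union>\<K> = A i"
    using assms(2) by (auto simp: sigma_compact_def)
  then obtain \<K> where K: "\<And>i. i \<in> I \<Longrightarrow> countable (\<K> i) \<and> (\<forall>K\<in>\<K> i. compact K) \<and> \<Union>(\<K> i) = A i"
    by metis
  show ?thesis
    unfolding sigma_compact_def
  proof (intro exI[of _ "\<Union>i\<in>I. \<K> i"] conjI ballI)
    show "countable (\<Union>i\<in>I. \<K> i)" using K assms(1) by (intro countable_UN) auto
    have "\<Union> (\<Union>i\<in>I. \<K> i) = (\<Union>i\<in>I. \<Union> (\<K> i))" by blast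
    also have "\<dots> = (\<Union>i\<in>I. A i)" using K by (intro SUP_cong) auto
    finally show "\<Union> (\<Union>i\<in>I. \<K> i) = (\<Union>i\<in>I. A i)" .
  qed (use K in auto)
qed

text \<open>In the metrizable ambient space an open set is a countable union of closed sets; cutting
  these with the boxes \<open>B l\<close>, which exhaust the subspace, makes them compact.\<close>

lemma sigma_compact_open_Euclidean_space:
  assumes "openin (Euclidean_space n) S"
  shows "sigma_compact S"
proof -
  obtain T where T: "open T" "S = T \<inter> {x. \<forall>i\<ge>n. x i = 0}"
    using assms unfolding Euclidean_space_def openin_subtopology euclidean_product_topology by auto
  have "fsigma_in euclidean T"
    using T(1) by (intro open_imp_fsigma_in metrizable_space_euclidean) simp
  then obtain C :: "nat \<Rightarrow> (nat \<Rightarrow> real) set" where C: "\<And>k. closed (C k)" "\<Union> (range C) = T"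
    unfolding fsigma_in_ascending by auto
  define B where "B l = {x :: nat \<Rightarrow> real. (\<forall>i\<ge>n. x i = 0) \<and> (\<forall>i. \<bar>x i\<bar> \<le> real l)}" for l
  have B: "\<exists>l. x \<in> B l" if x: "\<forall>i\<ge>n. x i = 0" for x
  proof -
    obtain l where l: "(\<Sum>i<n. \<bar>x i\<bar>) \<le> real l" using real_arch_simple by blast
    have "\<bar>x i\<bar> \<le> real l" for i
    proof (cases "i < n")
      case True
      then show ?thesis using l member_le_sum[of i "{..<n}" "\<lambda>i. \<bar>x i\<bar>"] by simp
    qed (use x in auto)
    then show ?thesis using x by (auto simp: B_def)
  qed
  have "S = (\<Union>(k, l)\<in>UNIV. C k \<inter> B l)"
    using B unfolding T(2) C(2)[symmetric] by (auto simp: B_def)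
  moreover have "compact (C k \<inter> B l)" for k l
    unfolding B_def by (intro closed_Int_compact C compact_box)
  ultimately show ?thesis
    unfolding sigma_compact_def by (intro exI[of _ "range (\<lambda>(k, l). C k \<inter> B l)"]) auto
qed

lemma sigma_compact_continuous_image:
  assumes "sigma_compact S" "continuous_on S f"
  shows "sigma_compact (f ` S)"
proof -
  obtain \<K> where K: "countable \<K>" "\<forall>K\<in>\<K>. compact K" "\<Union>\<K> = S"
    using assms(1) by (auto simp: sigma_compact_def)
  have "compact (f ` K)" if "K \<in> \<K>" for K
    using K that by (intro compact_continuous_image continuous_on_subset[OF assms(2)]) auto
  then show ?thesis
    unfolding sigma_compact_def using K by (intro exI[of _ "(`) f ` \<K>"]) auto
qed

text \<open>The charts are used only here: sigma-compactness of open sets is what makes the continuous functions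
  dense in \<open>L\<^sup>p\<close>.\<close>

lemma compact_lie_group_sigma_compact:
  assumes "compact_lie_group TYPE('g::{topological_group_add, t2_space})" "open (U :: 'g set)"
  shows "sigma_compact U"
proof -
  obtain n and \<A> :: "('g set \<times> ('g \<Rightarrow> nat \<Rightarrow> real)) set" where A: "lie_group_atlas n \<A>"
    using assms(1) by (auto simp: compact_lie_group_def)
  have ch: "\<And>V \<phi>. (V, \<phi>) \<in> \<A> \<Longrightarrow> is_chart n V \<phi>" and cov: "(\<Union>(V, \<phi>)\<in>\<A>. V) = UNIV"
    using A by (auto simp: lie_group_atlas_def smooth_atlas_def)
  have "compact (UNIV :: 'g set)" using assms(1) by (simp add: compact_lie_group_def)
  moreover have "\<And>a. a \<in> \<A> \<Longrightarrow> open (fst a)" using ch by (auto simp: is_chart_def)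
  moreover have "UNIV \<subseteq> (\<Union>a\<in>\<A>. fst a)" using cov by (simp add: case_prod_unfold)
  ultimately obtain F where F: "F \<subseteq> \<A>" "finite F" "UNIV \<subseteq> (\<Union>a\<in>F. fst a)"
    by (rule compactE_image)
  have "sigma_compact (U \<inter> fst a)" if "a \<in> F" for a
  proof -
    obtain V \<phi> where a: "a = (V, \<phi>)" by (cases a)
    have "is_chart n V \<phi>" using ch F(1) that a by auto
    then obtain \<psi> where V: "open V" "openin (Euclidean_space n) (\<phi> ` V)" "homeomorphism V (\<phi> ` V) \<phi> \<psi>"
      by (auto simp: is_chart_def)
    have "openin (top_of_set V) (U \<inter> V)" by (subst Int_commute) (rule openin_open_Int[OF assms(2)])
    then have "openin (top_of_set (\<phi> ` V)) (\<phi> ` (U \<inter> V))"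
      by (rule homeomorphism_imp_open_map[OF V(3)])
    then obtain T where T: "open T" "\<phi> ` (U \<inter> V) = \<phi> ` V \<inter> T" by (auto simp: openin_open)
    obtain T' where T': "open T'" "\<phi> ` V = T' \<inter> {x. \<forall>i\<ge>n. x i = 0}"
      using V(2) unfolding Euclidean_space_def openin_subtopology euclidean_product_topology by auto
    have "openin (Euclidean_space n) (\<phi> ` (U \<inter> V))"
      unfolding T(2) T'(2) Euclidean_space_def openin_subtopology euclidean_product_topology
      using T(1) T'(1) by (intro exI[of _ "T \<inter> T'"]) auto
    then have "sigma_compact (\<psi> ` \<phi> ` (U \<inter> V))"
      using V(3) by (intro sigma_compact_continuous_image sigma_compact_open_Euclidean_space)
        (auto simp: homeomorphism_def intro: continuous_on_subset)
    moreover have "\<psi> ` \<phi> ` (U \<inter> V) = U \<inter> V"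
      using V(3) by (force simp: homeomorphism_def image_image)
    ultimately show ?thesis by (simp add: a)
  qed
  then have "sigma_compact (\<Union>a\<in>F. U \<inter> fst a)" using F(2) by (intro sigma_compact_UN) (auto simp: countable_finite)
  moreover have "(\<Union>a\<in>F. U \<inter> fst a) = U" using F(3) by auto
  ultimately show ?thesis by simp
qed

section \<open>Density in Lebesgue spaces\<close>

context haar_group
begin

text \<open>Values in the unit interval are required because then
  \<open>\<bar>indicator B x - g x\<bar> powr p\<close> is at most
  \<open>\<bar>indicator B x - g x\<bar>\<close>: one L^1 statement serves every exponent.\<close>

definition indicator_approx :: "'g set \<Rightarrow> bool" where
  "indicator_approx B \<longleftrightarrow> B \<in> sets borel \<and> (\<forall>e>0. \<exists>g :: 'g \<Rightarrow> real. continuous_on UNIV g \<and>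
     (\<forall>x. 0 \<le> g x \<and> g x \<le> 1) \<and> (\<integral>x. \<bar>indicator B x - g x\<bar> \<partial>\<mu>) < e)"

lemma integrable_indicator_diff:
  assumes "B \<in> sets borel" "continuous_on UNIV (g :: 'g \<Rightarrow> real)"
  shows "integrable \<mu> (\<lambda>x. \<bar>indicator B x - g x\<bar>)"
proof -
  have "integrable \<mu> (indicator B :: 'g \<Rightarrow> real)"
    using assms(1) sets_haar by (intro integrable_real_indicator) (auto simp: emeasure_eq_measure)
  then show ?thesis using integrable_continuous[OF assms(2)] by (intro integrable_abs Bochner_Integration.integrable_diff)
qed

text \<open>Inner regularity of open sets: the finite unions of the compact pieces exhaust
  \<open>U\<close>, and the measure is continuous along the decreasing complements.\<close>

lemma compact_approx_open:
  assumes "sigma_compact U" "open U" "e > 0"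
  obtains K where "compact K" "K \<subseteq> U" "measure \<mu> (U - K) < e"
proof -
  obtain \<K> where K: "countable \<K>" "\<forall>K\<in>\<K>. compact K" "\<Union>\<K> = U" using assms(1) by (auto simp: sigma_compact_def)
  \<comment> \<open>The additional empty set lets the enumeration work for an empty family
    too.\<close>
  define k where "k n = (\<Union>i<n. from_nat_into (insert {} \<K>) i)" for n
  have fk: "from_nat_into (insert {} \<K>) i \<in> insert {} \<K>" for i by (rule from_nat_into) simp
  have c: "compact (k n)" for n
    unfolding k_def using fk K(2) by (intro compact_UN) (auto, metis compact_empty insertE)
  have sub: "k n \<subseteq> U" for n unfolding k_def using fk K(3) by blast
  have "(\<Union>n. k n) = (\<Union>i. from_nat_into (insert {} \<K>) i)"
  proof (intro equalityI subsetI)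
    fix x assume "x \<in> (\<Union>i. from_nat_into (insert {} \<K>) i)"
    then obtain i where "x \<in> from_nat_into (insert {} \<K>) i" by blast
    then have "x \<in> k (Suc i)" unfolding k_def by blast
    then show "x \<in> (\<Union>n. k n)" by blast
  qed (auto simp: k_def)
  also have "\<dots> = \<Union> (insert {} \<K>)"
    using range_from_nat_into[of "insert {} \<K>"] K(1) by simp
  finally have un: "(\<Union>n. k n) = U" using K(3) by simp
  have "decseq (\<lambda>n. U - k n)" unfolding k_def by (auto simp: decseq_def)
  moreover have "range (\<lambda>n. U - k n) \<subseteq> sets \<mu>"
    using assms(2) compact_imp_closed[OF c] sets_haar by auto
  ultimately have "(\<lambda>n. measure \<mu> (U - k n)) \<longlonglongrightarrow> measure \<mu> (\<Inter>n. U - k n)"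
    by (intro finite_Lim_measure_decseq)
  moreover have "(\<Inter>n. U - k n) = {}" using un by blast
  ultimately have "(\<lambda>n. measure \<mu> (U - k n)) \<longlonglongrightarrow> 0" by (simp only: measure_empty)
  from LIMSEQ_D[OF this assms(3)] obtain n where "\<forall>m\<ge>n. norm (measure \<mu> (U - k m) - 0) < e" ..
  then have "measure \<mu> (U - k n) < e" by simp
  then show thesis by (rule that[OF c sub])
qed

lemma indicator_approx_open:
  assumes "sigma_compact U" "open U"
  shows "indicator_approx U"
  unfolding indicator_approx_def
proof (intro conjI allI impI)
  show "U \<in> sets borel" using assms by simp
  fix e :: real assume "e > 0"
  then obtain K where K: "compact K" "K \<subseteq> U" "measure \<mu> (U - K) < e"
    using compact_approx_open[OF assms] by blast
  have "closed (- U)" "closed K" "- U \<inter> K = {}" using assms(2) K compact_imp_closed by auto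
  from urysohn[OF this] obtain g :: "'g \<Rightarrow> real" where g: "continuous_on UNIV g \<and> (\<forall>x. 0 \<le> g x \<and> g x \<le> 1) \<and>
    (\<forall>x\<in>- U. g x = 0) \<and> (\<forall>x\<in>K. g x = 1)" ..
  have m: "U - K \<in> sets \<mu>" using assms(2) \<open>closed K\<close> sets_haar by auto
  have "\<bar>indicator U x - g x\<bar> \<le> indicator (U - K) x" for x
    using g K(2) by (cases "x \<in> K"; cases "x \<in> U") auto
  then have "(\<integral>x. \<bar>indicator U x - g x\<bar> \<partial>\<mu>) \<le> (\<integral>x. indicator (U - K) x \<partial>\<mu>)"
    using g assms(2) m by (intro integral_mono integrable_indicator_diff integrable_real_indicator)
      (auto simp: emeasure_eq_measure)
  also have "\<dots> = measure \<mu> (U - K)" using m by simp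
  finally have "(\<integral>x. \<bar>indicator U x - g x\<bar> \<partial>\<mu>) < e" using K(3) by simp
  then show "\<exists>g :: 'g \<Rightarrow> real. continuous_on UNIV g \<and> (\<forall>x. 0 \<le> g x \<and> g x \<le> 1) \<and> (\<integral>x. \<bar>indicator U x - g x\<bar> \<partial>\<mu>) < e"
    using g by blast
qed

lemma indicator_approx_compl:
  assumes "indicator_approx B" shows "indicator_approx (UNIV - B)"
  unfolding indicator_approx_def
proof (intro conjI allI impI)
  show "UNIV - B \<in> sets borel" using assms by (auto simp: indicator_approx_def)
  fix e :: real assume "e > 0"
  then obtain g :: "'g \<Rightarrow> real" where g: "continuous_on UNIV g" "\<forall>x. 0 \<le> g x \<and> g x \<le> 1"
     "(\<integral>x. \<bar>indicator B x - g x\<bar> \<partial>\<mu>) < e"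
    using assms by (auto simp: indicator_approx_def)
  have "\<bar>indicator (UNIV - B) x - (1 - g x)\<bar> = \<bar>indicator B x - g x\<bar>" for x
    by (auto simp: indicator_def)
  then show "\<exists>g :: 'g \<Rightarrow> real. continuous_on UNIV g \<and> (\<forall>x. 0 \<le> g x \<and> g x \<le> 1) \<and> (\<integral>x. \<bar>indicator (UNIV - B) x - g x\<bar> \<partial>\<mu>) < e"
    using g by (intro exI[of _ "\<lambda>x. 1 - g x"]) (auto intro!: continuous_intros)
qed

text \<open>The first \<open>N\<close> sets carry almost all of the mass. Their approximants are
  added and cut off at 1; disjointness bounds the sum of the indicators by 1, so the cut-off does
  not increase the error.\<close>

lemma indicator_approx_disjoint_UN:
  fixes A :: "nat \<Rightarrow> 'g set"
  assumes "disjoint_family A" "\<And>i. indicator_approx (A i)"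
  shows "indicator_approx (\<Union>i. A i)"
  unfolding indicator_approx_def
proof (intro conjI allI impI)
  have A: "A i \<in> sets borel" for i using assms(2) by (simp add: indicator_approx_def)
  then show U: "(\<Union>i. A i) \<in> sets borel" by auto
  fix e :: real assume e: "e > 0"
  have Am: "A i \<in> sets \<mu>" for i using A sets_haar by simp
  have "(\<lambda>i. measure \<mu> (A i)) sums measure \<mu> (\<Union>i. A i)"
    using assms(1) Am by (intro finite_measure_UNION) auto
  then have "(\<lambda>N. \<Sum>i<N. measure \<mu> (A i)) \<longlonglongrightarrow> measure \<mu> (\<Union>i. A i)" by (simp add: sums_def)
  from LIMSEQ_D[OF this half_gt_zero[OF e]]
  obtain N where "\<forall>n\<ge>N. norm ((\<Sum>i<n. measure \<mu> (A i)) - measure \<mu> (\<Union>i. A i)) < e / 2" ..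
  then have N: "\<bar>(\<Sum>i<N. measure \<mu> (A i)) - measure \<mu> (\<Union>i. A i)\<bar> < e / 2" by simp
  \<comment> \<open>Makes \<open>N\<close> errors add up to at most \<open>e / 2\<close>;
    \<open>Suc N\<close> avoids division by zero.\<close>
  define d where "d = e / (2 * real (Suc N))"
  have d: "d > 0" using e by (simp add: d_def)
  have "\<forall>i. \<exists>g :: 'g \<Rightarrow> real. continuous_on UNIV g \<and> (\<forall>x. 0 \<le> g x \<and> g x \<le> 1) \<and> (\<integral>x. \<bar>indicator (A i) x - g x\<bar> \<partial>\<mu>) < d"
    using assms(2) d by (auto simp: indicator_approx_def)
  then obtain g :: "nat \<Rightarrow> 'g \<Rightarrow> real" where g: "\<And>i. continuous_on UNIV (g i)" "\<And>i x. 0 \<le> g i x \<and> g i x \<le> 1"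
     "\<And>i. (\<integral>x. \<bar>indicator (A i) x - g i x\<bar> \<partial>\<mu>) < d"
    by metis
  define G where "G x = min 1 (\<Sum>i<N. g i x)" for x
  let ?R = "(\<Union>i. A i) - (\<Union>i<N. A i)"
  have R: "?R \<in> sets \<mu>" using Am by auto
  have cG: "continuous_on UNIV G" unfolding G_def by (intro continuous_intros g)
  have mR: "measure \<mu> ?R < e / 2"
  proof -
    have "measure \<mu> (\<Union>i<N. A i) = (\<Sum>i<N. measure \<mu> (A i))"
      using assms(1) Am by (intro finite_measure_finite_Union) (auto simp: disjoint_family_on_def)
    moreover have "measure \<mu> ?R = measure \<mu> (\<Union>i. A i) - measure \<mu> (\<Union>i<N. A i)"
      using Am by (intro finite_measure_Diff) auto
    ultimately show ?thesis using N by linarith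
  qed
  have bound: "\<bar>indicator (\<Union>i. A i) x - G x\<bar> \<le> (\<Sum>i<N. \<bar>indicator (A i) x - g i x\<bar>) + indicator ?R x" for x
  proof -
    have ind: "indicator (\<Union>i<N. A i) x = (\<Sum>i<N. indicator (A i) x :: real)"
      using assms(1) by (intro indicator_UN_disjoint) (auto simp: disjoint_family_on_def)
    have sp: "indicator (\<Union>i. A i) x = indicator (\<Union>i<N. A i) x + (indicator ?R x :: real)"
      by (auto simp: indicator_def)
    have le1: "indicator (\<Union>i<N. A i) x \<le> (1 :: real)" by (simp add: indicator_def)
    have "\<bar>min 1 (indicator (\<Union>i<N. A i) x) - min 1 (\<Sum>i<N. g i x)\<bar> \<le> \<bar>indicator (\<Union>i<N. A i) x - (\<Sum>i<N. g i x)\<bar>"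
      by linarith
    also have "\<dots> = \<bar>\<Sum>i<N. indicator (A i) x - g i x\<bar>" unfolding ind sum_subtractf ..
    also have "\<dots> \<le> (\<Sum>i<N. \<bar>indicator (A i) x - g i x\<bar>)" by (rule sum_abs)
    finally have "\<bar>indicator (\<Union>i<N. A i) x - G x\<bar> \<le> (\<Sum>i<N. \<bar>indicator (A i) x - g i x\<bar>)"
      using le1 by (simp add: G_def)
    moreover have "(0::real) \<le> indicator ?R x" by simp
    ultimately show ?thesis unfolding sp by linarith
  qed
  have iR: "integrable \<mu> (indicator ?R :: 'g \<Rightarrow> real)"
    using R by (intro integrable_real_indicator) (auto simp: emeasure_eq_measure)
  have "(\<integral>x. \<bar>indicator (\<Union>i. A i) x - G x\<bar> \<partial>\<mu>) \<le> (\<integral>x. (\<Sum>i<N. \<bar>indicator (A i) x - g i x\<bar>) + indicator ?R x \<partial>\<mu>)"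
    by (intro integral_mono bound integrable_indicator_diff U cG Bochner_Integration.integrable_add
        Bochner_Integration.integrable_sum A g iR)
  also have "\<dots> = (\<Sum>i<N. (\<integral>x. \<bar>indicator (A i) x - g i x\<bar> \<partial>\<mu>)) + measure \<mu> ?R"
  proof -
    have ii: "integrable \<mu> (\<lambda>x. \<bar>indicator (A i) x - g i x\<bar>)" for i
      by (rule integrable_indicator_diff[OF A g(1)])
    show ?thesis
      using R by (subst Bochner_Integration.integral_add[OF Bochner_Integration.integrable_sum[OF ii] iR])
        (simp add: Bochner_Integration.integral_sum[OF ii])
  qed
  also have "\<dots> \<le> (\<Sum>i<N. d) + measure \<mu> ?R" by (intro add_mono sum_mono less_imp_le[OF g(3)] order_refl)
  also have "(\<Sum>i<N. d) \<le> e / 2" using e by (simp add: d_def field_simps)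
  then have "(\<Sum>i<N. d) + measure \<mu> ?R < e" using mR by linarith
  finally have "(\<integral>x. \<bar>indicator (\<Union>i. A i) x - G x\<bar> \<partial>\<mu>) < e" .
  moreover have "0 \<le> G x \<and> G x \<le> 1" for x using g(2) by (auto simp: G_def intro!: sum_nonneg)
  ultimately show "\<exists>g :: 'g \<Rightarrow> real. continuous_on UNIV g \<and> (\<forall>x. 0 \<le> g x \<and> g x \<le> 1) \<and> (\<integral>x. \<bar>indicator (\<Union>i. A i) x - g x\<bar> \<partial>\<mu>) < e"
    using cG by blast
qed

text \<open>Dynkin's argument: open sets are stable under intersection, and approximability passes
  to complements and countable disjoint unions.\<close>

lemma indicator_approx_borel:
  assumes sc: "\<And>U :: 'g set. open U \<Longrightarrow> sigma_compact U" and B: "B \<in> sets borel"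
  shows "indicator_approx B"
proof -
  have "B \<in> sigma_sets UNIV {S :: 'g set. open S}" using B by (simp add: borel_def)
  then show ?thesis
  proof (rule sigma_sets_induct_disjoint[rotated 2])
    show "Int_stable {S :: 'g set. open S}" by (auto simp: Int_stable_def)
    show "indicator_approx {}" using indicator_approx_open[of "{}"] sc[of "{}"] by simp
  qed (use sc in \<open>auto intro: indicator_approx_open indicator_approx_compl indicator_approx_disjoint_UN\<close>)
qed

definition lp_approx :: "real \<Rightarrow> ('g \<Rightarrow> complex) \<Rightarrow> bool" where
  "lp_approx p f \<longleftrightarrow> f \<in> lp_space \<mu> p \<and> (\<forall>e>0. \<exists>g. continuous_fun g \<and> lp_norm \<mu> p (\<lambda>x. f x - g x) < e)"

lemma continuous_lp_space:
  assumes "1 \<le> p" "continuous_fun f" shows "f \<in> lp_space \<mu> p"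
proof -
  obtain B where "\<And>x. cmod (f x) \<le> B"
    using bounded_continuous[OF assms(2)] by (auto simp: bounded_iff)
  then show ?thesis using lp_norm_bounded(1)[OF assms(1) measurable_continuous[OF assms(2)]] by blast
qed

lemma lp_approx_indicator:
  assumes p: "1 \<le> p" and B: "indicator_approx B"
  shows "lp_approx p (\<lambda>x. c * complex_of_real (indicator B x))"
proof -
  have Bs: "B \<in> sets \<mu>" using B sets_haar by (simp add: indicator_approx_def)
  have p0: "p > 0" using p by simp
  have mI: "(\<lambda>x. complex_of_real (indicator B x)) \<in> borel_measurable \<mu>" using Bs by simp
  have I: "(\<lambda>x. complex_of_real (indicator B x)) \<in> lp_space \<mu> p"
    by (rule lp_norm_bounded(1)[OF p mI, of 1]) (simp add: indicator_def)
  show ?thesis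
    unfolding lp_approx_def
  proof (intro conjI allI impI)
    show "(\<lambda>x. c * complex_of_real (indicator B x)) \<in> lp_space \<mu> p" by (rule lp_space_scale(1)[OF p0 I])
    fix e :: real assume e: "e > 0"
    define d where "d = e / (cmod c + 1)"
    have d: "d > 0" unfolding d_def using e by (intro divide_pos_pos) (auto intro: add_nonneg_pos)
    have dp: "d powr p > 0" using d by simp
    obtain g :: "'g \<Rightarrow> real" where g: "continuous_on UNIV g" "\<forall>x. 0 \<le> g x \<and> g x \<le> 1"
     "(\<integral>x. \<bar>indicator B x - g x\<bar> \<partial>\<mu>) < d powr p"
      using B dp unfolding indicator_approx_def by blast
    have Cg: "continuous_fun (\<lambda>x. complex_of_real (g x))" by (intro continuous_on_of_real g(1))
    let ?D = "\<lambda>x. complex_of_real (indicator B x) - complex_of_real (g x)"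
    have le: "cmod (?D x) powr p \<le> \<bar>indicator B x - g x\<bar>" for x
    proof -
      have eq: "cmod (?D x) = \<bar>indicator B x - g x\<bar>" by (simp flip: of_real_diff)
      have "\<bar>indicator B x - g x\<bar> \<le> 1" using g(2)[rule_format, of x] by (auto simp: indicator_def)
      then have "\<bar>indicator B x - g x\<bar> powr p \<le> \<bar>indicator B x - g x\<bar> powr 1"
        using p by (intro powr_mono') auto
      then show ?thesis unfolding eq by simp
    qed
    have Dl: "?D \<in> lp_space \<mu> p" by (intro lp_space_diff(1) p I continuous_lp_space Cg)
    have "(\<integral>x. cmod (?D x) powr p \<partial>\<mu>) \<le> (\<integral>x. \<bar>indicator B x - g x\<bar> \<partial>\<mu>)"
      using Bs sets_haar g(1) by (intro integral_mono lp_space_integrable Dl integrable_indicator_diff le) auto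
    then have "lp_norm \<mu> p ?D \<le> d" using g(3) d p by (intro lp_norm_leI) auto
    moreover have "lp_norm \<mu> p (\<lambda>x. c * ?D x) = cmod c * lp_norm \<mu> p ?D" by (rule lp_space_scale(2)[OF p0 Dl])
    moreover have "(\<lambda>x. c * complex_of_real (indicator B x) - c * complex_of_real (g x)) = (\<lambda>x. c * ?D x)"
      by (simp add: right_diff_distrib)
    ultimately have "lp_norm \<mu> p (\<lambda>x. c * complex_of_real (indicator B x) - c * complex_of_real (g x)) \<le> cmod c * d"
      by (simp add: mult_left_mono)
    also have "\<dots> < (cmod c + 1) * d" using d by simp
    also have "\<dots> = e" unfolding d_def by (simp add: add_nonneg_pos less_imp_neq[symmetric])
    finally have "lp_norm \<mu> p (\<lambda>x. c * complex_of_real (indicator B x) - c * complex_of_real (g x)) < e" .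
    moreover have "continuous_fun (\<lambda>x. c * complex_of_real (g x))" by (intro continuous_on_mult continuous_on_const Cg)
    ultimately show "\<exists>h. continuous_fun h \<and> lp_norm \<mu> p (\<lambda>x. c * complex_of_real (indicator B x) - h x) < e"
      by blast
  qed
qed

lemma lp_approx_add:
  assumes p: "1 \<le> p" and "lp_approx p f1" "lp_approx p f2"
  shows "lp_approx p (\<lambda>x. f1 x + f2 x)"
  unfolding lp_approx_def
proof (intro conjI allI impI)
  have L: "f1 \<in> lp_space \<mu> p" "f2 \<in> lp_space \<mu> p" using assms by (auto simp: lp_approx_def)
  then show "(\<lambda>x. f1 x + f2 x) \<in> lp_space \<mu> p" by (rule lp_space_add(1)[OF p])
  fix e :: real assume "e > 0"
  then have "e / 2 > 0" by simp
  obtain g1 where g1: "continuous_fun g1" "lp_norm \<mu> p (\<lambda>x. f1 x - g1 x) < e / 2"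
    using assms(2) \<open>e / 2 > 0\<close> unfolding lp_approx_def by blast
  obtain g2 where g2: "continuous_fun g2" "lp_norm \<mu> p (\<lambda>x. f2 x - g2 x) < e / 2"
    using assms(3) \<open>e / 2 > 0\<close> unfolding lp_approx_def by blast
  have "lp_norm \<mu> p (\<lambda>x. (f1 x - g1 x) + (f2 x - g2 x)) \<le> lp_norm \<mu> p (\<lambda>x. f1 x - g1 x) + lp_norm \<mu> p (\<lambda>x. f2 x - g2 x)"
    by (intro lp_space_add(2) lp_space_diff(1) p L continuous_lp_space g1 g2)
  moreover have "(\<lambda>x. (f1 x - g1 x) + (f2 x - g2 x)) = (\<lambda>x. (f1 x + f2 x) - (g1 x + g2 x))" by auto
  ultimately have "lp_norm \<mu> p (\<lambda>x. (f1 x + f2 x) - (g1 x + g2 x)) < e" using g1 g2 by simp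
  moreover have "continuous_fun (\<lambda>x. g1 x + g2 x)" using g1 g2 by (intro continuous_intros)
  ultimately show "\<exists>g. continuous_fun g \<and> lp_norm \<mu> p (\<lambda>x. f1 x + f2 x - g x) < e" by blast
qed

lemma lp_approx_sum:
  assumes p: "1 \<le> p" shows "finite I \<Longrightarrow> (\<And>i. i \<in> I \<Longrightarrow> lp_approx p (f i)) \<Longrightarrow> lp_approx p (\<lambda>x. \<Sum>i\<in>I. f i x)"
proof (induction I rule: finite_induct)
  case empty
  have C0: "continuous_fun (\<lambda>x :: 'g. 0)" by simp
  have "lp_norm \<mu> p (\<lambda>x. 0 - 0) = 0" by (simp add: lp_norm_def)
  then show ?case using continuous_lp_space[OF p C0] C0 unfolding lp_approx_def by fastforce
next
  case (insert i I)
  then show ?case using lp_approx_add[OF p, of "f i" "\<lambda>x. \<Sum>i\<in>I. f i x"] by simp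
qed

lemma lp_approx_all:
  assumes sc: "\<And>U :: 'g set. open U \<Longrightarrow> sigma_compact U" and p: "1 \<le> p" and f: "f \<in> lp_space \<mu> p"
  shows "lp_approx p f"
  unfolding lp_approx_def
proof (intro conjI allI impI f)
  fix e :: real assume e: "e > 0"
  obtain F where F: "\<And>i. simple_function \<mu> (F i)" "\<And>x. (\<lambda>i. F i x) \<longlonglongrightarrow> f x" "\<And>i x. dist (F i x) 0 \<le> 2 * dist (f x) 0"
    using borel_measurable_implies_sequence_metric[OF lp_space_measurable[OF f], of 0] by auto
  have FA: "lp_approx p (F i)" for i
  proof -
    have fin: "finite (range (F i))" using simple_functionD(1)[OF F(1), of i] by simp
    have S: "F i -` {y} \<in> sets borel" for y
      using simple_functionD(2)[OF F(1), of i "{y}"] sets_haar by simp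
    have eq: "F i = (\<lambda>x. \<Sum>y\<in>range (F i). y * complex_of_real (indicator (F i -` {y}) x))"
    proof
      fix x
      have "(\<Sum>y\<in>range (F i). y * complex_of_real (indicator (F i -` {y}) x)) = (\<Sum>y\<in>range (F i). if y = F i x then y else 0)"
        by (intro sum.cong) (auto simp: indicator_def)
      also have "\<dots> = F i x" using fin by simp
      finally show "F i x = (\<Sum>y\<in>range (F i). y * complex_of_real (indicator (F i -` {y}) x))" by simp
    qed
    show ?thesis
      by (subst eq) (intro lp_approx_sum[OF p fin] lp_approx_indicator[OF p] indicator_approx_borel[OF sc] S)
  qed
  have meas: "(\<lambda>x. cmod (f x - F i x) powr p) \<in> borel_measurable \<mu>" for i
    using borel_measurable_simple_function[OF F(1)] lp_space_measurable[OF f] by measurable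
  \<comment> \<open>The simple functions satisfy \<open>cmod (F i x) \<le> 2 * cmod (f x)\<close>,
    whence the dominating function with the factor \<open>3 powr p\<close>.\<close>
  have "(\<lambda>i. \<integral>x. cmod (f x - F i x) powr p \<partial>\<mu>) \<longlonglongrightarrow> (\<integral>x. 0 \<partial>\<mu>)"
  proof (rule integral_dominated_convergence[where w = "\<lambda>x. 3 powr p * cmod (f x) powr p"])
    show "integrable \<mu> (\<lambda>x. 3 powr p * cmod (f x) powr p)" using lp_space_integrable[OF f] by simp
    show "AE x in \<mu>. (\<lambda>i. cmod (f x - F i x) powr p) \<longlonglongrightarrow> 0"
    proof (rule AE_I2)
      fix x
      have "(\<lambda>i. cmod (f x - F i x)) \<longlonglongrightarrow> cmod (f x - f x)" by (intro tendsto_intros F)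
      then have "(\<lambda>i. cmod (f x - F i x)) \<longlonglongrightarrow> 0" by simp
      then have "(\<lambda>i. cmod (f x - F i x) powr p) \<longlonglongrightarrow> 0 powr p" using p by (intro tendsto_powr') auto
      then show "(\<lambda>i. cmod (f x - F i x) powr p) \<longlonglongrightarrow> 0" by simp
    qed
    show "AE x in \<mu>. norm (cmod (f x - F i x) powr p) \<le> 3 powr p * cmod (f x) powr p" for i
    proof (rule AE_I2)
      fix x
      have "cmod (f x - F i x) \<le> 3 * cmod (f x)"
        using norm_triangle_ineq4[of "f x" "F i x"] F(3)[of i x] by simp
      then have "cmod (f x - F i x) powr p \<le> (3 * cmod (f x)) powr p" using p by (intro powr_mono2) auto
      then show "norm (cmod (f x - F i x) powr p) \<le> 3 powr p * cmod (f x) powr p" by (simp add: powr_mult)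
    qed
  qed (use meas in auto)
  then have lim: "(\<lambda>i. \<integral>x. cmod (f x - F i x) powr p \<partial>\<mu>) \<longlonglongrightarrow> 0" by simp
  have pe: "(e / 3) powr p > 0" using e by simp
  from LIMSEQ_D[OF lim pe]
  obtain i where "\<forall>n\<ge>i. norm ((\<integral>x. cmod (f x - F n x) powr p \<partial>\<mu>) - 0) < (e / 3) powr p" ..
  then have "norm ((\<integral>x. cmod (f x - F i x) powr p \<partial>\<mu>) - 0) < (e / 3) powr p" by blast
  then have i: "(\<integral>x. cmod (f x - F i x) powr p \<partial>\<mu>) < (e / 3) powr p" by simp
  have n1: "lp_norm \<mu> p (\<lambda>x. f x - F i x) \<le> e / 3" using i e p by (intro lp_norm_leI) auto
  have FL: "F i \<in> lp_space \<mu> p" using FA[of i] by (simp add: lp_approx_def)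
  have "e / 3 > 0" using e by simp
  then obtain g where g: "continuous_fun g" "lp_norm \<mu> p (\<lambda>x. F i x - g x) < e / 3"
    using FA[of i] unfolding lp_approx_def by blast
  have "lp_norm \<mu> p (\<lambda>x. f x - g x) \<le> lp_norm \<mu> p (\<lambda>x. f x - F i x) + lp_norm \<mu> p (\<lambda>x. F i x - g x)"
    by (intro lp_norm_triangle p lp_space_diff(1) f FL continuous_lp_space g)
  then have "lp_norm \<mu> p (\<lambda>x. f x - g x) < e" using n1 g(2) e by linarith
  then show "\<exists>g. continuous_fun g \<and> lp_norm \<mu> p (\<lambda>x. f x - g x) < e" using g(1) by blast
qed

lemma trig_poly_dense_lp:
  assumes sc: "\<And>U :: 'g set. open U \<Longrightarrow> sigma_compact U" and p: "1 \<le> p" and f: "f \<in> lp_space \<mu> p" and e: "e > 0"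
  shows "\<exists>m\<in>trig_poly. lp_norm \<mu> p (\<lambda>x. f x - m x) < e"
proof -
  have e3: "e / 3 > 0" using e by simp
  obtain g where g: "continuous_fun g" "lp_norm \<mu> p (\<lambda>x. f x - g x) < e / 3"
    using lp_approx_all[OF sc p f] e3 unfolding lp_approx_def by blast
  obtain m where m: "m \<in> trig_poly" "\<And>x. cmod (g x - m x) \<le> e / 3"
    using trig_poly_dense[OF g(1) e3] by blast
  have Cd: "continuous_fun (\<lambda>x. g x - m x)" by (intro continuous_on_diff g trig_poly_continuous m)
  have "lp_norm \<mu> p (\<lambda>x. g x - m x) \<le> e / 3"
    by (rule lp_norm_bounded(2)[OF p measurable_continuous[OF Cd] m(2)])
  moreover have "lp_norm \<mu> p (\<lambda>x. f x - m x) \<le> lp_norm \<mu> p (\<lambda>x. f x - g x) + lp_norm \<mu> p (\<lambda>x. g x - m x)"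
    by (intro lp_norm_triangle p lp_space_diff(1) f continuous_lp_space g trig_poly_continuous m)
  ultimately have "lp_norm \<mu> p (\<lambda>x. f x - m x) < e" using g(2) e by linarith
  then show ?thesis using m(1) by blast
qed

end

section \<open>Singular values\<close>

text \<open>A left inverse of a square matrix is also a right inverse, so orthonormal columns
  suffice.\<close>

lemma unitary_matI:
  assumes U: "U \<in> carrier_mat d d"
    and o: "\<And>i j. i < d \<Longrightarrow> j < d \<Longrightarrow> (\<Sum>k<d. cnj (U $$ (k, i)) * U $$ (k, j)) = (if i = j then 1 else 0)"
  shows "unitary_mat d U"
proof -
  have A: "mat_adjoint U \<in> carrier_mat d d" using U by simp
  have 1: "mat_adjoint U * U = 1\<^sub>m d"
  proof (rule eq_matI)
    fix i j assume "i < dim_row (1\<^sub>m d)" "j < dim_col (1\<^sub>m d)"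
    then have ij: "i < d" "j < d" by auto
    have "(mat_adjoint U * U) $$ (i, j) = (\<Sum>k<d. cnj (U $$ (k, i)) * U $$ (k, j))"
      unfolding mat_mult_index[OF A U ij] using U ij by (intro sum.cong) auto
    then show "(mat_adjoint U * U) $$ (i, j) = 1\<^sub>m d $$ (i, j)" using o[OF ij] ij by simp
  qed (use U in auto)
  then have "U * mat_adjoint U = 1\<^sub>m d" by (rule mat_mult_left_right_inverse[OF A U])
  then show ?thesis using 1 U by (simp add: unitary_mat_def)
qed

lemma mat_adjoint_mult:
  fixes A B :: "complex mat"
  assumes "A \<in> carrier_mat n m" "B \<in> carrier_mat m k"
  shows "mat_adjoint (A * B) = mat_adjoint B * mat_adjoint A"
proof (rule eq_matI)
  fix i j assume "i < dim_row (mat_adjoint B * mat_adjoint A)" "j < dim_col (mat_adjoint B * mat_adjoint A)"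
  then have ij: "i < k" "j < n" using assms by auto
  have "mat_adjoint (A * B) $$ (i, j) = cnj ((A * B) $$ (j, i))" using assms ij by simp
  also have "\<dots> = (\<Sum>l<m. cnj (A $$ (j, l)) * cnj (B $$ (l, i)))"
    unfolding mat_mult_index[OF assms ij(2,1)] by simp
  also have "\<dots> = (\<Sum>l<m. mat_adjoint B $$ (i, l) * mat_adjoint A $$ (l, j))"
    using assms ij by (intro sum.cong) auto
  also have "\<dots> = (mat_adjoint B * mat_adjoint A) $$ (i, j)"
    using assms ij by (intro mat_mult_index[symmetric]) auto
  finally show "mat_adjoint (A * B) $$ (i, j) = (mat_adjoint B * mat_adjoint A) $$ (i, j)" .
qed (use assms in auto)

lemma mat_adjoint_adjoint [simp]: "mat_adjoint (mat_adjoint A) = (A :: complex mat)"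
  by (rule eq_matI) auto

lemma unitary_mat_carrier: "unitary_mat d U \<Longrightarrow> U \<in> carrier_mat d d"
  by (simp add: unitary_mat_def)

lemma unitary_mat_mult:
  assumes "unitary_mat d U" "unitary_mat d V"
  shows "unitary_mat d (U * V)"
proof -
  note c = unitary_mat_carrier[OF assms(1)] unitary_mat_carrier[OF assms(2)]
  have a: "mat_adjoint (U * V) = mat_adjoint V * mat_adjoint U" by (rule mat_adjoint_mult[OF c])
  have ca: "mat_adjoint U \<in> carrier_mat d d" "mat_adjoint V \<in> carrier_mat d d" using c by auto
  have "mat_adjoint V * mat_adjoint U * (U * V) = mat_adjoint V * (mat_adjoint U * U * V)"
    using c ca by (simp add: assoc_mult_mat[of _ d d _ d _ d] mult_carrier_mat[of _ d d _ d])
  also have "\<dots> = 1\<^sub>m d" using assms c by (simp add: unitary_mat_def)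
  finally have 1: "mat_adjoint (U * V) * (U * V) = 1\<^sub>m d" unfolding a .
  have UV: "U * V \<in> carrier_mat d d" by (rule mult_carrier_mat[OF c])
  have "U * V * mat_adjoint (U * V) = 1\<^sub>m d"
    by (rule mat_mult_left_right_inverse[OF mat_adjoint_carrier[OF UV] UV 1])
  then show ?thesis using 1 UV by (simp add: unitary_mat_def)
qed

text \<open>Completes \<open>v\<close> to a basis and applies Gram-Schmidt, which keeps the first
  vector; normalising the columns then leaves a multiple of \<open>v\<close> in front.\<close>

lemma unitary_completion:
  fixes v :: "complex Matrix.vec"
  assumes v: "v \<in> carrier_vec n" "v \<noteq> 0\<^sub>v n" "n > 0"
  obtains U c where "unitary_mat n U" "\<And>i. i < n \<Longrightarrow> U $$ (i, 0) = c * v $ i"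
proof -
  interpret cof_vec_space n "TYPE(complex)" .
  define b where "b = basis_completion v"
  define ws where "ws = gram_schmidt n b"
  from basis_completion[OF v(1,2), folded b_def]
  have dist_b: "distinct b" and indep: "\<not> lin_dep (set b)" and b: "set b \<subseteq> carrier_vec n"
    and hdb: "hd b = v" and len_b: "length b = n" by auto
  from hdb len_b v(3) obtain vs where bv: "b = v # vs" by (cases b) auto
  from gram_schmidt_result[OF b dist_b indep refl, folded ws_def]
  have ws: "set ws \<subseteq> carrier_vec n" "corthogonal ws" "length ws = n" by (auto simp: len_b)
  from gram_schmidt_hd[OF v(1), of vs, folded bv] have hdws: "hd ws = v" unfolding ws_def .
  then have ws0: "ws ! 0 = v" using ws(3) v(3) by (cases ws) auto
  have wc: "ws ! i \<in> carrier_vec n" if "i < n" for i using ws that by auto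
  define s where "s i = (\<Sum>k<n. (cmod (ws ! i $ k))\<^sup>2)" for i
  have dot: "ws ! j \<bullet>c ws ! i = (\<Sum>k<n. cnj (ws ! i $ k) * ws ! j $ k)" if "i < n" "j < n" for i j
    using wc[OF that(1)] wc[OF that(2)]
    by (auto simp: scalar_prod_def conjugate_complex_def mult.commute atLeast0LessThan intro!: sum.cong)
  have self: "(\<Sum>k<n. cnj (ws ! i $ k) * ws ! i $ k) = complex_of_real (s i)" for i
    unfolding s_def of_real_sum by (intro sum.cong) (auto simp: complex_norm_square mult.commute simp del: of_real_power)
  have sp: "s i > 0" if "i < n" for i
  proof -
    have "ws ! i \<bullet>c ws ! i \<noteq> 0" using corthogonalD[OF ws(2), of i i] that ws(3) by simp
    then have "s i \<noteq> 0" unfolding dot[OF that that] self by auto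
    moreover have "s i \<ge> 0" unfolding s_def by (intro sum_nonneg) auto
    ultimately show ?thesis by simp
  qed
  define U where "U = Matrix.mat n n (\<lambda>(i, j). complex_of_real (1 / sqrt (s j)) * ws ! j $ i)"
  have "unitary_mat n U"
  proof (rule unitary_matI)
    show "U \<in> carrier_mat n n" by (simp add: U_def)
    fix i j assume ij: "i < n" "j < n"
    have "(\<Sum>k<n. cnj (U $$ (k, i)) * U $$ (k, j))
       = (\<Sum>k<n. complex_of_real (1 / sqrt (s i)) * complex_of_real (1 / sqrt (s j)) * (cnj (ws ! i $ k) * ws ! j $ k))"
      using ij by (intro sum.cong) (auto simp: U_def)
    also have "\<dots> = complex_of_real (1 / sqrt (s i)) * complex_of_real (1 / sqrt (s j)) * (\<Sum>k<n. cnj (ws ! i $ k) * ws ! j $ k)"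
      by (rule sum_distrib_left[symmetric])
    also have "\<dots> = (if i = j then 1 else 0)"
    proof (cases "i = j")
      case True
      have "1 / sqrt (s j) * (1 / sqrt (s j)) * s j = 1" using sp[OF ij(2)] by simp
      then show ?thesis unfolding True self of_real_mult[symmetric] by simp
    next
      case False
      then have "ws ! j \<bullet>c ws ! i = 0" using corthogonalD[OF ws(2), of j i] ij ws(3) by simp
      then show ?thesis using False unfolding dot[OF ij] by simp
    qed
    finally show "(\<Sum>k<n. cnj (U $$ (k, i)) * U $$ (k, j)) = (if i = j then 1 else 0)" .
  qed
  moreover have "U $$ (i, 0) = complex_of_real (1 / sqrt (s 0)) * v $ i" if "i < n" for i
    using that v(3) by (simp add: U_def ws0)
  ultimately show thesis by (rule that)
qed

section \<open>Spectral theorem and functional calculus for Hermitian matrices\<close>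

lemma mat_diag_mult_index:
  assumes "U \<in> carrier_mat d d" "i < d" "j < d"
  shows "(U * mat_diag d f * mat_adjoint U) $$ (i, j) = (\<Sum>k<d. U $$ (i, k) * f k * cnj (U $$ (j, k)))"
proof -
  have D: "mat_diag d f \<in> carrier_mat d d" by simp
  have "(U * mat_diag d f * mat_adjoint U) $$ (i, j) = (\<Sum>k<d. (U * mat_diag d f) $$ (i, k) * mat_adjoint U $$ (k, j))"
    using assms by (intro mat_mult_index[of _ d d _ d]) auto
  also have "\<dots> = (\<Sum>k<d. U $$ (i, k) * f k * cnj (U $$ (j, k)))"
  proof (rule sum.cong[OF refl])
    fix k assume "k \<in> {..<d}"
    then have k: "k < d" by simp
    have "(U * mat_diag d f) $$ (i, k) = U $$ (i, k) * f k"
      using assms k by (simp add: mat_diag_mult_right[of _ d])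
    then show "(U * mat_diag d f) $$ (i, k) * mat_adjoint U $$ (k, j) = U $$ (i, k) * f k * cnj (U $$ (j, k))"
      using assms k by simp
  qed
  finally show ?thesis .
qed

lemma unitary_conj_cancel:
  assumes U: "unitary_mat d U" and A: "A \<in> carrier_mat d d"
  shows "U * (mat_adjoint U * A * U) * mat_adjoint U = A"
proof -
  have c: "U \<in> carrier_mat d d" "mat_adjoint U \<in> carrier_mat d d" and u: "U * mat_adjoint U = 1\<^sub>m d"
    using U by (auto simp: unitary_mat_def)
  have "U * (mat_adjoint U * A * U) * mat_adjoint U = (U * mat_adjoint U) * A * (U * mat_adjoint U)"
    using c A by (simp add: assoc_mult_mat[of _ d d _ d _ d] mult_carrier_mat[of _ d d _ d])
  then show ?thesis using u A by simp
qed

text \<open>Deflation: when the first column of \<open>U\<close> is an eigenvector, the first column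
  of \<open>mat_adjoint U * A * U\<close> is a multiple of the first unit vector, and symmetry
  clears the first row as well. What remains is a Hermitian block of size \<open>n\<close>.\<close>

lemma hermitian_diagonalisable:
  assumes "A \<in> carrier_mat n n" "mat_adjoint A = A"
  shows "\<exists>U l. unitary_mat n U \<and> A = U * mat_diag n (\<lambda>i. complex_of_real (l i)) * mat_adjoint U"
  using assms
proof (induction n arbitrary: A)
  case 0
  have "unitary_mat 0 (1\<^sub>m 0)" by (rule unitary_matI) auto
  then show ?case using 0 by (intro exI[of _ "1\<^sub>m 0"]) (auto intro!: eq_matI)
next
  case (Suc n)
  note A = Suc.prems
  have sym: "A $$ (i, j) = cnj (A $$ (j, i))" if "i < Suc n" "j < Suc n" for i j
    using arg_cong[OF A(2), of "\<lambda>B. B $$ (i, j)"] A(1) that by simp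
  obtain e where "e \<in> spectrum A" using spectrum_non_empty[OF A(1)] by auto
  then have "eigenvalue A e" by (simp add: spectrum_def)
  then obtain v where v: "v \<in> carrier_vec (Suc n)" "v \<noteq> 0\<^sub>v (Suc n)" "A *\<^sub>v v = e \<cdot>\<^sub>v v"
    unfolding eigenvalue_def eigenvector_def using A(1) by auto
  obtain U c where U: "unitary_mat (Suc n) U" "\<And>i. i < Suc n \<Longrightarrow> U $$ (i, 0) = c * v $ i"
    using unitary_completion[OF v(1,2)] by auto
  have Uc: "U \<in> carrier_mat (Suc n) (Suc n)" by (rule unitary_mat_carrier[OF U(1)])
  define B where "B = mat_adjoint U * A * U"
  have Bc: "B \<in> carrier_mat (Suc n) (Suc n)" unfolding B_def by (rule mult_carrier_mat[OF mult_carrier_mat[OF mat_adjoint_carrier[OF Uc] A(1)] Uc])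
  have Badj: "mat_adjoint B = B"
  proof -
    have c1: "mat_adjoint U * A \<in> carrier_mat (Suc n) (Suc n)" by (rule mult_carrier_mat[OF mat_adjoint_carrier[OF Uc] A(1)])
    have "mat_adjoint B = mat_adjoint U * (mat_adjoint A * U)"
      unfolding B_def mat_adjoint_mult[OF c1 Uc] mat_adjoint_mult[OF mat_adjoint_carrier[OF Uc] A(1)] by simp
    also have "\<dots> = B" unfolding B_def A(2)
      by (rule assoc_mult_mat[OF mat_adjoint_carrier[OF Uc] A(1) Uc, symmetric])
    finally show ?thesis .
  qed
  have AU0: "(A * U) $$ (i, 0) = e * U $$ (i, 0)" if i: "i < Suc n" for i
  proof -
    have "(A * U) $$ (i, 0) = (\<Sum>l<Suc n. A $$ (i, l) * (c * v $ l))"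
      unfolding mat_mult_index[OF A(1) Uc i zero_less_Suc] using U(2) by (intro sum.cong) auto
    also have "\<dots> = c * (A *\<^sub>v v) $ i"
      unfolding mat_vec_mult_index[OF A(1) v(1) i] sum_distrib_left by (intro sum.cong) auto
    also have "\<dots> = e * U $$ (i, 0)" unfolding v(3) using v(1) i U(2)[OF i] by simp
    finally show ?thesis .
  qed
  have B0: "B $$ (i, 0) = (if i = 0 then e else 0)" if i: "i < Suc n" for i
  proof -
    have "B = mat_adjoint U * (A * U)" unfolding B_def
      by (rule assoc_mult_mat[OF mat_adjoint_carrier[OF Uc] A(1) Uc])
    then have "B $$ (i, 0) = (\<Sum>k<Suc n. mat_adjoint U $$ (i, k) * (A * U) $$ (k, 0))"
      using mat_mult_index[OF mat_adjoint_carrier[OF Uc] mult_carrier_mat[OF A(1) Uc] i zero_less_Suc] by simp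
    also have "\<dots> = e * (\<Sum>k<Suc n. cnj (U $$ (k, i)) * U $$ (k, 0))"
      unfolding sum_distrib_left using i Uc AU0 by (intro sum.cong) auto
    also have "\<dots> = (if i = 0 then e else 0)"
      using unitary_mat_cols[OF U(1) i zero_less_Suc] by simp
    finally show ?thesis .
  qed
  have Bsym: "B $$ (i, j) = cnj (B $$ (j, i))" if "i < Suc n" "j < Suc n" for i j
    using arg_cong[OF Badj, of "\<lambda>B. B $$ (i, j)"] Bc that by simp
  have ereal: "e = complex_of_real (Re e)"
    using Bsym[of 0 0] B0[of 0] by (simp add: complex_eq_iff)
  define B' where "B' = Matrix.mat n n (\<lambda>(i, j). B $$ (Suc i, Suc j))"
  have "mat_adjoint B' = B'"
  proof (rule eq_matI)
    fix i j assume "i < dim_row B'" "j < dim_col B'"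
    then show "mat_adjoint B' $$ (i, j) = B' $$ (i, j)"
      using Bsym[of "Suc i" "Suc j"] by (simp add: B'_def)
  qed (auto simp: B'_def)
  then obtain V l where V: "unitary_mat n V" "B' = V * mat_diag n (\<lambda>i. complex_of_real (l i)) * mat_adjoint V"
    using Suc.IH[of B'] by (auto simp: B'_def)
  have Vc: "V \<in> carrier_mat n n" by (rule unitary_mat_carrier[OF V(1)])
  define E where "E = Matrix.mat (Suc n) (Suc n) (\<lambda>(i, j). case (i, j) of (0, 0) \<Rightarrow> 1 | (Suc i, Suc j) \<Rightarrow> V $$ (i, j) | _ \<Rightarrow> 0)"
  have Ei: "E $$ (0, 0) = 1" "\<And>j. j < n \<Longrightarrow> E $$ (0, Suc j) = 0" "\<And>i. i < n \<Longrightarrow> E $$ (Suc i, 0) = 0"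
    "\<And>i j. i < n \<Longrightarrow> j < n \<Longrightarrow> E $$ (Suc i, Suc j) = V $$ (i, j)" by (auto simp: E_def)
  have Ec: "E \<in> carrier_mat (Suc n) (Suc n)" by (simp add: E_def)
  have Eu: "unitary_mat (Suc n) E"
  proof (rule unitary_matI[OF Ec])
    fix i j assume ij: "i < Suc n" "j < Suc n"
    show "(\<Sum>k<Suc n. cnj (E $$ (k, i)) * E $$ (k, j)) = (if i = j then 1 else 0)"
      using ij unitary_mat_cols[OF V(1)]
      by (cases i; cases j) (simp_all add: sum.lessThan_Suc_shift Ei del: sum.lessThan_Suc)
  qed
  define m where "m i = (case i of 0 \<Rightarrow> Re e | Suc i \<Rightarrow> l i)" for i
  have "B = E * mat_diag (Suc n) (\<lambda>i. complex_of_real (m i)) * mat_adjoint E"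
  proof (rule eq_matI)
    fix i j
    assume "i < dim_row (E * mat_diag (Suc n) (\<lambda>i. complex_of_real (m i)) * mat_adjoint E)"
      "j < dim_col (E * mat_diag (Suc n) (\<lambda>i. complex_of_real (m i)) * mat_adjoint E)"
    then have ij: "i < Suc n" "j < Suc n" using Ec by auto
    have BV: "B $$ (Suc i, Suc j) = (\<Sum>k<n. V $$ (i, k) * complex_of_real (l k) * cnj (V $$ (j, k)))" if "i < n" "j < n" for i j
      using mat_diag_mult_index[OF Vc that, of "\<lambda>i. complex_of_real (l i)"] that unfolding V(2)[symmetric] by (simp add: B'_def)
    have B0': "B $$ (0, j) = (if j = 0 then e else 0)" if "j < Suc n" for j
      using Bsym[of 0 j] B0[OF that] that ereal by (cases "j = 0") (auto simp: complex_eq_iff)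
    show "B $$ (i, j) = (E * mat_diag (Suc n) (\<lambda>i. complex_of_real (m i)) * mat_adjoint E) $$ (i, j)"
      unfolding mat_diag_mult_index[OF Ec ij] using ij B0 B0' ereal
      by (cases i; cases j) (simp_all add: sum.lessThan_Suc_shift Ei m_def BV del: sum.lessThan_Suc)
  qed (use Bc Ec in auto)
  then have "A = U * (E * mat_diag (Suc n) (\<lambda>i. complex_of_real (m i)) * mat_adjoint E) * mat_adjoint U"
    using unitary_conj_cancel[OF U(1) A(1)] by (simp add: B_def)
  also have "\<dots> = (U * E) * mat_diag (Suc n) (\<lambda>i. complex_of_real (m i)) * mat_adjoint (U * E)"
  proof -
    have D: "mat_diag (Suc n) (\<lambda>i. complex_of_real (m i)) \<in> carrier_mat (Suc n) (Suc n)" by simp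
    show ?thesis
      unfolding mat_adjoint_mult[OF Uc Ec] using Uc Ec D
      by (simp add: assoc_mult_mat[of _ "Suc n" "Suc n" _ "Suc n" _ "Suc n"] mult_carrier_mat[of _ "Suc n" "Suc n" _ "Suc n"])
  qed
  finally show ?case using unitary_mat_mult[OF U(1) Eu] by blast
qed

text \<open>Makes the description in \<open>psd_powr\<close> single-valued. \<open>W\<close>
  intertwines the two diagonal matrices, so its entries can be nonzero only where the eigenvalues
  agree, and there their powers agree as well.\<close>

lemma spectral_powr_unique:
  assumes U: "unitary_mat d U" and V: "unitary_mat d V"
    and l: "\<And>i. i < d \<Longrightarrow> l i \<ge> 0" and m: "\<And>i. i < d \<Longrightarrow> m i \<ge> 0"
    and eq: "U * mat_diag d (\<lambda>i. complex_of_real (l i)) * mat_adjoint U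
       = V * mat_diag d (\<lambda>i. complex_of_real (m i)) * mat_adjoint V"
  shows "U * mat_diag d (\<lambda>i. complex_of_real (l i powr q)) * mat_adjoint U
       = V * mat_diag d (\<lambda>i. complex_of_real (m i powr q)) * mat_adjoint V"
proof -
  note Uc = unitary_mat_carrier[OF U] and Vc = unitary_mat_carrier[OF V]
  note Ua = mat_adjoint_carrier[OF Uc] and Va = mat_adjoint_carrier[OF Vc]
  have inv: "mat_adjoint U * U = 1\<^sub>m d" "U * mat_adjoint U = 1\<^sub>m d" "mat_adjoint V * V = 1\<^sub>m d" "V * mat_adjoint V = 1\<^sub>m d"
    using U V by (auto simp: unitary_mat_def)
  define W where "W = mat_adjoint V * U"
  have Wc: "W \<in> carrier_mat d d" unfolding W_def by (rule mult_carrier_mat[OF Va Uc])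
  have D: "mat_diag d f \<in> carrier_mat d d" for f :: "nat \<Rightarrow> complex" by simp
  note assoc = assoc_mult_mat[of _ d d _ d _ d]
  have move: "mat_adjoint V * (U * X * mat_adjoint U) * U = W * X"
    "mat_adjoint V * (V * X * mat_adjoint V) * U = X * W" if X: "X \<in> carrier_mat d d" for X
  proof -
    have "mat_adjoint V * (U * X * mat_adjoint U) * U = W * X * (mat_adjoint U * U)"
      unfolding W_def using X Uc Vc Ua Va by (simp add: assoc mult_carrier_mat[of _ d d _ d])
    then show "mat_adjoint V * (U * X * mat_adjoint U) * U = W * X" using inv Wc X by simp
    have "mat_adjoint V * (V * X * mat_adjoint V) * U = (mat_adjoint V * V) * X * W"
      unfolding W_def using X Uc Vc Ua Va by (simp add: assoc mult_carrier_mat[of _ d d _ d])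
    then show "mat_adjoint V * (V * X * mat_adjoint V) * U = X * W" using inv Wc X by simp
  qed
  have "W * mat_diag d (\<lambda>i. complex_of_real (l i)) = mat_diag d (\<lambda>i. complex_of_real (m i)) * W"
    unfolding move(1)[OF D, symmetric] move(2)[OF D, symmetric] eq ..
  then have e: "W $$ (i, j) * complex_of_real (l j) = complex_of_real (m i) * W $$ (i, j)" if "i < d" "j < d" for i j
    using arg_cong[of _ _ "\<lambda>X. X $$ (i, j)"] that Wc
    by (metis (no_types, lifting) mat_diag_mult_right[OF Wc] mat_diag_mult_left[OF Wc] index_mat(1) case_prod_conv)
  have "W * mat_diag d (\<lambda>i. complex_of_real (l i powr q)) = mat_diag d (\<lambda>i. complex_of_real (m i powr q)) * W"
  proof (rule eq_matI)
    fix i j assume "i < dim_row (mat_diag d (\<lambda>i. complex_of_real (m i powr q)) * W)" "j < dim_col (mat_diag d (\<lambda>i. complex_of_real (m i powr q)) * W)"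
    then have ij: "i < d" "j < d" using Wc by (auto simp: mat_diag_def)
    have "W $$ (i, j) * complex_of_real (l j powr q) = complex_of_real (m i powr q) * W $$ (i, j)"
    proof (cases "W $$ (i, j) = 0")
      case False
      then have "complex_of_real (l j) = complex_of_real (m i)" using e[OF ij] by simp
      then show ?thesis by simp
    qed simp
    then show "(W * mat_diag d (\<lambda>i. complex_of_real (l i powr q))) $$ (i, j) = (mat_diag d (\<lambda>i. complex_of_real (m i powr q)) * W) $$ (i, j)"
      using ij Wc by (simp add: mat_diag_mult_right[OF Wc] mat_diag_mult_left[OF Wc])
  qed (use Wc in \<open>auto simp: mat_diag_def\<close>)
  then have "mat_adjoint V * (U * mat_diag d (\<lambda>i. complex_of_real (l i powr q)) * mat_adjoint U) * U
     = mat_adjoint V * (V * mat_diag d (\<lambda>i. complex_of_real (m i powr q)) * mat_adjoint V) * U"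
    unfolding move[OF D] .
  then have eqn: "V * (mat_adjoint V * (U * mat_diag d (\<lambda>i. complex_of_real (l i powr q)) * mat_adjoint U) * U) * mat_adjoint U
     = V * (mat_adjoint V * (V * mat_diag d (\<lambda>i. complex_of_real (m i powr q)) * mat_adjoint V) * U) * mat_adjoint U"
    by simp
  have canc: "V * (mat_adjoint V * X * U) * mat_adjoint U = X" if X: "X \<in> carrier_mat d d" for X
  proof -
    have "V * (mat_adjoint V * X * U) * mat_adjoint U = (V * mat_adjoint V) * X * (U * mat_adjoint U)"
      using X Uc Vc Ua Va by (simp add: assoc mult_carrier_mat[of _ d d _ d])
    then show ?thesis using inv X by simp
  qed
  show ?thesis
    using eqn unfolding canc[OF mult_carrier_mat[OF mult_carrier_mat[OF Uc D] Ua]]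
      canc[OF mult_carrier_mat[OF mult_carrier_mat[OF Vc D] Va]] .
qed

lemma psd_powr_eq:
  assumes U: "unitary_mat d U" and l: "\<And>i. i < d \<Longrightarrow> l i \<ge> 0"
  shows "psd_powr (U * mat_diag d (\<lambda>i. complex_of_real (l i)) * mat_adjoint U) q
    = U * mat_diag d (\<lambda>i. complex_of_real (l i powr q)) * mat_adjoint U"
proof -
  let ?N = "U * mat_diag d (\<lambda>i. complex_of_real (l i)) * mat_adjoint U"
  have d: "dim_row ?N = d" using unitary_mat_carrier[OF U] by simp
  show ?thesis
    unfolding psd_powr_def d
  proof (rule the_equality)
    show "\<exists>U' l'. unitary_mat d U' \<and> (\<forall>i<d. 0 \<le> l' i) \<and>
        ?N = U' * mat_diag d (\<lambda>i. complex_of_real (l' i)) * mat_adjoint U' \<and>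
        U * mat_diag d (\<lambda>i. complex_of_real (l i powr q)) * mat_adjoint U
          = U' * mat_diag d (\<lambda>i. complex_of_real (l' i powr q)) * mat_adjoint U'"
      using U l by blast
    fix B
    assume "\<exists>U' l'. unitary_mat d U' \<and> (\<forall>i<d. 0 \<le> l' i) \<and>
        ?N = U' * mat_diag d (\<lambda>i. complex_of_real (l' i)) * mat_adjoint U' \<and>
        B = U' * mat_diag d (\<lambda>i. complex_of_real (l' i powr q)) * mat_adjoint U'"
    then obtain U' l' where U': "unitary_mat d U'" "\<And>i. i < d \<Longrightarrow> 0 \<le> l' i"
        "?N = U' * mat_diag d (\<lambda>i. complex_of_real (l' i)) * mat_adjoint U'"
        "B = U' * mat_diag d (\<lambda>i. complex_of_real (l' i powr q)) * mat_adjoint U'" by blast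
    show "B = U * mat_diag d (\<lambda>i. complex_of_real (l i powr q)) * mat_adjoint U"
      unfolding U'(4) using spectral_powr_unique[OF U U'(1) l U'(2,3)] by simp
  qed
qed

section \<open>Singular values and Schatten norms\<close>

lemma trace_spectral:
  assumes U: "unitary_mat d U"
  shows "sum_list (diag_mat (U * mat_diag d f * mat_adjoint U)) = (\<Sum>k<d. f k)"
proof -
  have Uc: "U \<in> carrier_mat d d" by (rule unitary_mat_carrier[OF U])
  have "sum_list (diag_mat (U * mat_diag d f * mat_adjoint U)) = (\<Sum>i<d. (U * mat_diag d f * mat_adjoint U) $$ (i, i))"
    using Uc by (simp add: diag_mat_def interv_sum_list_conv_sum_set_nat atLeast0LessThan)
  also have "\<dots> = (\<Sum>i<d. \<Sum>k<d. U $$ (i, k) * f k * cnj (U $$ (i, k)))"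
    using mat_diag_mult_index[OF Uc] by (intro sum.cong) auto
  also have "\<dots> = (\<Sum>k<d. f k * (\<Sum>i<d. cnj (U $$ (i, k)) * U $$ (i, k)))"
    by (subst sum.swap) (simp add: sum_distrib_left mult_ac)
  also have "\<dots> = (\<Sum>k<d. f k)" using unitary_mat_cols[OF U] by (intro sum.cong) auto
  finally show ?thesis .
qed

text \<open>\<open>U\<close> diagonalises \<open>mat_adjoint M * M\<close>, so the squared column
  norms of \<open>M * U\<close> are its eigenvalues. Their roots are the eigenvalues of
  \<open>mat_abs M\<close>, whose powers sum to the trace in the Schatten norm.\<close>

lemma singular_values:
  assumes M: "M \<in> carrier_mat d d"
  obtains U s where "unitary_mat d U" "\<And>j. s j \<ge> 0"
    "\<And>j. j < d \<Longrightarrow> (\<Sum>k<d. (cmod ((M * U) $$ (k, j)))\<^sup>2) = (s j)\<^sup>2"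
    "\<And>q. q > 0 \<Longrightarrow> schatten_norm q M powr q = (\<Sum>j<d. s j powr q)"
proof -
  define N where "N = mat_adjoint M * M"
  have Ma: "mat_adjoint M \<in> carrier_mat d d" using M by simp
  have Nc: "N \<in> carrier_mat d d" unfolding N_def by (rule mult_carrier_mat[OF Ma M])
  have "mat_adjoint N = N" unfolding N_def mat_adjoint_mult[OF Ma M] by simp
  then obtain U l where U: "unitary_mat d U" and N: "N = U * mat_diag d (\<lambda>i. complex_of_real (l i)) * mat_adjoint U"
    using hermitian_diagonalisable[OF Nc] by blast
  have Uc: "U \<in> carrier_mat d d" by (rule unitary_mat_carrier[OF U])
  have Ua: "mat_adjoint U \<in> carrier_mat d d" using Uc by simp
  have inv: "mat_adjoint U * U = 1\<^sub>m d" using U by (simp add: unitary_mat_def)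
  have D: "mat_diag d (\<lambda>i. complex_of_real (l i)) \<in> carrier_mat d d" by simp
  have MU: "M * U \<in> carrier_mat d d" by (rule mult_carrier_mat[OF M Uc])
  have "mat_adjoint (M * U) * (M * U) = mat_adjoint U * N * U"
    unfolding mat_adjoint_mult[OF M Uc] N_def using M Ma Uc Ua by (simp add: assoc_mult_mat[of _ d d _ d _ d] mult_carrier_mat[of _ d d _ d])
  also have "\<dots> = (mat_adjoint U * U) * mat_diag d (\<lambda>i. complex_of_real (l i)) * (mat_adjoint U * U)"
    unfolding N using Uc Ua D by (simp add: assoc_mult_mat[of _ d d _ d _ d] mult_carrier_mat[of _ d d _ d])
  also have "\<dots> = mat_diag d (\<lambda>i. complex_of_real (l i))"
    unfolding inv left_mult_one_mat[OF D] right_mult_one_mat[OF D] ..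
  finally have eq: "mat_adjoint (M * U) * (M * U) = mat_diag d (\<lambda>i. complex_of_real (l i))" .
  have col: "(\<Sum>k<d. (cmod ((M * U) $$ (k, j)))\<^sup>2) = l j" if j: "j < d" for j
  proof -
    have "complex_of_real (\<Sum>k<d. (cmod ((M * U) $$ (k, j)))\<^sup>2) = (\<Sum>k<d. mat_adjoint (M * U) $$ (j, k) * (M * U) $$ (k, j))"
      unfolding of_real_sum using M Uc j by (intro sum.cong) (auto simp: complex_norm_square mult.commute simp del: of_real_power)
    also have "\<dots> = (mat_adjoint (M * U) * (M * U)) $$ (j, j)"
      by (rule mat_mult_index[OF mat_adjoint_carrier[OF MU] MU j j, symmetric])
    also have "\<dots> = complex_of_real (l j)" unfolding eq using j by (simp add: mat_diag_def)
    finally show ?thesis by (simp only: of_real_eq_iff)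
  qed
  have l: "l j \<ge> 0" if "j < d" for j unfolding col[OF that, symmetric] by (intro sum_nonneg) auto
  \<comment> \<open>Zero beyond the dimension, so that nonnegativity holds for every index.\<close>
  define s where "s j = (if j < d then sqrt (l j) else 0)" for j
  have s: "s j \<ge> 0" for j using l by (simp add: s_def)
  have s2: "l j powr (1/2) = s j" if "j < d" for j using l[OF that] that by (simp add: s_def powr_half_sqrt)
  have abs: "mat_abs M = U * mat_diag d (\<lambda>i. complex_of_real (s i)) * mat_adjoint U"
  proof -
    have "mat_abs M = U * mat_diag d (\<lambda>i. complex_of_real (l i powr (1/2))) * mat_adjoint U"
      unfolding mat_abs_def N_def[symmetric] N by (rule psd_powr_eq[OF U l])
    also have "mat_diag d (\<lambda>i. complex_of_real (l i powr (1/2))) = mat_diag d (\<lambda>i. complex_of_real (s i))"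
      by (rule eq_matI) (auto simp: mat_diag_def s2)
    finally show ?thesis .
  qed
  have sch: "schatten_norm q M powr q = (\<Sum>j<d. s j powr q)" if q: "q > 0" for q
  proof -
    have "Re (sum_list (diag_mat (psd_powr (mat_abs M) q))) = (\<Sum>j<d. s j powr q)"
      unfolding abs psd_powr_eq[OF U s] trace_spectral[OF U] by simp
    then show ?thesis unfolding schatten_norm_def using q by (simp add: powr_powr sum_nonneg)
  qed
  show thesis
  proof (rule that[OF U s _ sch])
    show "(\<Sum>k<d. (cmod ((M * U) $$ (k, j)))\<^sup>2) = (s j)\<^sup>2" if "j < d" for j
      using col[OF that] l[OF that] that by (simp add: s_def)
  qed
qed

lemma op_infty_norm_transpose:
  assumes M: "M \<in> carrier_mat d d" and j: "j < d"
  shows "(\<Sum>k<d. cmod (M $$ (k, j))) \<le> op_infty_norm (transpose_mat M)"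
proof -
  have "(\<Sum>k<d. cmod (transpose_mat M $$ (j, k))) \<le> op_infty_norm (transpose_mat M)"
    unfolding op_infty_norm_def using M j by (intro Max_ge) auto
  moreover have "(\<Sum>k<d. cmod (transpose_mat M $$ (j, k))) = (\<Sum>k<d. cmod (M $$ (k, j)))"
    using M j by (intro sum.cong) auto
  ultimately show ?thesis by simp
qed

text \<open>A column of \<open>U\<close> is a unit vector, so its image under \<open>M\<close> is no
  longer than the Frobenius norm of \<open>M\<close>; and each of the \<open>d\<close> columns of
  \<open>M\<close> has Euclidean norm at most its absolute column sum.\<close>

lemma singular_value_le:
  assumes M: "M \<in> carrier_mat d d" and U: "unitary_mat d U" and j: "j < d"
  shows "(\<Sum>k<d. (cmod ((M * U) $$ (k, j)))\<^sup>2) \<le> real d * (op_infty_norm (transpose_mat M))\<^sup>2"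
proof -
  let ?K = "op_infty_norm (transpose_mat M)"
  have Uc: "U \<in> carrier_mat d d" by (rule unitary_mat_carrier[OF U])
  have u1: "(\<Sum>l<d. (cmod (U $$ (l, j)))\<^sup>2) = 1"
  proof -
    have "complex_of_real (\<Sum>l<d. (cmod (U $$ (l, j)))\<^sup>2) = (\<Sum>l<d. cnj (U $$ (l, j)) * U $$ (l, j))"
      unfolding of_real_sum by (intro sum.cong) (auto simp: complex_norm_square mult.commute simp del: of_real_power)
    also have "\<dots> = 1" using unitary_mat_cols[OF U j j] by simp
    finally show ?thesis by (simp only: of_real_eq_1_iff)
  qed
  have "(cmod ((M * U) $$ (k, j)))\<^sup>2 \<le> (\<Sum>l<d. (cmod (M $$ (k, l)))\<^sup>2)" if k: "k < d" for k
  proof -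
    have "cmod ((M * U) $$ (k, j)) \<le> (\<Sum>l<d. cmod (M $$ (k, l)) * cmod (U $$ (l, j)))"
      unfolding mat_mult_index[OF M Uc k j] by (rule order_trans[OF norm_sum]) (simp add: norm_mult)
    then have "(cmod ((M * U) $$ (k, j)))\<^sup>2 \<le> (\<Sum>l<d. cmod (M $$ (k, l)) * cmod (U $$ (l, j)))\<^sup>2"
      by (intro power_mono) auto
    also have "\<dots> \<le> (\<Sum>l<d. (cmod (M $$ (k, l)))\<^sup>2) * (\<Sum>l<d. (cmod (U $$ (l, j)))\<^sup>2)"
      by (rule Cauchy_Schwarz_ineq_sum)
    finally show ?thesis unfolding u1 by simp
  qed
  then have "(\<Sum>k<d. (cmod ((M * U) $$ (k, j)))\<^sup>2) \<le> (\<Sum>k<d. \<Sum>l<d. (cmod (M $$ (k, l)))\<^sup>2)"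
    by (intro sum_mono) auto
  also have "\<dots> = (\<Sum>l<d. \<Sum>k<d. (cmod (M $$ (k, l)))\<^sup>2)" by (rule sum.swap)
  also have "\<dots> \<le> (\<Sum>l<d. ?K\<^sup>2)"
  proof (rule sum_mono)
    fix l assume "l \<in> {..<d}"
    then have l: "l < d" by simp
    have "(\<Sum>k<d. (cmod (M $$ (k, l)))\<^sup>2) \<le> (\<Sum>k<d. cmod (M $$ (k, l)) * (\<Sum>k<d. cmod (M $$ (k, l))))"
      unfolding power2_eq_square by (intro sum_mono mult_left_mono member_le_sum) auto
    also have "\<dots> = (\<Sum>k<d. cmod (M $$ (k, l)))\<^sup>2" by (simp add: sum_distrib_right power2_eq_square)
    also have "\<dots> \<le> ?K\<^sup>2" by (intro power_mono op_infty_norm_transpose[OF M l] sum_nonneg) auto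
    finally show "(\<Sum>k<d. (cmod (M $$ (k, l)))\<^sup>2) \<le> ?K\<^sup>2" .
  qed
  finally show ?thesis by simp
qed

section \<open>Schur orthogonality\<close>

lemma invertible_matE:
  assumes "invertible_mat S" "S \<in> carrier_mat d d"
  obtains R where "R \<in> carrier_mat d d" "S * R = 1\<^sub>m d" "R * S = 1\<^sub>m d"
proof -
  obtain R where R: "inverts_mat S R" "inverts_mat R S"
    using assms(1) by (auto simp: invertible_mat_def)
  have 1: "S * R = 1\<^sub>m d" "R * S = 1\<^sub>m (dim_row R)" using R assms(2) by (auto simp: inverts_mat_def)
  \<comment> \<open>\<open>inverts_mat\<close> does not prescribe the size of the inverse; it is
    read off from the two products.\<close>
  have "dim_col R = d" using arg_cong[OF 1(1), of dim_col] by simp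
  moreover have "dim_row R = d" using arg_cong[OF 1(2), of dim_col] assms(2) by simp
  ultimately show thesis using that[of R] 1 by (auto intro: carrier_matI)
qed

lemma invertible_matI:
  assumes "S \<in> carrier_mat d d" "R \<in> carrier_mat d d" "S * R = 1\<^sub>m d" "R * S = 1\<^sub>m d"
  shows "invertible_mat S"
  using assms by (auto simp: invertible_mat_def inverts_mat_def square_mat.simps)

lemma equivalent_reps_refl:
  assumes "unitary_rep \<xi>" shows "equivalent_reps \<xi> \<xi>"
proof -
  let ?I = "1\<^sub>m (rep_dim \<xi>) :: complex mat"
  have "invertible_mat ?I" by (rule invertible_matI[of _ "rep_dim \<xi>" ?I]) auto
  then show ?thesis
    unfolding equivalent_reps_def
    by (intro conjI refl bexI[of _ ?I])
      (auto simp: left_mult_one_mat[OF unitary_rep_carrier[OF assms]] right_mult_one_mat[OF unitary_rep_carrier[OF assms]])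
qed

lemma equivalent_reps_sym:
  assumes "unitary_rep \<xi>" "unitary_rep \<eta>" "equivalent_reps \<xi> \<eta>"
  shows "equivalent_reps \<eta> \<xi>"
proof -
  let ?d = "rep_dim \<xi>"
  obtain S where S: "rep_dim \<xi> = rep_dim \<eta>" "S \<in> carrier_mat ?d ?d" "invertible_mat S" "\<And>x. S * \<xi> x = \<eta> x * S"
    using assms(3) by (auto simp: equivalent_reps_def)
  obtain R where R: "R \<in> carrier_mat ?d ?d" "S * R = 1\<^sub>m ?d" "R * S = 1\<^sub>m ?d"
    using invertible_matE[OF S(3,2)] .
  have c: "\<xi> x \<in> carrier_mat ?d ?d" "\<eta> x \<in> carrier_mat ?d ?d" for x
    using unitary_rep_carrier[OF assms(1)] unitary_rep_carrier[OF assms(2)] S(1) by auto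
  have "R * \<eta> x = \<xi> x * R" for x
  proof -
    have "R * \<eta> x = R * (\<eta> x * S) * R"
      using c R S(2) by (simp add: assoc_mult_mat[of _ ?d ?d _ ?d _ ?d] mult_carrier_mat[of _ ?d ?d _ ?d]
          right_mult_one_mat[OF c(2)])
    also have "\<dots> = R * (S * \<xi> x) * R" by (simp add: S(4))
    also have "\<dots> = (R * S) * \<xi> x * R"
      using c[of x] R(1) S(2) by (simp add: assoc_mult_mat[of _ ?d ?d _ ?d _ ?d] mult_carrier_mat[of _ ?d ?d _ ?d])
    also have "\<dots> = \<xi> x * R" unfolding R(3) using c[of x] by simp
    finally show ?thesis .
  qed
  moreover have "invertible_mat R" by (rule invertible_matI[OF R(1) S(2) R(3,2)])
  ultimately show ?thesis using R(1) S(1) unfolding equivalent_reps_def by auto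
qed

lemma equivalent_reps_trans:
  assumes "unitary_rep \<xi>" "unitary_rep \<eta>" "unitary_rep \<zeta>" "equivalent_reps \<xi> \<eta>" "equivalent_reps \<eta> \<zeta>"
  shows "equivalent_reps \<xi> \<zeta>"
proof -
  let ?d = "rep_dim \<xi>"
  obtain S where S: "rep_dim \<xi> = rep_dim \<eta>" "S \<in> carrier_mat ?d ?d" "invertible_mat S" "\<And>x. S * \<xi> x = \<eta> x * S"
    using assms(4) by (auto simp: equivalent_reps_def)
  obtain T where T: "rep_dim \<eta> = rep_dim \<zeta>" "T \<in> carrier_mat ?d ?d" "invertible_mat T" "\<And>x. T * \<eta> x = \<zeta> x * T"
    using assms(5) S(1) by (auto simp: equivalent_reps_def)
  obtain R where R: "R \<in> carrier_mat ?d ?d" "S * R = 1\<^sub>m ?d" "R * S = 1\<^sub>m ?d"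
    using invertible_matE[OF S(3,2)] .
  obtain Q where Q: "Q \<in> carrier_mat ?d ?d" "T * Q = 1\<^sub>m ?d" "Q * T = 1\<^sub>m ?d"
    using invertible_matE[OF T(3,2)] .
  have c: "\<xi> x \<in> carrier_mat ?d ?d" "\<eta> x \<in> carrier_mat ?d ?d" "\<zeta> x \<in> carrier_mat ?d ?d" for x
    using unitary_rep_carrier[OF assms(1)] unitary_rep_carrier[OF assms(2)] unitary_rep_carrier[OF assms(3)] S(1) T(1) by auto
  note assoc = assoc_mult_mat[of _ ?d ?d _ ?d _ ?d] and mc = mult_carrier_mat[of _ ?d ?d _ ?d]
  have "T * S * \<xi> x = \<zeta> x * (T * S)" for x
  proof -
    have "T * S * \<xi> x = T * (\<eta> x * S)" unfolding S(4)[symmetric] by (rule assoc[OF T(2) S(2) c(1)])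
    also have "\<dots> = T * \<eta> x * S" by (rule assoc[OF T(2) c(2) S(2), symmetric])
    also have "\<dots> = \<zeta> x * (T * S)" unfolding T(4) by (rule assoc[OF c(3) T(2) S(2)])
    finally show ?thesis .
  qed
  moreover have "invertible_mat (T * S)"
  proof (rule invertible_matI[OF mc[OF T(2) S(2)] mc[OF R(1) Q(1)]])
    have "T * S * (R * Q) = T * (S * R) * Q" using R(1) Q(1) S(2) T(2) by (simp add: assoc mc)
    then show "T * S * (R * Q) = 1\<^sub>m ?d" using R(2) Q(2) T(2) by simp
    have "R * Q * (T * S) = R * (Q * T) * S" using R(1) Q(1) S(2) T(2) by (simp add: assoc mc)
    then show "R * Q * (T * S) = 1\<^sub>m ?d" using R Q(3) by simp
  qed
  ultimately show ?thesis using S T mc[OF T(2) S(2)] unfolding equivalent_reps_def by auto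
qed

definition irr_equiv :: "(('g::topological_group_add \<Rightarrow> complex mat) \<times> ('g \<Rightarrow> complex mat)) set" where
  "irr_equiv = {(\<xi>, \<eta>). irreducible_unitary_rep \<xi> \<and> irreducible_unitary_rep \<eta> \<and> equivalent_reps \<xi> \<eta>}"

lemma equiv_irr_equiv: "equiv {\<xi>. irreducible_unitary_rep \<xi>} irr_equiv"
  unfolding equiv_def refl_on_def sym_def trans_def irr_equiv_def
  using equivalent_reps_refl equivalent_reps_sym equivalent_reps_trans irreducible_unitary by blast

lemma unitary_dual_eq: "unitary_dual = {\<xi>. irreducible_unitary_rep \<xi>} // irr_equiv"
  by (simp add: unitary_dual_def irr_equiv_def)

lemma unitary_dual_irreducible:
  assumes "c \<in> unitary_dual" "\<xi> \<in> c" shows "irreducible_unitary_rep \<xi>"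
  using in_quotient_imp_subset[OF equiv_irr_equiv assms(1)[unfolded unitary_dual_eq]] assms(2) by auto

lemma unitary_dual_equivalent:
  assumes "c \<in> unitary_dual" "\<xi> \<in> c" "\<eta> \<in> c" shows "equivalent_reps \<xi> \<eta>"
  using in_quotient_imp_in_rel[OF equiv_irr_equiv assms(1)[unfolded unitary_dual_eq], of \<xi> \<eta>] assms(2,3)
  by (simp add: irr_equiv_def)

lemma unitary_dual_inequivalent:
  assumes "c \<in> unitary_dual" "c' \<in> unitary_dual" "\<xi> \<in> c" "\<eta> \<in> c'" "c \<noteq> c'"
  shows "\<not> equivalent_reps \<xi> \<eta>"
proof
  assume "equivalent_reps \<xi> \<eta>"
  then have "(\<xi>, \<eta>) \<in> irr_equiv"
    using unitary_dual_irreducible[OF assms(1,3)] unitary_dual_irreducible[OF assms(2,4)] by (simp add: irr_equiv_def)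
  then show False
    using quotient_eqI[OF equiv_irr_equiv assms(1,2)[unfolded unitary_dual_eq] assms(3,4)] assms(5) by simp
qed

lemma unitary_dual_covers:
  assumes "irreducible_unitary_rep \<xi>" obtains c where "c \<in> unitary_dual" "\<xi> \<in> c"
proof -
  have "irr_equiv `` {\<xi>} \<in> unitary_dual" unfolding unitary_dual_eq using assms by (intro quotientI) simp
  moreover have "\<xi> \<in> irr_equiv `` {\<xi>}" using equiv_class_self[OF equiv_irr_equiv] assms by simp
  ultimately show thesis by (rule that)
qed

section \<open>Schur's lemma\<close>

lemma mat_vec_zero_imp_zero:
  assumes "T \<in> carrier_mat n m" "\<And>v. v \<in> carrier_vec m \<Longrightarrow> T *\<^sub>v v = 0\<^sub>v n"
  shows "T = (0\<^sub>m n m :: complex mat)"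
proof (rule eq_matI)
  fix i j assume "i < dim_row (0\<^sub>m n m)" "j < dim_col (0\<^sub>m n m)"
  then have ij: "i < n" "j < m" by auto
  have "(T *\<^sub>v unit_vec m j) $ i = T $$ (i, j)"
    using assms(1) ij by (subst mat_vec_mult_index[OF assms(1)]) (auto simp: if_distrib cong: if_cong)
  then show "T $$ (i, j) = 0\<^sub>m n m $$ (i, j)" using assms(2)[of "unit_vec m j"] ij by simp
qed (use assms in auto)

text \<open>The kernel of an intertwiner is an invariant subspace; containing a nonzero vector, it
  is the whole space.\<close>

lemma intertwiner_kernel:
  assumes \<xi>: "irreducible_unitary_rep \<xi>" and \<eta>: "irreducible_unitary_rep \<eta>"
    and T: "T \<in> carrier_mat (rep_dim \<xi>) (rep_dim \<eta>)" "\<And>x. \<xi> x * T = T * \<eta> x"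
    and v: "v \<in> carrier_vec (rep_dim \<eta>)" "v \<noteq> 0\<^sub>v (rep_dim \<eta>)" "T *\<^sub>v v = 0\<^sub>v (rep_dim \<xi>)"
  shows "T = 0\<^sub>m (rep_dim \<xi>) (rep_dim \<eta>)"
proof -
  let ?d = "rep_dim \<xi>" and ?e = "rep_dim \<eta>"
  note c = unitary_rep_carrier[OF irreducible_unitary[OF \<xi>]] unitary_rep_carrier[OF irreducible_unitary[OF \<eta>]]
  define W where "W = {v \<in> carrier_vec ?e. T *\<^sub>v v = 0\<^sub>v ?d}"
  have sub: "VectorSpace.subspace class_ring W (module_vec TYPE(complex) ?e)"
  proof (rule subspace_module_vecI)
    show "v + w \<in> W" if "v \<in> W" "w \<in> W" for v w
      using that T(1) by (auto simp: W_def mult_add_distrib_mat_vec[OF T(1)])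
    show "k \<cdot>\<^sub>v w \<in> W" if "w \<in> W" for k w
      using that T(1) by (auto simp: W_def mult_mat_vec[OF T(1)])
    show "0\<^sub>v ?e \<in> W" using T(1) by (auto simp: W_def intro!: eq_vecI)
  qed (auto simp: W_def)
  have inv: "\<forall>x. \<forall>w\<in>W. \<eta> x *\<^sub>v w \<in> W"
  proof (intro allI ballI)
    fix x w assume "w \<in> W"
    then have w: "w \<in> carrier_vec ?e" "T *\<^sub>v w = 0\<^sub>v ?d" by (auto simp: W_def)
    have "T *\<^sub>v (\<eta> x *\<^sub>v w) = (T * \<eta> x) *\<^sub>v w" by (rule assoc_mult_mat_vec[OF T(1) c(2) w(1), symmetric])
    also have "\<dots> = \<xi> x *\<^sub>v (T *\<^sub>v w)" unfolding T(2)[symmetric] by (rule assoc_mult_mat_vec[OF c(1) T(1) w(1)])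
    also have "\<dots> = 0\<^sub>v ?d" unfolding w(2) using c(1)[of x] by (auto intro!: eq_vecI)
    finally show "\<eta> x *\<^sub>v w \<in> W" using mult_mat_vec_carrier[OF c(2) w(1)] by (simp add: W_def)
  qed
  have "W = {0\<^sub>v ?e} \<or> W = carrier_vec ?e" using \<eta> sub inv unfolding irreducible_unitary_rep_def by blast
  moreover have "v \<in> W" using v by (simp add: W_def)
  ultimately have "W = carrier_vec ?e" using v(2) by auto
  then show ?thesis using T(1) by (intro mat_vec_zero_imp_zero) (auto simp: W_def)
qed

text \<open>The range of an intertwiner is an invariant subspace, here not zero.\<close>

lemma intertwiner_surjective:
  assumes \<xi>: "irreducible_unitary_rep \<xi>" and \<eta>: "irreducible_unitary_rep \<eta>"
    and T: "T \<in> carrier_mat (rep_dim \<xi>) (rep_dim \<eta>)" "\<And>x. \<xi> x * T = T * \<eta> x"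
    and nz: "T \<noteq> 0\<^sub>m (rep_dim \<xi>) (rep_dim \<eta>)" and u: "u \<in> carrier_vec (rep_dim \<xi>)"
  shows "\<exists>v \<in> carrier_vec (rep_dim \<eta>). T *\<^sub>v v = u"
proof -
  let ?d = "rep_dim \<xi>" and ?e = "rep_dim \<eta>"
  note c = unitary_rep_carrier[OF irreducible_unitary[OF \<xi>]] unitary_rep_carrier[OF irreducible_unitary[OF \<eta>]]
  define W where "W = (\<lambda>v. T *\<^sub>v v) ` carrier_vec ?e"
  have sub: "VectorSpace.subspace class_ring W (module_vec TYPE(complex) ?d)"
  proof (rule subspace_module_vecI)
    show "W \<subseteq> carrier_vec ?d" using T(1) by (auto simp: W_def)
    show "v + w \<in> W" if vw: "v \<in> W" "w \<in> W" for v w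
    proof -
      obtain a b where ab: "a \<in> carrier_vec ?e" "b \<in> carrier_vec ?e" "v = T *\<^sub>v a" "w = T *\<^sub>v b"
        using vw by (auto simp: W_def)
      then have "v + w = T *\<^sub>v (a + b)" by (simp add: mult_add_distrib_mat_vec[OF T(1)])
      then show ?thesis using ab(1,2) unfolding W_def by (intro image_eqI[of _ _ "a + b"]) auto
    qed
    show "k \<cdot>\<^sub>v w \<in> W" if w: "w \<in> W" for k w
    proof -
      obtain a where a: "a \<in> carrier_vec ?e" "w = T *\<^sub>v a" using w by (auto simp: W_def)
      then have "k \<cdot>\<^sub>v w = T *\<^sub>v (k \<cdot>\<^sub>v a)" by (simp add: mult_mat_vec[OF T(1)])
      then show ?thesis using a(1) unfolding W_def by (intro image_eqI[of _ _ "k \<cdot>\<^sub>v a"]) auto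
    qed
    have "0\<^sub>v ?d = T *\<^sub>v 0\<^sub>v ?e" using T(1) by (auto intro!: eq_vecI)
    then show "0\<^sub>v ?d \<in> W" unfolding W_def by (intro image_eqI[of _ _ "0\<^sub>v ?e"]) auto
  qed
  have inv: "\<forall>x. \<forall>w\<in>W. \<xi> x *\<^sub>v w \<in> W"
  proof (intro allI ballI)
    fix x w assume "w \<in> W"
    then obtain a where a: "a \<in> carrier_vec ?e" "w = T *\<^sub>v a" by (auto simp: W_def)
    have "\<xi> x *\<^sub>v w = (\<xi> x * T) *\<^sub>v a" unfolding a(2) by (rule assoc_mult_mat_vec[OF c(1) T(1) a(1), symmetric])
    also have "\<dots> = T *\<^sub>v (\<eta> x *\<^sub>v a)" unfolding T(2) by (rule assoc_mult_mat_vec[OF T(1) c(2) a(1)])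
    finally show "\<xi> x *\<^sub>v w \<in> W" unfolding W_def using mult_mat_vec_carrier[OF c(2) a(1)] by (rule image_eqI)
  qed
  have "W = {0\<^sub>v ?d} \<or> W = carrier_vec ?d" using \<xi> sub inv unfolding irreducible_unitary_rep_def by blast
  moreover have "W \<noteq> {0\<^sub>v ?d}"
  proof
    assume "W = {0\<^sub>v ?d}"
    then have "T *\<^sub>v v = 0\<^sub>v ?d" if "v \<in> carrier_vec ?e" for v using that by (auto simp: W_def)
    then show False using mat_vec_zero_imp_zero[OF T(1)] nz by blast
  qed
  ultimately have "u \<in> W" using u by simp
  then show ?thesis by (auto simp: W_def)
qed

text \<open>Surjectivity provides a right inverse \<open>S\<close>, which is also a left inverse
  because the kernel is trivial. The traces of \<open>T * S\<close> and \<open>S * T\<close>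
  coincide, so the dimensions do.\<close>

lemma intertwiner_equivalent:
  assumes \<xi>: "irreducible_unitary_rep \<xi>" and \<eta>: "irreducible_unitary_rep \<eta>"
    and T: "T \<in> carrier_mat (rep_dim \<xi>) (rep_dim \<eta>)" "\<And>x. \<xi> x * T = T * \<eta> x"
    and nz: "T \<noteq> 0\<^sub>m (rep_dim \<xi>) (rep_dim \<eta>)"
  shows "equivalent_reps \<eta> \<xi>"
proof -
  let ?d = "rep_dim \<xi>" and ?e = "rep_dim \<eta>"
  have "\<forall>i. \<exists>v \<in> carrier_vec ?e. T *\<^sub>v v = unit_vec ?d i"
    using intertwiner_surjective[OF \<xi> \<eta> T nz] by auto
  then obtain v where v: "\<And>i. v i \<in> carrier_vec ?e" "\<And>i. T *\<^sub>v v i = unit_vec ?d i" by metis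
  define S where "S = Matrix.mat ?e ?d (\<lambda>(k, i). v i $ k)"
  have S: "S \<in> carrier_mat ?e ?d" by (simp add: S_def)
  have TS: "T * S = 1\<^sub>m ?d"
  proof (rule eq_matI)
    fix i j assume "i < dim_row (1\<^sub>m ?d)" "j < dim_col (1\<^sub>m ?d)"
    then have ij: "i < ?d" "j < ?d" by auto
    have "(T * S) $$ (i, j) = (\<Sum>k<?e. T $$ (i, k) * v j $ k)"
      unfolding mat_mult_index[OF T(1) S ij] using ij by (intro sum.cong) (auto simp: S_def)
    also have "\<dots> = (T *\<^sub>v v j) $ i" by (rule mat_vec_mult_index[OF T(1) v(1) ij(1), symmetric])
    also have "\<dots> = 1\<^sub>m ?d $$ (i, j)" using ij by (auto simp: v(2))
    finally show "(T * S) $$ (i, j) = 1\<^sub>m ?d $$ (i, j)" .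
  qed (use T S in auto)
  have ST: "S * T = 1\<^sub>m ?e"
  proof -
    have STc: "S * T \<in> carrier_mat ?e ?e" by (rule mult_carrier_mat[OF S T(1)])
    define D where "D = S * T - 1\<^sub>m ?e"
    have Dc: "D \<in> carrier_mat ?e ?e" unfolding D_def by (rule minus_carrier_mat) simp
    have "D = 0\<^sub>m ?e ?e"
    proof (rule mat_vec_zero_imp_zero[OF Dc])
      fix w :: "complex Matrix.vec" assume w: "w \<in> carrier_vec ?e"
      have Tw: "T *\<^sub>v w \<in> carrier_vec ?d" by (rule mult_mat_vec_carrier[OF T(1) w])
      have Dw: "D *\<^sub>v w = S *\<^sub>v (T *\<^sub>v w) - w"
        unfolding D_def using minus_mult_distrib_mat_vec[OF STc _ w] assoc_mult_mat_vec[OF S T(1) w] w by simp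
      have STw: "S *\<^sub>v (T *\<^sub>v w) \<in> carrier_vec ?e" by (rule mult_mat_vec_carrier[OF S Tw])
      have "T *\<^sub>v (S *\<^sub>v (T *\<^sub>v w)) = (T * S) *\<^sub>v (T *\<^sub>v w)" by (rule assoc_mult_mat_vec[OF T(1) S Tw, symmetric])
      also have "\<dots> = T *\<^sub>v w" unfolding TS using Tw by simp
      finally have TST: "T *\<^sub>v (S *\<^sub>v (T *\<^sub>v w)) = T *\<^sub>v w" .
      have "T *\<^sub>v (D *\<^sub>v w) = 0\<^sub>v ?d"
        unfolding Dw mult_minus_distrib_mat_vec[OF T(1) STw w] TST using Tw by simp
      then show "D *\<^sub>v w = 0\<^sub>v ?e"
        using intertwiner_kernel[OF \<xi> \<eta> T _ _] nz mult_mat_vec_carrier[OF Dc w] by blast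
    qed
    show ?thesis
    proof (rule eq_matI)
      fix i j assume "i < dim_row (1\<^sub>m ?e)" "j < dim_col (1\<^sub>m ?e)"
      then have ij: "i < ?e" "j < ?e" by auto
      have "(S * T) $$ (i, j) - 1\<^sub>m ?e $$ (i, j) = D $$ (i, j)" using STc ij by (simp add: D_def)
      also have "\<dots> = 0" unfolding \<open>D = 0\<^sub>m ?e ?e\<close> using ij by simp
      finally show "(S * T) $$ (i, j) = 1\<^sub>m ?e $$ (i, j)" by simp
    qed (use STc in auto)
  qed
  have "(\<Sum>i<?d. (T * S) $$ (i, i)) = (\<Sum>k<?e. (S * T) $$ (k, k))"
  proof -
    have "(\<Sum>i<?d. (T * S) $$ (i, i)) = (\<Sum>i<?d. \<Sum>k<?e. T $$ (i, k) * S $$ (k, i))"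
      by (intro sum.cong refl mat_mult_index[OF T(1) S]) auto
    also have "\<dots> = (\<Sum>k<?e. \<Sum>i<?d. S $$ (k, i) * T $$ (i, k))"
      by (subst sum.swap) (simp add: mult.commute)
    also have "\<dots> = (\<Sum>k<?e. (S * T) $$ (k, k))"
      by (intro sum.cong refl mat_mult_index[OF S T(1), symmetric]) auto
    finally show ?thesis .
  qed
  then have "complex_of_nat ?d = of_nat ?e" unfolding TS ST by simp
  then have de: "?d = ?e" by simp
  have "invertible_mat T" using T(1) S TS ST unfolding de by (intro invertible_matI)
  then show ?thesis unfolding equivalent_reps_def using T de by auto
qed

text \<open>Subtracting an eigenvalue leaves an intertwiner with nontrivial kernel, hence
  zero.\<close>

lemma intertwiner_scalar:
  assumes \<xi>: "irreducible_unitary_rep \<xi>"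
    and T: "T \<in> carrier_mat (rep_dim \<xi>) (rep_dim \<xi>)" "\<And>x. \<xi> x * T = T * \<xi> x"
  shows "\<exists>c. T = c \<cdot>\<^sub>m 1\<^sub>m (rep_dim \<xi>)"
proof -
  let ?d = "rep_dim \<xi>"
  note c = unitary_rep_carrier[OF irreducible_unitary[OF \<xi>]]
  have "?d > 0" using \<xi> by (simp add: irreducible_unitary_rep_def)
  then obtain e where "e \<in> spectrum T" using spectrum_non_empty[OF T(1)] by auto
  then obtain v where v: "v \<in> carrier_vec ?d" "v \<noteq> 0\<^sub>v ?d" "T *\<^sub>v v = e \<cdot>\<^sub>v v"
    unfolding spectrum_def eigenvalue_def eigenvector_def using T(1) by auto
  define D where "D = T - e \<cdot>\<^sub>m 1\<^sub>m ?d"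
  have I: "e \<cdot>\<^sub>m 1\<^sub>m ?d \<in> carrier_mat ?d ?d" by simp
  have Dc: "D \<in> carrier_mat ?d ?d" unfolding D_def by (rule minus_carrier_mat[OF I])
  have "\<xi> x * D = D * \<xi> x" for x
  proof -
    have "\<xi> x * D = \<xi> x * T - \<xi> x * (e \<cdot>\<^sub>m 1\<^sub>m ?d)" unfolding D_def by (rule mult_minus_distrib_mat[OF c T(1) I])
    also have "\<xi> x * (e \<cdot>\<^sub>m 1\<^sub>m ?d) = e \<cdot>\<^sub>m 1\<^sub>m ?d * \<xi> x"
      using c[of x] by (simp add: mult_smult_distrib[of _ ?d ?d _ ?d] mult_smult_assoc_mat[of _ ?d ?d _ ?d])
    also have "\<xi> x * T - e \<cdot>\<^sub>m 1\<^sub>m ?d * \<xi> x = D * \<xi> x"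
      unfolding D_def T(2) by (rule minus_mult_distrib_mat[OF T(1) I c, symmetric])
    finally show ?thesis .
  qed
  moreover have "D *\<^sub>v v = 0\<^sub>v ?d"
  proof -
    have "D *\<^sub>v v = T *\<^sub>v v - (e \<cdot>\<^sub>m 1\<^sub>m ?d) *\<^sub>v v" unfolding D_def by (rule minus_mult_distrib_mat_vec[OF T(1) I v(1)])
    also have "(e \<cdot>\<^sub>m 1\<^sub>m ?d) *\<^sub>v v = e \<cdot>\<^sub>v v"
    proof (rule eq_vecI)
      fix i assume "i < dim_vec (e \<cdot>\<^sub>v v)"
      then have i: "i < ?d" using v(1) by simp
      have "((e \<cdot>\<^sub>m 1\<^sub>m ?d) *\<^sub>v v) $ i = (\<Sum>l<?d. if l = i then e * v $ l else 0)"
        unfolding mat_vec_mult_index[OF I v(1) i] using i by (intro sum.cong) auto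
      then show "((e \<cdot>\<^sub>m 1\<^sub>m ?d) *\<^sub>v v) $ i = (e \<cdot>\<^sub>v v) $ i" using i v(1) by simp
    qed (use v(1) in simp)
    finally show ?thesis unfolding v(3) using v(1) by simp
  qed
  ultimately have "D = 0\<^sub>m ?d ?d" using intertwiner_kernel[OF \<xi> \<xi> Dc _ v(1,2)] by blast
  have "T = e \<cdot>\<^sub>m 1\<^sub>m ?d"
  proof (rule eq_matI)
    fix i j assume "i < dim_row (e \<cdot>\<^sub>m 1\<^sub>m ?d)" "j < dim_col (e \<cdot>\<^sub>m 1\<^sub>m ?d)"
    then have ij: "i < ?d" "j < ?d" by auto
    have "T $$ (i, j) - (e \<cdot>\<^sub>m 1\<^sub>m ?d) $$ (i, j) = D $$ (i, j)" using ij T(1) by (simp add: D_def)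
    also have "\<dots> = 0" unfolding \<open>D = 0\<^sub>m ?d ?d\<close> using ij by simp
    finally show "T $$ (i, j) = (e \<cdot>\<^sub>m 1\<^sub>m ?d) $$ (i, j)" by simp
  qed (use T in auto)
  then show ?thesis ..
qed

section \<open>Orthogonality relations for coefficients\<close>

context haar_group
begin

text \<open>Left invariance moves the translation by \<open>y\<close> from one factor of the inner
  product to the other; there it acts through \<open>\<eta>\<close>.\<close>

lemma coef_intertwiner:
  assumes \<xi>: "unitary_rep \<xi>" "a < rep_dim \<xi>" and \<eta>: "unitary_rep \<eta>" "b < rep_dim \<eta>"
  defines "T \<equiv> Matrix.mat (rep_dim \<xi>) (rep_dim \<eta>) (\<lambda>(i, j). ip (\<lambda>x. \<xi> x $$ (i, a)) (\<lambda>x. \<eta> x $$ (j, b)))"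
  shows "\<xi> y * T = T * \<eta> y"
proof (rule eq_matI)
  let ?d = "rep_dim \<xi>" and ?e = "rep_dim \<eta>"
  have T: "T \<in> carrier_mat ?d ?e" by (simp add: T_def)
  note c = unitary_rep_carrier[OF \<xi>(1)] unitary_rep_carrier[OF \<eta>(1)]
  note C = coef_continuous[OF \<xi>(1)] coef_continuous[OF \<eta>(1)]
  fix i j assume "i < dim_row (T * \<eta> y)" "j < dim_col (T * \<eta> y)"
  then have ij: "i < ?d" "j < ?e" using T c(2)[of y] by auto
  have "(\<xi> y * T) $$ (i, j) = (\<Sum>k<?d. \<xi> y $$ (i, k) * ip (\<lambda>x. \<xi> x $$ (k, a)) (\<lambda>x. \<eta> x $$ (j, b)))"
    unfolding mat_mult_index[OF c(1) T ij] using ij by (intro sum.cong) (auto simp: T_def)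
  also have "\<dots> = ip (\<lambda>x. \<Sum>k<?d. \<xi> y $$ (i, k) * \<xi> x $$ (k, a)) (\<lambda>x. \<eta> x $$ (j, b))"
    using C ij \<xi>(2) \<eta>(2) by (subst ip_sum_left) (auto intro!: continuous_on_mult continuous_on_const simp: ip_scale_left)
  also have "(\<lambda>x. \<Sum>k<?d. \<xi> y $$ (i, k) * \<xi> x $$ (k, a)) = ltrans (- y) (\<lambda>x. \<xi> x $$ (i, a))"
    unfolding ltrans_def using coef_add[OF \<xi>(1) ij(1) \<xi>(2)] by simp
  also have "ip \<dots> (\<lambda>x. \<eta> x $$ (j, b)) = ip (\<lambda>x. \<xi> x $$ (i, a)) (ltrans y (\<lambda>x. \<eta> x $$ (j, b)))"
    using ip_ltrans_left[OF C(1)[OF ij(1) \<xi>(2)] C(2)[OF ij(2) \<eta>(2)], of "- y"] by simp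
  also have "ltrans y (\<lambda>x. \<eta> x $$ (j, b)) = (\<lambda>x. \<Sum>l<?e. cnj (\<eta> y $$ (l, j)) * \<eta> x $$ (l, b))"
    unfolding ltrans_def using coef_ltrans[OF \<eta>(1) ij(2) \<eta>(2)] by simp
  also have "ip (\<lambda>x. \<xi> x $$ (i, a)) \<dots> = (\<Sum>l<?e. ip (\<lambda>x. \<xi> x $$ (i, a)) (\<lambda>x. \<eta> x $$ (l, b)) * \<eta> y $$ (l, j))"
    using C ij \<xi>(2) \<eta>(2)
    by (subst ip_sum_right) (auto intro!: continuous_on_mult continuous_on_const simp: ip_scale_right mult.commute[of _ "\<eta> y $$ _"])
  also have "\<dots> = (T * \<eta> y) $$ (i, j)"
    unfolding mat_mult_index[OF T c(2) ij] using ij by (intro sum.cong) (auto simp: T_def)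
  finally show "(\<xi> y * T) $$ (i, j) = (T * \<eta> y) $$ (i, j)" .
qed (use unitary_rep_carrier[OF \<xi>(1), of y] unitary_rep_carrier[OF \<eta>(1), of y] in \<open>auto simp: T_def\<close>)

lemma schur_orthogonality_inequivalent:
  assumes \<xi>: "irreducible_unitary_rep \<xi>" "i < rep_dim \<xi>" "a < rep_dim \<xi>"
    and \<eta>: "irreducible_unitary_rep \<eta>" "j < rep_dim \<eta>" "b < rep_dim \<eta>"
    and ne: "\<not> equivalent_reps \<eta> \<xi>"
  shows "ip (\<lambda>x. \<xi> x $$ (i, a)) (\<lambda>x. \<eta> x $$ (j, b)) = 0"
proof -
  define T where "T = Matrix.mat (rep_dim \<xi>) (rep_dim \<eta>) (\<lambda>(i, j). ip (\<lambda>x. \<xi> x $$ (i, a)) (\<lambda>x. \<eta> x $$ (j, b)))"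
  have T: "T \<in> carrier_mat (rep_dim \<xi>) (rep_dim \<eta>)" by (simp add: T_def)
  have "\<xi> y * T = T * \<eta> y" for y
    unfolding T_def by (rule coef_intertwiner[OF irreducible_unitary[OF \<xi>(1)] \<xi>(3) irreducible_unitary[OF \<eta>(1)] \<eta>(3)])
  then have "T = 0\<^sub>m (rep_dim \<xi>) (rep_dim \<eta>)"
    using intertwiner_equivalent[OF \<xi>(1) \<eta>(1) T] ne by blast
  then have "T $$ (i, j) = 0" using \<xi>(2) \<eta>(2) by simp
  then show ?thesis using \<xi>(2) \<eta>(2) by (simp add: T_def)
qed

lemma schur_orthogonality:
  assumes \<xi>: "irreducible_unitary_rep \<xi>" and ij: "i < rep_dim \<xi>" "a < rep_dim \<xi>" "j < rep_dim \<xi>" "b < rep_dim \<xi>"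
  shows "ip (\<lambda>x. \<xi> x $$ (i, a)) (\<lambda>x. \<xi> x $$ (j, b)) = (if i = j \<and> a = b then 1 / of_nat (rep_dim \<xi>) else 0)"
proof -
  let ?d = "rep_dim \<xi>"
  note U = irreducible_unitary[OF \<xi>]
  define T where "T = Matrix.mat ?d ?d (\<lambda>(i, j). ip (\<lambda>x. \<xi> x $$ (i, a)) (\<lambda>x. \<xi> x $$ (j, b)))"
  have T: "T \<in> carrier_mat ?d ?d" by (simp add: T_def)
  have "\<xi> y * T = T * \<xi> y" for y
    unfolding T_def by (rule coef_intertwiner[OF U ij(2) U ij(4)])
  then obtain c where c: "T = c \<cdot>\<^sub>m 1\<^sub>m ?d" using intertwiner_scalar[OF \<xi> T] by blast
  have Tij: "ip (\<lambda>x. \<xi> x $$ (i, a)) (\<lambda>x. \<xi> x $$ (j, b)) = (if i = j then c else 0)" if "i < ?d" "j < ?d" for i j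
    using arg_cong[OF c, of "\<lambda>M. M $$ (i, j)"] that by (simp add: T_def)
  \<comment> \<open>The trace determines the scalar \<open>c\<close>: under the integral it is the
    inner product of two columns of a unitary matrix.\<close>
  have "(\<Sum>i<?d. ip (\<lambda>x. \<xi> x $$ (i, a)) (\<lambda>x. \<xi> x $$ (i, b))) = (\<integral>x. (\<Sum>i<?d. cnj (\<xi> x $$ (i, b)) * \<xi> x $$ (i, a)) \<partial>\<mu>)"
    unfolding ip_def using ij
    by (subst Bochner_Integration.integral_sum)
      (auto intro!: integrable_continuous continuous_on_mult continuous_on_cnj coef_continuous[OF U] simp: mult.commute)
  also have "\<dots> = (\<integral>x. (if b = a then 1 else 0) \<partial>\<mu>)"
  proof (rule Bochner_Integration.integral_cong[OF refl])
    fix x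
    have "unitary_mat ?d (\<xi> x)" using U by (simp add: unitary_rep_def)
    then show "(\<Sum>i<?d. cnj (\<xi> x $$ (i, b)) * \<xi> x $$ (i, a)) = (if b = a then 1 else 0)"
      using ij by (intro unitary_mat_cols)
  qed
  finally have "of_nat ?d * c = (if b = a then 1 else 0)" using Tij by simp
  moreover have "?d > 0" using ij by simp
  ultimately have "c = (if a = b then 1 / of_nat ?d else 0)" by (auto simp: field_simps split: if_splits)
  then show ?thesis using Tij[OF ij(1,3)] by simp
qed

end

section \<open>Khintchine and Hoelder inequalities\<close>

text \<open>Sub-Gaussian bound for a random sign: the left side is twice its moment generating
  function.\<close>

lemma exp_add_exp_minus_le:
  fixes a :: real
  shows "exp a + exp (- a) \<le> 2 * exp (a\<^sup>2)"
proof -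
  have pos: "exp b + exp (- b) \<le> 2 * exp (b\<^sup>2)" if b: "b \<ge> 0" for b :: real
  proof (cases "b \<le> 1")
    case True
    have "exp b \<le> 1 + b + b\<^sup>2" using b True by (rule exp_bound)
    moreover have "exp (- b) \<le> 1 - b + b\<^sup>2"
    proof -
      have "exp (- b) = 1 / exp b" by (simp add: exp_minus field_simps)
      also have "\<dots> \<le> 1 / (1 + b)" using b exp_ge_add_one_self[of b] by (intro divide_left_mono) auto
      also have "\<dots> \<le> 1 - b + b\<^sup>2"
      proof -
        have "1 \<le> (1 - b + b\<^sup>2) * (1 + b)"
          using b by (simp add: algebra_simps power2_eq_square)
        then show ?thesis using b by (simp add: pos_divide_le_eq)
      qed
      finally show ?thesis .
    qed
    moreover have "1 + b\<^sup>2 \<le> exp (b\<^sup>2)" by (rule exp_ge_add_one_self)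
    ultimately show ?thesis by linarith
  next
    case False
    then have "b * 1 \<le> b * b" by (intro mult_left_mono) auto
    then have "b \<le> b\<^sup>2" by (simp add: power2_eq_square)
    then have "exp b \<le> exp (b\<^sup>2)" "exp (- b) \<le> exp (b\<^sup>2)" using b by auto
    then show ?thesis by linarith
  qed
  show ?thesis using pos[of a] pos[of "- a"] by (cases "a \<ge> 0") auto
qed

text \<open>From \<open>y \<le> exp y\<close> at \<open>y = x / p\<close>; it trades moments for
  exponential moments.\<close>

lemma powr_le_exp:
  fixes x p :: real
  assumes "p > 0" "x \<ge> 0" shows "x powr p \<le> p powr p * exp x"
proof -
  have "x / p \<le> exp (x / p)" using exp_ge_add_one_self[of "x / p"] by linarith
  then have "x \<le> p * exp (x / p)" using assms by (simp add: field_simps)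
  then have "x powr p \<le> (p * exp (x / p)) powr p" using assms by (intro powr_mono2) auto
  also have "\<dots> = p powr p * exp x" using assms by (simp add: powr_mult exp_powr_real)
  finally show ?thesis .
qed

text \<open>A sign vector is encoded by the set of its plus signs, so that averages over signs are
  sums over \<open>Pow I\<close>.\<close>

definition sgn_of :: "nat set \<Rightarrow> nat \<Rightarrow> real" where
  "sgn_of S k = (if k \<in> S then 1 else - 1)"

text \<open>Independence of the signs: the sum over subsets is the expansion of the product of the
  factors \<open>exp (a k) + exp (- a k)\<close>.\<close>

lemma sum_exp_signs:
  assumes "finite I"
  shows "(\<Sum>S\<in>Pow I. exp (\<Sum>k\<in>I. sgn_of S k * a k)) \<le> 2 ^ card I * exp (\<Sum>k\<in>I. (a k)\<^sup>2)"
proof -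
  have "(\<Sum>S\<in>Pow I. exp (\<Sum>k\<in>I. sgn_of S k * a k)) = (\<Sum>S\<in>Pow I. (\<Prod>k\<in>S. exp (a k)) * (\<Prod>k\<in>I - S. exp (- a k)))"
  proof (rule sum.cong[OF refl])
    fix S assume "S \<in> Pow I"
    then have S: "S \<subseteq> I" by simp
    have "exp (\<Sum>k\<in>I. sgn_of S k * a k) = (\<Prod>k\<in>I. exp (sgn_of S k * a k))" by (rule exp_sum[OF assms])
    also have "\<dots> = (\<Prod>k\<in>I - S. exp (sgn_of S k * a k)) * (\<Prod>k\<in>S. exp (sgn_of S k * a k))"
      by (rule prod.subset_diff[OF S assms])
    also have "(\<Prod>k\<in>S. exp (sgn_of S k * a k)) = (\<Prod>k\<in>S. exp (a k))"
      by (intro prod.cong) (auto simp: sgn_of_def)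
    also have "(\<Prod>k\<in>I - S. exp (sgn_of S k * a k)) = (\<Prod>k\<in>I - S. exp (- a k))"
      by (intro prod.cong) (auto simp: sgn_of_def)
    finally show "exp (\<Sum>k\<in>I. sgn_of S k * a k) = (\<Prod>k\<in>S. exp (a k)) * (\<Prod>k\<in>I - S. exp (- a k))" by simp
  qed
  also have "\<dots> = (\<Prod>k\<in>I. exp (a k) + exp (- a k))" by (rule prod_add[OF assms, symmetric])
  also have "\<dots> \<le> (\<Prod>k\<in>I. 2 * exp ((a k)\<^sup>2))"
    by (intro prod_mono conjI exp_add_exp_minus_le) (auto intro: add_nonneg_nonneg)
  also have "\<dots> = 2 ^ card I * exp (\<Sum>k\<in>I. (a k)\<^sup>2)" using assms by (simp add: prod.distrib exp_sum)
  finally show ?thesis .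
qed

text \<open>The moment is bounded by the exponential moments of the sum and of its negative; as the
  squares of the coefficients sum to at most 1, each of these has average at most
  \<open>exp 1\<close>.\<close>

lemma khintchine_real:
  fixes a :: "nat \<Rightarrow> real"
  assumes I: "finite I" and p: "p > 0" and a: "(\<Sum>k\<in>I. (a k)\<^sup>2) \<le> 1"
  shows "(\<Sum>S\<in>Pow I. \<bar>\<Sum>k\<in>I. sgn_of S k * a k\<bar> powr p) \<le> 2 ^ card I * (p powr p * (2 * exp 1))"
proof -
  let ?X = "\<lambda>S. \<Sum>k\<in>I. sgn_of S k * a k"
  have "(\<Sum>S\<in>Pow I. \<bar>?X S\<bar> powr p) \<le> (\<Sum>S\<in>Pow I. p powr p * (exp (?X S) + exp (- ?X S)))"
  proof (rule sum_mono)
    fix S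
    have "\<bar>?X S\<bar> powr p \<le> p powr p * exp \<bar>?X S\<bar>" by (rule powr_le_exp[OF p]) simp
    also have "\<dots> \<le> p powr p * (exp (?X S) + exp (- ?X S))"
      by (intro mult_left_mono) (auto simp: abs_if)
    finally show "\<bar>?X S\<bar> powr p \<le> p powr p * (exp (?X S) + exp (- ?X S))" .
  qed
  also have "\<dots> = p powr p * ((\<Sum>S\<in>Pow I. exp (?X S)) + (\<Sum>S\<in>Pow I. exp (\<Sum>k\<in>I. sgn_of S k * (- a k))))"
    by (simp add: sum_distrib_left sum.distrib distrib_left sum_negf)
  also have "\<dots> \<le> p powr p * (2 ^ card I * exp 1 + 2 ^ card I * exp 1)"
  proof (intro mult_left_mono add_mono)
    have e: "exp (\<Sum>k\<in>I. (a k)\<^sup>2) \<le> exp 1" using a by simp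
    show "(\<Sum>S\<in>Pow I. exp (?X S)) \<le> 2 ^ card I * exp 1"
      by (rule order_trans[OF sum_exp_signs[OF I]]) (use e in \<open>simp add: mult_left_mono\<close>)
    show "(\<Sum>S\<in>Pow I. exp (\<Sum>k\<in>I. sgn_of S k * (- a k))) \<le> 2 ^ card I * exp 1"
      by (rule order_trans[OF sum_exp_signs[OF I]]) (use e in \<open>simp add: mult_left_mono\<close>)
  qed simp
  finally show ?thesis by (simp add: algebra_simps)
qed

text \<open>Real and imaginary part contribute \<open>p powr p * (2 * exp 1)\<close> each; the
  factor \<open>2 powr p\<close> is the price of splitting a complex number into them.\<close>

definition khintchine_const :: "real \<Rightarrow> real" where
  "khintchine_const p = 2 powr p * (p powr p * (4 * exp 1))"

lemma khintchine:
  fixes a :: "nat \<Rightarrow> complex"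
  assumes I: "finite I" and p: "p > 0" and a: "(\<Sum>k\<in>I. (cmod (a k))\<^sup>2) \<le> t\<^sup>2" and t: "t \<ge> 0"
  shows "(\<Sum>S\<in>Pow I. cmod (\<Sum>k\<in>I. of_real (sgn_of S k) * a k) powr p) \<le> 2 ^ card I * khintchine_const p * t powr p"
proof (cases "t = 0")
  case True
  then have "(\<Sum>k\<in>I. (cmod (a k))\<^sup>2) = 0" using a sum_nonneg[of I "\<lambda>k. (cmod (a k))\<^sup>2"] by simp
  then have "a k = 0" if "k \<in> I" for k using that I by (simp add: sum_nonneg_eq_0_iff)
  then show ?thesis using True by simp
next
  case False
  then have tp: "t > 0" using t by simp
  define b where "b k = a k / of_real t" for k
  have b1: "(\<Sum>k\<in>I. (cmod (b k))\<^sup>2) \<le> 1"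
  proof -
    have "(\<Sum>k\<in>I. (cmod (b k))\<^sup>2) = (\<Sum>k\<in>I. (cmod (a k))\<^sup>2) / t\<^sup>2"
      unfolding b_def sum_divide_distrib using tp by (simp add: norm_divide power_divide)
    also have "\<dots> \<le> 1" using a tp by simp
    finally show ?thesis .
  qed
  have re: "(\<Sum>k\<in>I. (Re (b k))\<^sup>2) \<le> 1" and im: "(\<Sum>k\<in>I. (Im (b k))\<^sup>2) \<le> 1"
    by (rule order_trans[OF sum_mono b1]; simp add: cmod_power2)+
  have pt: "cmod (\<Sum>k\<in>I. of_real (sgn_of S k) * a k) powr p \<le> t powr p * (2 powr p *
      (\<bar>\<Sum>k\<in>I. sgn_of S k * Re (b k)\<bar> powr p + \<bar>\<Sum>k\<in>I. sgn_of S k * Im (b k)\<bar> powr p))" for S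
  proof -
    let ?Z = "\<Sum>k\<in>I. of_real (sgn_of S k) * b k"
    let ?x = "\<bar>\<Sum>k\<in>I. sgn_of S k * Re (b k)\<bar>" and ?y = "\<bar>\<Sum>k\<in>I. sgn_of S k * Im (b k)\<bar>"
    have "cmod ?Z \<le> \<bar>Re ?Z\<bar> + \<bar>Im ?Z\<bar>" by (rule cmod_le)
    also have "\<dots> = ?x + ?y" by simp
    also have "\<dots> \<le> 2 * max ?x ?y" by simp
    finally have "cmod ?Z powr p \<le> (2 * max ?x ?y) powr p" using p by (intro powr_mono2) auto
    also have "\<dots> = 2 powr p * (max ?x ?y powr p)" by (simp add: powr_mult)
    also have "\<dots> \<le> 2 powr p * (?x powr p + ?y powr p)" by (intro mult_left_mono) (auto simp: max_def)
    finally have 1: "cmod ?Z powr p \<le> 2 powr p * (?x powr p + ?y powr p)" .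
    have "(\<Sum>k\<in>I. of_real (sgn_of S k) * a k) = of_real t * ?Z"
      unfolding b_def sum_distrib_left using tp by (intro sum.cong) auto
    then have "cmod (\<Sum>k\<in>I. of_real (sgn_of S k) * a k) powr p = t powr p * cmod ?Z powr p"
      using tp by (simp add: norm_mult powr_mult)
    also have "\<dots> \<le> t powr p * (2 powr p * (?x powr p + ?y powr p))" using 1 by (intro mult_left_mono) auto
    finally show ?thesis .
  qed
  have "(\<Sum>S\<in>Pow I. cmod (\<Sum>k\<in>I. of_real (sgn_of S k) * a k) powr p) \<le> (\<Sum>S\<in>Pow I. t powr p * (2 powr p *
      (\<bar>\<Sum>k\<in>I. sgn_of S k * Re (b k)\<bar> powr p + \<bar>\<Sum>k\<in>I. sgn_of S k * Im (b k)\<bar> powr p)))"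
    by (intro sum_mono pt)
  also have "\<dots> = t powr p * (2 powr p * ((\<Sum>S\<in>Pow I. \<bar>\<Sum>k\<in>I. sgn_of S k * Re (b k)\<bar> powr p)
      + (\<Sum>S\<in>Pow I. \<bar>\<Sum>k\<in>I. sgn_of S k * Im (b k)\<bar> powr p)))"
    by (simp add: sum_distrib_left sum.distrib distrib_left)
  also have "\<dots> \<le> t powr p * (2 powr p * (2 ^ card I * (p powr p * (2 * exp 1)) + 2 ^ card I * (p powr p * (2 * exp 1))))"
    by (intro mult_left_mono add_mono khintchine_real I p re im) auto
  also have "\<dots> = 2 ^ card I * khintchine_const p * t powr p"
    by (simp add: khintchine_const_def algebra_simps)
  finally show ?thesis .
qed

lemma khintchine_const_pos: "p > 0 \<Longrightarrow> khintchine_const p > 0"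
  by (simp add: khintchine_const_def)

definition dft :: "nat \<Rightarrow> nat \<Rightarrow> nat \<Rightarrow> complex" where
  "dft d i k = exp (2 * of_real pi * \<i> * of_nat k / of_nat d) ^ i / of_real (sqrt (real d))"

lemma dft_norm:
  assumes "d > 0" shows "cmod (dft d i k) = 1 / sqrt (real d)"
proof -
  have "cmod (exp (2 * of_real pi * \<i> * of_nat k / of_nat d)) = 1" by (simp add: norm_exp_eq_Re)
  then show ?thesis using assms by (simp add: dft_def norm_divide norm_power)
qed

text \<open>Off the diagonal this is a full geometric sum over a root of unity different from 1;
  indices below \<open>d\<close> belong to distinct roots.\<close>

lemma dft_orthogonal:
  assumes d: "d > 0" and kl: "k < d" "l < d"
  shows "(\<Sum>i<d. cnj (dft d i k) * dft d i l) = (if k = l then 1 else 0)"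
proof -
  define w where "w k = exp (2 * of_real pi * \<i> * of_nat k / of_nat d)" for k
  have cw: "cnj (w k) * w k = 1" for k
  proof -
    have "cmod (w k) = 1" by (simp add: w_def norm_exp_eq_Re)
    then show ?thesis using complex_norm_square[of "w k"] by (simp add: mult.commute)
  qed
  have wd: "w k ^ d = 1" for k unfolding w_def by (rule complex_root_unity) (use d in simp)
  let ?z = "cnj (w k) * w l"
  have "(\<Sum>i<d. cnj (dft d i k) * dft d i l) = (\<Sum>i<d. ?z ^ i / of_nat d)"
  proof (rule sum.cong[OF refl])
    fix i
    have "of_real (sqrt (real d)) * of_real (sqrt (real d)) = (of_nat d :: complex)"
      by (simp flip: of_real_mult)
    then show "cnj (dft d i k) * dft d i l = ?z ^ i / of_nat d"
      by (simp add: dft_def w_def[symmetric] power_mult_distrib)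
  qed
  also have "\<dots> = (\<Sum>i<d. ?z ^ i) / of_nat d" by (simp add: sum_divide_distrib)
  also have "\<dots> = (if k = l then 1 else 0)"
  proof (cases "k = l")
    case True
    then show ?thesis using d cw by simp
  next
    case False
    have "?z \<noteq> 1"
    proof
      assume "?z = 1"
      then have "w k * (cnj (w k) * w l) = w k" by simp
      then have "w l = w k" using cw[of k] by (simp add: mult.assoc[symmetric] mult.commute[of "w k"])
      then have "l mod d = k mod d"
        unfolding w_def using complex_root_unity_eq[of d l k] d by simp
      then show False using kl False by simp
    qed
    moreover have "?z ^ d = 1" using wd[of k] wd[of l] by (simp add: power_mult_distrib flip: complex_cnj_power)
    ultimately have "(\<Sum>i<d. ?z ^ i) = 0" by (simp add: geometric_sum)
    then show ?thesis using False by simp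
  qed
  finally show ?thesis .
qed

section \<open>Hoelder's inequality and pairings with bounded functions\<close>

lemma powr_le_one_add_powr:
  fixes x :: real
  assumes "0 < r" "r \<le> p" "0 \<le> x" shows "x powr r \<le> 1 + x powr p"
proof (cases "x \<le> 1")
  case True
  then have "x powr r \<le> 1 powr r" using assms by (intro powr_mono2) auto
  then show ?thesis using powr_ge_zero[of x p] by (simp only: powr_one_eq_one)
next
  case False
  then have "x powr r \<le> x powr p" using assms by (intro powr_mono) auto
  then show ?thesis by simp
qed

text \<open>Young's inequality after normalising by \<open>a\<close> and \<open>b\<close>. The norm
  of \<open>f\<close> is enlarged by \<open>e / b\<close> so that one can divide by it, which costs
  exactly \<open>e\<close> in the end.\<close>

lemma (in prob_space) holder_bound:
  assumes pq: "1 < p" "1 < q" "1 / p + 1 / q = 1" and f: "f \<in> lp_space M p"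
    and w: "w \<in> borel_measurable M" "\<And>x. cmod (w x) \<le> 1"
    and b: "b > 0" "(\<integral>x. cmod (w x) powr q \<partial>M) \<le> b powr q"
  shows "(\<integral>x. cmod (f x) * cmod (w x) \<partial>M) \<le> lp_norm M p f * b"
proof (rule field_le_epsilon)
  fix e :: real assume e: "e > 0"
  define a where "a = lp_norm M p f + e / b"
  have a: "a > 0" "lp_norm M p f \<le> a" using e b(1) lp_norm_nonneg[of M p f]
    unfolding a_def by (auto intro: add_nonneg_pos)
  have fi: "integrable M (\<lambda>x. cmod (f x) powr p)" by (rule lp_space_integrable[OF f])
  have wi: "integrable M (\<lambda>x. cmod (w x) powr q)"
  proof (rule integrable_const_bound[of _ 1])
    show "AE x in M. norm (cmod (w x) powr q) \<le> 1"
    proof (rule AE_I2)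
      fix x
      have "cmod (w x) powr q \<le> 1 powr q" using w(2)[of x] pq by (intro powr_mono2) auto
      then show "norm (cmod (w x) powr q) \<le> 1" by simp
    qed
  qed (use w(1) in simp)
  have pt: "cmod (f x) * cmod (w x) \<le> a * b * (cmod (f x) powr p / a powr p / p + cmod (w x) powr q / b powr q / q)" for x
  proof -
    have "cmod (f x) / a * (cmod (w x) / b) \<le> (cmod (f x) / a) powr p / p + (cmod (w x) / b) powr q / q"
      using pq a b by (intro Youngs_inequality) auto
    also have "\<dots> = cmod (f x) powr p / a powr p / p + cmod (w x) powr q / b powr q / q"
      using a b by (simp add: powr_divide)
    finally have "a * b * (cmod (f x) / a * (cmod (w x) / b)) \<le> a * b * (cmod (f x) powr p / a powr p / p + cmod (w x) powr q / b powr q / q)"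
      using a b by (intro mult_left_mono) auto
    then show ?thesis using a b by simp
  qed
  have gi: "integrable M (\<lambda>x. a * b * (cmod (f x) powr p / a powr p / p + cmod (w x) powr q / b powr q / q))"
    using fi wi by simp
  have li: "integrable M (\<lambda>x. cmod (f x) * cmod (w x))"
  proof (rule Bochner_Integration.integrable_bound[OF gi])
    show "(\<lambda>x. cmod (f x) * cmod (w x)) \<in> borel_measurable M" using lp_space_measurable[OF f] w(1) by measurable
    show "AE x in M. norm (cmod (f x) * cmod (w x)) \<le> norm (a * b * (cmod (f x) powr p / a powr p / p + cmod (w x) powr q / b powr q / q))"
      using pt by (intro AE_I2) (simp add: order_trans[OF _ abs_ge_self])
  qed
  have "(\<integral>x. cmod (f x) * cmod (w x) \<partial>M) \<le> (\<integral>x. a * b * (cmod (f x) powr p / a powr p / p + cmod (w x) powr q / b powr q / q) \<partial>M)"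
    by (intro integral_mono li gi pt)
  also have "\<dots> = a * b * ((\<integral>x. cmod (f x) powr p \<partial>M) / a powr p / p + (\<integral>x. cmod (w x) powr q \<partial>M) / b powr q / q)"
    using fi wi by simp
  also have "\<dots> \<le> a * b * (1 / p + 1 / q)"
  proof (intro mult_left_mono add_mono divide_right_mono)
    have "(\<integral>x. cmod (f x) powr p \<partial>M) \<le> a powr p"
      using a pq lp_norm_nonneg[of M p f] by (subst lp_norm_powr[symmetric]) (auto intro: powr_mono2)
    then show "(\<integral>x. cmod (f x) powr p \<partial>M) / a powr p \<le> 1" using a by simp
    show "(\<integral>x. cmod (w x) powr q \<partial>M) / b powr q \<le> 1" using b by simp
  qed (use pq a b in auto)
  also have "\<dots> = lp_norm M p f * b + e" unfolding pq(3) a_def using b by (simp add: distrib_right)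
  finally show "(\<integral>x. cmod (f x) * cmod (w x) \<partial>M) \<le> lp_norm M p f * b + e" .
qed

text \<open>Source of \<open>min 2 p\<close>. For \<open>p = 1\<close> the bound on \<open>w\<close>
  suffices. For \<open>1 < p \<le> 2\<close> the conjugate exponent \<open>q\<close> is at least 2,
  and \<open>cmod (w x) \<le> 1\<close> bounds \<open>cmod (w x) powr q\<close> by the square. For
  \<open>p > 2\<close> the q-norm is at most the 2-norm, since the total mass is 1.\<close>

lemma (in prob_space) pairing_bound:
  assumes p: "1 \<le> p" and f: "f \<in> lp_space M p"
    and w: "w \<in> borel_measurable M" "\<And>x. cmod (w x) \<le> 1"
    and d: "d \<ge> 1" "(\<integral>x. (cmod (w x))\<^sup>2 \<partial>M) \<le> 1 / d"
  shows "integrable M (\<lambda>x. f x * cnj (w x))"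
    and "cmod (\<integral>x. f x * cnj (w x) \<partial>M) \<le> d powr (1 / min 2 p - 1) * lp_norm M p f"
proof -
  have fm: "f \<in> borel_measurable M" by (rule lp_space_measurable[OF f])
  have fi: "integrable M (\<lambda>x. cmod (f x) powr p)" by (rule lp_space_integrable[OF f])
  have i1: "integrable M (\<lambda>x. cmod (f x))"
  proof (rule Bochner_Integration.integrable_bound)
    show "integrable M (\<lambda>x. 1 + cmod (f x) powr p)" using fi by simp
    show "AE x in M. norm (cmod (f x)) \<le> norm (1 + cmod (f x) powr p)"
      using powr_le_one_add_powr[of 1 p "cmod (f _)"] p by (intro AE_I2) simp
  qed (use fm in simp)
  have fw: "cmod (f x) * cmod (w x) \<le> cmod (f x)" for x using w(2)[of x] by (simp add: mult_left_le)
  have cm: "(\<lambda>x. cnj (w x)) \<in> borel_measurable M"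
    using measurable_compose[OF w(1) borel_measurable_continuous_onI[of cnj]] by (auto intro: continuous_intros)
  show "integrable M (\<lambda>x. f x * cnj (w x))"
    by (rule Bochner_Integration.integrable_bound[OF i1]) (use fm cm fw in \<open>auto simp: norm_mult\<close>)
  have wi: "integrable M (\<lambda>x. (cmod (w x))\<^sup>2)"
    by (rule integrable_const_bound[of _ 1]) (use w in \<open>auto simp: power_le_one\<close>)
  have le: "cmod (\<integral>x. f x * cnj (w x) \<partial>M) \<le> (\<integral>x. cmod (f x) * cmod (w x) \<partial>M)"
    by (rule order_trans[OF integral_norm_bound]) (simp add: norm_mult)
  consider "p = 1" | "1 < p" "p \<le> 2" | "2 < p" using p by linarith
  then show "cmod (\<integral>x. f x * cnj (w x) \<partial>M) \<le> d powr (1 / min 2 p - 1) * lp_norm M p f"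
  proof cases
    case 1
    have "(\<integral>x. cmod (f x) * cmod (w x) \<partial>M) \<le> (\<integral>x. cmod (f x) \<partial>M)"
      using fw i1 fm w(1) by (intro integral_mono) (auto intro!: Bochner_Integration.integrable_bound[OF i1])
    also have "\<dots> = lp_norm M p f" unfolding lp_norm_def 1 by simp
    finally show ?thesis using le 1 d by (simp add: min_def)
  next
    case 2
    define q where "q = p / (p - 1)"
    have q: "1 < q" "1 / p + 1 / q = 1" "q \<ge> 2" using 2 by (auto simp: q_def field_simps)
    have "(\<integral>x. cmod (w x) powr q \<partial>M) \<le> (\<integral>x. (cmod (w x))\<^sup>2 \<partial>M)"
    proof (rule integral_mono')
      show "integrable M (\<lambda>x. (cmod (w x))\<^sup>2)" by (rule wi)
      fix x
      have "cmod (w x) powr q \<le> cmod (w x) powr 2" using q(3) w(2)[of x] by (intro powr_mono') auto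
      also have "\<dots> = (cmod (w x))\<^sup>2" by (cases "w x = 0") (auto simp: powr_numeral)
      finally show "cmod (w x) powr q \<le> (cmod (w x))\<^sup>2" .
    qed simp
    also note d(2)
    also have "1 / d = d powr (- 1)" using d by (simp add: powr_minus_divide)
    also have "\<dots> = (d powr (- 1 / q)) powr q" unfolding powr_powr using q by simp
    finally have "(\<integral>x. cmod (f x) * cmod (w x) \<partial>M) \<le> lp_norm M p f * d powr (- 1 / q)"
      using d by (intro holder_bound[OF 2(1) q(1,2) f w]) auto
    also have "- 1 / q = 1 / min 2 p - 1" using q(2) 2 by (simp add: min_def)
    finally show ?thesis using le by (simp add: mult.commute)
  next
    case 3
    define q where "q = p / (p - 1)"
    have q: "1 < q" "1 / p + 1 / q = 1" "q < 2" using 3 by (auto simp: q_def field_simps)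
    define \<beta> where "\<beta> = d powr (- 1 / 2)"
    have \<beta>0: "\<beta> > 0" using d by (simp add: \<beta>_def)
    have "\<beta> powr 2 = d powr (- 1)" unfolding \<beta>_def powr_powr by simp
    also have "\<dots> = 1 / d" using d by (simp add: powr_minus_divide)
    finally have \<beta>: "\<beta> > 0" "\<beta> powr 2 = 1 / d" using \<beta>0 by auto
    \<comment> \<open>Weighted Young inequality against the constant \<open>\<beta>\<close>, the
      bound for the 2-norm; integrated, it does the work of Jensen's inequality.\<close>
    have pt: "\<beta> powr (2 - q) * cmod (w x) powr q \<le> q / 2 * (cmod (w x))\<^sup>2 + (1 - q / 2) * \<beta> powr 2" for x
    proof (cases "w x = 0")
      case True
      then show ?thesis using q by simp
    next
      case False
      have "(cmod (w x) powr 2) powr (q / 2) * (\<beta> powr 2) powr (1 - q / 2) \<le> q / 2 * cmod (w x) powr 2 + (1 - q / 2) * \<beta> powr 2"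
        using q False \<beta> d by (intro Youngs_inequality_0) auto
      moreover have "(cmod (w x) powr 2) powr (q / 2) = cmod (w x) powr q" unfolding powr_powr by simp
      moreover have "(\<beta> powr 2) powr (1 - q / 2) = \<beta> powr (2 - q)" unfolding powr_powr by (simp add: algebra_simps)
      moreover have "cmod (w x) powr 2 = (cmod (w x))\<^sup>2" using False by (simp add: powr_numeral)
      ultimately show ?thesis by (simp add: mult.commute)
    qed
    have ii: "integrable M (\<lambda>x. cmod (w x) powr q)"
    proof (rule integrable_const_bound[of _ 1])
      show "AE x in M. norm (cmod (w x) powr q) \<le> 1"
      proof (rule AE_I2)
        fix x
        have "cmod (w x) powr q \<le> 1 powr q" using w(2)[of x] q by (intro powr_mono2) auto
        then show "norm (cmod (w x) powr q) \<le> 1" by simp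
      qed
    qed (use w(1) in simp)
    have "\<beta> powr (2 - q) * (\<integral>x. cmod (w x) powr q \<partial>M) = (\<integral>x. \<beta> powr (2 - q) * cmod (w x) powr q \<partial>M)" by simp
    also have "\<dots> \<le> (\<integral>x. q / 2 * (cmod (w x))\<^sup>2 + (1 - q / 2) * \<beta> powr 2 \<partial>M)"
      using wi ii pt by (intro integral_mono) auto
    also have "\<dots> = q / 2 * (\<integral>x. (cmod (w x))\<^sup>2 \<partial>M) + (1 - q / 2) * \<beta> powr 2"
      using wi prob_space by simp
    also have "\<dots> \<le> q / 2 * \<beta> powr 2 + (1 - q / 2) * \<beta> powr 2"
      unfolding \<beta>(2) using d(2) q by (intro add_mono mult_left_mono) auto
    also have "\<dots> = \<beta> powr (2 - q) * \<beta> powr q" using \<beta>(1) by (simp add: powr_add[symmetric] algebra_simps)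
    finally have "(\<integral>x. cmod (w x) powr q \<partial>M) \<le> \<beta> powr q" using \<beta>(1) by simp
    then have "(\<integral>x. cmod (f x) * cmod (w x) \<partial>M) \<le> lp_norm M p f * \<beta>"
      using 3 \<beta> by (intro holder_bound[OF _ q(1,2) f w]) auto
    then show ?thesis using le 3 by (simp add: \<beta>_def min_def mult.commute)
  qed
qed

section \<open>Decomposition on one class\<close>

lemma sum_cmod_sq_col:
  assumes M: "M \<in> carrier_mat n m" and j: "j < m"
  shows "complex_of_real (\<Sum>k<n. (cmod (M $$ (k, j)))\<^sup>2) = (mat_adjoint M * M) $$ (j, j)"
  unfolding of_real_sum mat_mult_index[OF mat_adjoint_carrier[OF M] M j j] using M j
  by (intro sum.cong) (auto simp: complex_norm_square mult.commute simp del: of_real_power)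

lemma unitary_mult_col_norm:
  assumes U: "unitary_mat d U" and Z: "Z \<in> carrier_mat d d" and j: "j < d"
  shows "(\<Sum>k<d. (cmod ((U * Z) $$ (k, j)))\<^sup>2) = (\<Sum>k<d. (cmod (Z $$ (k, j)))\<^sup>2)"
proof -
  have Uc: "U \<in> carrier_mat d d" and inv: "mat_adjoint U * U = 1\<^sub>m d" using U by (auto simp: unitary_mat_def)
  have UZ: "U * Z \<in> carrier_mat d d" by (rule mult_carrier_mat[OF Uc Z])
  have "mat_adjoint (U * Z) * (U * Z) = mat_adjoint Z * (mat_adjoint U * U) * Z"
    unfolding mat_adjoint_mult[OF Uc Z] using Uc Z
    by (simp add: assoc_mult_mat[of _ d d _ d _ d] mult_carrier_mat[of _ d d _ d])
  also have "\<dots> = mat_adjoint Z * Z" unfolding inv right_mult_one_mat[OF mat_adjoint_carrier[OF Z]] ..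
  finally have "complex_of_real (\<Sum>k<d. (cmod ((U * Z) $$ (k, j)))\<^sup>2) = of_real (\<Sum>k<d. (cmod (Z $$ (k, j)))\<^sup>2)"
    unfolding sum_cmod_sq_col[OF UZ j] sum_cmod_sq_col[OF Z j] by simp
  then show ?thesis by (simp only: of_real_eq_iff)
qed

text \<open>The discrete Fourier matrix with signed columns; what matters is that all its entries have modulus
  \<open>d\<^sup>-\<^sup>1\<^sup>/\<^sup>2\<close>.\<close>

definition twist :: "nat \<Rightarrow> nat set \<Rightarrow> nat \<Rightarrow> nat \<Rightarrow> complex" where
  "twist d S i k = of_real (sgn_of S k) * dft d i k"

lemma twist_norm: "d > 0 \<Longrightarrow> cmod (twist d S i k) = 1 / sqrt (real d)"
  by (simp add: twist_def norm_mult dft_norm sgn_of_def)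

lemma twist_row: "d > 0 \<Longrightarrow> (\<Sum>k<d. (cmod (twist d S i k))\<^sup>2) = 1"
  by (simp add: twist_norm power_divide)

lemma twist_orthogonal:
  assumes "d > 0" "k < d" "l < d"
  shows "(\<Sum>i<d. cnj (twist d S i k) * twist d S i l) = (if k = l then 1 else 0)"
proof -
  have "(\<Sum>i<d. cnj (twist d S i k) * twist d S i l)
      = of_real (sgn_of S k * sgn_of S l) * (\<Sum>i<d. cnj (dft d i k) * dft d i l)"
    unfolding sum_distrib_left by (intro sum.cong) (auto simp: twist_def)
  also have "\<dots> = (if k = l then 1 else 0)"
    unfolding dft_orthogonal[OF assms] by (simp add: sgn_of_def)
  finally show ?thesis .
qed

context haar_group
begin

text \<open>Entry \<open>(i, j)\<close> of \<open>V \<xi>(x) Z\<close>, where \<open>V\<close> is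
  the matrix of \<open>twist\<close>. The functionals take \<open>Z = Q\<close>, the output
  functions \<open>Z = \<sigma> * Q\<close>.\<close>

definition twisted_coef :: "nat \<Rightarrow> nat set \<Rightarrow> ('g \<Rightarrow> complex mat) \<Rightarrow> complex mat \<Rightarrow> nat \<Rightarrow> nat \<Rightarrow> 'g \<Rightarrow> complex" where
  "twisted_coef d S \<xi> Z i j x = (\<Sum>k<d. twist d S i k * (\<xi> x * Z) $$ (k, j))"

lemma rep_mult_index:
  assumes "unitary_rep \<xi>" "Z \<in> carrier_mat (rep_dim \<xi>) (rep_dim \<xi>)" "k < rep_dim \<xi>" "j < rep_dim \<xi>"
  shows "(\<xi> x * Z) $$ (k, j) = (\<Sum>l<rep_dim \<xi>. \<xi> x $$ (k, l) * Z $$ (l, j))"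
  by (rule mat_mult_index[OF unitary_rep_carrier[OF assms(1)] assms(2-4)])

lemma continuous_twisted_coef:
  assumes "unitary_rep \<xi>" "Z \<in> carrier_mat (rep_dim \<xi>) (rep_dim \<xi>)" "j < rep_dim \<xi>"
  shows "continuous_fun (twisted_coef (rep_dim \<xi>) S \<xi> Z i j)"
proof -
  have eq: "twisted_coef (rep_dim \<xi>) S \<xi> Z i j = (\<lambda>x. \<Sum>k<rep_dim \<xi>. twist (rep_dim \<xi>) S i k * (\<Sum>l<rep_dim \<xi>. \<xi> x $$ (k, l) * Z $$ (l, j)))"
    unfolding twisted_coef_def using assms by (intro ext sum.cong refl) (simp add: rep_mult_index del: index_mult_mat)
  show ?thesis
    unfolding eq using assms by (intro continuous_on_sum continuous_on_mult continuous_on_const coef_continuous) auto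
qed

text \<open>Khintchine's inequality at each point \<open>x\<close>: the unitary
  \<open>\<xi> x\<close> keeps the column norm \<open>s\<close>, and the Fourier entries divide it
  by \<open>sqrt d\<close>. Integration gives the average of the \<open>p\<close>-th powers; the
  passage to \<open>r \<le> p\<close> is \<open>x powr r \<le> 1 + x powr p\<close> for the norm
  relative to \<open>t\<close>.\<close>

lemma twisted_coef_average:
  assumes \<xi>: "unitary_rep \<xi>" "rep_dim \<xi> > 0" and Z: "Z \<in> carrier_mat (rep_dim \<xi>) (rep_dim \<xi>)" and j: "j < rep_dim \<xi>"
    and p: "1 \<le> p" and r: "0 < r" "r \<le> p"
    and s: "s \<ge> 0" "(\<Sum>k<rep_dim \<xi>. (cmod (Z $$ (k, j)))\<^sup>2) = s\<^sup>2"
  shows "(\<Sum>S\<in>Pow {..<rep_dim \<xi>}. lp_norm \<mu> p (twisted_coef (rep_dim \<xi>) S \<xi> Z i j) powr r)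
    \<le> 2 ^ rep_dim \<xi> * ((1 + khintchine_const p) * (s / sqrt (rep_dim \<xi>)) powr r)"
proof -
  let ?d = "rep_dim \<xi>" and ?g = "\<lambda>S. twisted_coef (rep_dim \<xi>) S \<xi> Z i j"
  define t where "t = s / sqrt ?d"
  have t: "t \<ge> 0" using s by (simp add: t_def)
  have p0: "p > 0" using p by simp
  have C: "continuous_fun (?g S)" for S by (rule continuous_twisted_coef[OF \<xi>(1) Z j])
  have L: "?g S \<in> lp_space \<mu> p" for S by (rule continuous_lp_space[OF p C])
  have pt: "(\<Sum>S\<in>Pow {..<?d}. cmod (?g S x) powr p) \<le> 2 ^ ?d * khintchine_const p * t powr p" for x
  proof -
    define a where "a k = dft ?d i k * (\<xi> x * Z) $$ (k, j)" for k
    have "unitary_mat ?d (\<xi> x)" using \<xi>(1) by (simp add: unitary_rep_def)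
    then have cn: "(\<Sum>k<?d. (cmod ((\<xi> x * Z) $$ (k, j)))\<^sup>2) = s\<^sup>2"
      using unitary_mult_col_norm[OF _ Z j] s(2) by simp
    have "(\<Sum>k<?d. (cmod (a k))\<^sup>2) = (\<Sum>k<?d. (cmod ((\<xi> x * Z) $$ (k, j)))\<^sup>2) / real ?d"
      unfolding sum_divide_distrib using \<xi>(2)
      by (intro sum.cong) (auto simp: a_def norm_mult dft_norm power_mult_distrib power_divide)
    also have "\<dots> = t\<^sup>2" unfolding cn t_def by (simp add: power_divide)
    finally have "(\<Sum>k<?d. (cmod (a k))\<^sup>2) \<le> t\<^sup>2" by simp
    from khintchine[OF _ p0 this t] have "(\<Sum>S\<in>Pow {..<?d}. cmod (\<Sum>k<?d. of_real (sgn_of S k) * a k) powr p)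
        \<le> 2 ^ ?d * khintchine_const p * t powr p" by simp
    moreover have "(\<Sum>k<?d. of_real (sgn_of S k) * a k) = ?g S x" for S
      unfolding twisted_coef_def twist_def a_def by (simp add: mult.assoc)
    ultimately show ?thesis by simp
  qed
  have int: "(\<Sum>S\<in>Pow {..<?d}. lp_norm \<mu> p (?g S) powr p) \<le> 2 ^ ?d * khintchine_const p * t powr p"
  proof -
    have "(\<Sum>S\<in>Pow {..<?d}. lp_norm \<mu> p (?g S) powr p) = (\<integral>x. (\<Sum>S\<in>Pow {..<?d}. cmod (?g S x) powr p) \<partial>\<mu>)"
      unfolding lp_norm_powr[OF p0] by (rule Bochner_Integration.integral_sum[symmetric]) (rule lp_space_integrable[OF L])
    also have "\<dots> \<le> (\<integral>x. 2 ^ ?d * khintchine_const p * t powr p \<partial>\<mu>)"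
      by (intro integral_mono pt Bochner_Integration.integrable_sum lp_space_integrable L) simp
    finally show ?thesis by simp
  qed
  show ?thesis
    unfolding t_def[symmetric]
  proof (cases "t = 0")
    case True
    \<comment> \<open>Here norms cannot be measured relative to \<open>t\<close>, but the integrated
      bound already makes all of them vanish.\<close>
    then have le0: "(\<Sum>S\<in>Pow {..<?d}. lp_norm \<mu> p (?g S) powr p) \<le> 0" using int by simp
    have z: "lp_norm \<mu> p (?g S) = 0" if S: "S \<in> Pow {..<?d}" for S
    proof (rule ccontr)
      assume "lp_norm \<mu> p (?g S) \<noteq> 0"
      then have "0 < lp_norm \<mu> p (?g S) powr p" by simp
      also have "\<dots> \<le> (\<Sum>S\<in>Pow {..<?d}. lp_norm \<mu> p (?g S) powr p)"
        by (rule member_le_sum[OF S]) auto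
      finally show False using le0 by simp
    qed
    have "(\<Sum>S\<in>Pow {..<?d}. lp_norm \<mu> p (?g S) powr r) = 0"
      using z by (intro sum.neutral ballI) simp
    then show "(\<Sum>S\<in>Pow {..<?d}. lp_norm \<mu> p (?g S) powr r) \<le> 2 ^ ?d * ((1 + khintchine_const p) * t powr r)"
      using True by simp
  next
    case False
    then have tp: "t > 0" using t by simp
    have "(\<Sum>S\<in>Pow {..<?d}. lp_norm \<mu> p (?g S) powr r)
       \<le> (\<Sum>S\<in>Pow {..<?d}. t powr r * (1 + lp_norm \<mu> p (?g S) powr p / t powr p))"
    proof (rule sum_mono)
      fix S
      have "(lp_norm \<mu> p (?g S) / t) powr r \<le> 1 + (lp_norm \<mu> p (?g S) / t) powr p"
        using tp by (intro powr_le_one_add_powr r divide_nonneg_pos lp_norm_nonneg)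
      then have "t powr r * (lp_norm \<mu> p (?g S) / t) powr r \<le> t powr r * (1 + (lp_norm \<mu> p (?g S) / t) powr p)"
        by (intro mult_left_mono) auto
      then show "lp_norm \<mu> p (?g S) powr r \<le> t powr r * (1 + lp_norm \<mu> p (?g S) powr p / t powr p)"
        using tp lp_norm_nonneg[of \<mu> p "?g S"] by (simp add: powr_divide)
    qed
    also have "\<dots> = t powr r * (2 ^ ?d + (\<Sum>S\<in>Pow {..<?d}. lp_norm \<mu> p (?g S) powr p) / t powr p)"
      by (simp add: sum_distrib_left[symmetric] sum.distrib sum_divide_distrib card_Pow)
    also have "\<dots> \<le> t powr r * (2 ^ ?d + 2 ^ ?d * khintchine_const p)"
    proof (intro mult_left_mono add_left_mono)
      show "(\<Sum>S\<in>Pow {..<?d}. lp_norm \<mu> p (?g S) powr p) / t powr p \<le> 2 ^ ?d * khintchine_const p"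
        using int tp by (simp add: pos_divide_le_eq)
    qed simp
    finally show "(\<Sum>S\<in>Pow {..<?d}. lp_norm \<mu> p (?g S) powr r) \<le> 2 ^ ?d * ((1 + khintchine_const p) * t powr r)"
      by (simp add: algebra_simps)
  qed
qed

text \<open>Some choice of signs does not exceed the average. The average is taken after summing
  over \<open>i\<close> and \<open>j\<close>, so a single \<open>S\<close> serves all entries; the
  \<open>d\<close> values of \<open>i\<close> turn \<open>(s j / sqrt d) powr r\<close> into
  \<open>d powr (1 - r / 2) * s j powr r\<close>.\<close>

lemma good_signs:
  assumes \<xi>: "unitary_rep \<xi>" "rep_dim \<xi> > 0" and Z: "Z \<in> carrier_mat (rep_dim \<xi>) (rep_dim \<xi>)"
    and p: "1 \<le> p" and r: "0 < r" "r \<le> p"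
    and s: "\<And>j. s j \<ge> 0" "\<And>j. j < rep_dim \<xi> \<Longrightarrow> (\<Sum>k<rep_dim \<xi>. (cmod (Z $$ (k, j)))\<^sup>2) = (s j)\<^sup>2"
  obtains S where "(\<Sum>i<rep_dim \<xi>. \<Sum>j<rep_dim \<xi>. lp_norm \<mu> p (twisted_coef (rep_dim \<xi>) S \<xi> Z i j) powr r)
    \<le> (1 + khintchine_const p) * (real (rep_dim \<xi>) powr (1 - r / 2) * (\<Sum>j<rep_dim \<xi>. s j powr r))"
proof -
  let ?d = "rep_dim \<xi>" and ?n = "\<lambda>S i j. lp_norm \<mu> p (twisted_coef (rep_dim \<xi>) S \<xi> Z i j) powr r"
  let ?B = "(1 + khintchine_const p) * (real ?d powr (1 - r / 2) * (\<Sum>j<?d. s j powr r))"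
  have dr: "real ?d * (s j / sqrt ?d) powr r = real ?d powr (1 - r / 2) * s j powr r" for j
  proof -
    have "(s j / sqrt ?d) powr r = s j powr r / sqrt ?d powr r" using s(1) by (simp add: powr_divide)
    also have "sqrt ?d powr r = real ?d powr (r / 2)"
      by (simp add: powr_half_sqrt[symmetric] powr_powr)
    also have "real ?d * (s j powr r / real ?d powr (r / 2)) = real ?d powr (1 - r / 2) * s j powr r"
      using \<xi>(2) by (simp add: powr_diff)
    finally show ?thesis .
  qed
  have "(\<Sum>S\<in>Pow {..<?d}. \<Sum>i<?d. \<Sum>j<?d. ?n S i j) = (\<Sum>i<?d. \<Sum>S\<in>Pow {..<?d}. \<Sum>j<?d. ?n S i j)"
    by (rule sum.swap)
  also have "\<dots> = (\<Sum>i<?d. \<Sum>j<?d. \<Sum>S\<in>Pow {..<?d}. ?n S i j)"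
    by (rule sum.cong[OF refl sum.swap])
  also have "\<dots> \<le> (\<Sum>i<?d. \<Sum>j<?d. 2 ^ ?d * ((1 + khintchine_const p) * (s j / sqrt ?d) powr r))"
    by (intro sum_mono twisted_coef_average[OF \<xi> Z _ p r s(1)] s(2)) auto
  also have "\<dots> = 2 ^ ?d * ((1 + khintchine_const p) * (\<Sum>j<?d. real ?d * (s j / sqrt ?d) powr r))"
    unfolding sum_distrib_left[symmetric] sum_constant card_lessThan by (simp only: mult_ac)
  also have "\<dots> = 2 ^ ?d * ?B" unfolding dr sum_distrib_left[symmetric] ..
  finally have tot: "(\<Sum>S\<in>Pow {..<?d}. \<Sum>i<?d. \<Sum>j<?d. ?n S i j) \<le> 2 ^ ?d * ?B" .
  have "\<exists>S\<in>Pow {..<?d}. (\<Sum>i<?d. \<Sum>j<?d. ?n S i j) \<le> ?B"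
  proof (rule ccontr)
    assume "\<not> (\<exists>S\<in>Pow {..<?d}. (\<Sum>i<?d. \<Sum>j<?d. ?n S i j) \<le> ?B)"
    then have "(\<Sum>S\<in>Pow {..<?d}. ?B) < (\<Sum>S\<in>Pow {..<?d}. \<Sum>i<?d. \<Sum>j<?d. ?n S i j)"
      by (intro sum_strict_mono) (auto simp: not_le)
    then show False using tot by (simp add: card_Pow)
  qed
  then show thesis using that by blast
qed

lemma twisted_coef_expand:
  assumes "unitary_rep \<xi>" "Q \<in> carrier_mat (rep_dim \<xi>) (rep_dim \<xi>)" "j < rep_dim \<xi>"
  shows "twisted_coef (rep_dim \<xi>) S \<xi> Q i j =
    (\<lambda>x. \<Sum>(k, l)\<in>{..<rep_dim \<xi>} \<times> {..<rep_dim \<xi>}. twist (rep_dim \<xi>) S i k * Q $$ (l, j) * \<xi> x $$ (k, l))"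
proof
  fix x
  have "twisted_coef (rep_dim \<xi>) S \<xi> Q i j x =
    (\<Sum>k<rep_dim \<xi>. \<Sum>l<rep_dim \<xi>. twist (rep_dim \<xi>) S i k * Q $$ (l, j) * \<xi> x $$ (k, l))"
    unfolding twisted_coef_def using assms
    by (intro sum.cong refl) (simp add: rep_mult_index sum_distrib_left mult_ac del: index_mult_mat)
  then show "twisted_coef (rep_dim \<xi>) S \<xi> Q i j x =
    (\<Sum>(k, l)\<in>{..<rep_dim \<xi>} \<times> {..<rep_dim \<xi>}. twist (rep_dim \<xi>) S i k * Q $$ (l, j) * \<xi> x $$ (k, l))"
    by (simp add: sum.cartesian_product)
qed

lemma ip_twisted_coef:
  assumes f: "continuous_fun f" and \<xi>: "unitary_rep \<xi>" and Q: "Q \<in> carrier_mat (rep_dim \<xi>) (rep_dim \<xi>)" and j: "j < rep_dim \<xi>"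
  shows "ip f (twisted_coef (rep_dim \<xi>) S \<xi> Q i j) =
    (\<Sum>k<rep_dim \<xi>. \<Sum>l<rep_dim \<xi>. cnj (twist (rep_dim \<xi>) S i k) * cnj (Q $$ (l, j)) * ip f (\<lambda>x. \<xi> x $$ (k, l)))"
proof -
  let ?I = "{..<rep_dim \<xi>} \<times> {..<rep_dim \<xi>}"
  have "ip f (\<lambda>x. \<Sum>z\<in>?I. (case z of (k, l) \<Rightarrow> twist (rep_dim \<xi>) S i k * Q $$ (l, j) * \<xi> x $$ (k, l)))
    = (\<Sum>z\<in>?I. ip f (\<lambda>x. case z of (k, l) \<Rightarrow> twist (rep_dim \<xi>) S i k * Q $$ (l, j) * \<xi> x $$ (k, l)))"
    using f coef_continuous[OF \<xi>] by (intro ip_sum_right) (auto intro!: continuous_on_mult continuous_on_const)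
  also have "\<dots> = (\<Sum>(k, l)\<in>?I. cnj (twist (rep_dim \<xi>) S i k) * cnj (Q $$ (l, j)) * ip f (\<lambda>x. \<xi> x $$ (k, l)))"
    by (intro sum.cong) (auto simp: ip_scale_right)
  finally show ?thesis unfolding twisted_coef_expand[OF \<xi> Q j] by (simp add: sum.cartesian_product)
qed

lemma ip_coef_twisted:
  assumes \<xi>: "irreducible_unitary_rep \<xi>" and Q: "Q \<in> carrier_mat (rep_dim \<xi>) (rep_dim \<xi>)" and j: "j < rep_dim \<xi>"
    and ab: "a < rep_dim \<xi>" "b < rep_dim \<xi>"
  shows "ip (\<lambda>x. \<xi> x $$ (a, b)) (twisted_coef (rep_dim \<xi>) S \<xi> Q i j)
    = cnj (twist (rep_dim \<xi>) S i a) * cnj (Q $$ (b, j)) / of_nat (rep_dim \<xi>)"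
proof -
  let ?d = "rep_dim \<xi>" and ?V = "twist (rep_dim \<xi>) S"
  note U = irreducible_unitary[OF \<xi>]
  have "ip (\<lambda>x. \<xi> x $$ (a, b)) (twisted_coef ?d S \<xi> Q i j)
    = (\<Sum>k<?d. \<Sum>l<?d. cnj (?V i k) * cnj (Q $$ (l, j)) * ip (\<lambda>x. \<xi> x $$ (a, b)) (\<lambda>x. \<xi> x $$ (k, l)))"
    by (rule ip_twisted_coef[OF coef_continuous[OF U ab] U Q j])
  also have "\<dots> = (\<Sum>k<?d. \<Sum>l<?d. if l = b then if k = a then cnj (?V i a) * cnj (Q $$ (b, j)) / of_nat ?d else 0 else 0)"
    using ab by (intro sum.cong refl) (auto simp: schur_orthogonality[OF \<xi>])
  also have "\<dots> = cnj (?V i a) * cnj (Q $$ (b, j)) / of_nat ?d"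
    using ab by simp
  finally show ?thesis .
qed

text \<open>By Schur orthogonality the squared norm is \<open>1 / d\<close> times the squared norms
  of a row of \<open>V\<close> and of a column of \<open>Q\<close>, both equal to 1.\<close>

lemma sqn_twisted_coef:
  assumes \<xi>: "irreducible_unitary_rep \<xi>" and Q: "unitary_mat (rep_dim \<xi>) Q" and j: "j < rep_dim \<xi>"
  shows "sqn (twisted_coef (rep_dim \<xi>) S \<xi> Q i j) = 1 / real (rep_dim \<xi>)"
proof -
  let ?d = "rep_dim \<xi>" and ?V = "twist (rep_dim \<xi>) S" and ?w = "twisted_coef (rep_dim \<xi>) S \<xi> Q i j"
  note U = irreducible_unitary[OF \<xi>] and Qc = unitary_mat_carrier[OF Q]
  have d: "?d > 0" using j by simp
  have cw: "continuous_fun ?w" by (rule continuous_twisted_coef[OF U Qc j])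
  have "ip ?w ?w = (\<Sum>k<?d. \<Sum>l<?d. cnj (?V i k) * cnj (Q $$ (l, j)) * ip ?w (\<lambda>x. \<xi> x $$ (k, l)))"
    by (rule ip_twisted_coef[OF cw U Qc j])
  also have "\<dots> = (\<Sum>k<?d. \<Sum>l<?d. cnj (?V i k) * cnj (Q $$ (l, j)) * (?V i k * Q $$ (l, j) / of_nat ?d))"
  proof (intro sum.cong refl)
    fix k l assume "k \<in> {..<?d}" "l \<in> {..<?d}"
    then have "ip ?w (\<lambda>x. \<xi> x $$ (k, l)) = cnj (cnj (?V i k) * cnj (Q $$ (l, j)) / of_nat ?d)"
      using ip_coef_twisted[OF \<xi> Qc j, of k l S i] ip_cnj[of "\<lambda>x. \<xi> x $$ (k, l)" ?w] by simp
    then show "cnj (?V i k) * cnj (Q $$ (l, j)) * ip ?w (\<lambda>x. \<xi> x $$ (k, l))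
      = cnj (?V i k) * cnj (Q $$ (l, j)) * (?V i k * Q $$ (l, j) / of_nat ?d)" by simp
  qed
  also have "\<dots> = (\<Sum>k<?d. cnj (?V i k) * ?V i k) * (\<Sum>l<?d. cnj (Q $$ (l, j)) * Q $$ (l, j)) / of_nat ?d"
    unfolding sum_product sum_divide_distrib by (intro sum.cong refl) simp
  also have "(\<Sum>k<?d. cnj (?V i k) * ?V i k) = of_real (\<Sum>k<?d. (cmod (?V i k))\<^sup>2)"
    unfolding of_real_sum by (intro sum.cong) (auto simp: complex_norm_square mult.commute simp del: of_real_power)
  also have "(\<Sum>k<?d. (cmod (?V i k))\<^sup>2) = 1" by (rule twist_row[OF d])
  also have "(\<Sum>l<?d. cnj (Q $$ (l, j)) * Q $$ (l, j)) = 1" using unitary_mat_cols[OF Q j j] by simp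
  finally show ?thesis by (simp add: sqn_def)
qed

text \<open>Cauchy-Schwarz between a row of \<open>V\<close> and a column of the unitary matrix
  \<open>\<xi> x * Q\<close>.\<close>

lemma twisted_coef_le_1:
  assumes \<xi>: "unitary_rep \<xi>" and Q: "unitary_mat (rep_dim \<xi>) Q" and j: "j < rep_dim \<xi>"
  shows "cmod (twisted_coef (rep_dim \<xi>) S \<xi> Q i j x) \<le> 1"
proof -
  let ?d = "rep_dim \<xi>" and ?V = "twist (rep_dim \<xi>) S"
  have d: "?d > 0" using j by simp
  have "unitary_mat ?d (\<xi> x * Q)" using \<xi> Q by (intro unitary_mat_mult) (auto simp: unitary_rep_def)
  then have c1: "(\<Sum>k<?d. (cmod ((\<xi> x * Q) $$ (k, j)))\<^sup>2) = 1"
  proof -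
    assume u: "unitary_mat ?d (\<xi> x * Q)"
    have "complex_of_real (\<Sum>k<?d. (cmod ((\<xi> x * Q) $$ (k, j)))\<^sup>2) = 1"
      unfolding sum_cmod_sq_col[OF unitary_mat_carrier[OF u] j] using u j by (simp add: unitary_mat_def)
    then show ?thesis by (simp only: of_real_eq_1_iff)
  qed
  have "cmod (twisted_coef ?d S \<xi> Q i j x) \<le> (\<Sum>k<?d. cmod (?V i k) * cmod ((\<xi> x * Q) $$ (k, j)))"
    unfolding twisted_coef_def by (rule order_trans[OF norm_sum]) (simp add: norm_mult)
  then have "(cmod (twisted_coef ?d S \<xi> Q i j x))\<^sup>2 \<le> (\<Sum>k<?d. cmod (?V i k) * cmod ((\<xi> x * Q) $$ (k, j)))\<^sup>2"
    by (intro power_mono) auto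
  also have "\<dots> \<le> (\<Sum>k<?d. (cmod (?V i k))\<^sup>2) * (\<Sum>k<?d. (cmod ((\<xi> x * Q) $$ (k, j)))\<^sup>2)"
    by (rule Cauchy_Schwarz_ineq_sum)
  also have "\<dots> = 1" unfolding c1 twist_row[OF d] by simp
  finally show ?thesis by (simp add: power2_le_imp_le abs_square_le_1)
qed

text \<open>The factor \<open>of_nat d\<close> cancels Schur's \<open>1 / d\<close>. Summing over
  \<open>i\<close> removes \<open>V\<close> by the orthogonality of its columns, and summing over
  \<open>j\<close> leaves \<open>Q * mat_adjoint Q = 1\<close>.\<close>

lemma twisted_reconstruction:
  assumes \<xi>: "irreducible_unitary_rep \<xi>" and Q: "unitary_mat (rep_dim \<xi>) Q" and \<sigma>: "\<sigma> \<in> carrier_mat (rep_dim \<xi>) (rep_dim \<xi>)"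
    and ab: "a < rep_dim \<xi>" "b < rep_dim \<xi>"
  shows "(\<Sum>i<rep_dim \<xi>. \<Sum>j<rep_dim \<xi>. ip (\<lambda>x. \<xi> x $$ (a, b)) (twisted_coef (rep_dim \<xi>) S \<xi> Q i j) *
      (of_nat (rep_dim \<xi>) * twisted_coef (rep_dim \<xi>) S \<xi> (\<sigma> * Q) i j x)) = (\<xi> x * \<sigma>) $$ (a, b)"
proof -
  let ?d = "rep_dim \<xi>" and ?V = "twist (rep_dim \<xi>) S" and ?Z = "\<xi> x * (\<sigma> * Q)"
  note U = irreducible_unitary[OF \<xi>] and Qc = unitary_mat_carrier[OF Q]
  have c: "\<xi> x \<in> carrier_mat ?d ?d" by (rule unitary_rep_carrier[OF U])
  have d: "?d > 0" using ab by simp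
  have Zc: "?Z \<in> carrier_mat ?d ?d" by (rule mult_carrier_mat[OF c mult_carrier_mat[OF \<sigma> Qc]])
  have "(\<Sum>i<?d. \<Sum>j<?d. ip (\<lambda>x. \<xi> x $$ (a, b)) (twisted_coef ?d S \<xi> Q i j) * (of_nat ?d * twisted_coef ?d S \<xi> (\<sigma> * Q) i j x))
     = (\<Sum>i<?d. \<Sum>j<?d. \<Sum>k<?d. cnj (Q $$ (b, j)) * ?Z $$ (k, j) * (cnj (?V i a) * ?V i k))"
    using d by (intro sum.cong refl) (simp add: ip_coef_twisted[OF \<xi> Qc _ ab] twisted_coef_def sum_distrib_left mult_ac)
  also have "\<dots> = (\<Sum>j<?d. \<Sum>i<?d. \<Sum>k<?d. cnj (Q $$ (b, j)) * ?Z $$ (k, j) * (cnj (?V i a) * ?V i k))"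
    by (rule sum.swap)
  also have "\<dots> = (\<Sum>j<?d. \<Sum>k<?d. \<Sum>i<?d. cnj (Q $$ (b, j)) * ?Z $$ (k, j) * (cnj (?V i a) * ?V i k))"
    by (intro sum.cong refl sum.swap)
  also have "\<dots> = (\<Sum>j<?d. \<Sum>k<?d. if k = a then cnj (Q $$ (b, j)) * ?Z $$ (a, j) else 0)"
    unfolding sum_distrib_left[symmetric] using ab by (intro sum.cong refl) (auto simp: twist_orthogonal)
  also have "\<dots> = (\<Sum>j<?d. ?Z $$ (a, j) * mat_adjoint Q $$ (j, b))"
    using ab Qc by (intro sum.cong refl) (simp add: mult.commute)
  also have "\<dots> = (?Z * mat_adjoint Q) $$ (a, b)"
    by (rule mat_mult_index[OF Zc mat_adjoint_carrier[OF Qc] ab, symmetric])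
  also have "?Z * mat_adjoint Q = \<xi> x * \<sigma> * (Q * mat_adjoint Q)"
    using c \<sigma> Qc by (simp add: assoc_mult_mat[of _ ?d ?d _ ?d _ ?d] mult_carrier_mat[of _ ?d ?d _ ?d])
  also have "\<dots> = \<xi> x * \<sigma>"
    using Q right_mult_one_mat[OF mult_carrier_mat[OF c \<sigma>]] by (simp add: unitary_mat_def)
  finally show ?thesis .
qed

text \<open>All that is needed from one class: \<open>w\<close> are the kernels of the functionals,
  \<open>y\<close> the output functions. The factor \<open>d\<close> in \<open>y\<close> contributes
  \<open>d powr r\<close>, which with \<open>d powr (1 - r / 2)\<close> from the signs gives
  \<open>d powr (1 + r / 2)\<close>. The vanishing on inequivalent representations keeps the classes
  from interacting.\<close>

lemma class_decomposition:
  assumes \<xi>: "irreducible_unitary_rep \<xi>" and \<sigma>: "\<sigma> \<in> carrier_mat (rep_dim \<xi>) (rep_dim \<xi>)"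
    and p: "1 \<le> p" and r: "0 < r" "r \<le> 1"
  shows "\<exists>y w.
    (\<forall>i<rep_dim \<xi>. \<forall>j<rep_dim \<xi>. continuous_fun (y i j) \<and> continuous_fun (w i j) \<and>
        (\<forall>x. cmod (w i j x) \<le> 1) \<and> sqn (w i j) = 1 / real (rep_dim \<xi>)) \<and>
    (\<forall>a<rep_dim \<xi>. \<forall>b<rep_dim \<xi>. \<forall>x. (\<Sum>i<rep_dim \<xi>. \<Sum>j<rep_dim \<xi>. ip (\<lambda>x. \<xi> x $$ (a, b)) (w i j) * y i j x) = (\<xi> x * \<sigma>) $$ (a, b)) \<and>
    (\<forall>\<eta>. irreducible_unitary_rep \<eta> \<longrightarrow> \<not> equivalent_reps \<xi> \<eta> \<longrightarrow>
       (\<forall>a<rep_dim \<eta>. \<forall>b<rep_dim \<eta>. \<forall>i<rep_dim \<xi>. \<forall>j<rep_dim \<xi>. ip (\<lambda>x. \<eta> x $$ (a, b)) (w i j) = 0)) \<and>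
    (\<Sum>i<rep_dim \<xi>. \<Sum>j<rep_dim \<xi>. lp_norm \<mu> p (y i j) powr r)
      \<le> (1 + khintchine_const p) * (real (rep_dim \<xi>) powr (1 + r / 2) * schatten_norm r \<sigma> powr r)"
proof -
  let ?d = "rep_dim \<xi>"
  note U = irreducible_unitary[OF \<xi>]
  have d: "?d > 0" using \<xi> by (simp add: irreducible_unitary_rep_def)
  have p0: "p > 0" and rp: "r \<le> p" using p r by auto
  obtain Q s where Q: "unitary_mat ?d Q" and s: "\<And>j. s j \<ge> 0"
    "\<And>j. j < ?d \<Longrightarrow> (\<Sum>k<?d. (cmod ((\<sigma> * Q) $$ (k, j)))\<^sup>2) = (s j)\<^sup>2"
    and sch: "\<And>q. q > 0 \<Longrightarrow> schatten_norm q \<sigma> powr q = (\<Sum>j<?d. s j powr q)"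
    using singular_values[OF \<sigma>] by metis
  note Qc = unitary_mat_carrier[OF Q]
  have Z: "\<sigma> * Q \<in> carrier_mat ?d ?d" by (rule mult_carrier_mat[OF \<sigma> Qc])
  obtain S where S: "(\<Sum>i<?d. \<Sum>j<?d. lp_norm \<mu> p (twisted_coef ?d S \<xi> (\<sigma> * Q) i j) powr r)
    \<le> (1 + khintchine_const p) * (real ?d powr (1 - r / 2) * (\<Sum>j<?d. s j powr r))"
    using good_signs[OF U d Z p r(1) rp s] by blast
  define w where "w = twisted_coef ?d S \<xi> Q"
  define y where "y i j x = of_nat ?d * twisted_coef ?d S \<xi> (\<sigma> * Q) i j x" for i j x
  have cz: "continuous_fun (twisted_coef ?d S \<xi> (\<sigma> * Q) i j)" if "j < ?d" for i j
    by (rule continuous_twisted_coef[OF U Z that])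
  have n: "lp_norm \<mu> p (y i j) = real ?d * lp_norm \<mu> p (twisted_coef ?d S \<xi> (\<sigma> * Q) i j)" if "j < ?d" for i j
    unfolding y_def using lp_space_scale(2)[OF p0 continuous_lp_space[OF p cz[OF that]], of "of_nat ?d"] by simp
  have "(\<Sum>i<?d. \<Sum>j<?d. lp_norm \<mu> p (y i j) powr r)
     = (\<Sum>i<?d. \<Sum>j<?d. real ?d powr r * lp_norm \<mu> p (twisted_coef ?d S \<xi> (\<sigma> * Q) i j) powr r)"
    using n by (intro sum.cong refl) (simp add: powr_mult)
  also have "\<dots> = real ?d powr r * (\<Sum>i<?d. \<Sum>j<?d. lp_norm \<mu> p (twisted_coef ?d S \<xi> (\<sigma> * Q) i j) powr r)"
    by (simp add: sum_distrib_left)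
  also have "\<dots> \<le> real ?d powr r * ((1 + khintchine_const p) * (real ?d powr (1 - r / 2) * (\<Sum>j<?d. s j powr r)))"
    by (intro mult_left_mono S) simp
  also have "\<dots> = (1 + khintchine_const p) * ((real ?d powr r * real ?d powr (1 - r / 2)) * schatten_norm r \<sigma> powr r)"
    by (simp only: sch[OF r(1)] mult_ac)
  also have "real ?d powr r * real ?d powr (1 - r / 2) = real ?d powr (1 + r / 2)"
    using d by (simp add: powr_add[symmetric] add.commute)
  finally have 4: "(\<Sum>i<?d. \<Sum>j<?d. lp_norm \<mu> p (y i j) powr r)
      \<le> (1 + khintchine_const p) * (real ?d powr (1 + r / 2) * schatten_norm r \<sigma> powr r)" .
  have 1: "continuous_fun (y i j) \<and> continuous_fun (w i j) \<and> (\<forall>x. cmod (w i j x) \<le> 1) \<and> sqn (w i j) = 1 / real ?d"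
    if "i < ?d" "j < ?d" for i j
    unfolding w_def y_def[abs_def]
    by (intro conjI allI continuous_on_mult continuous_on_const cz continuous_twisted_coef[OF U Qc] that
        twisted_coef_le_1[OF U Q] sqn_twisted_coef[OF \<xi> Q])
  have 2: "(\<Sum>i<?d. \<Sum>j<?d. ip (\<lambda>x. \<xi> x $$ (a, b)) (w i j) * y i j x) = (\<xi> x * \<sigma>) $$ (a, b)"
    if "a < ?d" "b < ?d" for a b x
    unfolding w_def y_def by (rule twisted_reconstruction[OF \<xi> Q \<sigma> that])
  have 3: "ip (\<lambda>x. \<eta> x $$ (a, b)) (w i j) = 0"
    if \<eta>: "irreducible_unitary_rep \<eta>" "\<not> equivalent_reps \<xi> \<eta>" and ab: "a < rep_dim \<eta>" "b < rep_dim \<eta>" and ij: "i < ?d" "j < ?d"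
    for \<eta> a b i j
    unfolding w_def ip_twisted_coef[OF coef_continuous[OF irreducible_unitary[OF \<eta>(1)] ab] U Qc ij(2)]
    using schur_orthogonality_inequivalent[OF \<eta>(1) ab \<xi> _ _ \<eta>(2)] by simp
  have g1: "\<forall>i<?d. \<forall>j<?d. continuous_fun (y i j) \<and> continuous_fun (w i j) \<and> (\<forall>x. cmod (w i j x) \<le> 1) \<and>
      sqn (w i j) = 1 / real ?d"
    using 1 by (intro allI impI)
  have g2: "\<forall>a<?d. \<forall>b<?d. \<forall>x. (\<Sum>i<?d. \<Sum>j<?d. ip (\<lambda>x. \<xi> x $$ (a, b)) (w i j) * y i j x) = (\<xi> x * \<sigma>) $$ (a, b)"
    using 2 by (intro allI impI)
  have g3: "\<forall>\<eta>. irreducible_unitary_rep \<eta> \<longrightarrow> \<not> equivalent_reps \<xi> \<eta> \<longrightarrow>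
      (\<forall>a<rep_dim \<eta>. \<forall>b<rep_dim \<eta>. \<forall>i<?d. \<forall>j<?d. ip (\<lambda>x. \<eta> x $$ (a, b)) (w i j) = 0)"
    using 3 by (intro allI impI)
  show ?thesis by (intro exI[of _ y] exI[of _ w] conjI g1 g2 g3 4)
qed

end

section \<open>Nuclearity\<close>

lemma lp_norm_cong_AE:
  assumes "AE x in M. f x = g x" "f \<in> borel_measurable M" "g \<in> borel_measurable M"
  shows "lp_norm M p f = lp_norm M p g"
proof -
  have "(\<integral>x. cmod (f x) powr p \<partial>M) = (\<integral>x. cmod (g x) powr p \<partial>M)"
    using assms by (intro integral_cong_AE) auto
  then show ?thesis by (simp add: lp_norm_def)
qed

lemma lp_norm_eq_0_imp_AE:
  assumes "f \<in> lp_space M p" "lp_norm M p f = 0"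
  shows "AE x in M. f x = 0"
proof -
  have "(\<integral>x. cmod (f x) powr p \<partial>M) = 0" using assms(2) by (simp add: lp_norm_def)
  then have "AE x in M. cmod (f x) powr p = 0"
    using integral_nonneg_eq_0_iff_AE[OF lp_space_integrable[OF assms(1)]] by simp
  then show ?thesis by simp
qed

text \<open>The element \<open>z\<close> witnesses that the supremum is taken over a nonempty
  set.\<close>

lemma dual_norm_bounds:
  assumes "\<And>f. f \<in> E \<Longrightarrow> cmod (\<Lambda> f) \<le> b * nE f" "b \<ge> 0" "z \<in> E" "nE z \<le> 1"
  shows "0 \<le> dual_norm E nE \<Lambda>" "dual_norm E nE \<Lambda> \<le> b"
proof -
  have ub: "t \<le> b" if t: "t \<in> {cmod (\<Lambda> f) | f. f \<in> E \<and> nE f \<le> 1}" for t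
  proof -
    obtain f where f: "t = cmod (\<Lambda> f)" "f \<in> E" "nE f \<le> 1" using t by blast
    have "t \<le> b * nE f" unfolding f(1) by (rule assms(1)[OF f(2)])
    also have "\<dots> \<le> b * 1" using f(3) assms(2) by (intro mult_left_mono)
    finally show ?thesis by simp
  qed
  have ne: "cmod (\<Lambda> z) \<in> {cmod (\<Lambda> f) | f. f \<in> E \<and> nE f \<le> 1}" using assms(3,4) by blast
  show "dual_norm E nE \<Lambda> \<le> b" unfolding dual_norm_def using ne ub by (intro cSup_least) auto
  have "0 \<le> cmod (\<Lambda> z)" by simp
  also have "\<dots> \<le> dual_norm E nE \<Lambda>" unfolding dual_norm_def by (rule cSup_upper[OF ne]) (use ub in \<open>auto simp: bdd_above_def\<close>)
  finally show "0 \<le> dual_norm E nE \<Lambda>" .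
qed

text \<open>The terms are eventually at most 1, and there
  \<open>b n \<le> b n powr r\<close>.\<close>

lemma summable_of_summable_powr:
  fixes b :: "nat \<Rightarrow> real"
  assumes b: "\<And>n. 0 \<le> b n" and r: "0 < r" "r \<le> 1" and s: "summable (\<lambda>n. b n powr r)"
  shows "summable b"
proof -
  have "(\<lambda>n. b n powr r) \<longlonglongrightarrow> 0" by (rule summable_LIMSEQ_zero[OF s])
  from LIMSEQ_D[OF this, of 1] obtain N where N: "\<And>n. n \<ge> N \<Longrightarrow> b n powr r < 1" by auto
  have "b n \<le> b n powr r" if n: "n \<ge> N" for n
  proof -
    have "b n \<le> 1"
    proof (rule ccontr)
      assume "\<not> b n \<le> 1"
      then have "1 powr r \<le> b n powr r" using r by (intro powr_mono2) auto
      then show False using N[OF n] by simp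
    qed
    then have "b n powr 1 \<le> b n powr r" using b r by (intro powr_mono') auto
    then show ?thesis using b[of n] by simp
  qed
  then show ?thesis using b by (intro summable_comparison_test[OF _ s]) auto
qed

context haar_group
begin

text \<open>Multiplying the symbol by \<open>\<xi> x\<close> undoes its definition. Equality with
  \<open>\<sigma>\<close> holds only almost everywhere, so the size of \<open>\<sigma>\<close> is
  read off at one point where it holds.\<close>

lemma symbol_identity:
  assumes \<xi>: "unitary_rep \<xi>" and AE: "AE x in \<mu>. symbol A x \<xi> = \<sigma>"
  shows "\<sigma> \<in> carrier_mat (rep_dim \<xi>) (rep_dim \<xi>)"
    and "i < rep_dim \<xi> \<Longrightarrow> j < rep_dim \<xi> \<Longrightarrow> AE x in \<mu>. A (\<lambda>y. \<xi> y $$ (i, j)) x = (\<xi> x * \<sigma>) $$ (i, j)"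
proof -
  let ?d = "rep_dim \<xi>"
  note c = unitary_rep_carrier[OF \<xi>]
  define B where "B x = Matrix.mat ?d ?d (\<lambda>(i, j). A (\<lambda>y. \<xi> y $$ (i, j)) x)" for x
  have Bc: "B x \<in> carrier_mat ?d ?d" for x by (simp add: B_def)
  have sB: "symbol A x \<xi> = mat_adjoint (\<xi> x) * B x" for x by (simp add: symbol_def B_def)
  have "\<exists>x. symbol A x \<xi> = \<sigma>"
  proof (rule ccontr)
    assume "\<nexists>x. symbol A x \<xi> = \<sigma>"
    then have "AE x in \<mu>. False" using AE by simp
    then show False using AE_False by simp
  qed
  then obtain x0 where "symbol A x0 \<xi> = \<sigma>" ..
  then show "\<sigma> \<in> carrier_mat ?d ?d"
    using mult_carrier_mat[OF mat_adjoint_carrier[OF c[of x0]] Bc[of x0]] by (simp add: sB)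
  assume ij: "i < ?d" "j < ?d"
  show "AE x in \<mu>. A (\<lambda>y. \<xi> y $$ (i, j)) x = (\<xi> x * \<sigma>) $$ (i, j)"
    using AE
  proof eventually_elim
    case (elim x)
    have u: "\<xi> x * mat_adjoint (\<xi> x) = 1\<^sub>m ?d" using \<xi> by (simp add: unitary_rep_def unitary_mat_def)
    have "\<xi> x * \<sigma> = \<xi> x * mat_adjoint (\<xi> x) * B x"
      unfolding elim[symmetric] sB by (rule assoc_mult_mat[OF c mat_adjoint_carrier[OF c] Bc, symmetric])
    also have "\<dots> = B x" unfolding u by (rule left_mult_one_mat[OF Bc])
    finally show ?case using ij by (simp add: B_def)
  qed
qed

text \<open>The rank-one terms of all classes are arranged in one sequence. Its partial sums are
  uniformly bounded operators and coincide with \<open>A\<close> on each trigonometric polynomial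
  from some index on.\<close>

lemma nuclear_of_summable:
  fixes \<rho> :: "('g \<Rightarrow> complex mat) set \<Rightarrow> ('g \<Rightarrow> complex mat)"
  assumes sc: "\<And>U :: 'g set. open U \<Longrightarrow> sigma_compact U"
    and p: "1 \<le> p1" "1 \<le> p2" and r: "0 < r" "r \<le> 1"
    and A: "bounded_linear_op (lp_space \<mu> p1) (lp_norm \<mu> p1) (lp_space \<mu> p2) (lp_norm \<mu> p2) A"
    and \<rho>: "\<And>c. c \<in> unitary_dual \<Longrightarrow> \<rho> c \<in> c"
    and \<sigma>: "\<And>c. c \<in> unitary_dual \<Longrightarrow> AE x in \<mu>. symbol A x (\<rho> c) = \<sigma> c"
    and summ: "(\<lambda>c. real (rep_dim (\<rho> c)) powr (1 + (1 / min 2 p1 - 1 / 2) * r) * schatten_norm r (\<sigma> c) powr r)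
      summable_on unitary_dual"
  shows "r_nuclear r (lp_space \<mu> p1) (lp_norm \<mu> p1) (lp_space \<mu> p2) (lp_norm \<mu> p2) A"
proof -
  let ?E = "lp_space \<mu> p1" and ?F = "lp_space \<mu> p2" and ?nE = "lp_norm \<mu> p1" and ?nF = "lp_norm \<mu> p2"
  let ?d = "\<lambda>c. rep_dim (\<rho> c)"
  have p10: "p1 > 0" and p20: "p2 > 0" using p by auto
  have irr: "irreducible_unitary_rep (\<rho> c)" if "c \<in> unitary_dual" for c
    by (rule unitary_dual_irreducible[OF that \<rho>[OF that]])
  note U = irreducible_unitary[OF irr]
  have dpos: "?d c > 0" if "c \<in> unitary_dual" for c using irr[OF that] by (simp add: irreducible_unitary_rep_def)
  define T where "T c = real (?d c) powr (1 + (1 / min 2 p1 - 1 / 2) * r) * schatten_norm r (\<sigma> c) powr r" for c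
  define K where "K = 1 + khintchine_const p2"
  have K: "K > 0" unfolding K_def using khintchine_const_pos[OF p20] by simp
  \<comment> \<open>Names the outcome of \<open>class_decomposition\<close>, so that
    \<open>y\<close> and \<open>w\<close> can be chosen for all classes at once.\<close>
  define P where "P c y w \<longleftrightarrow>
    (\<forall>i<?d c. \<forall>j<?d c. continuous_fun (y i j) \<and> continuous_fun (w i j) \<and>
        (\<forall>x. cmod (w i j x) \<le> 1) \<and> sqn (w i j) = 1 / real (?d c)) \<and>
    (\<forall>a<?d c. \<forall>b<?d c. \<forall>x. (\<Sum>i<?d c. \<Sum>j<?d c. ip (\<lambda>x. \<rho> c x $$ (a, b)) (w i j) * y i j x) = (\<rho> c x * \<sigma> c) $$ (a, b)) \<and>
    (\<forall>\<eta>. irreducible_unitary_rep \<eta> \<longrightarrow> \<not> equivalent_reps (\<rho> c) \<eta> \<longrightarrow>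
       (\<forall>a<rep_dim \<eta>. \<forall>b<rep_dim \<eta>. \<forall>i<?d c. \<forall>j<?d c. ip (\<lambda>x. \<eta> x $$ (a, b)) (w i j) = 0)) \<and>
    (\<Sum>i<?d c. \<Sum>j<?d c. ?nF (y i j) powr r) \<le> K * (real (?d c) powr (1 + r / 2) * schatten_norm r (\<sigma> c) powr r)" for c y w
  have "\<forall>c\<in>unitary_dual. \<exists>y w. P c y w"
    unfolding P_def K_def
    by (intro ballI class_decomposition irr p(2) r symbol_identity(1)[OF U \<sigma>])
  then obtain y w where P: "\<And>c. c \<in> unitary_dual \<Longrightarrow> P c (y c) (w c)" by metis
  have cy: "continuous_fun (y c i j)" and cw: "continuous_fun (w c i j)" and w1: "cmod (w c i j x) \<le> 1"
    and wsq: "sqn (w c i j) = 1 / real (?d c)" if "c \<in> unitary_dual" "i < ?d c" "j < ?d c" for c i j x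
    using P[OF that(1)] that(2,3) unfolding P_def by blast+
  have recon: "(\<Sum>i<?d c. \<Sum>j<?d c. ip (\<lambda>x. \<rho> c x $$ (a, b)) (w c i j) * y c i j x) = (\<rho> c x * \<sigma> c) $$ (a, b)"
    if "c \<in> unitary_dual" "a < ?d c" "b < ?d c" for c a b x
    using P[OF that(1)] that(2,3) unfolding P_def by blast
  have orth: "ip (\<lambda>x. \<eta> x $$ (a, b)) (w c i j) = 0"
    if "c \<in> unitary_dual" "irreducible_unitary_rep \<eta>" "\<not> equivalent_reps (\<rho> c) \<eta>" "a < rep_dim \<eta>" "b < rep_dim \<eta>" "i < ?d c" "j < ?d c"
    for c \<eta> a b i j
    using P[OF that(1)] that(2-) unfolding P_def by blast
  have ysum: "(\<Sum>i<?d c. \<Sum>j<?d c. ?nF (y c i j) powr r) \<le> K * (real (?d c) powr (1 + r / 2) * schatten_norm r (\<sigma> c) powr r)"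
    if "c \<in> unitary_dual" for c
    using P[OF that] unfolding P_def by blast
  have yF: "y c i j \<in> ?F" if "c \<in> unitary_dual" "i < ?d c" "j < ?d c" for c i j
    by (rule continuous_lp_space[OF p(2) cy[OF that]])

  \<comment> \<open>The norm bound that \<open>pairing_bound\<close> gives for the functionals of
    class \<open>c\<close>.\<close>
  define \<beta> where "\<beta> c = real (?d c) powr (1 / min 2 p1 - 1)" for c
  have pair: "integrable \<mu> (\<lambda>x. f x * cnj (w c i j x))" "cmod (ip f (w c i j)) \<le> \<beta> c * ?nE f"
    if c: "c \<in> unitary_dual" "i < ?d c" "j < ?d c" and f: "f \<in> ?E" for c i j f
  proof -
    have d1: "real (?d c) \<ge> 1" using dpos[OF c(1)] by simp
    have sq: "(\<integral>x. (cmod (w c i j x))\<^sup>2 \<partial>\<mu>) \<le> 1 / real (?d c)" using wsq[OF c] by (simp add: sqn_eq)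
    note pb = pairing_bound[OF p(1) f measurable_continuous[OF cw[OF c]] w1[OF c] d1 sq]
    show "integrable \<mu> (\<lambda>x. f x * cnj (w c i j x))" by (rule pb(1))
    show "cmod (ip f (w c i j)) \<le> \<beta> c * ?nE f" unfolding ip_def \<beta>_def by (rule pb(2))
  qed
  define v where "v = (\<lambda>(c, i, j). (\<beta> c * ?nF (y c i j)) powr r)"
  have v_nn: "v z \<ge> 0" for z by (simp add: v_def case_prod_unfold)
  have vsum: "(\<Sum>i<?d c. \<Sum>j<?d c. v (c, i, j)) \<le> K * T c" if c: "c \<in> unitary_dual" for c
  proof -
    have "(\<Sum>i<?d c. \<Sum>j<?d c. v (c, i, j)) = \<beta> c powr r * (\<Sum>i<?d c. \<Sum>j<?d c. ?nF (y c i j) powr r)"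
      unfolding v_def by (simp add: powr_mult lp_norm_nonneg \<beta>_def sum_distrib_left)
    also have "\<dots> \<le> \<beta> c powr r * (K * (real (?d c) powr (1 + r / 2) * schatten_norm r (\<sigma> c) powr r))"
      by (intro mult_left_mono ysum c) simp
    also have "\<dots> = K * ((\<beta> c powr r * real (?d c) powr (1 + r / 2)) * schatten_norm r (\<sigma> c) powr r)"
      by (simp only: mult_ac)
    \<comment> \<open>The exponents add up:
      \<open>(1 / min 2 p1 - 1) * r + (1 + r / 2)\<close>.\<close>
    also have "\<beta> c powr r * real (?d c) powr (1 + r / 2) = real (?d c) powr (1 + (1 / min 2 p1 - 1 / 2) * r)"
      unfolding \<beta>_def powr_powr powr_add[symmetric] by (simp add: algebra_simps)
    finally show ?thesis by (simp add: T_def)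
  qed

  \<comment> \<open>The support of a summable family is countable; restricting to it gives a
    countable index set without any appeal to the size of the dual.\<close>
  define C0 where "C0 = {c \<in> unitary_dual. T c \<noteq> 0}"
  have Tsum: "T summable_on unitary_dual" using summ by (simp add: T_def[abs_def])
  have C0c: "countable C0" unfolding C0_def by (rule summable_countable_real[OF Tsum])
  have T_nn: "T c \<ge> 0" for c by (simp add: T_def)
  have C0D: "c \<in> unitary_dual" if "c \<in> C0" for c using that by (simp add: C0_def)
  define I where "I = Sigma C0 (\<lambda>c. {..<?d c} \<times> {..<?d c})"
  have Ic: "countable I" unfolding I_def by (intro countable_SIGMA C0c) auto
  have vI: "v summable_on I"
  proof (rule nonneg_bdd_above_summable_on[OF v_nn])
    show "bdd_above (sum v ` {F. F \<subseteq> I \<and> finite F})"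
    proof (rule bdd_aboveI2)
      fix F assume "F \<in> {F. F \<subseteq> I \<and> finite F}"
      then have F: "F \<subseteq> I" "finite F" by auto
      have fF: "finite (fst ` F)" "fst ` F \<subseteq> C0" using F by (auto simp: I_def)
      have "sum v F \<le> sum v (Sigma (fst ` F) (\<lambda>c. {..<?d c} \<times> {..<?d c}))"
        using F v_nn by (intro sum_mono2) (auto simp: I_def, force+)
      also have "\<dots> = (\<Sum>c\<in>fst ` F. \<Sum>z\<in>{..<?d c} \<times> {..<?d c}. v (c, z))"
        using fF by (subst sum.Sigma) auto
      also have "\<dots> = (\<Sum>c\<in>fst ` F. \<Sum>i<?d c. \<Sum>j<?d c. v (c, i, j))"
        by (simp add: sum.cartesian_product)
      also have "\<dots> \<le> (\<Sum>c\<in>fst ` F. K * T c)" using fF C0D by (intro sum_mono vsum) auto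
      also have "\<dots> = K * (\<Sum>c\<in>fst ` F. T c)" by (simp add: sum_distrib_left)
      also have "\<dots> \<le> K * infsum T unitary_dual"
        using K fF C0D T_nn by (intro mult_left_mono finite_sum_le_infsum Tsum) auto
      finally show "sum v F \<le> K * infsum T unitary_dual" .
    qed
  qed
  \<comment> \<open>\<open>e\<close> numbers the triples injectively. Numbers outside its range will
    carry zero terms, so finite and infinite index sets are treated alike.\<close>
  define e where "e = to_nat_on I"
  have einj: "inj_on e I" unfolding e_def by (rule inj_on_to_nat_on[OF Ic])
  define dec where "dec = inv_into I e"
  have dec: "dec (e z) = z" if "z \<in> I" for z unfolding dec_def by (rule inv_into_f_f[OF einj that])
  have decI: "dec n \<in> I" "e (dec n) = n" if "n \<in> e ` I" for n using that dec by auto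
  define Y where "Y n = (if n \<in> e ` I then (case dec n of (c, i, j) \<Rightarrow> y c i j) else (\<lambda>_. 0))" for n
  define \<Lambda> where "\<Lambda> n f = (if n \<in> e ` I then (case dec n of (c, i, j) \<Rightarrow> ip f (w c i j)) else 0)" for n f
  define bb where "bb n = (if n \<in> e ` I then \<beta> (fst (dec n)) else 0)" for n
  define b where "b n = bb n * ?nF (Y n)" for n
  have decE: "\<exists>c i j. dec n = (c, i, j) \<and> c \<in> unitary_dual \<and> i < ?d c \<and> j < ?d c" if "n \<in> e ` I" for n
    using decI(1)[OF that] C0D by (auto simp: I_def)
  have bb_nn: "bb n \<ge> 0" for n by (simp add: bb_def \<beta>_def)
  have b_nn: "b n \<ge> 0" for n unfolding b_def by (intro mult_nonneg_nonneg bb_nn lp_norm_nonneg)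
  have bsum: "summable (\<lambda>n. b n powr r)"
  proof -
    have "(\<lambda>n. b n powr r) \<circ> e summable_on I"
    proof (rule summable_on_cong[THEN iffD1, OF _ vI])
      fix z assume z: "z \<in> I"
      obtain c i j where "z = (c, i, j)" by (cases z) auto
      then show "v z = ((\<lambda>n. b n powr r) \<circ> e) z"
        using z dec[OF z] by (auto simp: v_def b_def bb_def Y_def)
    qed
    then have "(\<lambda>n. b n powr r) summable_on e ` I" using summable_on_reindex[OF einj] by blast
    then have "(\<lambda>n. b n powr r) summable_on UNIV"
      by (rule summable_on_cong_neutral[THEN iffD1, rotated 3]) (auto simp: b_def bb_def)
    then show ?thesis by (subst (asm) summable_on_UNIV_nonneg_real_iff) auto
  qed
  have bs: "summable b" by (rule summable_of_summable_powr[OF b_nn r bsum])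
  have YF: "Y n \<in> ?F" for n
  proof (cases "n \<in> e ` I")
    case True
    then show ?thesis using decE[OF True] yF by (auto simp: Y_def)
  next
    case False
    have "continuous_fun (\<lambda>x :: 'g. 0)" by simp
    then show ?thesis using continuous_lp_space[OF p(2)] False by (simp add: Y_def)
  qed
  have \<Lambda>_bound: "cmod (\<Lambda> n f) \<le> bb n * ?nE f" if f: "f \<in> ?E" for n f
  proof (cases "n \<in> e ` I")
    case True
    then show ?thesis using decE[OF True] pair(2)[OF _ _ _ f] by (auto simp: \<Lambda>_def bb_def)
  qed (simp add: \<Lambda>_def bb_def)
  have \<Lambda>_add: "\<Lambda> n (\<lambda>x. f x + g x) = \<Lambda> n f + \<Lambda> n g" if fg: "f \<in> ?E" "g \<in> ?E" for n f g
  proof (cases "n \<in> e ` I")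
    case True
    obtain c i j where z: "dec n = (c, i, j)" "c \<in> unitary_dual" "i < ?d c" "j < ?d c" using decE[OF True] by blast
    have "ip (\<lambda>x. f x + g x) (w c i j) = ip f (w c i j) + ip g (w c i j)"
      unfolding ip_def distrib_right by (intro Bochner_Integration.integral_add pair(1) z fg)
    then show ?thesis using True z by (simp add: \<Lambda>_def)
  qed (simp add: \<Lambda>_def)
  have \<Lambda>_scale: "\<Lambda> n (\<lambda>x. k * f x) = k * \<Lambda> n f" for n k f
    by (simp add: \<Lambda>_def ip_scale_left case_prod_unfold)
  have \<Lambda>_dual: "\<Lambda> n \<in> dual_space ?E ?nE" for n
    unfolding dual_space_def using \<Lambda>_add \<Lambda>_scale \<Lambda>_bound by blast
  have zE: "(\<lambda>x. 0) \<in> ?E" "?nE (\<lambda>x. 0) \<le> 1"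
    using continuous_lp_space[OF p(1), of "\<lambda>x. 0"] by (auto simp: lp_norm_def)
  have dn: "0 \<le> dual_norm ?E ?nE (\<Lambda> n)" "dual_norm ?E ?nE (\<Lambda> n) \<le> bb n" for n
    using dual_norm_bounds[where E = ?E and nE = ?nE and \<Lambda> = "\<Lambda> n" and b = "bb n" and z = "\<lambda>x. 0"] \<Lambda>_bound bb_nn zE
    by blast+
  have nuc_sum: "summable (\<lambda>n. dual_norm ?E ?nE (\<Lambda> n) powr r * ?nF (Y n) powr r)"
  proof (rule summable_comparison_test[OF _ bsum])
    have "norm (dual_norm ?E ?nE (\<Lambda> n) powr r * ?nF (Y n) powr r) \<le> b n powr r" for n
    proof -
      have "dual_norm ?E ?nE (\<Lambda> n) powr r * ?nF (Y n) powr r \<le> bb n powr r * ?nF (Y n) powr r"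
        using r dn by (intro mult_right_mono powr_mono2) auto
      also have "\<dots> = b n powr r" unfolding b_def using bb_nn lp_norm_nonneg by (simp add: powr_mult)
      finally show ?thesis by simp
    qed
    then show "\<exists>N. \<forall>n\<ge>N. norm (dual_norm ?E ?nE (\<Lambda> n) powr r * ?nF (Y n) powr r) \<le> b n powr r" by blast
  qed

  obtain C where C: "\<And>f. f \<in> ?E \<Longrightarrow> ?nF (A f) \<le> C * ?nE f"
    using A unfolding bounded_linear_op_def by blast
  have AF: "A f \<in> ?F" if "f \<in> ?E" for f using A that unfolding bounded_linear_op_def by blast
  have A_add: "AE x in \<mu>. A (\<lambda>y. f y + g y) x = A f x + A g x" if fg: "f \<in> ?E" "g \<in> ?E" for f g
  proof -
    have "?nF (\<lambda>x. A (\<lambda>y. f y + g y) x - (A f x + A g x)) = 0" using A fg unfolding bounded_linear_op_def by blast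
    moreover have "(\<lambda>x. A (\<lambda>y. f y + g y) x - (A f x + A g x)) \<in> ?F"
      by (intro lp_space_diff(1) lp_space_add(1) p AF fg)
    ultimately have "AE x in \<mu>. A (\<lambda>y. f y + g y) x - (A f x + A g x) = 0" by (intro lp_norm_eq_0_imp_AE)
    then show ?thesis by simp
  qed
  have A_scale: "AE x in \<mu>. A (\<lambda>y. k * f y) x = k * A f x" if f: "f \<in> ?E" for k f
  proof -
    have "?nF (\<lambda>x. A (\<lambda>y. k * f y) x - k * A f x) = 0" using A f unfolding bounded_linear_op_def by blast
    moreover have "(\<lambda>x. A (\<lambda>y. k * f y) x - k * A f x) \<in> ?F"
      by (intro lp_space_diff(1) lp_space_scale(1) p p10 p20 AF f)
    ultimately have "AE x in \<mu>. A (\<lambda>y. k * f y) x - k * A f x = 0" by (intro lp_norm_eq_0_imp_AE)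
    then show ?thesis by simp
  qed
  define B where "B N f x = (\<Sum>n<N. \<Lambda> n f * Y n x)" for N f x
  \<comment> \<open>Eventual equality almost everywhere, rather than convergence: it passes to
    linear combinations, and each trigonometric polynomial involves only finitely many
    classes.\<close>
  define ok where "ok m \<longleftrightarrow> m \<in> ?E \<and> (\<exists>N0. \<forall>N\<ge>N0. AE x in \<mu>. A m x = B N m x)" for m
  have ok_add: "ok (\<lambda>x. f x + g x)" if fg: "ok f" "ok g" for f g
  proof -
    have E: "f \<in> ?E" "g \<in> ?E" using fg by (auto simp: ok_def)
    obtain N1 N2 where N: "\<And>N. N \<ge> N1 \<Longrightarrow> AE x in \<mu>. A f x = B N f x" "\<And>N. N \<ge> N2 \<Longrightarrow> AE x in \<mu>. A g x = B N g x"
      using fg by (auto simp: ok_def)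
    have "AE x in \<mu>. A (\<lambda>x. f x + g x) x = B N (\<lambda>x. f x + g x) x" if "N \<ge> max N1 N2" for N
    proof -
      have "AE x in \<mu>. A f x = B N f x" "AE x in \<mu>. A g x = B N g x" using N that by auto
      then show ?thesis using A_add[OF E]
        by eventually_elim (simp add: B_def \<Lambda>_add[OF E] distrib_right sum.distrib)
    qed
    then show ?thesis unfolding ok_def using lp_space_add(1)[OF p(1) E] by blast
  qed
  have ok_scale: "ok (\<lambda>x. k * f x)" if f: "ok f" for k f
  proof -
    have E: "f \<in> ?E" using f by (auto simp: ok_def)
    obtain N1 where N: "\<And>N. N \<ge> N1 \<Longrightarrow> AE x in \<mu>. A f x = B N f x" using f by (auto simp: ok_def)
    have "AE x in \<mu>. A (\<lambda>x. k * f x) x = B N (\<lambda>x. k * f x) x" if "N \<ge> N1" for N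
      using N[OF that] A_scale[OF E, of k]
      by eventually_elim (simp add: B_def \<Lambda>_scale sum_distrib_left mult.assoc)
    then show ?thesis unfolding ok_def using lp_space_scale(1)[OF p10 E] by blast
  qed
  have ok_rho: "ok (\<lambda>x. \<rho> c x $$ (a, b))" if c: "c \<in> unitary_dual" and ab: "a < ?d c" "b < ?d c" for c a b
  proof -
    let ?m = "\<lambda>x. \<rho> c x $$ (a, b)"
    have Cm: "continuous_fun ?m" by (rule coef_continuous[OF U[OF c] ab])
    \<comment> \<open>The indices that belong to class \<open>c\<close>, none if \<open>c\<close>
      lies outside \<open>C0\<close>; by orthogonality the functionals of all other classes vanish
      on this coefficient.\<close>
    define J where "J = e ` (I \<inter> ({c} \<times> ({..<?d c} \<times> {..<?d c})))"
    have Jfin: "finite J" unfolding J_def by (intro finite_imageI finite_Int disjI2 finite_cartesian_product) auto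
    obtain N0 where N0: "J \<subseteq> {..<N0}" using Jfin finite_nat_bounded by blast
    have \<Lambda>0: "\<Lambda> n ?m = 0" if "n \<notin> J" for n
    proof (cases "n \<in> e ` I")
      case True
      obtain c' i j where z: "dec n = (c', i, j)" "c' \<in> unitary_dual" "i < ?d c'" "j < ?d c'" using decE[OF True] by blast
      have "c' \<noteq> c"
      proof
        assume "c' = c"
        then have "n \<in> J" unfolding J_def using decI[OF True] z by (intro image_eqI[of _ _ "dec n"]) auto
        then show False using that by simp
      qed
      then have "\<not> equivalent_reps (\<rho> c') (\<rho> c)" using unitary_dual_inequivalent[OF z(2) c \<rho>[OF z(2)] \<rho>[OF c]] by blast
      then have "ip ?m (w c' i j) = 0" using orth[OF z(2) irr[OF c] _ ab z(3,4)] by blast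
      then show ?thesis using True z by (simp add: \<Lambda>_def)
    qed (simp add: \<Lambda>_def)
    have BJ: "B N ?m x = (\<Sum>n\<in>J. \<Lambda> n ?m * Y n x)" if "N \<ge> N0" for N x
      unfolding B_def using N0 that \<Lambda>0 by (intro sum.mono_neutral_right) auto
    have "AE x in \<mu>. A ?m x = B N ?m x" if N: "N \<ge> N0" for N
    proof (cases "c \<in> C0")
      case True
      have sub: "{c} \<times> ({..<?d c} \<times> {..<?d c}) \<subseteq> I" using True by (auto simp: I_def)
      then have Je: "J = e ` ({c} \<times> ({..<?d c} \<times> {..<?d c}))" unfolding J_def by (simp add: Int_absorb1)
      have "(\<Sum>n\<in>J. \<Lambda> n ?m * Y n x) = (\<rho> c x * \<sigma> c) $$ (a, b)" for x
      proof -
        have "(\<Sum>n\<in>J. \<Lambda> n ?m * Y n x) = (\<Sum>z\<in>{c} \<times> ({..<?d c} \<times> {..<?d c}). \<Lambda> (e z) ?m * Y (e z) x)"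
          unfolding Je using sum.reindex[OF inj_on_subset[OF einj sub]] by (simp add: o_def)
        also have "\<dots> = (\<Sum>z\<in>{c} \<times> ({..<?d c} \<times> {..<?d c}). case z of (c', i, j) \<Rightarrow> ip ?m (w c' i j) * y c' i j x)"
        proof (rule sum.cong[OF refl])
          fix z assume "z \<in> {c} \<times> ({..<?d c} \<times> {..<?d c})"
          then have "z \<in> I" using sub by blast
          then show "\<Lambda> (e z) ?m * Y (e z) x = (case z of (c', i, j) \<Rightarrow> ip ?m (w c' i j) * y c' i j x)"
            using dec by (simp add: \<Lambda>_def Y_def case_prod_unfold)
        qed
        also have "\<dots> = (\<Sum>i<?d c. \<Sum>j<?d c. ip ?m (w c i j) * y c i j x)"
          by (simp add: sum.cartesian_product[symmetric])
        also have "\<dots> = (\<rho> c x * \<sigma> c) $$ (a, b)" by (rule recon[OF c ab])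
        finally show ?thesis .
      qed
      then show ?thesis unfolding BJ[OF N] using symbol_identity(2)[OF U[OF c] \<sigma>[OF c] ab] by simp
    next
      case False
      then have "J = {}" by (auto simp: J_def I_def)
      then have B0: "B N ?m x = 0" for x unfolding BJ[OF N] by simp
      \<comment> \<open>The class contributes no terms, so \<open>A\<close> has to annihilate its
        coefficients: the Schatten norm is 0, hence the \<open>y\<close> of this class vanish almost
        everywhere, and reconstruction gives 0.\<close>
      have "T c = 0" using False c by (simp add: C0_def)
      then have s0: "schatten_norm r (\<sigma> c) powr r = 0" using dpos[OF c] unfolding T_def by simp
      have y0: "AE x in \<mu>. y c i j x = 0" if ij: "i < ?d c" "j < ?d c" for i j
      proof -
        have "?nF (y c i j) powr r \<le> (\<Sum>j<?d c. ?nF (y c i j) powr r)"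
          using ij by (intro member_le_sum) auto
        also have "\<dots> \<le> (\<Sum>i<?d c. \<Sum>j<?d c. ?nF (y c i j) powr r)"
          using ij by (intro member_le_sum[of i _ "\<lambda>i. \<Sum>j<?d c. ?nF (y c i j) powr r"] sum_nonneg) auto
        also have "\<dots> \<le> 0" using ysum[OF c] s0 by simp
        finally have "?nF (y c i j) = 0" using powr_gt_zero[of "?nF (y c i j)" r] by linarith
        then show ?thesis by (rule lp_norm_eq_0_imp_AE[OF yF[OF c ij]])
      qed
      have "AE x in \<mu>. \<forall>i\<in>{..<?d c}. \<forall>j\<in>{..<?d c}. y c i j x = 0"
        using y0 by (intro AE_finite_allI) auto
      then show ?thesis using symbol_identity(2)[OF U[OF c] \<sigma>[OF c] ab]
      proof eventually_elim
        case (elim x)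
        have "(\<rho> c x * \<sigma> c) $$ (a, b) = 0"
          unfolding recon[OF c ab, symmetric] using elim(1) by (intro sum.neutral ballI) auto
        then show ?case using elim(2) B0 by simp
      qed
    qed
    then show ?thesis unfolding ok_def using continuous_lp_space[OF p(1) Cm] by blast
  qed
  have ok0: "ok (\<lambda>x. 0)"
  proof -
    have "AE x in \<mu>. A (\<lambda>y. 0) x = 0" using A_scale[OF zE(1), of 0] by simp
    moreover have "\<Lambda> n (\<lambda>x. 0) = 0" for n using \<Lambda>_scale[of n 0 "\<lambda>x. 0"] by simp
    ultimately show ?thesis unfolding ok_def B_def using zE(1) by simp
  qed
  have ok_sum: "finite S \<Longrightarrow> (\<And>s. s \<in> S \<Longrightarrow> ok (g s)) \<Longrightarrow> ok (\<lambda>x. \<Sum>s\<in>S. g s x)" for S :: "nat set" and g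
    by (induction S rule: finite_induct) (auto intro: ok0 ok_add)
  have ok_trig: "ok m" if "m \<in> trig_poly" for m
    using that
  proof (induction rule: trig_poly.induct)
    case (coef \<xi> i j)
    obtain c where c: "c \<in> unitary_dual" "\<xi> \<in> c" using unitary_dual_covers[OF coef(1)] .
    \<comment> \<open>\<open>\<xi>\<close> is an arbitrary member of the class; the similarity
      \<open>S\<close> expresses its coefficients through those of the representative
      \<open>\<rho> c\<close>.\<close>
    obtain S where S: "rep_dim \<xi> = ?d c" "S \<in> carrier_mat (?d c) (?d c)" "invertible_mat S" "\<And>x. S * \<xi> x = \<rho> c x * S"
      using unitary_dual_equivalent[OF c \<rho>[OF c(1)]] by (auto simp: equivalent_reps_def)
    obtain R where R: "R \<in> carrier_mat (?d c) (?d c)" "S * R = 1\<^sub>m (?d c)" "R * S = 1\<^sub>m (?d c)"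
      using invertible_matE[OF S(3,2)] .
    have \<xi>c: "\<xi> x \<in> carrier_mat (?d c) (?d c)" for x
      using unitary_rep_carrier[OF irreducible_unitary[OF coef(1)], of x] S(1) by simp
    have \<rho>c: "\<rho> c x \<in> carrier_mat (?d c) (?d c)" for x by (rule unitary_rep_carrier[OF U[OF c(1)]])
    have ij: "i < ?d c" "j < ?d c" using coef S(1) by auto
    have "(\<lambda>x. \<xi> x $$ (i, j)) = (\<lambda>x. \<Sum>k<?d c. R $$ (i, k) * (\<Sum>l<?d c. S $$ (l, j) * \<rho> c x $$ (k, l)))"
    proof
      fix x
      have "\<xi> x = R * S * \<xi> x" unfolding R(3) using \<xi>c[of x] by simp
      also have "\<dots> = R * (\<rho> c x * S)" unfolding S(4)[symmetric] by (rule assoc_mult_mat[OF R(1) S(2) \<xi>c])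
      finally have "\<xi> x $$ (i, j) = (\<Sum>k<?d c. R $$ (i, k) * (\<rho> c x * S) $$ (k, j))"
        using mat_mult_index[OF R(1) mult_carrier_mat[OF \<rho>c S(2)] ij, of x] by simp
      also have "\<dots> = (\<Sum>k<?d c. R $$ (i, k) * (\<Sum>l<?d c. S $$ (l, j) * \<rho> c x $$ (k, l)))"
        using ij by (intro sum.cong refl) (simp add: mat_mult_index[OF \<rho>c S(2)] mult.commute[of "\<rho> c x $$ _"] del: index_mult_mat)
      finally show "\<xi> x $$ (i, j) = (\<Sum>k<?d c. R $$ (i, k) * (\<Sum>l<?d c. S $$ (l, j) * \<rho> c x $$ (k, l)))" .
    qed
    moreover have "ok (\<lambda>x. \<Sum>k<?d c. R $$ (i, k) * (\<Sum>l<?d c. S $$ (l, j) * \<rho> c x $$ (k, l)))"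
      using c by (intro ok_sum ok_scale ok_rho) auto
    ultimately show ?case by simp
  qed (auto intro: ok0 ok_add ok_scale)

  have BF: "B N f \<in> ?F" "?nF (B N f) \<le> suminf b * ?nE f" if f: "f \<in> ?E" for N f
  proof -
    have s: "(\<lambda>x. \<Lambda> n f * Y n x) \<in> ?F" for n by (intro lp_space_scale(1) p20 YF)
    note ls = lp_space_sum[OF p(2), of "{..<N}" "\<lambda>n x. \<Lambda> n f * Y n x" \<mu>, OF _ s]
    show "B N f \<in> ?F" using ls by (simp add: B_def[abs_def])
    have "?nF (B N f) \<le> (\<Sum>n<N. ?nF (\<lambda>x. \<Lambda> n f * Y n x))" using ls by (simp add: B_def[abs_def])
    also have "\<dots> = (\<Sum>n<N. cmod (\<Lambda> n f) * ?nF (Y n))" using lp_space_scale(2)[OF p20 YF] by simp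
    also have "\<dots> \<le> (\<Sum>n<N. b n * ?nE f)"
    proof (rule sum_mono)
      fix n
      have "cmod (\<Lambda> n f) * ?nF (Y n) \<le> bb n * ?nE f * ?nF (Y n)" by (intro mult_right_mono \<Lambda>_bound f lp_norm_nonneg)
      then show "cmod (\<Lambda> n f) * ?nF (Y n) \<le> b n * ?nE f" by (simp add: b_def mult_ac)
    qed
    also have "\<dots> = (\<Sum>n<N. b n) * ?nE f" by (simp add: sum_distrib_right)
    also have "\<dots> \<le> suminf b * ?nE f"
      by (intro mult_right_mono sum_le_suminf bs lp_norm_nonneg) (auto simp: b_nn)
    finally show "?nF (B N f) \<le> suminf b * ?nE f" .
  qed
  have conv: "(\<lambda>N. ?nF (\<lambda>x. A f x - B N f x)) \<longlonglongrightarrow> 0" if f: "f \<in> ?E" for f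
  proof (rule LIMSEQ_I)
    fix \<epsilon> :: real assume \<epsilon>: "\<epsilon> > 0"
    \<comment> \<open>Dominates the norm of \<open>A\<close> minus any partial sum. The absolute
      value saves proving \<open>C \<ge> 0\<close>, and the summand 1 makes \<open>D\<close>
      positive.\<close>
    define D where "D = \<bar>C\<bar> + suminf b + 1"
    have D: "D > 0" unfolding D_def using suminf_nonneg[OF bs b_nn] by simp
    have "\<epsilon> / D > 0" using \<epsilon> D by simp
    then obtain m where m: "m \<in> trig_poly" "?nE (\<lambda>x. f x - m x) < \<epsilon> / D"
      using trig_poly_dense_lp[OF sc p(1) f] by blast
    have mE: "m \<in> ?E" by (rule continuous_lp_space[OF p(1) trig_poly_continuous[OF m(1)]])
    let ?g = "\<lambda>x. f x - m x"
    have gE: "?g \<in> ?E" by (rule lp_space_diff(1)[OF p(1) f mE])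
    obtain N0 where N0: "\<And>N. N \<ge> N0 \<Longrightarrow> AE x in \<mu>. A m x = B N m x" using ok_trig[OF m(1)] by (auto simp: ok_def)
    have "norm (?nF (\<lambda>x. A f x - B N f x) - 0) < \<epsilon>" if N: "N \<ge> N0" for N
    proof -
      have "AE x in \<mu>. A f x = A m x + A ?g x" using A_add[OF mE gE] by simp
      then have ae: "AE x in \<mu>. A f x - B N f x = A ?g x - B N ?g x" using N0[OF N]
      proof eventually_elim
        case (elim x)
        have "B N f x = B N m x + B N ?g x"
          using \<Lambda>_add[OF mE gE] by (simp add: B_def distrib_right sum.distrib)
        then show ?case using elim by simp
      qed
      have "?nF (\<lambda>x. A f x - B N f x) = ?nF (\<lambda>x. A ?g x - B N ?g x)"
        using ae by (intro lp_norm_cong_AE lp_space_measurable[of _ _ p2] lp_space_diff(1) p AF BF f gE) auto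
      also have "\<dots> \<le> ?nF (A ?g) + ?nF (B N ?g)" by (intro lp_space_diff(2) p AF BF gE)
      also have "\<dots> \<le> \<bar>C\<bar> * ?nE ?g + suminf b * ?nE ?g"
        using C[OF gE] BF(2)[OF gE, of N] mult_right_mono[OF abs_ge_self[of C] lp_norm_nonneg[of \<mu> p1 ?g]] by linarith
      also have "\<dots> \<le> D * ?nE ?g" unfolding D_def using lp_norm_nonneg[of \<mu> p1 ?g] by (simp add: algebra_simps)
      also have "\<dots> < \<epsilon>" using m(2) D by (simp add: pos_less_divide_eq mult.commute)
      finally show ?thesis using lp_norm_nonneg[of \<mu> p2 "\<lambda>x. A f x - B N f x"] by simp
    qed
    then show "\<exists>N0. \<forall>N\<ge>N0. norm (?nF (\<lambda>x. A f x - B N f x) - 0) < \<epsilon>" by blast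
  qed
  have conv': "\<forall>f\<in>?E. (\<lambda>N. ?nF (\<lambda>x. A f x - (\<Sum>n<N. \<Lambda> n f * Y n x))) \<longlonglongrightarrow> 0"
    using conv unfolding B_def by blast
  show ?thesis
    unfolding r_nuclear_def using \<Lambda>_dual YF conv' nuc_sum by blast
qed

text \<open>Since the largest singular value is at most \<open>\<surd>d\<close> times the largest column sum, the hypothesis for
  \<open>p\<^sub>2 > 2\<close> dominates the one for \<open>p\<^sub>2 \<le> 2\<close> term by term.\<close>

lemma symbol_weight_le:
  assumes M: "M \<in> carrier_mat d d" and d: "d > 0" and r: "0 < r" and p: "2 < (p :: real)"
  shows "real d powr (1 + (q - 1 / 2) * r) * schatten_norm r M powr r
    \<le> real d powr (1 + (q - 1 / p) * r) * op_infty_norm (transpose_mat M) powr ((p - 2) / p * r)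
      * schatten_norm (2 * r / p) M powr (2 * r / p)"
proof -
  obtain Q s where Q: "unitary_mat d Q" and s: "\<And>j. s j \<ge> 0"
    "\<And>j. j < d \<Longrightarrow> (\<Sum>k<d. (cmod ((M * Q) $$ (k, j)))\<^sup>2) = (s j)\<^sup>2"
    and sch: "\<And>q. q > 0 \<Longrightarrow> schatten_norm q M powr q = (\<Sum>j<d. s j powr q)"
    using singular_values[OF M] by metis
  let ?K = "op_infty_norm (transpose_mat M)"
  have "0 \<le> (\<Sum>k<d. cmod (M $$ (k, 0)))" by (intro sum_nonneg) auto
  also have "\<dots> \<le> ?K" by (rule op_infty_norm_transpose[OF M d])
  finally have K: "?K \<ge> 0" .
  have sK: "s j \<le> sqrt d * ?K" if j: "j < d" for j
  proof (rule power2_le_imp_le)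
    show "(s j)\<^sup>2 \<le> (sqrt d * ?K)\<^sup>2"
      using singular_value_le[OF M Q j] unfolding s(2)[OF j] by (simp add: power_mult_distrib)
  qed (use K in simp)
  have e: "2 * r / p > 0" "(p - 2) / p * r > 0" "2 * r / p + (p - 2) / p * r = r"
    using r p by (auto simp: field_simps)
  \<comment> \<open>The exponent \<open>r\<close> is split into \<open>(p - 2) / p * r\<close> and
    \<open>2 * r / p\<close>; in the first part \<open>s j\<close> is estimated by
    \<open>sqrt d\<close> times the column sum bound, and the resulting power of \<open>d\<close>
    changes \<open>1 / 2\<close> into \<open>1 / p\<close> in the weight.\<close>
  have trm: "s j powr r \<le> real d powr ((1 / 2 - 1 / p) * r) * ?K powr ((p - 2) / p * r) * s j powr (2 * r / p)" if j: "j < d" for j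
  proof -
    have "s j powr r = s j powr ((p - 2) / p * r) * s j powr (2 * r / p)"
      unfolding powr_add[symmetric] using e(3) by (simp add: add.commute)
    also have "\<dots> \<le> (sqrt d * ?K) powr ((p - 2) / p * r) * s j powr (2 * r / p)"
      using s(1) sK[OF j] e by (intro mult_right_mono powr_mono2) auto
    also have "(sqrt d * ?K) powr ((p - 2) / p * r) = (real d powr (1 / 2)) powr ((p - 2) / p * r) * ?K powr ((p - 2) / p * r)"
      using K by (simp add: powr_mult powr_half_sqrt)
    also have "(real d powr (1 / 2)) powr ((p - 2) / p * r) = real d powr ((1 / 2 - 1 / p) * r)"
      unfolding powr_powr using p by (intro arg_cong[where f = "\<lambda>z. real d powr z"]) (simp add: field_simps)
    finally show ?thesis .
  qed
  have "real d powr (1 + (q - 1 / 2) * r) * schatten_norm r M powr r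
      = real d powr (1 + (q - 1 / 2) * r) * (\<Sum>j<d. s j powr r)" unfolding sch[OF r] ..
  also have "\<dots> \<le> real d powr (1 + (q - 1 / 2) * r) *
      (\<Sum>j<d. real d powr ((1 / 2 - 1 / p) * r) * ?K powr ((p - 2) / p * r) * s j powr (2 * r / p))"
    by (intro mult_left_mono sum_mono trm) auto
  also have "\<dots> = (real d powr (1 + (q - 1 / 2) * r) * real d powr ((1 / 2 - 1 / p) * r)) *
      ?K powr ((p - 2) / p * r) * (\<Sum>j<d. s j powr (2 * r / p))"
    unfolding sum_distrib_left[symmetric] by (simp only: mult.assoc)
  also have "real d powr (1 + (q - 1 / 2) * r) * real d powr ((1 / 2 - 1 / p) * r) = real d powr (1 + (q - 1 / p) * r)"
    unfolding powr_add[symmetric] by (simp add: algebra_simps)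
  also have "(\<Sum>j<d. s j powr (2 * r / p)) = schatten_norm (2 * r / p) M powr (2 * r / p)"
    by (rule sch[OF e(1), symmetric])
  finally show ?thesis .
qed

end

theorem theorem3p3:
  fixes \<mu> :: "'g::{topological_group_add, t2_space} measure"
    and p1 p2 r :: real
    and A :: "('g \<Rightarrow> complex) \<Rightarrow> ('g \<Rightarrow> complex)"
    and \<rho> :: "('g \<Rightarrow> complex mat) set \<Rightarrow> ('g \<Rightarrow> complex mat)"
    and \<sigma> :: "('g \<Rightarrow> complex mat) set \<Rightarrow> complex mat"
  assumes "compact_lie_group TYPE('g)"
    and "normalised_haar \<mu>"
    and "1 \<le> p1" and "1 \<le> p2" and "0 < r" and "r \<le> 1"
    and "bounded_linear_op (lp_space \<mu> p1) (lp_norm \<mu> p1) (lp_space \<mu> p2) (lp_norm \<mu> p2) A"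
    and "\<And>c. c \<in> unitary_dual \<Longrightarrow> \<rho> c \<in> c"
    and "\<And>c. c \<in> unitary_dual \<Longrightarrow> AE x in \<mu>. symbol A x (\<rho> c) = \<sigma> c"
  shows
    "(p2 \<le> 2 \<and>
      (\<lambda>c. real (rep_dim (\<rho> c)) powr (1 + (1 / min 2 p1 - 1 / 2) * r) *
           schatten_norm r (\<sigma> c) powr r) summable_on unitary_dual
      \<longrightarrow> r_nuclear r (lp_space \<mu> p1) (lp_norm \<mu> p1) (lp_space \<mu> p2) (lp_norm \<mu> p2) A) \<and>
     (p2 > 2 \<and>
      (\<lambda>c. real (rep_dim (\<rho> c)) powr (1 + (1 / min 2 p1 - 1 / p2) * r) *
           op_infty_norm (transpose_mat (\<sigma> c)) powr ((p2 - 2) / p2 * r) *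
           schatten_norm (2 * r / p2) (\<sigma> c) powr (2 * r / p2)) summable_on unitary_dual
      \<longrightarrow> r_nuclear r (lp_space \<mu> p1) (lp_norm \<mu> p1) (lp_space \<mu> p2) (lp_norm \<mu> p2) A)"
proof -
  interpret haar_group \<mu>
    using assms(1,2) by unfold_locales (simp_all add: compact_lie_group_def)
  have sc: "sigma_compact U" if "open U" for U :: "'g set"
    by (rule compact_lie_group_sigma_compact[OF assms(1) that])
  note nuc = nuclear_of_summable[OF sc assms(3-9)]
  show ?thesis
  proof (intro conjI impI)
    assume "p2 \<le> 2 \<and> (\<lambda>c. real (rep_dim (\<rho> c)) powr (1 + (1 / min 2 p1 - 1 / 2) * r) *
           schatten_norm r (\<sigma> c) powr r) summable_on unitary_dual"
    then show "r_nuclear r (lp_space \<mu> p1) (lp_norm \<mu> p1) (lp_space \<mu> p2) (lp_norm \<mu> p2) A"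
      by (intro nuc) blast+
  next
    assume h: "p2 > 2 \<and> (\<lambda>c. real (rep_dim (\<rho> c)) powr (1 + (1 / min 2 p1 - 1 / p2) * r) *
           op_infty_norm (transpose_mat (\<sigma> c)) powr ((p2 - 2) / p2 * r) *
           schatten_norm (2 * r / p2) (\<sigma> c) powr (2 * r / p2)) summable_on unitary_dual"
    have "(\<lambda>c. real (rep_dim (\<rho> c)) powr (1 + (1 / min 2 p1 - 1 / 2) * r) *
           schatten_norm r (\<sigma> c) powr r) summable_on unitary_dual"
    proof (rule summable_on_comparison_test[OF conjunct2[OF h]])
      fix c :: "('g \<Rightarrow> complex mat) set"
      assume c: "c \<in> unitary_dual"
      have irr: "irreducible_unitary_rep (\<rho> c)" by (rule unitary_dual_irreducible[OF c assms(8)[OF c]])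
      show "real (rep_dim (\<rho> c)) powr (1 + (1 / min 2 p1 - 1 / 2) * r) * schatten_norm r (\<sigma> c) powr r
        \<le> real (rep_dim (\<rho> c)) powr (1 + (1 / min 2 p1 - 1 / p2) * r) *
           op_infty_norm (transpose_mat (\<sigma> c)) powr ((p2 - 2) / p2 * r) *
           schatten_norm (2 * r / p2) (\<sigma> c) powr (2 * r / p2)"
        using irr h assms(5) symbol_identity(1)[OF irreducible_unitary[OF irr] assms(9)[OF c]]
        by (intro symbol_weight_le) (auto simp: irreducible_unitary_rep_def)
    qed simp
    then show "r_nuclear r (lp_space \<mu> p1) (lp_norm \<mu> p1) (lp_space \<mu> p2) (lp_norm \<mu> p2) A"
      by (intro nuc) blast+
  qed
qed

end
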